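(* Let $V$ be a finite set with $|V|=\ell\geq 2$, let $\bm{n}\in\mathbb{Z}_{\geq 0}^{V}$ and let $G=(V,E)$ be a digraph. (1) If $E=\emptyset$, then $c\mathscr{A}(\bm{n},G)$ is hereditarily inductively free. (2) If $V=\{1,\dots,\ell\}$ and $E=\{(j,i)\mid i,j\in V,\ i<j\}$, then $c\mathscr{A}(\bm{n},G)$ is hereditarily free if and only if $\ell\leq 5$.
   Context: $\mathbb{K}$ is a field of characteristic zero. A digraph has $E\subseteq\{(i,j)\mid i\neq j\}$; $\varepsilon_G(i,j)=1$ if $(i,j)\in E$, else $0$. $\mathscr{A}(\bm{n},G)$ is the arrangement in $\mathbb{K}^V$ of hyperplanes $\{x_i-x_j=c\}$, $i\neq j$, $c\in\mathbb{Z}$, $-n_i-\varepsilon_G(i,j)\leq c\leq n_j+\varepsilon_G(j,i)$; its cone $c\mathscr{A}(\bm{n},G)$ is the central arrangement in $\mathbb{K}^V\times\mathbb{K}$ (coordinates $x_i$, $z$) consisting of $\{z=0\}$ and $\{x_i-x_j=cz\}$ for each $\{x_i-x_j=c\}\in\mathscr{A}(\bm{n},G)$. For a central arrangement $\mathscr{A}$ in $\mathbb{K}^N$ with $S=\mathbb{K}[y_1,\dots,y_N]$: $\mathscr{A}$ is free if $D(\mathscr{A})=\{\theta\in\bigoplus_kS\partial_k\mid\theta(\alpha_H)\in\alpha_HS\ \forall H\in\mathscr{A}\}$ is a free $S$-module ($\alpha_H$ a defining linear form), with exponents the degrees of a homogeneous basis. $L(\mathscr{A})$ is the set of all intersections of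 subsets of $\mathscr{A}$ (including the whole space), and for $X\in L(\mathscr{A})$ the restriction is $\mathscr{A}^X=\{H\cap X\mid H\in\mathscr{A},\ X\not\subseteq H\}$, an arrangement in $X$. $\mathscr{A}$ is hereditarily free if $\mathscr{A}^X$ is free for all $X\in L(\mathscr{A})$. Inductively free arrangements form the smallest class of central arrangements containing the empty arrangements such that if some $H\in\mathscr{A}$ has $\mathscr{A}\setminus\{H\}$ and $\mathscr{A}^H$ in the class and $\exp(\mathscr{A}^H)\subseteq\exp(\mathscr{A}\setminus\{H\})$, then $\mathscr{A}$ is in the class. $\mathscr{A}$ is hereditarily inductively free if $\mathscr{A}^X$ is inductively free for every $X\in L(\mathscr{A})$. *)

theory Defs
  imports Complex_Main "HOL-Library.Poly_Mapping" "HOL-Library.Function_Algebras"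
    "HOL-Library.Multiset"
begin

definition fscale :: "'b::times \<Rightarrow> ('i \<Rightarrow> 'b) \<Rightarrow> ('i \<Rightarrow> 'b)" where
  "fscale c v = (\<lambda>i. c * v i)"

global_interpretation fun_space: vector_space "fscale :: 'k::field \<Rightarrow> ('i \<Rightarrow> 'k) \<Rightarrow> ('i \<Rightarrow> 'k)"
  by standard (auto simp: fscale_def fun_eq_iff algebra_simps)

text \<open>\<open>K\<^sup>I\<close> is modelled by the functions vanishing outside \<open>I\<close>.\<close>

definition coord_space :: "'i set \<Rightarrow> ('i \<Rightarrow> 'k::zero) set" where
  "coord_space I = {v. \<forall>i. i \<notin> I \<longrightarrow> v i = 0}"

type_synonym 'k mpoly = "(nat \<Rightarrow>\<^sub>0 nat) \<Rightarrow>\<^sub>0 'k"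

text \<open>The ring \<open>S = K[y\<^sub>0, \<dots>, y\<^sub>N\<^sub>-\<^sub>1]\<close>, as a subring of the polynomials in
  countably many variables.\<close>

definition poly_ring :: "nat \<Rightarrow> 'k::zero mpoly set" where
  "poly_ring N = {p. \<forall>m\<in>Poly_Mapping.keys p. Poly_Mapping.keys m \<subseteq> {..<N}}"

definition homogeneous :: "nat \<Rightarrow> 'k::zero mpoly \<Rightarrow> bool" where
  "homogeneous d p \<longleftrightarrow>
     (\<forall>m\<in>Poly_Mapping.keys p. (\<Sum>i\<in>Poly_Mapping.keys m. Poly_Mapping.lookup m i) = d)"

definition partial_deriv :: "nat \<Rightarrow> 'k::comm_ring_1 mpoly \<Rightarrow> 'k mpoly" where
  "partial_deriv k p =
     (\<Sum>m\<in>Poly_Mapping.keys p. Poly_Mapping.single (m - Poly_Mapping.single k 1)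
        (of_nat (Poly_Mapping.lookup m k) * Poly_Mapping.lookup p m))"

definition linear_form :: "nat \<Rightarrow> (nat \<Rightarrow> 'k::comm_ring_1) \<Rightarrow> 'k mpoly" where
  "linear_form N a = (\<Sum>k<N. Poly_Mapping.single (Poly_Mapping.single k 1) (a k))"

text \<open>The family \<open>\<theta>\<close> stands for the derivation \<open>\<Sum>k<N. \<theta> k \<partial>\<^sub>k\<close>.\<close>

definition derivations :: "nat \<Rightarrow> (nat \<Rightarrow> 'k::comm_ring_1 mpoly) set" where
  "derivations N = {\<theta> \<in> coord_space {..<N}. \<forall>k<N. \<theta> k \<in> poly_ring N}"

definition apply_deriv :: "nat \<Rightarrow> (nat \<Rightarrow> 'k::comm_ring_1 mpoly) \<Rightarrow> 'k mpoly \<Rightarrow> 'k mpoly" where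
  "apply_deriv N \<theta> p = (\<Sum>k<N. \<theta> k * partial_deriv k p)"

definition kernel_form :: "nat \<Rightarrow> (nat \<Rightarrow> 'k::comm_ring_1) \<Rightarrow> (nat \<Rightarrow> 'k) set" where
  "kernel_form N a = {v \<in> coord_space {..<N}. (\<Sum>k<N. a k * v k) = 0}"

text \<open>The module \<open>D(A)\<close>. The forms defining a hyperplane \<open>H\<close> differ by nonzero
  scalars, so quantifying over all of them is the same as choosing one.\<close>

definition log_derivations ::
    "nat \<Rightarrow> (nat \<Rightarrow> 'k::field) set set \<Rightarrow> (nat \<Rightarrow> 'k mpoly) set" where
  "log_derivations N A = {\<theta> \<in> derivations N. \<forall>H\<in>A. \<forall>a. H = kernel_form N a \<longrightarrow>
     (\<exists>g\<in>poly_ring N. apply_deriv N \<theta> (linear_form N a) = linear_form N a * g)}"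

text \<open>The library locale \<open>module\<close> takes scalars from a whole type, whereas here they are
  restricted to a subring \<open>S\<close>.\<close>

definition module_basis ::
    "'r::comm_ring_1 set \<Rightarrow> ('i \<Rightarrow> 'r) set \<Rightarrow> ('i \<Rightarrow> 'r) set \<Rightarrow> bool" where
  "module_basis S M B \<longleftrightarrow> B \<subseteq> M \<and>
     (\<forall>\<theta>\<in>M. \<exists>!c. (\<forall>b. c b \<in> S) \<and> finite {b. c b \<noteq> 0} \<and> {b. c b \<noteq> 0} \<subseteq> B \<and>
        \<theta> = (\<Sum>b | c b \<noteq> 0. fscale (c b) b))"

definition std_free :: "nat \<Rightarrow> (nat \<Rightarrow> 'k::field) set set \<Rightarrow> bool" where
  "std_free N A \<longleftrightarrow> (\<exists>B. module_basis (poly_ring N) (log_derivations N A) B)"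

text \<open>The degree of a homogeneous derivation is the polynomial degree of its
  coefficients, i.e. each \<open>\<partial>\<^sub>k\<close> has degree \<open>0\<close>.\<close>

definition std_has_exponents :: "nat \<Rightarrow> (nat \<Rightarrow> 'k::field) set set \<Rightarrow> nat multiset \<Rightarrow> bool" where
  "std_has_exponents N A e \<longleftrightarrow> (\<exists>B d. finite B \<and>
     module_basis (poly_ring N) (log_derivations N A) B \<and>
     (\<forall>b\<in>B. \<forall>k<N. homogeneous (d b) (b k)) \<and> e = image_mset d (mset_set B))"

text \<open>An arrangement \<open>A\<close> in a vector space \<open>X\<close> is given by both \<open>X\<close> and \<open>A\<close>, where \<open>X\<close> is a
  subspace of a function space; a restriction to \<open>Y\<close> is then again a set of subspaces of \<open>Y\<close>.
  Freeness and exponents are read off in linear coordinates on \<open>X\<close>; they do not depend on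
  the choice of these. In particular exponents are unique, so \<open>has_exponents\<close> is single-valued.\<close>

definition coordinates ::
    "('i \<Rightarrow> 'k::field) set \<Rightarrow> nat \<Rightarrow> (('i \<Rightarrow> 'k) \<Rightarrow> (nat \<Rightarrow> 'k)) \<Rightarrow> bool" where
  "coordinates X N f \<longleftrightarrow>
     Vector_Spaces.linear fscale fscale f \<and> bij_betw f X (coord_space {..<N})"

definition free_arrangement :: "('i \<Rightarrow> 'k::field) set \<Rightarrow> ('i \<Rightarrow> 'k) set set \<Rightarrow> bool" where
  "free_arrangement X A \<longleftrightarrow> (\<exists>N f. coordinates X N f \<and> std_free N ((`) f ` A))"

definition has_exponents ::
    "('i \<Rightarrow> 'k::field) set \<Rightarrow> ('i \<Rightarrow> 'k) set set \<Rightarrow> nat multiset \<Rightarrow> bool" where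
  "has_exponents X A e \<longleftrightarrow> (\<exists>N f. coordinates X N f \<and> std_has_exponents N ((`) f ` A) e)"

definition fin_dim_subspace :: "('i \<Rightarrow> 'k::field) set \<Rightarrow> bool" where
  "fin_dim_subspace X \<longleftrightarrow> (\<exists>B. finite B \<and> X = fun_space.span B)"

definition central_arrangement :: "('i \<Rightarrow> 'k::field) set \<Rightarrow> ('i \<Rightarrow> 'k) set set \<Rightarrow> bool" where
  "central_arrangement X A \<longleftrightarrow> fin_dim_subspace X \<and> finite A \<and>
     (\<forall>H\<in>A. fun_space.subspace H \<and> H \<subseteq> X \<and> fun_space.dim X = fun_space.dim H + 1)"

definition intersection_lattice :: "'v set \<Rightarrow> 'v set set \<Rightarrow> 'v set set" where
  "intersection_lattice X A = {X \<inter> \<Inter> B | B. B \<subseteq> A}"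

definition restriction :: "'v set set \<Rightarrow> 'v set \<Rightarrow> 'v set set" where
  "restriction A Y = {H \<inter> Y | H. H \<in> A \<and> \<not> Y \<subseteq> H}"

definition hereditarily_free :: "('i \<Rightarrow> 'k::field) set \<Rightarrow> ('i \<Rightarrow> 'k) set set \<Rightarrow> bool" where
  "hereditarily_free X A \<longleftrightarrow>
     (\<forall>Y\<in>intersection_lattice X A. free_arrangement Y (restriction A Y))"

inductive inductively_free :: "('i \<Rightarrow> 'k::field) set \<Rightarrow> ('i \<Rightarrow> 'k) set set \<Rightarrow> bool" where
  empty: "fin_dim_subspace X \<Longrightarrow> inductively_free X {}"
| add: "\<lbrakk>central_arrangement X A; H \<in> A;
         inductively_free X (A - {H}); inductively_free H (restriction A H);
         has_exponents X (A - {H}) e; has_exponents H (restriction A H) e'; e' \<subseteq># e\<rbrakk>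
        \<Longrightarrow> inductively_free X A"

definition hereditarily_inductively_free ::
    "('i \<Rightarrow> 'k::field) set \<Rightarrow> ('i \<Rightarrow> 'k) set set \<Rightarrow> bool" where
  "hereditarily_inductively_free X A \<longleftrightarrow>
     (\<forall>Y\<in>intersection_lattice X A. inductively_free Y (restriction A Y))"

definition digraph :: "'a set \<Rightarrow> ('a \<times> 'a) set \<Rightarrow> bool" where
  "digraph V E \<longleftrightarrow> E \<subseteq> {(i, j). i \<in> V \<and> j \<in> V \<and> i \<noteq> j}"

definition edge_ind :: "('a \<times> 'a) set \<Rightarrow> 'a \<Rightarrow> 'a \<Rightarrow> int" where
  "edge_ind E i j = (if (i, j) \<in> E then 1 else 0)"

definition affine_hyperplane :: "'a set \<Rightarrow> 'a \<Rightarrow> 'a \<Rightarrow> int \<Rightarrow> ('a \<Rightarrow> 'k::field_char_0) set" where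
  "affine_hyperplane V i j c = {x \<in> coord_space V. x i - x j = of_int c}"

definition deformation ::
    "'a set \<Rightarrow> ('a \<Rightarrow> nat) \<Rightarrow> ('a \<times> 'a) set \<Rightarrow> ('a \<Rightarrow> 'k::field_char_0) set set" where
  "deformation V n E = {affine_hyperplane V i j c | i j c. i \<in> V \<and> j \<in> V \<and> i \<noteq> j \<and>
     - int (n i) - edge_ind E i j \<le> c \<and> c \<le> int (n j) + edge_ind E j i}"

text \<open>\<open>K\<^sup>V \<times> K\<close> has the coordinates \<open>x\<^sub>i\<close> at \<open>Some i\<close> and \<open>z\<close> at \<open>None\<close>.\<close>

definition cone_space :: "'a set \<Rightarrow> ('a option \<Rightarrow> 'k::field_char_0) set" where
  "cone_space V = coord_space (insert None (Some ` V))"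

definition cone_deformation ::
    "'a set \<Rightarrow> ('a \<Rightarrow> nat) \<Rightarrow> ('a \<times> 'a) set \<Rightarrow> ('a option \<Rightarrow> 'k::field_char_0) set set" where
  "cone_deformation V n E =
     insert {v \<in> cone_space V. v None = 0}
       {{v \<in> cone_space V. v (Some i) - v (Some j) = of_int c * v None} | i j c.
          i \<in> V \<and> j \<in> V \<and> i \<noteq> j \<and>
          (affine_hyperplane V i j c :: ('a \<Rightarrow> 'k) set) \<in> deformation V n E}"

end

theory Submission
  imports Defs "HOL-Computational_Algebra.Polynomial"
begin

text \<open>
  Attach to the vertex \<open>v\<close> an interval \<open>[a v, b v]\<close> of reals, and let the hyperplane \<open>x\<^sub>u - x\<^sub>v = c z\<close> be
  present iff the \<open>c\<close>-translate of the interval of \<open>u\<close> meets that of \<open>v\<close>. The case \<open>E = {}\<close> is given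
  by the intervals \<open>[0, n v]\<close>, the transitive tournament by \<open>[s v, s v + n v + 1]\<close> with
  \<open>s v = v / (l + 1)\<close>. Restricting to such a hyperplane replaces two intervals, one of them translated, by
  their union, so every flat off \<open>z = 0\<close> is again of this type.

  If all endpoints are integers, or all intervals but one have integral length and no two different
  intervals share a residue modulo 1, the arrangement is inductively free with explicit exponents, by
  induction on the interval lengths. Merging never creates residues. So for \<open>l \<le> 5\<close>
  at most two intervals have non-integral length, and two such intervals leave room for only one
  further vertex; that case is reduced to the previous ones.

  For \<open>l \<ge> 6\<close> one can merge down to three vertices such that some hyperplane \<open>H\<close> has
  \<open>exp(A - {H}) = (0, 1, h, h)\<close> and \<open>exp(A\<^sup>H) = (0, 1, h + 1)\<close>, and then \<open>D(A)\<close> needs five generators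
  in rank four.

  Polynomial derivations are treated as polynomial vector fields on a subspace, and the
  addition theorem is proved for free arrangements whose exponents sum to the number of hyperplanes,
  so that Saito's criterion is not needed.
\<close>

section \<open>Polynomial functions on subspaces of function spaces\<close>

text \<open>Inductive freeness compares the exponents of deletion and restriction at every step, so
  the induction must run in a class that contains both and has exponents in closed form. Intervals
  serve this purpose: a deletion shortens one, a restriction glues two, and exponents are read off
  from lengths and from counts of end points. That two meeting intervals have an interval as union
  becomes, for integer bounds, the inequality \<open>tri\<close>, which rules out gaps between two
  ranges of constants. The bound 5 is a count. Initially each interval has the same residue at both
  ends, and different intervals have different residues; a glued interval inherits its end residues.
  So on a flat the number of vertices plus the number of non-integral intervals is at most l, and
  three such intervals need six residues. In the counterexample six residues are interleaved so that
  deleting one hyperplane leaves a single non-integral interval and a double exponent h, while the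
  restriction has h + 1 in place of h. Characteristic zero makes the field infinite: polynomials may
  be treated as functions, and restriction to lines replaces factorization.\<close>

definition linear_fun :: "(('i \<Rightarrow> 'k::field) \<Rightarrow> 'k) \<Rightarrow> bool" where
  "linear_fun \<phi> \<longleftrightarrow> (\<forall>x y. \<phi> (x + y) = \<phi> x + \<phi> y) \<and> (\<forall>c x. \<phi> (fscale c x) = c * \<phi> x)"

abbreviation linear_map :: "(('i \<Rightarrow> 'k::field) \<Rightarrow> ('j \<Rightarrow> 'k)) \<Rightarrow> bool" where
  "linear_map \<equiv> Vector_Spaces.linear fscale fscale"

lemma linear_map_iff:
  "linear_map g \<longleftrightarrow> (\<forall>x y. g (x + y) = g x + g y) \<and> (\<forall>c x. g (fscale c x) = fscale c (g x))"
  unfolding Vector_Spaces.linear_iff by (simp add: fun_space.vector_space_axioms)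

lemma linear_map_add: "linear_map g \<Longrightarrow> g (x + y) = g x + g y"
  and linear_map_scale: "linear_map g \<Longrightarrow> g (fscale c x) = fscale c (g x)"
  by (auto simp: linear_map_iff)

lemma fscale_apply [simp]: "fscale c x i = c * x i"
  by (simp add: fscale_def)

lemma fscale_0_left [simp]: "fscale (0::'k::field) x = 0"
  and fscale_0_right [simp]: "fscale (c::'k::field) (0::'i \<Rightarrow> 'k) = 0"
  and fscale_1 [simp]: "fscale (1::'k::field) x = x"
  by (auto simp: fun_eq_iff)

lemma fscale_fscale [simp]: "fscale (a::'k::field) (fscale b x) = fscale (a * b) x"
  by (auto simp: fun_eq_iff mult.assoc)

lemma linear_map_0: "linear_map g \<Longrightarrow> g 0 = 0"
  using linear_map_scale[of g 0 0] by simp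

lemma linear_map_sum: "linear_map g \<Longrightarrow> g (\<Sum>i\<in>I. x i) = (\<Sum>i\<in>I. g (x i))"
  by (induction I rule: infinite_finite_induct) (auto simp: linear_map_0 linear_map_add)

lemma linear_fun_add: "linear_fun \<phi> \<Longrightarrow> \<phi> (x + y) = \<phi> x + \<phi> y"
  and linear_fun_scale: "linear_fun \<phi> \<Longrightarrow> \<phi> (fscale c x) = c * \<phi> x"
  by (auto simp: linear_fun_def)

lemma linear_fun_0: "linear_fun \<phi> \<Longrightarrow> \<phi> 0 = 0"
  using linear_fun_scale[of \<phi> 0 0] by simp

lemma linear_fun_diff: "linear_fun \<phi> \<Longrightarrow> \<phi> (x - y) = \<phi> x - \<phi> y"
  by (metis add_diff_cancel_right' diff_add_cancel linear_fun_add)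

lemma linear_fun_sum: "linear_fun \<phi> \<Longrightarrow> \<phi> (\<Sum>i\<in>I. x i) = (\<Sum>i\<in>I. \<phi> (x i))"
  by (induction I rule: infinite_finite_induct) (auto simp: linear_fun_0 linear_fun_add)

lemma linear_fun_comp: "linear_fun \<phi> \<Longrightarrow> linear_map g \<Longrightarrow> linear_fun (\<lambda>x. \<phi> (g x))"
  by (auto simp: linear_fun_def linear_map_iff)

lemma linear_fun_component: "linear_map g \<Longrightarrow> linear_fun (\<lambda>x. g x i)"
  by (auto simp: linear_fun_def linear_map_iff)

lemma linear_fun_proj: "linear_fun (\<lambda>x. x i)"
  by (auto simp: linear_fun_def)

lemma sum_fun_apply: "(\<Sum>i\<in>I. F i) x = (\<Sum>i\<in>I. F i x)" for F :: "'j \<Rightarrow> 'i \<Rightarrow> 'k::comm_monoid_add"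
  by (induction I rule: infinite_finite_induct) auto

abbreviation subsp :: "('i \<Rightarrow> 'k::field) set \<Rightarrow> bool" where
  "subsp \<equiv> fun_space.subspace"

lemma subsp_0: "subsp Y \<Longrightarrow> 0 \<in> Y"
  and subsp_add: "subsp Y \<Longrightarrow> x \<in> Y \<Longrightarrow> y \<in> Y \<Longrightarrow> x + y \<in> Y"
  and subsp_scale: "subsp Y \<Longrightarrow> x \<in> Y \<Longrightarrow> fscale c x \<in> Y"
  by (auto simp: fun_space.subspace_def)

lemma subsp_diff: "subsp Y \<Longrightarrow> x \<in> Y \<Longrightarrow> y \<in> Y \<Longrightarrow> x - y \<in> Y"
  by (rule fun_space.subspace_diff)

lemma subsp_sum: "subsp Y \<Longrightarrow> (\<And>i. i \<in> I \<Longrightarrow> x i \<in> Y) \<Longrightarrow> (\<Sum>i\<in>I. x i) \<in> Y"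
  by (rule fun_space.subspace_sum)

lemma subsp_line: "subsp Y \<Longrightarrow> x \<in> Y \<Longrightarrow> y \<in> Y \<Longrightarrow> x + fscale t y \<in> Y"
  by (simp add: subsp_add subsp_scale)

inductive_set polyfun :: "(('i \<Rightarrow> 'k::field) \<Rightarrow> 'k) set" where
  const: "(\<lambda>_. c) \<in> polyfun"
| lin: "linear_fun \<phi> \<Longrightarrow> \<phi> \<in> polyfun"
| add: "p \<in> polyfun \<Longrightarrow> q \<in> polyfun \<Longrightarrow> (\<lambda>y. p y + q y) \<in> polyfun"
| mult: "p \<in> polyfun \<Longrightarrow> q \<in> polyfun \<Longrightarrow> (\<lambda>y. p y * q y) \<in> polyfun"

text \<open>Agreement on \<open>Y\<close> with a global polynomial function: passing to a smaller
  subspace is then mere monotonicity, no coordinates have to be chosen, and values outside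
  \<open>Y\<close> never matter.\<close>

definition pfun :: "('i \<Rightarrow> 'k::field) set \<Rightarrow> (('i \<Rightarrow> 'k) \<Rightarrow> 'k) set" where
  "pfun Y = {p. \<exists>q\<in>polyfun. \<forall>y\<in>Y. p y = q y}"

lemma pfunI: "q \<in> polyfun \<Longrightarrow> (\<And>y. y \<in> Y \<Longrightarrow> p y = q y) \<Longrightarrow> p \<in> pfun Y"
  by (auto simp: pfun_def)

lemma pfun_polyfun: "p \<in> polyfun \<Longrightarrow> p \<in> pfun Y"
  by (auto simp: pfun_def)

lemma pfun_const: "(\<lambda>_. c) \<in> pfun Y"
  by (intro pfun_polyfun polyfun.const)

lemma pfun_lin: "linear_fun \<phi> \<Longrightarrow> \<phi> \<in> pfun Y"
  by (intro pfun_polyfun polyfun.lin)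

lemma pfun_add: assumes "p \<in> pfun Y" "q \<in> pfun Y" shows "(\<lambda>y. p y + q y) \<in> pfun Y"
proof -
  obtain p' q' where "p' \<in> polyfun" "\<forall>y\<in>Y. p y = p' y" "q' \<in> polyfun" "\<forall>y\<in>Y. q y = q' y"
    using assms by (auto simp: pfun_def)
  then show ?thesis by (intro pfunI[OF polyfun.add[of p' q']]) auto
qed

lemma pfun_mult: assumes "p \<in> pfun Y" "q \<in> pfun Y" shows "(\<lambda>y. p y * q y) \<in> pfun Y"
proof -
  obtain p' q' where "p' \<in> polyfun" "\<forall>y\<in>Y. p y = p' y" "q' \<in> polyfun" "\<forall>y\<in>Y. q y = q' y"
    using assms by (auto simp: pfun_def)
  then show ?thesis by (intro pfunI[OF polyfun.mult[of p' q']]) auto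
qed

lemma pfun_cmult: "p \<in> pfun Y \<Longrightarrow> (\<lambda>y. c * p y) \<in> pfun Y"
  by (rule pfun_mult[OF pfun_const])

lemma pfun_uminus: "p \<in> pfun Y \<Longrightarrow> (\<lambda>y. - p y) \<in> pfun Y"
  using pfun_cmult[of p Y "-1"] by simp

lemma pfun_diff: "p \<in> pfun Y \<Longrightarrow> q \<in> pfun Y \<Longrightarrow> (\<lambda>y. p y - q y) \<in> pfun Y"
  using pfun_add[OF _ pfun_uminus, of p Y q] by simp

lemma pfun_sum: "(\<And>i. i \<in> I \<Longrightarrow> p i \<in> pfun Y) \<Longrightarrow> (\<lambda>y. \<Sum>i\<in>I. p i y) \<in> pfun Y"
  by (induction I rule: infinite_finite_induct) (auto intro: pfun_add pfun_const)

lemma pfun_prod: "(\<And>i. i \<in> I \<Longrightarrow> p i \<in> pfun Y) \<Longrightarrow> (\<lambda>y. \<Prod>i\<in>I. p i y) \<in> pfun Y"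
  by (induction I rule: infinite_finite_induct) (auto intro: pfun_mult pfun_const)

lemma pfun_cong: "p \<in> pfun Y \<Longrightarrow> (\<And>y. y \<in> Y \<Longrightarrow> p y = q y) \<Longrightarrow> q \<in> pfun Y"
  by (auto simp: pfun_def)

lemma pfun_mono: "p \<in> pfun Y \<Longrightarrow> Z \<subseteq> Y \<Longrightarrow> p \<in> pfun Z"
  by (auto simp: pfun_def)

lemma polyfun_comp:
  assumes "p \<in> polyfun" and g: "linear_map g"
  shows "(\<lambda>y. p (g y)) \<in> polyfun"
  using assms(1)
proof (induction rule: polyfun.induct)
  case (lin \<phi>)
  show ?case by (rule polyfun.lin, rule linear_fun_comp[OF lin g])
qed (simp_all add: polyfun.const polyfun.add polyfun.mult)

lemma pfun_comp:
  assumes "p \<in> pfun Y" "linear_map g" "\<And>z. z \<in> Z \<Longrightarrow> g z \<in> Y" shows "(\<lambda>z. p (g z)) \<in> pfun Z"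
proof -
  obtain q where q: "q \<in> polyfun" "\<And>y. y \<in> Y \<Longrightarrow> p y = q y" using assms(1) by (auto simp: pfun_def)
  show ?thesis by (rule pfunI[OF polyfun_comp[OF q(1) assms(2)]]) (simp add: q(2) assms(3))
qed

lemma polyfun_line: "p \<in> polyfun \<Longrightarrow> \<exists>P. \<forall>t. p (y + fscale t d) = poly P t"
proof (induction rule: polyfun.induct)
  case (const c)
  show ?case by (rule exI[of _ "[:c:]"]) simp
next
  case (lin \<phi>)
  have "\<phi> (y + fscale t d) = poly [:\<phi> y, \<phi> d:] t" for t
    by (simp add: linear_fun_add[OF lin] linear_fun_scale[OF lin])
  then show ?case by blast
next
  case (add p q)
  then obtain P Q where "\<forall>t. p (y + fscale t d) = poly P t" "\<forall>t. q (y + fscale t d) = poly Q t" by blast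
  then have "p (y + fscale t d) + q (y + fscale t d) = poly (P + Q) t" for t by simp
  then show ?case by blast
next
  case (mult p q)
  then obtain P Q where "\<forall>t. p (y + fscale t d) = poly P t" "\<forall>t. q (y + fscale t d) = poly Q t" by blast
  then have "p (y + fscale t d) * q (y + fscale t d) = poly (P * Q) t" for t by simp
  then show ?case by blast
qed

lemma pfun_line:
  assumes "p \<in> pfun Y" "subsp Y" "y \<in> Y" "d \<in> Y"
  shows "\<exists>P. \<forall>t. p (y + fscale t d) = poly P t"
proof -
  obtain q where q: "q \<in> polyfun" "\<And>y. y \<in> Y \<Longrightarrow> p y = q y" using assms(1) by (auto simp: pfun_def)
  obtain P where "\<forall>t. q (y + fscale t d) = poly P t" using polyfun_line[OF q(1)] by blast
  then show ?thesis using q(2) assms(2-4) by (intro exI[of _ P]) (simp add: subsp_line)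
qed

lemma pfun_ray:
  assumes "p \<in> pfun Y" "subsp Y" "y \<in> Y"
  shows "\<exists>P. \<forall>t. p (fscale t y) = poly P t"
  using pfun_line[OF assms(1,2) subsp_0[OF assms(2)] assms(3)] by auto

text \<open>A line joins a point where \<open>p\<close> is nonzero to one where \<open>q\<close> is
  nonzero. Along it both are nonzero one-variable polynomials, but their product vanishes on the
  whole infinite field.\<close>

lemma pfun_domain:
  fixes Y :: "('i \<Rightarrow> 'k::field_char_0) set"
  assumes Y: "subsp Y" and p: "p \<in> pfun Y" and q: "q \<in> pfun Y" and pq: "\<forall>y\<in>Y. p y * q y = 0"
  shows "(\<forall>y\<in>Y. p y = 0) \<or> (\<forall>y\<in>Y. q y = 0)"
proof (rule ccontr)
  assume "\<not> ?thesis"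
  then obtain x y where xy: "x \<in> Y" "y \<in> Y" "p x \<noteq> 0" "q y \<noteq> 0" by blast
  have d: "y - x \<in> Y" using xy Y by (simp add: subsp_diff)
  obtain P where P: "\<And>t. p (x + fscale t (y - x)) = poly P t" using pfun_line[OF p Y xy(1) d] by blast
  obtain Q where Q: "\<And>t. q (x + fscale t (y - x)) = poly Q t" using pfun_line[OF q Y xy(1) d] by blast
  have "poly (P * Q) t = 0" for t
    using pq subsp_line[OF Y xy(1) d, of t] by (auto simp flip: P[rule_format] Q[rule_format])
  then have "P * Q = 0" using poly_all_0_iff_0 by blast
  moreover have "P \<noteq> 0" using P[of 0] xy(3) by auto
  moreover have "Q \<noteq> 0" using Q[of 1] xy(4) by auto
  ultimately show False by simp
qed

lemma pfun_cancel:
  fixes Y :: "('i \<Rightarrow> 'k::field_char_0) set"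
  assumes Y: "subsp Y" "p \<in> pfun Y" "q \<in> pfun Y" "r \<in> pfun Y"
    and eq: "\<forall>y\<in>Y. p y * q y = p y * r y" and nz: "z \<in> Y" "p z \<noteq> 0"
  shows "\<forall>y\<in>Y. q y = r y"
proof -
  have "\<forall>y\<in>Y. p y * (q y - r y) = 0" using eq by (simp add: right_diff_distrib)
  from pfun_domain[OF Y(1,2) pfun_diff[OF Y(3,4)] this] nz show ?thesis by auto
qed

text \<open>The shift \<open>y - \<alpha>(y) e\<close> changes every linear functional by a multiple
  of \<alpha>, and \<open>p q - p' q' = (p - p') q + p' (q - q')\<close> carries this through
  products. For \<open>\<alpha> e = 1\<close> the shift is a projection onto the kernel, which turns
  this into the factor theorem for a hyperplane.\<close>

lemma polyfun_divide:
  assumes "p \<in> polyfun" "linear_fun \<alpha>"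
  shows "\<exists>q\<in>polyfun. \<forall>y. p y - p (y - fscale (\<alpha> y) e) = \<alpha> y * q y"
  using assms(1)
proof (induction rule: polyfun.induct)
  case (const c)
  show ?case by (rule bexI[of _ "\<lambda>_. 0"]) (auto intro: polyfun.const)
next
  case (lin \<phi>)
  have "\<forall>y. \<phi> y - \<phi> (y - fscale (\<alpha> y) e) = \<alpha> y * \<phi> e"
    by (simp add: linear_fun_diff[OF lin] linear_fun_scale[OF lin])
  then show ?case by (intro bexI[OF _ polyfun.const])
next
  case (add p q)
  then obtain p' q' where "p' \<in> polyfun" "\<forall>y. p y - p (y - fscale (\<alpha> y) e) = \<alpha> y * p' y"
    "q' \<in> polyfun" "\<forall>y. q y - q (y - fscale (\<alpha> y) e) = \<alpha> y * q' y" by blast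
  then have "(p y + q y) - (p (y - fscale (\<alpha> y) e) + q (y - fscale (\<alpha> y) e)) = \<alpha> y * (p' y + q' y)" for y
    by (simp only: add_diff_add distrib_left)
  then show ?case by (intro bexI[OF _ polyfun.add[OF \<open>p' \<in> polyfun\<close> \<open>q' \<in> polyfun\<close>]] allI)
next
  case (mult p q)
  then obtain p' q' where *: "p' \<in> polyfun" "\<forall>y. p y - p (y - fscale (\<alpha> y) e) = \<alpha> y * p' y"
    "q' \<in> polyfun" "\<forall>y. q y - q (y - fscale (\<alpha> y) e) = \<alpha> y * q' y" by blast
  have lm: "linear_map (\<lambda>y. y - fscale (\<alpha> y) e)"
    using assms(2) by (auto simp: linear_map_iff linear_fun_def fun_eq_iff algebra_simps)
  have eq: "p y * q y - p z * q z = (p y - p z) * q y + p z * (q y - q z)" for y z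
    by (simp add: algebra_simps)
  have "p y * q y - p (y - fscale (\<alpha> y) e) * q (y - fscale (\<alpha> y) e)
      = \<alpha> y * (p' y * q y + p (y - fscale (\<alpha> y) e) * q' y)" for y
    unfolding eq[of y "y - fscale (\<alpha> y) e"] *(2)[rule_format] *(4)[rule_format]
    by (simp only: distrib_left mult.assoc mult.left_commute)
  then show ?case
    by (intro bexI[OF _ polyfun.add[OF polyfun.mult[OF *(1) \<open>q \<in> polyfun\<close>]
            polyfun.mult[OF polyfun_comp[OF \<open>p \<in> polyfun\<close> lm] *(3)]]] allI)
qed

lemma linear_map_proj: "linear_fun \<alpha> \<Longrightarrow> linear_map (\<lambda>y. y - fscale (\<alpha> y) e)"
  by (auto simp: linear_map_iff linear_fun_def fun_eq_iff algebra_simps)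

lemma pfun_divide:
  assumes Y: "subsp Y" and p: "p \<in> pfun Y" and \<alpha>: "linear_fun \<alpha>" and e: "e \<in> Y" "\<alpha> e \<noteq> 0"
    and van: "\<forall>y\<in>Y. \<alpha> y = 0 \<longrightarrow> p y = 0"
  shows "\<exists>q\<in>pfun Y. \<forall>y\<in>Y. p y = \<alpha> y * q y"
proof -
  obtain p' where p': "p' \<in> polyfun" "\<And>y. y \<in> Y \<Longrightarrow> p y = p' y" using p by (auto simp: pfun_def)
  \<comment> \<open>Normalised to \<open>\<alpha> e' = 1\<close>, so that the shift along
    \<open>e'\<close> lands in the kernel, where \<open>p\<close> vanishes.\<close>
  define e' where "e' = fscale (1 / \<alpha> e) e"
  have e': "e' \<in> Y" "\<alpha> e' = 1" using e Y \<alpha> by (auto simp: e'_def subsp_scale linear_fun_scale)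
  obtain q where q: "q \<in> polyfun" "\<forall>y. p' y - p' (y - fscale (\<alpha> y) e') = \<alpha> y * q y"
    using polyfun_divide[OF p'(1) \<alpha>] by blast
  have "p y = \<alpha> y * q y" if y: "y \<in> Y" for y
  proof -
    have "y - fscale (\<alpha> y) e' \<in> Y" using y e' Y by (simp add: subsp_diff subsp_scale)
    moreover have "\<alpha> (y - fscale (\<alpha> y) e') = 0" using \<alpha> e' by (simp add: linear_fun_diff linear_fun_scale)
    ultimately have "p' (y - fscale (\<alpha> y) e') = 0" using van p'(2) by metis
    then show ?thesis using q(2) p'(2)[OF y] by (metis diff_zero)
  qed
  then show ?thesis using pfun_polyfun[OF q(1)] by blast
qed

text \<open>On the ray through \<open>y\<close> the hypothesis reads
  \<open>t ^ e * P t = p y * t ^ d\<close>, and the left side has no term of degree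
  \<open>d < e\<close>. The negative degree \<open>d - e\<close> of \<open>p\<close> is expressed
  with powers on both sides.\<close>

lemma pfun_negative_degree:
  fixes Y :: "('i \<Rightarrow> 'k::field_char_0) set"
  assumes Y: "subsp Y" and p: "p \<in> pfun Y" and lt: "d < e"
    and h: "\<And>t y. t \<noteq> 0 \<Longrightarrow> y \<in> Y \<Longrightarrow> t ^ e * p (fscale t y) = t ^ d * p y" and y: "y \<in> Y"
  shows "p y = 0"
proof -
  obtain P where P: "\<And>t. p (fscale t y) = poly P t" using pfun_ray[OF p Y y] by blast
  \<comment> \<open>The extra factor \<open>monom 1 1\<close> makes the identity true at 0 as well,
    where \<open>h\<close> gives nothing.\<close>
  have "poly (monom 1 1 * (monom 1 e * P - monom (p y) d)) t = 0" for t
    using h[of t y] y P[of t] by (cases "t = 0") (auto simp: poly_monom)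
  then have "monom 1 1 * (monom 1 e * P - monom (p y) d) = 0" using poly_all_0_iff_0 by blast
  then have "monom 1 e * P = monom (p y) d" by (simp add: monom_eq_0_iff)
  then have "coeff (monom 1 e * P) d = p y" by simp
  then show ?thesis using lt by (simp add: coeff_monom_mult)
qed

lemma pfun_zero_degree:
  fixes Y :: "('i \<Rightarrow> 'k::field_char_0) set"
  assumes Y: "subsp Y" and p: "p \<in> pfun Y"
    and h: "\<And>t y. t \<noteq> 0 \<Longrightarrow> y \<in> Y \<Longrightarrow> p (fscale t y) = p y" and y: "y \<in> Y"
  shows "p y = p 0"
proof -
  obtain P where P: "\<And>t. p (fscale t y) = poly P t" using pfun_ray[OF p Y y] by blast
  have "poly (monom 1 1 * (P - [:p y:])) t = 0" for t
    using h[of t y] y P[of t] by (cases "t = 0") (auto simp: poly_monom)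
  then have "monom 1 1 * (P - [:p y:]) = 0" using poly_all_0_iff_0 by blast
  then have "P = [:p y:]" by (simp add: monom_eq_0_iff)
  then show ?thesis using P[of 0] by simp
qed

text \<open>Fraction-free Gaussian elimination over the domain of polynomial functions: more rows
  than columns force a nontrivial relation. All rank arguments below rest on it.\<close>

lemma pfun_elimination:
  fixes Y :: "('i \<Rightarrow> 'k::field_char_0) set"
  assumes Y: "subsp Y" and "finite J" "finite I" "card J < card I" "\<And>i j. i \<in> I \<Longrightarrow> j \<in> J \<Longrightarrow> m i j \<in> pfun Y"
  shows "\<exists>c. (\<forall>i\<in>I. c i \<in> pfun Y) \<and> (\<exists>i\<in>I. \<exists>y\<in>Y. c i y \<noteq> 0) \<and>
    (\<forall>j\<in>J. \<forall>y\<in>Y. (\<Sum>i\<in>I. c i y * m i j y) = 0)"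
  using assms(2-)
proof (induction J arbitrary: I m rule: finite_induct)
  case empty
  then obtain i where "i \<in> I" by (metis card.empty equals0I less_irrefl)
  then show ?case using subsp_0[OF Y] by (intro exI[of _ "\<lambda>_ _. 1"]) (auto intro: pfun_const)
next
  case (insert j0 J)
  show ?case
  proof (cases "\<forall>i\<in>I. \<forall>y\<in>Y. m i j0 y = 0")
    case True
    have "\<exists>c. (\<forall>i\<in>I. c i \<in> pfun Y) \<and> (\<exists>i\<in>I. \<exists>y\<in>Y. c i y \<noteq> 0) \<and>
        (\<forall>j\<in>J. \<forall>y\<in>Y. (\<Sum>i\<in>I. c i y * m i j y) = 0)"
      by (rule insert.IH) (use insert in auto)
    then obtain c where "\<forall>i\<in>I. c i \<in> pfun Y" "\<exists>i\<in>I. \<exists>y\<in>Y. c i y \<noteq> 0"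
        "\<forall>j\<in>J. \<forall>y\<in>Y. (\<Sum>i\<in>I. c i y * m i j y) = 0" by blast
    then show ?thesis using True by (intro exI[of _ c]) auto
  next
    case False
    then obtain i0 y0 where i0: "i0 \<in> I" "y0 \<in> Y" "m i0 j0 y0 \<noteq> 0" by blast
    \<comment> \<open>The pivot \<open>m i0 j0\<close> clears column \<open>j0\<close> from the
      other rows without division.\<close>
    define m' where "m' i j y = m i0 j0 y * m i j y - m i j0 y * m i0 j y" for i j y
    have m'fun: "m' i j = (\<lambda>y. m i0 j0 y * m i j y - m i j0 y * m i0 j y)" for i j
      by (auto simp: m'_def)
    have "\<exists>c. (\<forall>i\<in>I-{i0}. c i \<in> pfun Y) \<and> (\<exists>i\<in>I-{i0}. \<exists>y\<in>Y. c i y \<noteq> 0) \<and>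
        (\<forall>j\<in>J. \<forall>y\<in>Y. (\<Sum>i\<in>I-{i0}. c i y * m' i j y) = 0)"
      by (rule insert.IH)
        (use insert i0 in \<open>auto simp: m'fun intro!: pfun_diff pfun_mult\<close>)
    then obtain c where c: "\<And>i. i\<in>I-{i0} \<Longrightarrow> c i \<in> pfun Y" "\<exists>i\<in>I-{i0}. \<exists>y\<in>Y. c i y \<noteq> 0"
        "\<And>j y. j\<in>J \<Longrightarrow> y\<in>Y \<Longrightarrow> (\<Sum>i\<in>I-{i0}. c i y * m' i j y) = 0" by blast
    \<comment> \<open>The relation among the reduced rows is multiplied by the pivot; the
      coefficient of row \<open>i0\<close> collects the terms subtracted during the
      reduction.\<close>
    define c' where "c' i = (if i = i0 then (\<lambda>y. - (\<Sum>i\<in>I-{i0}. c i y * m i j0 y)) else (\<lambda>y. c i y * m i0 j0 y))" for i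
    have "c' i \<in> pfun Y" if "i \<in> I" for i
      using that c(1) insert.prems(3) i0
      by (auto simp: c'_def intro!: pfun_uminus pfun_sum pfun_mult)
    moreover have "\<exists>i\<in>I. \<exists>y\<in>Y. c' i y \<noteq> 0"
    proof -
      obtain i where i: "i \<in> I - {i0}" "\<exists>y\<in>Y. c i y \<noteq> 0" using c(2) by blast
      have mp: "m i0 j0 \<in> pfun Y" using i0 insert.prems(3) by auto
      have "\<not> (\<forall>y\<in>Y. c i y * m i0 j0 y = 0)"
        using pfun_domain[OF Y c(1)[OF i(1)] mp] i(2) i0(2,3) by blast
      then show ?thesis using i(1) by (intro bexI[of _ i]) (auto simp: c'_def)
    qed
    moreover have "(\<Sum>i\<in>I. c' i y * m i j y) = 0" if j: "j \<in> insert j0 J" and y: "y \<in> Y" for j y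
    proof -
      have "(\<Sum>i\<in>I. c' i y * m i j y) = c' i0 y * m i0 j y + (\<Sum>i\<in>I-{i0}. c' i y * m i j y)"
        using i0(1) insert.prems(1) by (simp add: sum.remove)
      also have "(\<Sum>i\<in>I-{i0}. c' i y * m i j y) = (\<Sum>i\<in>I-{i0}. c i y * m i0 j0 y * m i j y)"
        by (intro sum.cong) (auto simp: c'_def)
      also have "c' i0 y * m i0 j y = - (\<Sum>i\<in>I-{i0}. c i y * m i j0 y * m i0 j y)"
        by (simp add: c'_def sum_distrib_right)
      finally have "(\<Sum>i\<in>I. c' i y * m i j y) = (\<Sum>i\<in>I-{i0}. c i y * m' i j y)"
        by (simp add: m'_def right_diff_distrib sum_subtractf mult.assoc)
      also have "\<dots> = 0"
      proof (cases "j = j0")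
        case True
        then show ?thesis by (intro sum.neutral) (simp add: m'_def)
      next
        case False
        then show ?thesis using c(3) j y by auto
      qed
      finally show ?thesis .
    qed
    ultimately show ?thesis by blast
  qed
qed

section \<open>Logarithmic vector fields\<close>

definition pmap :: "('i \<Rightarrow> 'k::field) set \<Rightarrow> (('i \<Rightarrow> 'k) \<Rightarrow> ('i \<Rightarrow> 'k)) set" where
  "pmap Y = {\<theta>. (\<forall>y\<in>Y. \<theta> y \<in> Y) \<and> (\<forall>\<phi>. linear_fun \<phi> \<longrightarrow> (\<lambda>y. \<phi> (\<theta> y)) \<in> pfun Y)}"

text \<open>Tangency to each hyperplane as a set. For polynomial fields this amounts to divisibility
  of \<open>\<theta>(\<alpha>)\<close> by \<alpha>, but no form has to be chosen and restriction to
  a hyperplane of \<open>A\<close> is immediate.\<close>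

definition lder :: "('i \<Rightarrow> 'k::field) set \<Rightarrow> ('i \<Rightarrow> 'k) set set \<Rightarrow> (('i \<Rightarrow> 'k) \<Rightarrow> ('i \<Rightarrow> 'k)) set" where
  "lder Y A = {\<theta> \<in> pmap Y. \<forall>H\<in>A. \<forall>y\<in>H. \<theta> y \<in> H}"

definition is_form :: "('i \<Rightarrow> 'k::field) set \<Rightarrow> ('i \<Rightarrow> 'k) set \<Rightarrow> (('i \<Rightarrow> 'k) \<Rightarrow> 'k) \<Rightarrow> bool" where
  "is_form Y H \<alpha> \<longleftrightarrow> linear_fun \<alpha> \<and> (\<exists>e\<in>Y. \<alpha> e \<noteq> 0) \<and> H = {y\<in>Y. \<alpha> y = 0}"

definition hyperplane :: "('i \<Rightarrow> 'k::field) set \<Rightarrow> ('i \<Rightarrow> 'k) set \<Rightarrow> bool" where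
  "hyperplane Y H \<longleftrightarrow> (\<exists>\<alpha>. is_form Y H \<alpha>)"

text \<open>An indexed family, so that repeated degrees are kept apart, with all identities tested
  on \<open>Y\<close> only.\<close>

definition lder_basis ::
  "('i \<Rightarrow> 'k::field) set \<Rightarrow> ('i \<Rightarrow> 'k) set set \<Rightarrow> 'b set \<Rightarrow> ('b \<Rightarrow> ('i \<Rightarrow> 'k) \<Rightarrow> ('i \<Rightarrow> 'k)) \<Rightarrow> bool" where
  "lder_basis Y A I \<theta> \<longleftrightarrow> finite I \<and> (\<forall>i\<in>I. \<theta> i \<in> lder Y A) \<and>
     (\<forall>\<eta>\<in>lder Y A. \<exists>c. (\<forall>i\<in>I. c i \<in> pfun Y) \<and> (\<forall>y\<in>Y. \<eta> y = (\<Sum>i\<in>I. fscale (c i y) (\<theta> i y)))) \<and>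
     (\<forall>c. (\<forall>i\<in>I. c i \<in> pfun Y) \<longrightarrow> (\<forall>y\<in>Y. (\<Sum>i\<in>I. fscale (c i y) (\<theta> i y)) = 0) \<longrightarrow>
        (\<forall>i\<in>I. \<forall>y\<in>Y. c i y = 0))"

definition homog :: "('i \<Rightarrow> 'k::field) set \<Rightarrow> nat \<Rightarrow> (('i \<Rightarrow> 'k) \<Rightarrow> ('i \<Rightarrow> 'k)) \<Rightarrow> bool" where
  "homog Y d \<theta> \<longleftrightarrow> (\<forall>t y. t \<noteq> 0 \<longrightarrow> y \<in> Y \<longrightarrow> \<theta> (fscale t y) = fscale (t ^ d) (\<theta> y))"

definition fin_coords :: "('i \<Rightarrow> 'k::field) set \<Rightarrow> bool" where
  "fin_coords Y \<longleftrightarrow> subsp Y \<and> (\<exists>N f. coordinates Y N f)"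

lemma pmapD: "\<theta> \<in> pmap Y \<Longrightarrow> y \<in> Y \<Longrightarrow> \<theta> y \<in> Y"
  and pmap_pfun: "\<theta> \<in> pmap Y \<Longrightarrow> linear_fun \<phi> \<Longrightarrow> (\<lambda>y. \<phi> (\<theta> y)) \<in> pfun Y"
  by (auto simp: pmap_def)

lemma lder_pmap: "\<theta> \<in> lder Y A \<Longrightarrow> \<theta> \<in> pmap Y"
  and lderD: "\<theta> \<in> lder Y A \<Longrightarrow> H \<in> A \<Longrightarrow> y \<in> H \<Longrightarrow> \<theta> y \<in> H"
  by (auto simp: lder_def)

lemma lder_basis_span:
  assumes "lder_basis Y A I \<theta>" "\<eta> \<in> lder Y A"
  obtains c where "\<forall>i\<in>I. c i \<in> pfun Y" "\<forall>y\<in>Y. \<eta> y = (\<Sum>i\<in>I. fscale (c i y) (\<theta> i y))"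
  using assms(1)[unfolded lder_basis_def, THEN conjunct2, THEN conjunct2, THEN conjunct1, rule_format, OF assms(2)]
  by blast

lemma lder_basis_indep:
  assumes "lder_basis Y A I \<theta>" "\<forall>i\<in>I. c i \<in> pfun Y" "\<forall>y\<in>Y. (\<Sum>i\<in>I. fscale (c i y) (\<theta> i y)) = 0"
  shows "\<forall>i\<in>I. \<forall>y\<in>Y. c i y = 0"
  using assms(1)[unfolded lder_basis_def, THEN conjunct2, THEN conjunct2, THEN conjunct2, rule_format] assms(2,3)
  by blast

lemma pmapI:
  "(\<And>y. y \<in> Y \<Longrightarrow> \<theta> y \<in> Y) \<Longrightarrow> (\<And>\<phi>. linear_fun \<phi> \<Longrightarrow> (\<lambda>y. \<phi> (\<theta> y)) \<in> pfun Y) \<Longrightarrow> \<theta> \<in> pmap Y"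
  by (auto simp: pmap_def)

lemma pmap_add:
  assumes "subsp Y" "\<theta> \<in> pmap Y" "\<eta> \<in> pmap Y" shows "(\<lambda>y. \<theta> y + \<eta> y) \<in> pmap Y"
proof (rule pmapI)
  show "\<theta> y + \<eta> y \<in> Y" if "y \<in> Y" for y
    using that assms by (auto intro: subsp_add dest: pmapD)
  show "(\<lambda>y. \<phi> (\<theta> y + \<eta> y)) \<in> pfun Y" if "linear_fun \<phi>" for \<phi>
    using pfun_add[OF assms(2,3)[THEN pmap_pfun, OF that]] linear_fun_add[OF that]
    by (elim pfun_cong) simp
qed

lemma pmap_scale:
  assumes "subsp Y" "p \<in> pfun Y" "\<theta> \<in> pmap Y" shows "(\<lambda>y. fscale (p y) (\<theta> y)) \<in> pmap Y"
proof (rule pmapI)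
  show "fscale (p y) (\<theta> y) \<in> Y" if "y \<in> Y" for y
    using that assms by (auto intro: subsp_scale dest: pmapD)
  show "(\<lambda>y. \<phi> (fscale (p y) (\<theta> y))) \<in> pfun Y" if "linear_fun \<phi>" for \<phi>
    using pfun_mult[OF assms(2) pmap_pfun[OF assms(3) that]] linear_fun_scale[OF that]
    by (elim pfun_cong) simp
qed

lemma pmap_const: "b \<in> Y \<Longrightarrow> (\<lambda>_. b) \<in> pmap Y"
  by (auto simp: pmap_def intro: pfun_const)

lemma pmap_sum:
  assumes "subsp Y" "\<And>i. i \<in> I \<Longrightarrow> \<theta> i \<in> pmap Y" shows "(\<lambda>y. \<Sum>i\<in>I. \<theta> i y) \<in> pmap Y"
proof (rule pmapI)
  show "(\<Sum>i\<in>I. \<theta> i y) \<in> Y" if "y \<in> Y" for y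
    using that assms by (auto intro!: subsp_sum dest: pmapD)
  show "(\<lambda>y. \<phi> (\<Sum>i\<in>I. \<theta> i y)) \<in> pfun Y" if "linear_fun \<phi>" for \<phi>
    unfolding linear_fun_sum[OF that] by (rule pfun_sum, rule pmap_pfun[OF assms(2) that])
qed

lemma hyperplane_subsp: "subsp Y \<Longrightarrow> hyperplane Y H \<Longrightarrow> subsp H"
  by (auto simp: hyperplane_def is_form_def fun_space.subspace_def linear_fun_0 linear_fun_add linear_fun_scale)

lemma hyperplane_subset: "hyperplane Y H \<Longrightarrow> H \<subseteq> Y"
  by (auto simp: hyperplane_def is_form_def)

lemma lder_sum:
  assumes Y: "subsp Y" and A: "\<forall>h\<in>A. hyperplane Y h"
    and c: "\<And>i. i \<in> I \<Longrightarrow> c i \<in> pfun Y" and \<theta>: "\<And>i. i \<in> I \<Longrightarrow> \<theta> i \<in> lder Y A"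
  shows "(\<lambda>y. \<Sum>i\<in>I. fscale (c i y) (\<theta> i y)) \<in> lder Y A"
proof -
  have "(\<Sum>i\<in>I. fscale (c i y) (\<theta> i y)) \<in> H" if "H \<in> A" "y \<in> H" for H y
    using that \<theta> hyperplane_subsp[OF Y] A by (intro subsp_sum subsp_scale) (auto dest: lderD)
  moreover have "(\<lambda>y. \<Sum>i\<in>I. fscale (c i y) (\<theta> i y)) \<in> pmap Y"
    using c \<theta> by (intro pmap_sum pmap_scale Y) (auto dest: lder_pmap)
  ultimately show ?thesis by (auto simp: lder_def)
qed

lemma is_form_proj:
  assumes Y: "subsp Y" and H: "is_form Y H \<alpha>"
  obtains e where "e \<in> Y" "\<alpha> e = 1" "linear_map (\<lambda>y. y - fscale (\<alpha> y) e)"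
    "\<And>y. y \<in> Y \<Longrightarrow> y - fscale (\<alpha> y) e \<in> H" "\<And>y. y \<in> H \<Longrightarrow> y - fscale (\<alpha> y) e = y"
proof -
  obtain e0 where e0: "e0 \<in> Y" "\<alpha> e0 \<noteq> 0" and \<alpha>: "linear_fun \<alpha>" and Heq: "H = {y\<in>Y. \<alpha> y = 0}"
    using H by (auto simp: is_form_def)
  define e where "e = fscale (1 / \<alpha> e0) e0"
  have e: "e \<in> Y" "\<alpha> e = 1" using e0 Y \<alpha> by (auto simp: e_def subsp_scale linear_fun_scale)
  have "y - fscale (\<alpha> y) e \<in> H" if "y \<in> Y" for y
    using that e Y \<alpha> by (auto simp: Heq subsp_diff subsp_scale linear_fun_diff linear_fun_scale)
  moreover have "y - fscale (\<alpha> y) e = y" if "y \<in> H" for y using that by (simp add: Heq)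
  ultimately show ?thesis using that e linear_map_proj[OF \<alpha>] by blast
qed

lemma hyperplane_subset_eq:
  assumes Y: "subsp Y" and H: "hyperplane Y H" and H': "hyperplane Y H'" and sub: "H \<subseteq> H'"
  shows "H = H'"
proof -
  obtain \<alpha> \<beta> where \<alpha>: "is_form Y H \<alpha>" and \<beta>: "is_form Y H' \<beta>" using H H' by (auto simp: hyperplane_def)
  obtain e where e: "e \<in> Y" "\<alpha> e = 1" "\<And>y. y \<in> Y \<Longrightarrow> y - fscale (\<alpha> y) e \<in> H"
    using is_form_proj[OF Y \<alpha>] by metis
  have lin: "linear_fun \<beta>" and H'eq: "H' = {y\<in>Y. \<beta> y = 0}" using \<beta> by (auto simp: is_form_def)
  have eq: "\<beta> y = \<alpha> y * \<beta> e" if "y \<in> Y" for y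
  proof -
    have "\<beta> (y - fscale (\<alpha> y) e) = 0" using e(3)[OF that] sub H'eq by auto
    then show ?thesis using lin by (simp add: linear_fun_diff linear_fun_scale)
  qed
  have "\<beta> e \<noteq> 0" using \<beta> eq by (auto simp: is_form_def)
  then have "H' \<subseteq> H" using eq \<alpha> H'eq by (auto simp: is_form_def)
  then show ?thesis using sub by auto
qed

lemma hyperplane_restrict:
  assumes Y: "subsp Y" and H: "hyperplane Y H" and H': "is_form Y H' \<beta>" and ne: "H \<noteq> H'"
  shows "is_form H (H' \<inter> H) \<beta>"
proof -
  have "\<not> H \<subseteq> H'" using hyperplane_subset_eq[OF Y H] H' ne by (auto simp: hyperplane_def)
  then show ?thesis using H' hyperplane_subset[OF H] by (auto simp: is_form_def)
qed

lemma restriction_hyperplanes: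
  assumes Y: "subsp Y" and A: "\<forall>h\<in>A. hyperplane Y h" and H: "hyperplane Y H"
  shows "restriction A H = (\<lambda>h. h \<inter> H) ` (A - {H})"
proof -
  have "\<not> H \<subseteq> h \<longleftrightarrow> h \<noteq> H" if "h \<in> A" for h
    using hyperplane_subset_eq[OF Y H A[rule_format, OF that]] by blast
  then show ?thesis by (auto simp: restriction_def)
qed

lemma lder_restrict:
  assumes "\<theta> \<in> lder Y A" "H \<in> A" "H \<subseteq> Y"
  shows "\<theta> \<in> lder H (restriction A H)"
  using assms pfun_mono[OF _ assms(3)] by (auto simp: lder_def pmap_def restriction_def)

section \<open>Linear coordinates, and division of vector fields by a linear form\<close>

abbreviation std :: "nat \<Rightarrow> (nat \<Rightarrow> 'k::zero) set" where
  "std N \<equiv> coord_space {..<N}"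

definition unit_vec :: "nat \<Rightarrow> nat \<Rightarrow> 'k::zero_neq_one" where
  "unit_vec k = (\<lambda>i. if i = k then 1 else 0)"

lemma std_expand:
  fixes x :: "nat \<Rightarrow> 'k::field"
  assumes "x \<in> std N" shows "x = (\<Sum>k<N. fscale (x k) (unit_vec k))"
proof
  fix i show "x i = (\<Sum>k<N. fscale (x k) (unit_vec k)) i"
    using assms by (auto simp: sum_fun_apply unit_vec_def coord_space_def if_distrib cong: if_cong)
qed

lemma coordinates_basis:
  fixes Y :: "('i \<Rightarrow> 'k::field) set"
  assumes Y: "subsp Y" and c: "coordinates Y N f"
  shows "\<exists>b. (\<forall>k<N. b k \<in> Y) \<and> (\<forall>y\<in>Y. y = (\<Sum>k<N. fscale (f y k) (b k))) \<and>
    (\<forall>x\<in>std N. f (\<Sum>k<N. fscale (x k) (b k)) = x)"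
proof -
  have f: "linear_map f" "bij_betw f Y (std N)" using c by (auto simp: coordinates_def)
  define u :: "nat \<Rightarrow> nat \<Rightarrow> 'k" where "u = unit_vec"
  have u: "u k \<in> std N" if "k < N" for k using that by (auto simp: u_def unit_vec_def coord_space_def)
  define b where "b k = inv_into Y f (u k)" for k
  have b: "b k \<in> Y" "f (b k) = u k" if "k < N" for k
    using u[OF that] f(2) by (auto simp: b_def bij_betw_def inv_into_into f_inv_into_f)
  have fb: "f (\<Sum>k<N. fscale (x k) (b k)) = x" if "x \<in> std N" for x
    using b(2) std_expand[OF that] by (simp add: linear_map_sum[OF f(1)] linear_map_scale[OF f(1)] u_def)
  have "y = (\<Sum>k<N. fscale (f y k) (b k))" if y: "y \<in> Y" for y
  proof -
    have "f y \<in> std N" using f(2) y by (auto simp: bij_betw_def)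
    then have "f (\<Sum>k<N. fscale (f y k) (b k)) = f y" by (rule fb)
    moreover have "(\<Sum>k<N. fscale (f y k) (b k)) \<in> Y" using b(1) Y by (intro subsp_sum subsp_scale) auto
    ultimately show ?thesis using f(2) y by (metis bij_betw_def inj_onD)
  qed
  then show ?thesis using b(1) fb by (intro exI[of _ b]) auto
qed

lemma pmap_divide:
  assumes Y: "fin_coords Y" and \<alpha>: "is_form Y H \<alpha>" and \<eta>: "\<eta> \<in> pmap Y" and van: "\<And>y. y \<in> H \<Longrightarrow> \<eta> y = 0"
  shows "\<exists>\<psi>\<in>pmap Y. \<forall>y\<in>Y. \<eta> y = fscale (\<alpha> y) (\<psi> y)"
proof -
  have sY: "subsp Y" using Y by (simp add: fin_coords_def)
  obtain N f where cf: "coordinates Y N f" using Y by (auto simp: fin_coords_def)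
  obtain b where b: "\<forall>k<N. b k \<in> Y" "\<forall>y\<in>Y. y = (\<Sum>k<N. fscale (f y k) (b k))"
    using coordinates_basis[OF sY cf] by blast
  have f: "linear_map f" "\<And>k. k < N \<Longrightarrow> b k \<in> Y"
    "\<And>y. y \<in> Y \<Longrightarrow> y = (\<Sum>k<N. fscale (f y k) (b k))" using b cf by (auto simp: coordinates_def)
  obtain e where a: "linear_fun \<alpha>" "e \<in> Y" "\<alpha> e \<noteq> 0" "H = {y\<in>Y. \<alpha> y = 0}"
    using \<alpha> by (auto simp: is_form_def)
  have "\<exists>q\<in>pfun Y. \<forall>y\<in>Y. f (\<eta> y) k = \<alpha> y * q y" for k
  proof (rule pfun_divide[OF sY _ a(1-3)])
    show "(\<lambda>y. f (\<eta> y) k) \<in> pfun Y" by (rule pmap_pfun[OF \<eta> linear_fun_component[OF f(1)]])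
    show "\<forall>y\<in>Y. \<alpha> y = 0 \<longrightarrow> f (\<eta> y) k = 0" using van a(4) by (simp add: linear_map_0[OF f(1)])
  qed
  then obtain q where q: "\<And>k. q k \<in> pfun Y" "\<And>k y. y \<in> Y \<Longrightarrow> f (\<eta> y) k = \<alpha> y * q k y" by metis
  define \<psi> where "\<psi> = (\<lambda>y. \<Sum>k<N. fscale (q k y) (b k))"
  have "\<eta> y = fscale (\<alpha> y) (\<psi> y)" if y: "y \<in> Y" for y
  proof -
    have "\<eta> y = (\<Sum>k<N. fscale (\<alpha> y * q k y) (b k))"
      using f(3)[OF pmapD[OF \<eta> y]] q(2)[OF y] by simp
    also have "\<dots> = fscale (\<alpha> y) (\<psi> y)"
      by (simp add: \<psi>_def fun_eq_iff sum_fun_apply sum_distrib_left mult.assoc)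
    finally show ?thesis .
  qed
  moreover have "\<psi> \<in> pmap Y"
    unfolding \<psi>_def using f(2) q(1) by (intro pmap_sum pmap_scale pmap_const sY) auto
  ultimately show ?thesis by blast
qed

text \<open>A combination \<eta> that vanishes on \<open>H\<close> equals
  \<open>\<alpha> \<psi>\<close>, and \<psi> is again logarithmic along \<open>A\<close>, because
  \<alpha> can be cancelled on every hyperplane other than \<open>H\<close>. Expanding \<psi> in the
  basis and comparing shows that the coefficients of \<eta> are multiples of \<alpha>, hence zero on
  \<open>H\<close>.\<close>

lemma lder_basis_indep_restrict:
  fixes Y :: "('i \<Rightarrow> 'k::field_char_0) set"
  assumes Y: "fin_coords Y" and A: "\<forall>h\<in>A. hyperplane Y h" and H: "hyperplane Y H" and HA: "H \<notin> A"
    and bas: "lder_basis Y A I \<theta>" and c: "\<And>i. i \<in> I \<Longrightarrow> c i \<in> pfun H"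
    and rel: "\<And>y. y \<in> H \<Longrightarrow> (\<Sum>i\<in>I. fscale (c i y) (\<theta> i y)) = 0"
    and i: "i \<in> I" "y \<in> H"
  shows "c i y = 0"
proof -
  have sY: "subsp Y" using Y by (simp add: fin_coords_def)
  obtain \<alpha> where \<alpha>: "is_form Y H \<alpha>" using H by (auto simp: hyperplane_def)
  then have Heq: "H = {y\<in>Y. \<alpha> y = 0}" and la: "linear_fun \<alpha>" by (auto simp: is_form_def)
  have "\<exists>q\<in>polyfun. \<forall>y\<in>H. c i y = q y" if "i \<in> I" for i using c[OF that] by (auto simp: pfun_def)
  then obtain q where q: "\<And>i. i \<in> I \<Longrightarrow> q i \<in> polyfun" "\<And>i y. i \<in> I \<Longrightarrow> y \<in> H \<Longrightarrow> c i y = q i y" by metis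
  define \<eta> where "\<eta> = (\<lambda>y. \<Sum>i\<in>I. fscale (q i y) (\<theta> i y))"
  have th: "\<And>i. i \<in> I \<Longrightarrow> \<theta> i \<in> lder Y A" using bas by (auto simp: lder_basis_def)
  have \<eta>: "\<eta> \<in> lder Y A" unfolding \<eta>_def using th q(1) by (intro lder_sum sY A pfun_polyfun)
  have "\<eta> y = 0" if "y \<in> H" for y
    using rel[OF that] q(2)[OF _ that] by (simp add: \<eta>_def)
  then obtain \<psi> where \<psi>: "\<psi> \<in> pmap Y" "\<And>y. y \<in> Y \<Longrightarrow> \<eta> y = fscale (\<alpha> y) (\<psi> y)"
    using pmap_divide[OF Y \<alpha> lder_pmap[OF \<eta>]] by metis
  have "\<psi> \<in> lder Y A"
    unfolding lder_def
  proof (intro CollectI conjI ballI)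
    fix h y assume h: "h \<in> A" "y \<in> h"
    obtain \<beta> where \<beta>: "is_form Y h \<beta>" using A[rule_format, OF h(1)] by (auto simp: hyperplane_def)
    then have heq: "h = {y\<in>Y. \<beta> y = 0}" and lb: "linear_fun \<beta>" by (auto simp: is_form_def)
    have sh: "subsp h" and hY: "h \<subseteq> Y" using hyperplane_subsp[OF sY A[rule_format, OF h(1)]] heq by auto
    \<comment> \<open>As \<open>h\<close> and \<open>H\<close> differ, \<alpha> is not identically
      zero on \<open>h\<close>, which permits the cancellation there.\<close>
    obtain z where z: "z \<in> h" "\<alpha> z \<noteq> 0"
      using hyperplane_subset_eq[OF sY A[rule_format, OF h(1)] H] HA h(1) hY Heq by blast
    have m: "(\<lambda>y. \<beta> (\<psi> y)) \<in> pfun h" using pfun_mono[OF pmap_pfun[OF \<psi>(1) lb] hY] .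
    have eq: "\<forall>y\<in>h. \<alpha> y * \<beta> (\<psi> y) = \<alpha> y * 0"
    proof
      fix y assume y: "y \<in> h"
      have "\<beta> (\<eta> y) = 0" using lderD[OF \<eta> h(1) y] heq by auto
      then show "\<alpha> y * \<beta> (\<psi> y) = \<alpha> y * 0" using \<psi>(2)[of y] y hY lb by (auto simp: linear_fun_scale)
    qed
    have "\<forall>y\<in>h. \<beta> (\<psi> y) = 0" by (rule pfun_cancel[OF sh pfun_lin[OF la] m pfun_const eq z])
    then show "\<psi> y \<in> h" using h(2) hY pmapD[OF \<psi>(1)] by (auto simp: heq)
  qed (rule \<psi>(1))
  from lder_basis_span[OF bas this] obtain g where g: "\<forall>i\<in>I. g i \<in> pfun Y"
    "\<forall>y\<in>Y. \<psi> y = (\<Sum>i\<in>I. fscale (g i y) (\<theta> i y))" .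
  have "\<forall>i\<in>I. \<forall>y\<in>Y. q i y - \<alpha> y * g i y = 0"
  proof -
    have "\<forall>i\<in>I. (\<lambda>y. q i y - \<alpha> y * g i y) \<in> pfun Y"
      by (intro ballI pfun_diff[OF pfun_polyfun[OF q(1)]] pfun_mult[OF pfun_lin[OF la]] g(1)[rule_format])
    moreover have "\<forall>y\<in>Y. (\<Sum>i\<in>I. fscale (q i y - \<alpha> y * g i y) (\<theta> i y)) = 0"
    proof
      fix y assume y: "y \<in> Y"
      have "(\<Sum>i\<in>I. fscale (q i y) (\<theta> i y)) = fscale (\<alpha> y) (\<Sum>i\<in>I. fscale (g i y) (\<theta> i y))"
        using \<psi>(2)[OF y] g(2) y by (simp add: \<eta>_def)
      then have "\<forall>x. (\<Sum>i\<in>I. q i y * \<theta> i y x) = (\<Sum>i\<in>I. \<alpha> y * (g i y * \<theta> i y x))"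
        by (simp add: fun_eq_iff sum_fun_apply sum_distrib_left)
      then show "(\<Sum>i\<in>I. fscale (q i y - \<alpha> y * g i y) (\<theta> i y)) = 0"
        by (simp add: fun_eq_iff sum_fun_apply left_diff_distrib sum_subtractf mult.assoc)
    qed
    ultimately show ?thesis by (rule lder_basis_indep[OF bas])
  qed
  then show ?thesis using i q(2)[OF i] Heq by auto
qed

text \<open>On the kernel of \<open>\<beta> j\<close> the right side vanishes but \<open>u\<close>
  is not identically zero, so \<open>q\<close> vanishes there and the factor
  \<open>\<beta> j\<close> splits off. This takes the place of unique factorization.\<close>

lemma pfun_coprime_divide:
  fixes Y :: "('i \<Rightarrow> 'k::field_char_0) set"
  assumes Y: "subsp Y" and fin: "finite J" and \<beta>: "\<And>j. j \<in> J \<Longrightarrow> linear_fun (\<beta> j)"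
    and u: "u \<in> pfun Y" and nz: "\<And>j. j \<in> J \<Longrightarrow> \<exists>y\<in>Y. \<beta> j y = 0 \<and> u y \<noteq> 0" and \<beta>nz: "\<And>j. j \<in> J \<Longrightarrow> \<exists>y\<in>Y. \<beta> j y \<noteq> 0"
    and q: "q \<in> pfun Y" and r: "r \<in> pfun Y" and eq: "\<And>y. y \<in> Y \<Longrightarrow> u y * q y = (\<Prod>j\<in>J. \<beta> j y) * r y"
  shows "\<exists>s\<in>pfun Y. \<forall>y\<in>Y. q y = (\<Prod>j\<in>J. \<beta> j y) * s y"
  using fin \<beta> nz \<beta>nz q eq
proof (induction J arbitrary: q rule: finite_induct)
  case empty
  then show ?case by (intro bexI[of _ q]) auto
next
  case (insert j J)
  define h where "h = {y\<in>Y. \<beta> j y = 0}"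
  have lj: "linear_fun (\<beta> j)" using insert.prems by auto
  obtain e where e: "e \<in> Y" "\<beta> j e \<noteq> 0" using insert.prems(3)[of j] by blast
  have h: "is_form Y h (\<beta> j)" using lj e by (auto simp: is_form_def h_def)
  have sh: "subsp h" by (rule hyperplane_subsp[OF Y]) (use h in \<open>auto simp: hyperplane_def\<close>)
  have hY: "h \<subseteq> Y" by (auto simp: h_def)
  obtain z where z: "z \<in> h" "u z \<noteq> 0" using insert.prems(2)[of j] by (auto simp: h_def)
  have uq: "u \<in> pfun h" "q \<in> pfun h" using u insert.prems hY by (auto intro: pfun_mono)
  have "\<forall>y\<in>h. u y * q y = u y * 0"
    using insert.prems(5) insert.hyps by (auto simp: h_def)
  then have "\<forall>y\<in>h. q y = 0" by (rule pfun_cancel[OF sh uq pfun_const _ z])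
  then obtain q' where q': "q' \<in> pfun Y" "\<And>y. y \<in> Y \<Longrightarrow> q y = \<beta> j y * q' y"
    using pfun_divide[OF Y insert.prems(4) lj e] by (auto simp: h_def)
  have pr: "(\<lambda>y. (\<Prod>j\<in>J. \<beta> j y) * r y) \<in> pfun Y"
    by (rule pfun_mult[OF pfun_prod r], rule pfun_lin, rule insert.prems(1)) simp
  have "\<forall>y\<in>Y. \<beta> j y * (u y * q' y) = \<beta> j y * ((\<Prod>j\<in>J. \<beta> j y) * r y)"
    using insert.prems(5) insert.hyps q'(2) by (simp add: mult_ac)
  then have eq': "\<forall>y\<in>Y. u y * q' y = (\<Prod>j\<in>J. \<beta> j y) * r y"
    by (rule pfun_cancel[OF Y pfun_lin[OF lj] pfun_mult[OF u q'(1)] pr _ e])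
  have "\<exists>s\<in>pfun Y. \<forall>y\<in>Y. q' y = (\<Prod>j\<in>J. \<beta> j y) * s y"
  proof (rule insert.IH[OF _ _ _ q'(1)])
    show "linear_fun (\<beta> j)" "\<exists>y\<in>Y. \<beta> j y = 0 \<and> u y \<noteq> 0" "\<exists>y\<in>Y. \<beta> j y \<noteq> 0" if "j \<in> J" for j
      using that insert.prems(1-3) by blast+
    show "u y * q' y = (\<Prod>j\<in>J. \<beta> j y) * r y" if "y \<in> Y" for y using eq' that by blast
  qed
  then obtain s where "s \<in> pfun Y" "\<forall>y\<in>Y. q' y = (\<Prod>j\<in>J. \<beta> j y) * s y" by blast
  then show ?case using insert.hyps q'(2) by (intro bexI[of _ s]) auto
qed

lemma pfun_prod_nonzero:
  fixes Y :: "('i \<Rightarrow> 'k::field_char_0) set"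
  assumes Y: "subsp Y" and fin: "finite J" and \<beta>: "\<And>j. j \<in> J \<Longrightarrow> \<beta> j \<in> pfun Y"
    and nz: "\<And>j. j \<in> J \<Longrightarrow> \<exists>y\<in>Y. \<beta> j y \<noteq> 0"
  shows "\<exists>y\<in>Y. (\<Prod>j\<in>J. \<beta> j y) \<noteq> 0"
  using fin \<beta> nz
proof (induction J rule: finite_induct)
  case empty
  then show ?case using subsp_0[OF Y] by auto
next
  case (insert j J)
  have "(\<lambda>y. \<Prod>j\<in>J. \<beta> j y) \<in> pfun Y" using insert.prems by (intro pfun_prod) auto
  then have "\<not> (\<forall>y\<in>Y. \<beta> j y * (\<Prod>j\<in>J. \<beta> j y) = 0)"
    using pfun_domain[OF Y insert.prems(1)[of j]] insert by blast
  then show ?case using insert.hyps by auto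
qed

section \<open>The addition theorem\<close>

definition form_of :: "('i \<Rightarrow> 'k::field) set \<Rightarrow> ('i \<Rightarrow> 'k) set \<Rightarrow> ('i \<Rightarrow> 'k) \<Rightarrow> 'k" where
  "form_of Y H = (SOME \<alpha>. is_form Y H \<alpha>)"

lemma form_of:
  assumes "hyperplane Y H" shows "is_form Y H (form_of Y H)"
proof -
  obtain \<alpha> where "is_form Y H \<alpha>" using assms by (auto simp: hyperplane_def)
  then show ?thesis unfolding form_of_def by (rule someI[where P = "is_form Y H"])
qed

lemma is_form_linear: "is_form Y H \<alpha> \<Longrightarrow> linear_fun \<alpha>"
  and is_form_iff: "is_form Y H \<alpha> \<Longrightarrow> y \<in> H \<longleftrightarrow> y \<in> Y \<and> \<alpha> y = 0"
  and is_form_nonzero: "is_form Y H \<alpha> \<Longrightarrow> \<exists>e\<in>Y. \<alpha> e \<noteq> 0"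
  by (auto simp: is_form_def)

lemma is_form_hyperplane: "is_form Y H \<alpha> \<Longrightarrow> hyperplane Y H"
  by (auto simp: hyperplane_def)

text \<open>For hyperplanes \<open>h\<close> through a common \<open>K = h \<inter> H\<close>, with forms \<open>\<beta>\<close>, the polynomial
  \<open>\<alpha> \<cdot> \<theta>(\<beta>\<^sub>0) - \<beta>\<^sub>0 \<cdot> \<theta>(\<alpha>)\<close> vanishes on every such \<open>h\<close>, because \<open>h/K\<close> is a line containing both
  \<open>y\<close> and \<open>\<theta> y\<close>. Restricting to \<open>H\<close> and cancelling \<open>\<beta>\<^sub>0\<close> gives the divisibility.\<close>

lemma lder_divisible_one:
  fixes Y :: "('i \<Rightarrow> 'k::field_char_0) set"
  assumes Y: "subsp Y" and \<alpha>: "is_form Y H \<alpha>" and fin: "finite J" and h0: "h0 \<notin> J"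
    and J: "\<forall>h\<in>insert h0 J. hyperplane Y h \<and> h \<noteq> H \<and> h \<inter> H = K"
    and \<theta>: "\<theta> \<in> lder Y (insert h0 J)"
  shows "\<exists>g\<in>pfun H. \<forall>y\<in>H. \<alpha> (\<theta> y) = (\<Prod>h\<in>J. form_of Y h y) * g y"
proof -
  define \<beta> where "\<beta> = form_of Y"
  have H: "hyperplane Y H" using \<alpha> by (rule is_form_hyperplane)
  have \<beta>: "is_form Y h (\<beta> h)" if "h \<in> insert h0 J" for h unfolding \<beta>_def using form_of J that by blast
  have l\<alpha>: "linear_fun \<alpha>" and l\<beta>: "\<And>h. h \<in> insert h0 J \<Longrightarrow> linear_fun (\<beta> h)"
    using \<alpha> \<beta> is_form_linear by blast+
  have sH: "subsp H" by (rule hyperplane_subsp[OF Y H])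
  have HY: "H \<subseteq> Y" by (rule hyperplane_subset[OF H])
  define P where "P = (\<lambda>y. \<alpha> y * \<beta> h0 (\<theta> y) - \<beta> h0 y * \<alpha> (\<theta> y))"
  have pm: "\<theta> \<in> pmap Y" using \<theta> by (rule lder_pmap)
  have P: "P \<in> pfun Y"
    unfolding P_def
    by (rule pfun_diff[OF pfun_mult[OF pfun_lin[OF l\<alpha>] pmap_pfun[OF pm]] pfun_mult[OF pfun_lin pmap_pfun[OF pm l\<alpha>]]])
      (simp_all add: l\<beta>)
  have Pzero: "P y = 0" if h: "h \<in> insert h0 J" and y: "y \<in> h" for h y
  proof (cases "\<alpha> y = 0")
    case True
    have "y \<in> h \<inter> H" using y True \<alpha> is_form_iff[OF \<beta>[OF h]] by (auto simp: is_form_iff[OF \<alpha>])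
    then have "y \<in> h0" using J h by auto
    then have "\<beta> h0 y = 0" using is_form_iff[OF \<beta>[of h0]] by auto
    then show ?thesis using True by (simp add: P_def)
  next
    case False
    \<comment> \<open>The multiple of \<open>y\<close> is chosen to bring \<open>w\<close> into
      \<open>H\<close>; then \<open>w\<close> lies in \<open>h \<inter> H = K\<close>, hence in
      \<open>h0\<close>, and this is a linear relation between
      \<open>\<beta> h0 (\<theta> y)\<close> and \<open>\<alpha> (\<theta> y)\<close>.\<close>
    define w where "w = \<theta> y - fscale (\<alpha> (\<theta> y) / \<alpha> y) y"
    have sh: "subsp h" using hyperplane_subsp[OF Y] J h by blast
    have "\<theta> y \<in> h" using lderD[OF \<theta> h y] .
    then have wh: "w \<in> h" using y sh by (simp add: w_def subsp_diff subsp_scale)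
    have "\<alpha> w = 0" using False l\<alpha> by (simp add: w_def linear_fun_diff linear_fun_scale)
    then have "w \<in> h \<inter> H" using wh is_form_iff[OF \<beta>[OF h]] by (auto simp: is_form_iff[OF \<alpha>])
    then have "w \<in> h0" using J h by auto
    then have "\<beta> h0 w = 0" using is_form_iff[OF \<beta>[of h0]] by auto
    then have "\<beta> h0 (\<theta> y) = \<alpha> (\<theta> y) / \<alpha> y * \<beta> h0 y"
      using l\<beta>[of h0] by (simp add: w_def linear_fun_diff linear_fun_scale)
    then show ?thesis using False by (simp add: P_def)
  qed
  have ex0: "\<exists>q\<in>pfun Y. \<forall>y\<in>Y. P y = \<beta> h0 y * q y"
  proof -
    obtain e where e: "e \<in> Y" "\<beta> h0 e \<noteq> 0" using is_form_nonzero[OF \<beta>[of h0]] by auto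
    have "\<forall>y\<in>Y. \<beta> h0 y = 0 \<longrightarrow> P y = 0" using Pzero[of h0] is_form_iff[OF \<beta>[of h0]] by auto
    then show ?thesis by (intro pfun_divide[OF Y P l\<beta> e]) auto
  qed
  then obtain q0 where q0: "q0 \<in> pfun Y" "\<forall>y\<in>Y. P y = \<beta> h0 y * q0 y" by blast
  \<comment> \<open>The other factors split off one by one: on \<open>h\<close> the product of the
    earlier forms is not identically zero and can be cancelled, so the quotient vanishes on
    \<open>h\<close>.\<close>
  have "\<exists>q\<in>pfun Y. \<forall>y\<in>Y. q0 y = (\<Prod>h\<in>J'. \<beta> h y) * q y" if "J' \<subseteq> J" for J'
    using finite_subset[OF that fin] that
  proof (induction J' rule: finite_induct)
    case empty
    then show ?case using q0(1) by (intro bexI[of _ q0]) auto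
  next
    case (insert h J')
    then obtain q where q: "q \<in> pfun Y" "\<forall>y\<in>Y. q0 y = (\<Prod>h\<in>J'. \<beta> h y) * q y" by auto
    have hJ: "h \<in> insert h0 J" using insert by auto
    obtain e where e: "e \<in> Y" "\<beta> h e \<noteq> 0" using is_form_nonzero[OF \<beta>[OF hJ]] by auto
    have sh: "subsp h" and hY: "h \<subseteq> Y"
      using hyperplane_subsp[OF Y] hyperplane_subset J hJ by blast+
    have nz: "\<exists>y\<in>h. \<beta> h' y \<noteq> 0" if "h' \<in> insert h0 J'" for h'
    proof -
      have h': "h' \<in> insert h0 J" and ne: "h' \<noteq> h" using that insert h0 by auto
      have "hyperplane Y h" using J hJ by blast
      from is_form_nonzero[OF hyperplane_restrict[OF Y this \<beta>[OF h']]] ne show ?thesis by blast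
    qed
    have "\<exists>y\<in>h. (\<Prod>h\<in>insert h0 J'. \<beta> h y) \<noteq> 0"
      by (rule pfun_prod_nonzero[OF sh _ _ nz]) (use insert l\<beta> in \<open>auto intro!: pfun_lin\<close>)
    then obtain z where z: "z \<in> h" "(\<Prod>h\<in>insert h0 J'. \<beta> h z) \<noteq> 0" by blast
    have pr: "(\<lambda>y. \<Prod>h\<in>insert h0 J'. \<beta> h y) \<in> pfun h"
      by (rule pfun_prod, rule pfun_lin, rule l\<beta>) (use insert in auto)
    have "\<forall>y\<in>h. (\<Prod>h\<in>insert h0 J'. \<beta> h y) * q y = (\<Prod>h\<in>insert h0 J'. \<beta> h y) * 0"
    proof
      fix y assume y: "y \<in> h"
      then have "P y = 0" "y \<in> Y" using Pzero[OF hJ y] hY by auto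
      moreover have "h0 \<notin> J'" using insert h0 by auto
      ultimately show "(\<Prod>h\<in>insert h0 J'. \<beta> h y) * q y = (\<Prod>h\<in>insert h0 J'. \<beta> h y) * 0"
        using q0(2) q(2) insert.hyps by (auto simp: mult_ac)
    qed
    then have "\<forall>y\<in>h. q y = 0" by (rule pfun_cancel[OF sh pr pfun_mono[OF q(1) hY] pfun_const _ z])
    then have "\<forall>y\<in>Y. \<beta> h y = 0 \<longrightarrow> q y = 0" using is_form_iff[OF \<beta>[OF hJ]] by auto
    from pfun_divide[OF Y q(1) l\<beta>[OF hJ] e this]
    obtain q' where "q' \<in> pfun Y" "\<forall>y\<in>Y. q y = \<beta> h y * q' y" by blast
    then show ?case using insert.hyps q(2) by (intro bexI[of _ q']) auto
  qed
  from this[OF order_refl] obtain q where q: "q \<in> pfun Y" "\<forall>y\<in>Y. q0 y = (\<Prod>h\<in>J. \<beta> h y) * q y" by blast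
  have h0H: "hyperplane Y h0" "h0 \<noteq> H" using J by auto
  obtain z where z: "z \<in> H" "\<beta> h0 z \<noteq> 0"
    using is_form_nonzero[OF hyperplane_restrict[OF Y H \<beta>[of h0]]] h0H by auto
  \<comment> \<open>On \<open>H\<close> the term of \<open>P\<close> with factor \<alpha> drops
    out.\<close>
  have eq: "\<forall>y\<in>H. \<beta> h0 y * \<alpha> (\<theta> y) = \<beta> h0 y * ((\<Prod>h\<in>J. \<beta> h y) * - q y)"
  proof
    fix y assume y: "y \<in> H"
    then have "P y = - (\<beta> h0 y * \<alpha> (\<theta> y))" using is_form_iff[OF \<alpha>] by (simp add: P_def)
    then have "\<beta> h0 y * \<alpha> (\<theta> y) = - P y" by simp
    also have "P y = \<beta> h0 y * ((\<Prod>h\<in>J. \<beta> h y) * q y)" using q0(2) q(2) y HY by auto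
    finally show "\<beta> h0 y * \<alpha> (\<theta> y) = \<beta> h0 y * ((\<Prod>h\<in>J. \<beta> h y) * - q y)" by simp
  qed
  have qH: "(\<lambda>y. - q y) \<in> pfun H" by (rule pfun_uminus[OF pfun_mono[OF q(1) HY]])
  have p1: "(\<lambda>y. \<alpha> (\<theta> y)) \<in> pfun H" by (rule pfun_mono[OF pmap_pfun[OF pm l\<alpha>] HY])
  have p2: "(\<lambda>y. (\<Prod>h\<in>J. \<beta> h y) * - q y) \<in> pfun H"
    by (rule pfun_mult[OF pfun_prod qH], rule pfun_lin, rule l\<beta>) simp
  have "\<forall>y\<in>H. \<alpha> (\<theta> y) = (\<Prod>h\<in>J. \<beta> h y) * - q y"
    by (rule pfun_cancel[OF sH pfun_lin[OF l\<beta>] p1 p2 eq z]) simp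
  then show ?thesis unfolding \<beta>_def by (rule bexI[OF _ qH])
qed

text \<open>This is the classical polynomial of degree
  \<open>card A - card (restriction A H)\<close>: hyperplanes are grouped by their trace on
  \<open>H\<close>, one representative of each group is left out, and the forms of the rest are
  multiplied. Inside a group \<open>lder_divisible_one\<close> applies; different groups are coprime
  on \<open>H\<close> because their traces differ.\<close>

lemma lder_divisible:
  fixes Y :: "('i \<Rightarrow> 'k::field_char_0) set"
  assumes Y: "subsp Y" and \<alpha>: "is_form Y H \<alpha>" and fin: "finite A" and HA: "H \<notin> A" and A: "\<forall>h\<in>A. hyperplane Y h"
  shows "\<exists>R\<subseteq>A. card R + card (restriction A H) = card A \<and>
    (\<forall>\<theta>\<in>lder Y A. \<exists>g\<in>pfun H. \<forall>y\<in>H. \<alpha> (\<theta> y) = (\<Prod>h\<in>R. form_of Y h y) * g y)"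
proof -
  have H: "hyperplane Y H" using \<alpha> by (rule is_form_hyperplane)
  have sH: "subsp H" by (rule hyperplane_subsp[OF Y H])
  have Hs: "H \<subseteq> Y" by (rule hyperplane_subset[OF H])
  define A'' where "A'' = restriction A H"
  have A''eq: "A'' = (\<lambda>h. h \<inter> H) ` A" unfolding A''_def restriction_hyperplanes[OF Y A H] using HA by simp
  have "\<exists>h\<in>A. K = h \<inter> H" if "K \<in> A''" for K using that A''eq by auto
  then obtain s where s: "\<And>K. K \<in> A'' \<Longrightarrow> s K \<in> A" "\<And>K. K \<in> A'' \<Longrightarrow> s K \<inter> H = K" by metis
  have finA'': "finite A''" using fin A''eq by simp
  have inj: "inj_on s A''" by (rule inj_onI) (metis s(2))
  define R where "R = A - s ` A''"
  have cR: "card R + card A'' = card A"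
  proof -
    have "card A = card (s ` A'') + card R"
      using card_Un_disjoint[of "s ` A''" R] fin finA'' s(1) by (simp add: R_def Un_absorb1 image_subset_iff)
    then show ?thesis using card_image[OF inj] by simp
  qed
  have "\<exists>g\<in>pfun H. \<forall>y\<in>H. \<alpha> (\<theta> y) = (\<Prod>h\<in>{h\<in>R. h \<inter> H \<in> S}. form_of Y h y) * g y"
    if \<theta>: "\<theta> \<in> lder Y A" and S: "S \<subseteq> A''" for \<theta> S
    using finite_subset[OF S finA''] S
  proof (induction S rule: finite_induct)
    case empty
    have "(\<lambda>y. \<alpha> (\<theta> y)) \<in> pfun H"
      by (rule pfun_mono[OF pmap_pfun[OF lder_pmap[OF \<theta>] is_form_linear[OF \<alpha>]] Hs])
    then show ?case by (intro bexI[of _ "\<lambda>y. \<alpha> (\<theta> y)"]) auto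
  next
    case (insert K S)
    define U where "U = {h\<in>R. h \<inter> H \<in> S}"
    define J where "J = {h\<in>R. h \<inter> H = K}"
    have finU: "finite U" and finJ: "finite J" using fin by (auto simp: U_def J_def R_def)
    obtain g where g: "g \<in> pfun H" "\<forall>y\<in>H. \<alpha> (\<theta> y) = (\<Prod>h\<in>U. form_of Y h y) * g y"
      using insert by (auto simp: U_def)
    have K: "K \<in> A''" using insert by auto
    have JA: "insert (s K) J \<subseteq> A" using s(1)[OF K] by (auto simp: J_def R_def)
    have th: "\<theta> \<in> lder Y (insert (s K) J)" using \<theta> JA by (auto simp: lder_def)
    have hy: "\<forall>h\<in>insert (s K) J. hyperplane Y h \<and> h \<noteq> H \<and> h \<inter> H = K"
      using JA A HA s(2)[OF K] by (auto simp: J_def)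
    have nJ: "s K \<notin> J" using K by (auto simp: J_def R_def)
    from lder_divisible_one[OF Y \<alpha> finJ nJ hy th]
    obtain r where r: "r \<in> pfun H" "\<forall>y\<in>H. \<alpha> (\<theta> y) = (\<Prod>h\<in>J. form_of Y h y) * r y" by blast
    have lin: "linear_fun (form_of Y h)" if "h \<in> A" for h using form_of is_form_linear A that by blast
    have UA: "U \<subseteq> A" and JA': "J \<subseteq> A" by (auto simp: U_def J_def R_def)
    have "\<exists>s\<in>pfun H. \<forall>y\<in>H. g y = (\<Prod>h\<in>J. form_of Y h y) * s y"
    proof (rule pfun_coprime_divide[OF sH finJ _ _ _ _ g(1) r(1)])
      show "linear_fun (form_of Y j)" if "j \<in> J" for j using lin that JA' by blast
      show "(\<lambda>y. \<Prod>h\<in>U. form_of Y h y) \<in> pfun H"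
        by (rule pfun_prod, rule pfun_lin, rule lin) (use UA in auto)
      show "(\<Prod>h\<in>U. form_of Y h y) * g y = (\<Prod>h\<in>J. form_of Y h y) * r y" if "y \<in> H" for y
        using g(2) r(2) that by auto
      fix j assume j: "j \<in> J"
      have fj: "is_form Y j (form_of Y j)" using form_of A j JA' by blast
      have jK: "j \<inter> H = K" using j by (simp add: J_def)
      have jH: "is_form H K (form_of Y j)" using hyperplane_restrict[OF Y H fj] j HA JA' jK by auto
      show "\<exists>y\<in>H. form_of Y j y \<noteq> 0" by (rule is_form_nonzero[OF jH])
      have sK: "subsp K" by (rule hyperplane_subsp[OF sH is_form_hyperplane[OF jH]])
      \<comment> \<open>The hyperplanes of \<open>U\<close> have traces other than \<open>K\<close>,
        so none of their forms vanishes on all of \<open>K\<close>.\<close>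
      have "\<exists>y\<in>K. (\<Prod>h\<in>U. form_of Y h y) \<noteq> 0"
      proof (rule pfun_prod_nonzero[OF sK finU])
        fix h assume h: "h \<in> U"
        show "form_of Y h \<in> pfun K" using pfun_lin lin UA h by blast
        have fh: "is_form Y h (form_of Y h)" using form_of A h UA by blast
        have "is_form H (h \<inter> H) (form_of Y h)" using hyperplane_restrict[OF Y H fh] h HA UA by auto
        moreover have "K \<noteq> h \<inter> H" using h insert.hyps by (auto simp: U_def)
        ultimately have "is_form K (h \<inter> H \<inter> K) (form_of Y h)"
          using hyperplane_restrict[OF sH is_form_hyperplane[OF jH]] by blast
        then show "\<exists>y\<in>K. form_of Y h y \<noteq> 0" by (rule is_form_nonzero)
      qed
      then show "\<exists>y\<in>H. form_of Y j y = 0 \<and> (\<Prod>h\<in>U. form_of Y h y) \<noteq> 0"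
        using is_form_iff[OF jH] by blast
    qed
    then obtain s' where s': "s' \<in> pfun H" "\<forall>y\<in>H. g y = (\<Prod>h\<in>J. form_of Y h y) * s' y" by blast
    have "{h\<in>R. h \<inter> H \<in> insert K S} = U \<union> J" "U \<inter> J = {}" using insert.hyps by (auto simp: U_def J_def)
    then show ?case using g(2) s' finU finJ
      by (intro bexI[of _ s']) (auto simp: prod.union_disjoint mult.assoc)
  qed
  from this[OF _ order_refl] have "\<forall>\<theta>\<in>lder Y A. \<exists>g\<in>pfun H. \<forall>y\<in>H. \<alpha> (\<theta> y) = (\<Prod>h\<in>{h\<in>R. h \<inter> H \<in> A''}. form_of Y h y) * g y"
    by blast
  moreover have "{h\<in>R. h \<inter> H \<in> A''} = R" using A''eq by (auto simp: R_def)
  ultimately show ?thesis using cR by (intro exI[of _ R]) (auto simp: R_def A''_def)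
qed

text \<open>The fields are expanded on \<open>H\<close> in the basis of the restriction. For degree
  reasons basis elements of degree above \<delta> do not occur, so the coefficient matrix has more
  rows than columns.\<close>

lemma lder_too_many:
  fixes Y :: "('i \<Rightarrow> 'k::field_char_0) set"
  assumes sH: "subsp H" and HY: "H \<subseteq> Y" and HA: "H \<in> A"
    and bas: "lder_basis H (restriction A H) J \<eta>" and e: "\<forall>j\<in>J. homog H (e j) (\<eta> j)"
    and fin: "finite I" and \<theta>: "\<forall>i\<in>I. \<theta> i \<in> lder Y A \<and> (\<exists>d\<le>\<delta>. homog Y d (\<theta> i))"
    and card: "card {j\<in>J. e j \<le> \<delta>} < card I"
  shows "\<exists>c. (\<forall>i\<in>I. c i \<in> pfun H) \<and> (\<exists>i\<in>I. \<exists>y\<in>H. c i y \<noteq> 0) \<and>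
    (\<forall>y\<in>H. (\<Sum>i\<in>I. fscale (c i y) (\<theta> i y)) = 0)"
proof -
  have finJ: "finite J" using bas by (simp add: lder_basis_def)
  have "\<exists>m. (\<forall>j\<in>J. m j \<in> pfun H) \<and> (\<forall>y\<in>H. \<theta> i y = (\<Sum>j\<in>J. fscale (m j y) (\<eta> j y)))" if "i \<in> I" for i
  proof -
    have "\<theta> i \<in> lder Y A" using \<theta> that by blast
    from lder_basis_span[OF bas lder_restrict[OF this HA HY]] obtain c where
      "\<forall>j\<in>J. c j \<in> pfun H" "\<forall>y\<in>H. \<theta> i y = (\<Sum>j\<in>J. fscale (c j y) (\<eta> j y))" .
    then show ?thesis by (intro exI[of _ c] conjI)
  qed
  then obtain m where m: "\<And>i. i \<in> I \<Longrightarrow> \<forall>j\<in>J. m i j \<in> pfun H"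
    "\<And>i. i \<in> I \<Longrightarrow> \<forall>y\<in>H. \<theta> i y = (\<Sum>j\<in>J. fscale (m i j y) (\<eta> j y))" by metis
  \<comment> \<open>Uniqueness of coefficients makes \<open>m i j\<close> homogeneous of degree
    \<open>d - e j\<close>, which is negative.\<close>
  have mz: "m i j y = 0" if i: "i \<in> I" and j: "j \<in> J" "\<delta> < e j" and y: "y \<in> H" for i j y
  proof -
    obtain d where d: "d \<le> \<delta>" "homog Y d (\<theta> i)" using \<theta> i by blast
    have h: "t ^ e j * m i j (fscale t z) = t ^ d * m i j z" if t: "t \<noteq> 0" and z: "z \<in> H" for t z
    proof -
      have lm: "linear_map (fscale t :: ('i \<Rightarrow> 'k) \<Rightarrow> _)" by (auto simp: linear_map_iff fun_eq_iff algebra_simps)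
      have "\<forall>j\<in>J. (\<lambda>y. t ^ e j * m i j (fscale t y) - t ^ d * m i j y) \<in> pfun H"
      proof
        fix j assume "j \<in> J"
        then have mj: "m i j \<in> pfun H" using m(1)[OF i] by blast
        show "(\<lambda>y. t ^ e j * m i j (fscale t y) - t ^ d * m i j y) \<in> pfun H"
          by (rule pfun_diff[OF pfun_cmult[OF pfun_comp[OF mj lm]] pfun_cmult[OF mj]])
            (rule subsp_scale[OF sH])
      qed
      moreover have "\<forall>y\<in>H. (\<Sum>j\<in>J. fscale (t ^ e j * m i j (fscale t y) - t ^ d * m i j y) (\<eta> j y)) = 0"
      proof
        fix y assume y: "y \<in> H"
        have ty: "fscale t y \<in> H" using y sH by (simp add: subsp_scale)
        have "(\<Sum>j\<in>J. fscale (m i j (fscale t y)) (\<eta> j (fscale t y))) = fscale (t ^ d) (\<Sum>j\<in>J. fscale (m i j y) (\<eta> j y))"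
        proof -
          have "\<theta> i (fscale t y) = fscale (t ^ d) (\<theta> i y)"
            using d(2) y HY t unfolding homog_def by blast
          then show ?thesis
            unfolding m(2)[OF i, rule_format, OF y] m(2)[OF i, rule_format, OF ty] .
        qed
        moreover have "(\<Sum>j\<in>J. fscale (m i j (fscale t y)) (\<eta> j (fscale t y)))
            = (\<Sum>j\<in>J. fscale (t ^ e j * m i j (fscale t y)) (\<eta> j y))"
        proof (rule sum.cong[OF refl])
          fix j assume "j \<in> J"
          then have "\<eta> j (fscale t y) = fscale (t ^ e j) (\<eta> j y)" using e y t unfolding homog_def by blast
          then show "fscale (m i j (fscale t y)) (\<eta> j (fscale t y)) = fscale (t ^ e j * m i j (fscale t y)) (\<eta> j y)"
            by (simp only: fscale_fscale mult.commute)
        qed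
        ultimately show "(\<Sum>j\<in>J. fscale (t ^ e j * m i j (fscale t y) - t ^ d * m i j y) (\<eta> j y)) = 0"
          by (simp add: fun_eq_iff sum_fun_apply left_diff_distrib sum_subtractf mult.assoc sum_distrib_left)
      qed
      ultimately have "\<forall>j\<in>J. \<forall>y\<in>H. t ^ e j * m i j (fscale t y) - t ^ d * m i j y = 0"
        by (rule lder_basis_indep[OF bas])
      then show ?thesis using j z by auto
    qed
    have "d < e j" using d(1) j(2) by simp
    from pfun_negative_degree[OF sH m(1)[OF i, rule_format, OF j(1)] this h y] show ?thesis by simp
  qed
  have "\<exists>c. (\<forall>i\<in>I. c i \<in> pfun H) \<and> (\<exists>i\<in>I. \<exists>y\<in>H. c i y \<noteq> 0) \<and>
    (\<forall>j\<in>{j\<in>J. e j \<le> \<delta>}. \<forall>y\<in>H. (\<Sum>i\<in>I. c i y * m i j y) = 0)"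
    by (rule pfun_elimination[OF sH _ fin card]) (simp add: finJ, use m(1) in blast)
  then obtain c where c: "\<forall>i\<in>I. c i \<in> pfun H" "\<exists>i\<in>I. \<exists>y\<in>H. c i y \<noteq> 0"
    "\<forall>j\<in>{j\<in>J. e j \<le> \<delta>}. \<forall>y\<in>H. (\<Sum>i\<in>I. c i y * m i j y) = 0" by blast
  have "(\<Sum>i\<in>I. fscale (c i y) (\<theta> i y)) = 0" if y: "y \<in> H" for y
  proof
    fix x
    have "(\<Sum>i\<in>I. fscale (c i y) (\<theta> i y)) x = (\<Sum>i\<in>I. \<Sum>j\<in>J. c i y * m i j y * \<eta> j y x)"
      using m(2) y by (simp add: sum_fun_apply sum_distrib_left mult.assoc)
    also have "\<dots> = (\<Sum>j\<in>J. (\<Sum>i\<in>I. c i y * m i j y) * \<eta> j y x)"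
      by (subst sum.swap) (simp add: sum_distrib_right)
    also have "\<dots> = 0"
    proof (intro sum.neutral ballI)
      fix j assume j: "j \<in> J"
      show "(\<Sum>i\<in>I. c i y * m i j y) * \<eta> j y x = 0"
      proof (cases "e j \<le> \<delta>")
        case True
        then show ?thesis using c(3) j y by auto
      next
        case False
        then have "(\<Sum>i\<in>I. c i y * m i j y) = 0" using mz j y by (intro sum.neutral) auto
        then show ?thesis by simp
      qed
    qed
    finally show "(\<Sum>i\<in>I. fscale (c i y) (\<theta> i y)) x = 0 x" by simp
  qed
  then show ?thesis using c by blast
qed

text \<open>\<open>B\<close> is the product from \<open>lder_divisible\<close> and has degree
  \<delta>, so the quotient \<open>g\<close> is homogeneous of degree \<open>d - \<delta>\<close>.
  Powers stand on both sides since that degree may be negative.\<close>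

lemma lder_values:
  fixes Y :: "('i \<Rightarrow> 'k::field_char_0) set"
  assumes Y: "subsp Y" and \<alpha>: "is_form Y H \<alpha>" and fin: "finite A" and HA: "H \<notin> A" and A: "\<forall>h\<in>A. hyperplane Y h"
    and card: "card A = card (restriction A H) + \<delta>"
  shows "\<exists>B\<in>pfun H. (\<exists>z\<in>H. B z \<noteq> 0) \<and>
    (\<forall>\<theta>\<in>lder Y A. \<forall>d. homog Y d \<theta> \<longrightarrow> (\<exists>g\<in>pfun H. (\<forall>y\<in>H. \<alpha> (\<theta> y) = B y * g y) \<and>
      (\<forall>t y. t \<noteq> 0 \<longrightarrow> y \<in> H \<longrightarrow> t ^ \<delta> * g (fscale t y) = t ^ d * g y)))"
proof -
  have H: "hyperplane Y H" using \<alpha> by (rule is_form_hyperplane)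
  have sH: "subsp H" by (rule hyperplane_subsp[OF Y H])
  have HY: "H \<subseteq> Y" by (rule hyperplane_subset[OF H])
  obtain R where R: "R \<subseteq> A" "card R + card (restriction A H) = card A"
    "\<forall>\<theta>\<in>lder Y A. \<exists>g\<in>pfun H. \<forall>y\<in>H. \<alpha> (\<theta> y) = (\<Prod>h\<in>R. form_of Y h y) * g y"
    using lder_divisible[OF Y \<alpha> fin HA A] by blast
  have cR: "card R = \<delta>" using R(2) card by simp
  define B where "B = (\<lambda>y. \<Prod>h\<in>R. form_of Y h y)"
  have fo: "is_form Y h (form_of Y h)" if "h \<in> R" for h using form_of A R(1) that by blast
  have lin: "linear_fun (form_of Y h)" if "h \<in> R" for h using fo[OF that] by (rule is_form_linear)
  have B: "B \<in> pfun H" unfolding B_def by (rule pfun_prod, rule pfun_lin, rule lin)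
  have "\<exists>z\<in>H. (\<Prod>h\<in>R. form_of Y h z) \<noteq> 0"
  proof (rule pfun_prod_nonzero[OF sH finite_subset[OF R(1) fin]])
    fix h assume h: "h \<in> R"
    show "form_of Y h \<in> pfun H" by (rule pfun_lin, rule lin[OF h])
    have "H \<noteq> h" using h R(1) HA by auto
    then show "\<exists>y\<in>H. form_of Y h y \<noteq> 0"
      by (rule is_form_nonzero[OF hyperplane_restrict[OF Y H fo[OF h]]])
  qed
  then obtain z where z: "z \<in> H" "B z \<noteq> 0" by (auto simp: B_def)
  have Bh: "B (fscale t y) = t ^ \<delta> * B y" for t y
  proof -
    have "B (fscale t y) = (\<Prod>h\<in>R. t * form_of Y h y)"
      unfolding B_def by (rule prod.cong[OF refl]) (rule linear_fun_scale[OF lin])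
    also have "\<dots> = t ^ \<delta> * B y" by (simp add: prod.distrib cR B_def)
    finally show ?thesis .
  qed
  have "\<exists>g\<in>pfun H. (\<forall>y\<in>H. \<alpha> (\<theta> y) = B y * g y) \<and>
      (\<forall>t y. t \<noteq> 0 \<longrightarrow> y \<in> H \<longrightarrow> t ^ \<delta> * g (fscale t y) = t ^ d * g y)"
    if th: "\<theta> \<in> lder Y A" and d: "homog Y d \<theta>" for \<theta> d
  proof -
    obtain g where g: "g \<in> pfun H" "\<forall>y\<in>H. \<alpha> (\<theta> y) = B y * g y" using R(3) th by (auto simp: B_def)
    have "t ^ \<delta> * g (fscale t y) = t ^ d * g y" if t: "t \<noteq> 0" and y: "y \<in> H" for t y
    proof -
      have lm: "linear_map (fscale t :: ('i \<Rightarrow> 'k) \<Rightarrow> _)" by (auto simp: linear_map_iff fun_eq_iff algebra_simps)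
      have m1: "(\<lambda>y. t ^ \<delta> * g (fscale t y)) \<in> pfun H"
        by (rule pfun_cmult[OF pfun_comp[OF g(1) lm]]) (rule subsp_scale[OF sH])
      have eq: "\<forall>y\<in>H. B y * (t ^ \<delta> * g (fscale t y)) = B y * (t ^ d * g y)"
      proof
        fix y assume y: "y \<in> H"
        have ty: "fscale t y \<in> H" by (rule subsp_scale[OF sH y])
        have "\<theta> (fscale t y) = fscale (t ^ d) (\<theta> y)" using d t y HY unfolding homog_def by blast
        then have "\<alpha> (\<theta> (fscale t y)) = t ^ d * \<alpha> (\<theta> y)"
          by (simp only: linear_fun_scale[OF is_form_linear[OF \<alpha>]])
        then have "B (fscale t y) * g (fscale t y) = t ^ d * (B y * g y)"
          by (simp only: g(2)[rule_format, OF ty] g(2)[rule_format, OF y])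
        then show "B y * (t ^ \<delta> * g (fscale t y)) = B y * (t ^ d * g y)"
          by (simp only: Bh mult.assoc mult.left_commute)
      qed
      have "\<forall>y\<in>H. t ^ \<delta> * g (fscale t y) = t ^ d * g y"
        by (rule pfun_cancel[OF sH B m1 pfun_cmult[OF g(1)] eq z])
      then show ?thesis using y by blast
    qed
    then show ?thesis using g by blast
  qed
  then show ?thesis using z by (intro bexI[OF _ B]) blast
qed

lemma size_filter_image_mset_set:
  "finite I \<Longrightarrow> size (filter_mset P (image_mset d (mset_set I))) = card {i\<in>I. P (d i)}"
  by (simp add: filter_mset_image_mset)

lemma restriction_Diff_self: "restriction (A - {H}) H = restriction A H"
  by (auto simp: restriction_def)

lemma lder_remove_iff:
  assumes \<alpha>: "is_form Y H \<alpha>" and HA: "H \<in> A"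
  shows "\<eta> \<in> lder Y A \<longleftrightarrow> \<eta> \<in> lder Y (A - {H}) \<and> (\<forall>y\<in>H. \<alpha> (\<eta> y) = 0)"
proof -
  have HY: "H \<subseteq> Y" by (rule hyperplane_subset[OF is_form_hyperplane[OF \<alpha>]])
  have "A = insert H (A - {H})" using HA by auto
  then have "\<eta> \<in> lder Y A \<longleftrightarrow> \<eta> \<in> lder Y (A - {H}) \<and> (\<forall>y\<in>H. \<eta> y \<in> H)" by (auto simp: lder_def)
  moreover have "\<eta> y \<in> H \<longleftrightarrow> \<alpha> (\<eta> y) = 0" if "\<eta> \<in> lder Y (A - {H})" "y \<in> H" for y
    using pmapD[OF lder_pmap[OF that(1)], of y] that(2) HY is_form_iff[OF \<alpha>] by auto
  ultimately show ?thesis by blast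
qed

text \<open>Terao's addition theorem. Some basis element \<open>\<theta> k\<close> of degree
  \<delta> takes on \<alpha> a nonzero constant multiple of \<open>B\<close> along \<open>H\<close>.
  Multiples of it correct the other elements so that they become tangent to \<open>H\<close>, and it
  is itself replaced by \<open>\<alpha> \<theta> k\<close>, of degree one more.\<close>

theorem addition:
  fixes Y :: "('i \<Rightarrow> 'k::field_char_0) set"
  assumes Y: "fin_coords Y" and fin: "finite A" and HA: "H \<in> A" and A: "\<forall>h\<in>A. hyperplane Y h"
    and bas: "lder_basis Y (A - {H}) I \<theta>" and d: "\<forall>i\<in>I. homog Y (d i) (\<theta> i)"
    and basH: "lder_basis H (restriction A H) J \<eta>" and e: "\<forall>j\<in>J. homog H (e j) (\<eta> j)"
    and mset: "image_mset d (mset_set I) = add_mset \<delta> (image_mset e (mset_set J))"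
    and card: "card (A - {H}) = card (restriction A H) + \<delta>"
  shows "\<exists>k\<in>I. d k = \<delta> \<and> (\<exists>\<theta>'. lder_basis Y A I \<theta>' \<and> (\<forall>i\<in>I. homog Y ((d(k := Suc \<delta>)) i) (\<theta>' i)))"
proof -
  have sY: "subsp Y" using Y by (simp add: fin_coords_def)
  have H: "hyperplane Y H" using A HA by blast
  obtain \<alpha> where \<alpha>: "is_form Y H \<alpha>" using H by (auto simp: hyperplane_def)
  have sH: "subsp H" by (rule hyperplane_subsp[OF sY H])
  have HY: "H \<subseteq> Y" by (rule hyperplane_subset[OF H])
  have l\<alpha>: "linear_fun \<alpha>" by (rule is_form_linear[OF \<alpha>])
  define A' where "A' = A - {H}"
  have A': "\<forall>h\<in>A'. hyperplane Y h" and HA': "H \<notin> A'" and finA': "finite A'" using A fin by (auto simp: A'_def)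
  have card': "card A' = card (restriction A' H) + \<delta>"
    using card by (simp add: A'_def restriction_Diff_self)
  have finI: "finite I" and finJ: "finite J" using bas basH by (auto simp: lder_basis_def)
  have bas: "lder_basis Y A' I \<theta>" using bas by (simp add: A'_def)
  have th: "\<theta> i \<in> lder Y A'" if "i \<in> I" for i using bas that by (simp add: lder_basis_def)
  have lderA: "\<eta> \<in> lder Y A \<longleftrightarrow> \<eta> \<in> lder Y A' \<and> (\<forall>y\<in>H. \<alpha> (\<eta> y) = 0)" for \<eta>
    unfolding A'_def by (rule lder_remove_iff[OF \<alpha> HA])
  from lder_values[OF sY \<alpha> finA' HA' A' card'] obtain B where B: "B \<in> pfun H" "\<exists>z\<in>H. B z \<noteq> 0"
    "\<forall>\<theta>\<in>lder Y A'. \<forall>d. homog Y d \<theta> \<longrightarrow> (\<exists>g\<in>pfun H. (\<forall>y\<in>H. \<alpha> (\<theta> y) = B y * g y) \<and>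
      (\<forall>t y. t \<noteq> 0 \<longrightarrow> y \<in> H \<longrightarrow> t ^ \<delta> * g (fscale t y) = t ^ d * g y))" by blast
  obtain z where z: "z \<in> H" "B z \<noteq> 0" using B(2) by blast
  have "\<exists>g\<in>pfun H. (\<forall>y\<in>H. \<alpha> (\<theta> i y) = B y * g y) \<and>
      (\<forall>t y. t \<noteq> 0 \<longrightarrow> y \<in> H \<longrightarrow> t ^ \<delta> * g (fscale t y) = t ^ d i * g y)" if "i \<in> I" for i
    using B(3) th[OF that] d that by blast
  then obtain g where g: "\<And>i. i \<in> I \<Longrightarrow> g i \<in> pfun H" "\<And>i y. i \<in> I \<Longrightarrow> y \<in> H \<Longrightarrow> \<alpha> (\<theta> i y) = B y * g i y"
    "\<And>i t y. i \<in> I \<Longrightarrow> t \<noteq> 0 \<Longrightarrow> y \<in> H \<Longrightarrow> t ^ \<delta> * g i (fscale t y) = t ^ d i * g i y" by metis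
  \<comment> \<open>Otherwise all basis elements of degree at most \<delta> are tangent to
    \<open>H\<close>. By \<open>mset\<close> there is one more of them than the restriction has in
    that range, so they are dependent on \<open>H\<close>, against
    \<open>lder_basis_indep_restrict\<close>.\<close>
  have "\<exists>k\<in>I. d k = \<delta> \<and> (\<exists>y\<in>H. g k y \<noteq> 0)"
  proof (rule ccontr)
    assume no: "\<not> ?thesis"
    define I0 where "I0 = {i\<in>I. d i \<le> \<delta>}"
    have gz: "g i y = 0" if i: "i \<in> I0" and y: "y \<in> H" for i y
    proof (cases "d i = \<delta>")
      case True
      then show ?thesis using no i y by (auto simp: I0_def)
    next
      case False
      then have lt: "d i < \<delta>" and iI: "i \<in> I" using i by (auto simp: I0_def)
      from pfun_negative_degree[OF sH g(1)[OF iI] lt g(3)[OF iI] y] show ?thesis by simp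
    qed
    have thA: "\<forall>i\<in>I0. \<theta> i \<in> lder Y A \<and> (\<exists>d\<le>\<delta>. homog Y d (\<theta> i))"
    proof
      fix i assume i: "i \<in> I0"
      then have iI: "i \<in> I" and le: "d i \<le> \<delta>" by (auto simp: I0_def)
      have "\<theta> i \<in> lder Y A" unfolding lderA using th[OF iI] g(2)[OF iI] gz[OF i] by simp
      then show "\<theta> i \<in> lder Y A \<and> (\<exists>d\<le>\<delta>. homog Y d (\<theta> i))" using d iI le by blast
    qed
    have "card I0 = Suc (card {j\<in>J. e j \<le> \<delta>})"
      using arg_cong[OF mset, of "\<lambda>M. size (filter_mset (\<lambda>x. x \<le> \<delta>) M)"] finI finJ
      by (simp add: size_filter_image_mset_set I0_def del: filter_mset_image_mset)
    then have lt: "card {j\<in>J. e j \<le> \<delta>} < card I0" by simp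
    have finI0: "finite I0" using finI by (simp add: I0_def)
    from lder_too_many[OF sH HY HA basH e finI0 thA lt]
    obtain c where c: "\<forall>i\<in>I0. c i \<in> pfun H" "\<exists>i\<in>I0. \<exists>y\<in>H. c i y \<noteq> 0"
      "\<forall>y\<in>H. (\<Sum>i\<in>I0. fscale (c i y) (\<theta> i y)) = 0" by blast
    define c' where "c' i = (if i \<in> I0 then c i else (\<lambda>_. 0))" for i
    obtain i y where iy: "i \<in> I0" "y \<in> H" "c i y \<noteq> 0" using c(2) by blast
    have "c' i y = 0"
    proof (rule lder_basis_indep_restrict[where c = c', OF Y A' H HA' bas])
      show "c' i \<in> pfun H" for i using c(1) by (auto simp: c'_def pfun_const)
      show "(\<Sum>i\<in>I. fscale (c' i y) (\<theta> i y)) = 0" if "y \<in> H" for y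
      proof -
        have "(\<Sum>i\<in>I. fscale (c' i y) (\<theta> i y)) = (\<Sum>i\<in>I0. fscale (c i y) (\<theta> i y))"
          by (rule sum.mono_neutral_cong_right[OF finI]) (auto simp: I0_def c'_def)
        then show ?thesis using c(3) that by simp
      qed
      show "i \<in> I" "y \<in> H" using iy by (auto simp: I0_def)
    qed
    then show False using iy by (simp add: c'_def)
  qed
  then obtain k y1 where k: "k \<in> I" "d k = \<delta>" and y1: "y1 \<in> H" "g k y1 \<noteq> 0" by blast
  define \<gamma> where "\<gamma> = g k 0"
  have gk: "g k y = \<gamma>" if "y \<in> H" for y
    unfolding \<gamma>_def
  proof (rule pfun_zero_degree[OF sH g(1)[OF k(1)] _ that])
    fix t y assume "(t::'k) \<noteq> 0" "y \<in> H"
    then show "g k (fscale t y) = g k y" using g(3)[OF k(1), of t y] k(2) by simp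
  qed
  have \<gamma>: "\<gamma> \<noteq> 0" using y1 gk by auto
  obtain u where u: "u \<in> Y" "\<alpha> u = 1" "linear_map (\<lambda>y. y - fscale (\<alpha> y) u)"
    "\<And>y. y \<in> Y \<Longrightarrow> y - fscale (\<alpha> y) u \<in> H" "\<And>y. y \<in> H \<Longrightarrow> y - fscale (\<alpha> y) u = y"
    by (rule is_form_proj[OF sY \<alpha>]) (use that in blast)
  define \<pi> where "\<pi> = (\<lambda>y. y - fscale (\<alpha> y) u)"
  have \<pi>: "linear_map \<pi>" "\<And>y. y \<in> Y \<Longrightarrow> \<pi> y \<in> H" "\<And>y. y \<in> H \<Longrightarrow> \<pi> y = y"
    using u by (auto simp: \<pi>_def)
  \<comment> \<open>On \<open>H\<close> this is the ratio of \<open>\<theta> j(\<alpha>)\<close> to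
    \<open>\<theta> k(\<alpha>)\<close>, with the common factor \<open>B\<close> removed; the
    projection \<pi> extends it to \<open>Y\<close>.\<close>
  define \<kappa> where "\<kappa> j y = g j (\<pi> y) / \<gamma>" for j y
  have \<kappa>: "\<kappa> j \<in> pfun Y" if "j \<in> I" for j
  proof -
    have "(\<lambda>y. 1 / \<gamma> * g j (\<pi> y)) \<in> pfun Y" by (rule pfun_cmult[OF pfun_comp[OF g(1)[OF that] \<pi>(1,2)]])
    then show ?thesis by (elim pfun_cong) (simp add: \<kappa>_def)
  qed
  define \<theta>' where "\<theta>' j = (if j = k then (\<lambda>y. fscale (\<alpha> y) (\<theta> k y)) else (\<lambda>y. \<theta> j y + fscale (- \<kappa> j y) (\<theta> k y)))" for j
  \<comment> \<open>Change of basis: a combination of \<theta>' with coefficients \<open>c\<close>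
    is the combination of \<theta> with coefficients \<open>C c\<close>.\<close>
  define C where "C c i = (if i = k then (\<lambda>y. \<alpha> y * c k y - (\<Sum>j\<in>I-{k}. c j y * \<kappa> j y)) else c i)"
    for c :: "'a \<Rightarrow> ('i \<Rightarrow> 'k) \<Rightarrow> 'k" and i
  have change: "(\<Sum>i\<in>I. fscale (c i y) (\<theta>' i y)) = (\<Sum>i\<in>I. fscale (C c i y) (\<theta> i y))" for c y
  proof
    fix x
    have 1: "(\<Sum>i\<in>I-{k}. c i y * \<theta>' i y x) = (\<Sum>i\<in>I-{k}. c i y * (\<theta> i y x - \<kappa> i y * \<theta> k y x))"
      by (rule sum.cong) (auto simp: \<theta>'_def)
    have 2: "(\<Sum>i\<in>I-{k}. C c i y * \<theta> i y x) = (\<Sum>i\<in>I-{k}. c i y * \<theta> i y x)"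
      by (rule sum.cong) (auto simp: C_def)
    show "(\<Sum>i\<in>I. fscale (c i y) (\<theta>' i y)) x = (\<Sum>i\<in>I. fscale (C c i y) (\<theta> i y)) x"
      unfolding sum_fun_apply fscale_apply sum.remove[OF finI k(1)] 1 2
      by (simp add: \<theta>'_def C_def algebra_simps sum_subtractf sum_distrib_left)
  qed
  have Cp: "C c i \<in> pfun Y" if c: "\<forall>i\<in>I. c i \<in> pfun Y" and i: "i \<in> I" for c i
  proof (cases "i = k")
    case True
    have "(\<lambda>y. \<alpha> y * c k y - (\<Sum>j\<in>I-{k}. c j y * \<kappa> j y)) \<in> pfun Y"
      by (rule pfun_diff[OF pfun_mult[OF pfun_lin[OF l\<alpha>]] pfun_sum]) (use c k(1) \<kappa> in \<open>auto intro!: pfun_mult\<close>)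
    then show ?thesis using True by (simp add: C_def)
  next
    case False
    then show ?thesis using c i by (simp add: C_def)
  qed
  have "lder_basis Y A I \<theta>'"
    unfolding lder_basis_def
  proof (intro conjI ballI allI impI)
    show "finite I" by (rule finI)
  next
    fix j assume j: "j \<in> I"
    show "\<theta>' j \<in> lder Y A"
    proof (cases "j = k")
      case True
      have "(\<lambda>y. fscale (\<alpha> y) (\<theta> k y)) \<in> pmap Y"
        by (rule pmap_scale[OF sY pfun_lin[OF l\<alpha>] lder_pmap[OF th[OF k(1)]]])
      moreover have "fscale (\<alpha> y) (\<theta> k y) \<in> h" if "h \<in> A'" "y \<in> h" for h y
        using lderD[OF th[OF k(1)] that] hyperplane_subsp[OF sY] A' that(1) by (blast intro: subsp_scale)
      moreover have "\<alpha> (fscale (\<alpha> y) (\<theta> k y)) = 0" if "y \<in> H" for y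
        using that is_form_iff[OF \<alpha>] linear_fun_scale[OF l\<alpha>] linear_fun_0[OF l\<alpha>] by simp
      ultimately show ?thesis unfolding lderA using True by (auto simp: \<theta>'_def lder_def)
    next
      case False
      have "(\<lambda>y. \<theta> j y + fscale (- \<kappa> j y) (\<theta> k y)) \<in> pmap Y"
        by (rule pmap_add[OF sY lder_pmap[OF th[OF j]] pmap_scale[OF sY pfun_uminus[OF \<kappa>[OF j]] lder_pmap[OF th[OF k(1)]]]])
      moreover have "\<theta> j y + fscale (- \<kappa> j y) (\<theta> k y) \<in> h" if "h \<in> A'" "y \<in> h" for h y
        using lderD[OF th[OF k(1)] that] lderD[OF th[OF j] that] hyperplane_subsp[OF sY] A' that(1)
        by (blast intro: subsp_scale subsp_add)
      moreover have "\<alpha> (\<theta> j y + fscale (- \<kappa> j y) (\<theta> k y)) = 0" if y: "y \<in> H" for y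
        unfolding linear_fun_add[OF l\<alpha>] linear_fun_scale[OF l\<alpha>] g(2)[OF j y] g(2)[OF k(1) y] gk[OF y]
        using \<gamma> \<pi>(3)[OF y] by (simp add: \<kappa>_def)
      ultimately show ?thesis unfolding lderA using False by (auto simp: \<theta>'_def lder_def)
    qed
  next
    fix \<eta> assume "\<eta> \<in> lder Y A"
    then have \<eta>: "\<eta> \<in> lder Y A'" "\<forall>y\<in>H. \<alpha> (\<eta> y) = 0" unfolding lderA by auto
    obtain c where c: "\<forall>i\<in>I. c i \<in> pfun Y" "\<forall>y\<in>Y. \<eta> y = (\<Sum>i\<in>I. fscale (c i y) (\<theta> i y))"
      by (rule lder_basis_span[OF bas \<eta>(1)])
    \<comment> \<open>The coefficient left for \<open>\<theta> k\<close> once the other elements are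
      the corrected ones. Tangency of \<eta> to \<open>H\<close> forces it to vanish on
      \<open>H\<close>, so \<alpha> divides it and \<open>\<alpha> \<theta> k\<close>
      suffices.\<close>
    define s where "s = (\<lambda>y. c k y + (\<Sum>j\<in>I-{k}. c j y * \<kappa> j y))"
    have s: "s \<in> pfun Y" unfolding s_def
      by (rule pfun_add[OF _ pfun_sum]) (use c(1) k(1) \<kappa> in \<open>auto intro!: pfun_mult\<close>)
    have eq: "\<forall>y\<in>H. B y * s y = B y * 0"
    proof
      fix y assume y: "y \<in> H"
      have "0 = \<alpha> (\<eta> y)" using \<eta>(2) y by simp
      also have "\<alpha> (\<eta> y) = (\<Sum>i\<in>I. c i y * \<alpha> (\<theta> i y))"
        using c(2) y HY by (auto simp: linear_fun_sum[OF l\<alpha>] linear_fun_scale[OF l\<alpha>])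
      also have "\<dots> = (\<Sum>i\<in>I. c i y * (B y * g i y))"
        by (rule sum.cong) (auto simp: g(2)[OF _ y])
      also have "\<dots> = c k y * (B y * \<gamma>) + (\<Sum>i\<in>I-{k}. c i y * (B y * g i y))"
        unfolding sum.remove[OF finI k(1)] gk[OF y] ..
      also have "(\<Sum>i\<in>I-{k}. c i y * (B y * g i y)) = B y * \<gamma> * (\<Sum>i\<in>I-{k}. c i y * \<kappa> i y)"
        unfolding sum_distrib_left using \<gamma> \<pi>(3)[OF y] by (intro sum.cong) (auto simp: \<kappa>_def)
      finally have "\<gamma> * (B y * s y) = 0" by (simp add: s_def algebra_simps)
      then show "B y * s y = B y * 0" using \<gamma> by simp
    qed
    have "\<forall>y\<in>H. s y = 0" by (rule pfun_cancel[OF sH B(1) pfun_mono[OF s HY] pfun_const eq z])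
    then have "\<forall>y\<in>Y. \<alpha> y = 0 \<longrightarrow> s y = 0" using is_form_iff[OF \<alpha>] by auto
    moreover have "\<alpha> u \<noteq> 0" using u(2) by simp
    ultimately obtain q where q: "q \<in> pfun Y" "\<forall>y\<in>Y. s y = \<alpha> y * q y"
      using pfun_divide[OF sY s l\<alpha> u(1)] by blast
    define c' where "c' i = (if i = k then q else c i)" for i
    have "\<forall>i\<in>I. c' i \<in> pfun Y" using c(1) q(1) by (simp add: c'_def)
    moreover have "\<forall>y\<in>Y. \<eta> y = (\<Sum>i\<in>I. fscale (c' i y) (\<theta>' i y))"
    proof
      fix y assume y: "y \<in> Y"
      have s1: "(\<Sum>j\<in>I-{k}. c' j y * \<kappa> j y) = (\<Sum>j\<in>I-{k}. c j y * \<kappa> j y)"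
        by (rule sum.cong) (auto simp: c'_def)
      have "C c' k y = \<alpha> y * q y - (\<Sum>j\<in>I-{k}. c j y * \<kappa> j y)" by (simp add: C_def s1) (simp add: c'_def)
      also have "\<dots> = c k y" unfolding q(2)[rule_format, OF y, symmetric] by (simp add: s_def)
      finally have "C c' i y = c i y" for i by (cases "i = k") (auto simp: C_def c'_def)
      then show "\<eta> y = (\<Sum>i\<in>I. fscale (c' i y) (\<theta>' i y))"
        using c(2) y unfolding change by simp
    qed
    ultimately show "\<exists>c. (\<forall>i\<in>I. c i \<in> pfun Y) \<and> (\<forall>y\<in>Y. \<eta> y = (\<Sum>i\<in>I. fscale (c i y) (\<theta>' i y)))"
      by (intro exI[of _ c'] conjI)
  next
    fix c i y assume c: "\<forall>i\<in>I. c i \<in> pfun Y" and rel: "\<forall>y\<in>Y. (\<Sum>i\<in>I. fscale (c i y) (\<theta>' i y)) = 0"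
      and i: "i \<in> I" and y: "y \<in> Y"
    have CpI: "\<forall>i\<in>I. C c i \<in> pfun Y" using Cp[OF c] by blast
    have Cz: "\<forall>i\<in>I. \<forall>y\<in>Y. C c i y = 0"
      by (rule lder_basis_indep[OF bas CpI rel[unfolded change]])
    then have cz: "c j y = 0" if "j \<in> I" "j \<noteq> k" "y \<in> Y" for j y using that by (auto simp: C_def)
    show "c i y = 0"
    proof (cases "i = k")
      case True
      have "\<forall>y\<in>Y. \<alpha> y * c k y = \<alpha> y * 0"
      proof
        fix y assume y: "y \<in> Y"
        have "C c k y = 0" using Cz k(1) y by blast
        then show "\<alpha> y * c k y = \<alpha> y * 0" using cz y by (simp add: C_def)
      qed
      moreover have "\<alpha> u \<noteq> 0" using u(2) by simp
      ultimately have "\<forall>y\<in>Y. c k y = 0"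
        by (rule pfun_cancel[OF sY pfun_lin[OF l\<alpha>] c[rule_format, OF k(1)] pfun_const _ u(1)])
      then show ?thesis using True y by blast
    next
      case False
      then show ?thesis using cz i y by blast
    qed
  qed
  moreover have "\<forall>i\<in>I. homog Y ((d(k := Suc \<delta>)) i) (\<theta>' i)"
  proof
    fix i assume i: "i \<in> I"
    show "homog Y ((d(k := Suc \<delta>)) i) (\<theta>' i)"
      unfolding homog_def
    proof (intro allI impI)
      fix t y assume t: "(t::'k) \<noteq> 0" and y: "y \<in> Y"
      have hk: "\<theta> k (fscale t y) = fscale (t ^ \<delta>) (\<theta> k y)" using d k t y unfolding homog_def by blast
      have hi: "\<theta> i (fscale t y) = fscale (t ^ d i) (\<theta> i y)" using d i t y unfolding homog_def by blast
      have \<alpha>t: "\<alpha> (fscale t y) = t * \<alpha> y" by (rule linear_fun_scale[OF l\<alpha>])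
      have "t ^ \<delta> * g i (fscale t (\<pi> y)) = t ^ d i * g i (\<pi> y)" by (rule g(3)[OF i t \<pi>(2)[OF y]])
      then have \<kappa>t: "t ^ \<delta> * \<kappa> i (fscale t y) = t ^ d i * \<kappa> i y"
        by (simp add: \<kappa>_def linear_map_scale[OF \<pi>(1)])
      show "\<theta>' i (fscale t y) = fscale (t ^ (d(k := Suc \<delta>)) i) (\<theta>' i y)"
      proof (cases "i = k")
        case True
        then show ?thesis by (simp add: \<theta>'_def \<alpha>t hk mult_ac)
      next
        case False
        have "\<kappa> i (fscale t y) * t ^ \<delta> = t ^ d i * \<kappa> i y" using \<kappa>t by (simp add: mult.commute)
        then have "\<theta>' i (fscale t y) = fscale (t ^ d i) (\<theta> i y) + fscale (- (t ^ d i * \<kappa> i y)) (\<theta> k y)"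
          using False by (simp add: \<theta>'_def hi hk)
        also have "\<dots> = fscale (t ^ d i) (\<theta>' i y)"
          using False by (simp add: \<theta>'_def fun_eq_iff right_diff_distrib mult.assoc)
        finally show ?thesis using False by simp
      qed
    qed
  qed
  ultimately show ?thesis using k by (intro bexI[of _ k] conjI exI[of _ \<theta>'])
qed

section \<open>Evaluation of polynomials\<close>

definition monom_eval :: "(nat \<Rightarrow>\<^sub>0 nat) \<Rightarrow> (nat \<Rightarrow> 'k::comm_ring_1) \<Rightarrow> 'k" where
  "monom_eval m x = (\<Prod>i\<in>Poly_Mapping.keys m. x i ^ Poly_Mapping.lookup m i)"

definition meval :: "'k::comm_ring_1 mpoly \<Rightarrow> (nat \<Rightarrow> 'k) \<Rightarrow> 'k" where
  "meval p x = (\<Sum>m\<in>Poly_Mapping.keys p. Poly_Mapping.lookup p m * monom_eval m x)"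

lemma monom_eval_superset:
  "finite S \<Longrightarrow> Poly_Mapping.keys m \<subseteq> S \<Longrightarrow> monom_eval m x = (\<Prod>i\<in>S. x i ^ Poly_Mapping.lookup m i)"
  unfolding monom_eval_def by (rule prod.mono_neutral_left) (auto simp: in_keys_iff)

lemma meval_superset:
  "finite S \<Longrightarrow> Poly_Mapping.keys p \<subseteq> S \<Longrightarrow> meval p x = (\<Sum>m\<in>S. Poly_Mapping.lookup p m * monom_eval m x)"
  unfolding meval_def by (rule sum.mono_neutral_left) (auto simp: in_keys_iff)

lemma monom_eval_add: "monom_eval (m + m') x = monom_eval m x * monom_eval m' x"
proof -
  let ?S = "Poly_Mapping.keys m \<union> Poly_Mapping.keys m'"
  have "monom_eval (m + m') x = (\<Prod>i\<in>?S. x i ^ Poly_Mapping.lookup (m + m') i)"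
    using keys_add[of m m'] by (intro monom_eval_superset) auto
  also have "\<dots> = (\<Prod>i\<in>?S. x i ^ Poly_Mapping.lookup m i) * (\<Prod>i\<in>?S. x i ^ Poly_Mapping.lookup m' i)"
    by (simp add: lookup_add power_add prod.distrib)
  also have "\<dots> = monom_eval m x * monom_eval m' x"
    by (subst (1 2) monom_eval_superset[of ?S]) auto
  finally show ?thesis .
qed

lemma meval_0 [simp]: "meval 0 x = 0"
  by (simp add: meval_def)

lemma meval_single [simp]: "meval (Poly_Mapping.single m c) x = c * monom_eval m x"
  by (simp add: meval_superset[of "{m}"])

lemma monom_eval_0 [simp]: "monom_eval 0 x = 1"
  by (simp add: monom_eval_def)

lemma monom_eval_single [simp]: "monom_eval (Poly_Mapping.single k 1) x = x k"
  by (simp add: monom_eval_def)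

lemma meval_add [simp]: "meval (p + q) x = meval p x + meval q x"
proof -
  let ?S = "Poly_Mapping.keys p \<union> Poly_Mapping.keys q"
  have "meval (p + q) x = (\<Sum>m\<in>?S. Poly_Mapping.lookup (p + q) m * monom_eval m x)"
    using keys_add[of p q] by (intro meval_superset) auto
  also have "\<dots> = (\<Sum>m\<in>?S. Poly_Mapping.lookup p m * monom_eval m x) + (\<Sum>m\<in>?S. Poly_Mapping.lookup q m * monom_eval m x)"
    by (simp add: lookup_add distrib_right sum.distrib)
  also have "\<dots> = meval p x + meval q x"
    by (subst (1 2) meval_superset[of ?S]) auto
  finally show ?thesis .
qed

lemma meval_sum: "meval (\<Sum>i\<in>I. p i) x = (\<Sum>i\<in>I. meval (p i) x)"
  by (induction I rule: infinite_finite_induct) auto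

lemma mpoly_sum_singles: "p = (\<Sum>m\<in>Poly_Mapping.keys p. Poly_Mapping.single m (Poly_Mapping.lookup p m))"
  by (rule poly_mapping_eqI)
    (auto simp: lookup_sum lookup_single when_def in_keys_iff sum.delta)

lemma meval_mult [simp]: "meval (p * q) x = meval p x * meval q x"
proof -
  have "p * q = (\<Sum>m\<in>Poly_Mapping.keys p. \<Sum>m'\<in>Poly_Mapping.keys q.
      Poly_Mapping.single (m + m') (Poly_Mapping.lookup p m * Poly_Mapping.lookup q m'))"
    using arg_cong2[OF mpoly_sum_singles mpoly_sum_singles, of "(*)" p q] by (simp only: sum_product mult_single)
  then have "meval (p * q) x = meval (\<Sum>m\<in>Poly_Mapping.keys p. \<Sum>m'\<in>Poly_Mapping.keys q.
      Poly_Mapping.single (m + m') (Poly_Mapping.lookup p m * Poly_Mapping.lookup q m')) x"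
    by (rule arg_cong)
  also have "\<dots> = (\<Sum>m\<in>Poly_Mapping.keys p. \<Sum>m'\<in>Poly_Mapping.keys q.
      Poly_Mapping.lookup p m * monom_eval m x * (Poly_Mapping.lookup q m' * monom_eval m' x))"
    by (simp only: meval_sum meval_single monom_eval_add mult_ac)
  finally show ?thesis by (simp only: meval_def sum_product)
qed

lemma monom_eval_upd:
  "monom_eval m (x(i := t * x i)) = t ^ Poly_Mapping.lookup m i * monom_eval m x"
proof -
  let ?S = "insert i (Poly_Mapping.keys m)"
  have "monom_eval m (x(i := t * x i)) = (\<Prod>j\<in>?S. (x(i := t * x i)) j ^ Poly_Mapping.lookup m j)"
    by (rule monom_eval_superset) auto
  also have "\<dots> = (\<Prod>j\<in>?S. (if j = i then t ^ Poly_Mapping.lookup m i else 1) * x j ^ Poly_Mapping.lookup m j)"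
    by (rule prod.cong) (auto simp: power_mult_distrib)
  also have "\<dots> = t ^ Poly_Mapping.lookup m i * (\<Prod>j\<in>?S. x j ^ Poly_Mapping.lookup m j)"
    by (simp add: prod.distrib del: prod.insert)
  also have "(\<Prod>j\<in>?S. x j ^ Poly_Mapping.lookup m j) = monom_eval m x"
    by (rule monom_eval_superset[symmetric]) auto
  finally show ?thesis .
qed

lemma monom_eval_scale:
  "monom_eval m (fscale t x) = t ^ (\<Sum>i\<in>Poly_Mapping.keys m. Poly_Mapping.lookup m i) * monom_eval m x"
  for x :: "nat \<Rightarrow> 'k::field"
  by (simp add: monom_eval_def power_mult_distrib prod.distrib power_sum)

lemma power_2_inject: "(2::'k::field_char_0) ^ a = 2 ^ b \<longleftrightarrow> a = b"
proof -
  have "(2::'k) ^ a = of_nat (2 ^ a)" "(2::'k) ^ b = of_nat (2 ^ b)" by simp_all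
  then show ?thesis by (simp only: of_nat_eq_iff) simp
qed

text \<open>Linear independence of characters: scaling the variable \<open>i\<close> by \<open>2\<close> separates two
  monomials with different exponents at \<open>i\<close>.\<close>

lemma monom_eval_independent:
  fixes c :: "(nat \<Rightarrow>\<^sub>0 nat) \<Rightarrow> 'k::field_char_0"
  assumes "finite S" "\<forall>m\<in>S. Poly_Mapping.keys m \<subseteq> {..<N}"
    "\<forall>x\<in>std N. (\<Sum>m\<in>S. c m * monom_eval m x) = 0" "m0 \<in> S"
  shows "c m0 = 0"
  using assms
proof (induction "card S" arbitrary: S c m0)
  case 0
  then show ?case by auto
next
  case (Suc n)
  show ?case
  proof (cases "S = {m0}")
    case True
    define x :: "nat \<Rightarrow> 'k" where "x i = (if i < N then 1 else 0)" for i
    have "x \<in> std N" by (auto simp: x_def coord_space_def)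
    moreover have "monom_eval m0 x = 1"
      unfolding monom_eval_def using Suc.prems(2,4) by (intro prod.neutral) (auto simp: x_def)
    ultimately show ?thesis using Suc.prems(3) True by auto
  next
    case False
    then obtain m1 where m1: "m1 \<in> S" "m1 \<noteq> m0" using Suc.prems(4) by auto
    obtain i where i: "Poly_Mapping.lookup m1 i \<noteq> Poly_Mapping.lookup m0 i"
      using m1(2) by (metis poly_mapping_eqI)
    have "i \<in> Poly_Mapping.keys m1 \<or> i \<in> Poly_Mapping.keys m0" using i by (auto simp: in_keys_iff)
    then have iN: "i < N" using Suc.prems(2,4) m1(1) by blast
    define c' where "c' m = c m * (2 ^ Poly_Mapping.lookup m i - 2 ^ Poly_Mapping.lookup m1 i)" for m
    have "c' m0 = 0"
    proof (rule Suc.hyps(1)[of "S - {m1}" c' m0])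
      show "n = card (S - {m1})" using Suc.hyps(2) Suc.prems(1) m1 by simp
      show "finite (S - {m1})" "m0 \<in> S - {m1}" using Suc.prems m1 by auto
      show "\<forall>m\<in>S - {m1}. Poly_Mapping.keys m \<subseteq> {..<N}" using Suc.prems by auto
      show "\<forall>x\<in>std N. (\<Sum>m\<in>S - {m1}. c' m * monom_eval m x) = 0"
      proof
        fix x :: "nat \<Rightarrow> 'k" assume x: "x \<in> std N"
        have x2: "x(i := 2 * x i) \<in> std N" using x iN by (auto simp: coord_space_def)
        have "(\<Sum>m\<in>S. c' m * monom_eval m x) = (\<Sum>m\<in>S. c m * monom_eval m (x(i := 2 * x i)))
            - 2 ^ Poly_Mapping.lookup m1 i * (\<Sum>m\<in>S. c m * monom_eval m x)"
          unfolding monom_eval_upd by (simp add: c'_def sum_distrib_left algebra_simps sum_subtractf)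
        also have "\<dots> = 0" using Suc.prems(3) x x2 by auto
        finally show "(\<Sum>m\<in>S - {m1}. c' m * monom_eval m x) = 0"
          using m1(1) Suc.prems(1) by (simp add: sum.remove c'_def)
      qed
    qed
    then show ?thesis using i by (auto simp: c'_def power_2_inject)
  qed
qed

lemma poly_ring_keys: "p \<in> poly_ring N \<longleftrightarrow> (\<forall>m\<in>Poly_Mapping.keys p. Poly_Mapping.keys m \<subseteq> {..<N})"
  by (simp add: poly_ring_def)

lemma meval_inject:
  fixes p q :: "'k::field_char_0 mpoly"
  assumes "p \<in> poly_ring N" "q \<in> poly_ring N" "\<forall>x\<in>std N. meval p x = meval q x"
  shows "p = q"
proof (rule poly_mapping_eqI)
  fix m
  let ?S = "Poly_Mapping.keys p \<union> Poly_Mapping.keys q"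
  have "Poly_Mapping.lookup p m - Poly_Mapping.lookup q m = 0" if "m \<in> ?S"
  proof (rule monom_eval_independent[of ?S N "\<lambda>m. Poly_Mapping.lookup p m - Poly_Mapping.lookup q m"])
    show "\<forall>x\<in>std N. (\<Sum>m\<in>?S. (Poly_Mapping.lookup p m - Poly_Mapping.lookup q m) * monom_eval m x) = 0"
    proof
      fix x :: "nat \<Rightarrow> 'k" assume "x \<in> std N"
      then have "meval p x - meval q x = 0" using assms(3) by simp
      then show "(\<Sum>m\<in>?S. (Poly_Mapping.lookup p m - Poly_Mapping.lookup q m) * monom_eval m x) = 0"
        by (simp add: meval_superset[of ?S] left_diff_distrib sum_subtractf)
    qed
  qed (use assms that in \<open>auto simp: poly_ring_keys\<close>)
  then show "Poly_Mapping.lookup p m = Poly_Mapping.lookup q m"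
    by (cases "m \<in> ?S") (auto simp: in_keys_iff)
qed

text \<open>A single scalar suffices: the powers of 2 are distinct in characteristic zero, so
  comparing coefficients fixes the degree of every monomial.\<close>

lemma meval_homogeneous:
  fixes p :: "'k::field_char_0 mpoly"
  assumes "p \<in> poly_ring N" "\<forall>x\<in>std N. meval p (fscale 2 x) = 2 ^ d * meval p x"
  shows "homogeneous d p"
  unfolding homogeneous_def
proof
  fix m assume m: "m \<in> Poly_Mapping.keys p"
  let ?deg = "\<lambda>m. \<Sum>i\<in>Poly_Mapping.keys m. Poly_Mapping.lookup m i"
  have "Poly_Mapping.lookup p m * (2 ^ ?deg m - 2 ^ d) = 0"
  proof (rule monom_eval_independent[of "Poly_Mapping.keys p" N "\<lambda>m. Poly_Mapping.lookup p m * (2 ^ ?deg m - 2 ^ d)"])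
    show "\<forall>x\<in>std N. (\<Sum>m\<in>Poly_Mapping.keys p. Poly_Mapping.lookup p m * (2 ^ ?deg m - 2 ^ d) * monom_eval m x) = 0"
    proof
      fix x :: "nat \<Rightarrow> 'k" assume "x \<in> std N"
      then have "meval p (fscale 2 x) - 2 ^ d * meval p x = 0" using assms(2) by simp
      then show "(\<Sum>m\<in>Poly_Mapping.keys p. Poly_Mapping.lookup p m * (2 ^ ?deg m - 2 ^ d) * monom_eval m x) = 0"
        by (simp add: meval_def monom_eval_scale algebra_simps sum_subtractf sum_distrib_left)
    qed
  qed (use assms m in \<open>auto simp: poly_ring_keys\<close>)
  then show "?deg m = d" using m by (auto simp: power_2_inject in_keys_iff)
qed

lemma poly_ring_add: "p \<in> poly_ring N \<Longrightarrow> q \<in> poly_ring N \<Longrightarrow> p + q \<in> poly_ring N"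
  using keys_add[of p q] by (auto simp: poly_ring_keys)

lemma poly_ring_0 [simp]: "0 \<in> poly_ring N"
  by (simp add: poly_ring_keys)

lemma poly_ring_sum: "(\<And>i. i \<in> I \<Longrightarrow> p i \<in> poly_ring N) \<Longrightarrow> (\<Sum>i\<in>I. p i) \<in> poly_ring N"
  by (induction I rule: infinite_finite_induct) (auto intro: poly_ring_add)

lemma poly_ring_mult:
  assumes "p \<in> poly_ring N" "q \<in> poly_ring N" shows "p * q \<in> poly_ring N"
  unfolding poly_ring_keys
proof
  fix m assume "m \<in> Poly_Mapping.keys (p * q)"
  then obtain a b where "m = a + b" "a \<in> Poly_Mapping.keys p" "b \<in> Poly_Mapping.keys q"
    using keys_mult[of p q] by blast
  then show "Poly_Mapping.keys m \<subseteq> {..<N}" using assms keys_add[of a b] by (auto simp: poly_ring_keys) blast+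
qed

lemma poly_ring_single: "Poly_Mapping.keys m \<subseteq> {..<N} \<Longrightarrow> Poly_Mapping.single m c \<in> poly_ring N"
  by (auto simp: poly_ring_keys)

lemma poly_ring_linear_form: "linear_form N a \<in> poly_ring N"
  unfolding linear_form_def by (intro poly_ring_sum poly_ring_single) auto

lemma meval_linear_form: "meval (linear_form N a) x = (\<Sum>k<N. a k * x k)"
  by (simp add: linear_form_def meval_sum del: One_nat_def)

lemma linear_fun_std:
  assumes "linear_fun \<phi>" "x \<in> std N" shows "\<phi> x = (\<Sum>k<N. \<phi> (unit_vec k) * x k)"
  by (subst std_expand[OF assms(2)])
    (simp add: linear_fun_sum[OF assms(1)] linear_fun_scale[OF assms(1)] mult.commute)

lemma linear_fun_form: "linear_fun (\<lambda>x. \<Sum>k<N. a k * x k)" for a :: "nat \<Rightarrow> 'k::field"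
  by (auto simp: linear_fun_def distrib_left sum.distrib sum_distrib_left mult_ac)

lemma polyfun_meval:
  assumes "q \<in> polyfun" shows "\<exists>p\<in>poly_ring N. \<forall>x\<in>std N. q x = meval p x"
  using assms
proof (induction rule: polyfun.induct)
  case (const c)
  have "(Poly_Mapping.single 0 c) \<in> poly_ring N" by (rule poly_ring_single) simp
  then show ?case by (rule bexI[rotated]) simp
next
  case (lin \<phi>)
  have "\<forall>x\<in>std N. \<phi> x = meval (linear_form N (\<lambda>k. \<phi> (unit_vec k))) x"
    using linear_fun_std[OF lin] by (simp add: meval_linear_form)
  then show ?case using poly_ring_linear_form by (rule bexI)
next
  case (add p q)
  then obtain p' q' where *: "p' \<in> poly_ring N" "\<forall>x\<in>std N. p x = meval p' x"
    "q' \<in> poly_ring N" "\<forall>x\<in>std N. q x = meval q' x" by blast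
  then have "\<forall>x\<in>std N. p x + q x = meval (p' + q') x" by simp
  then show ?case using poly_ring_add[OF *(1,3)] by (rule bexI)
next
  case (mult p q)
  then obtain p' q' where *: "p' \<in> poly_ring N" "\<forall>x\<in>std N. p x = meval p' x"
    "q' \<in> poly_ring N" "\<forall>x\<in>std N. q x = meval q' x" by blast
  then have "\<forall>x\<in>std N. p x * q x = meval (p' * q') x" by simp
  then show ?case using poly_ring_mult[OF *(1,3)] by (rule bexI)
qed

lemma pfun_meval: "q \<in> pfun (std N) \<Longrightarrow> \<exists>p\<in>poly_ring N. \<forall>x\<in>std N. q x = meval p x"
  using polyfun_meval unfolding pfun_def by fastforce

lemma pfun_power: "p \<in> pfun Y \<Longrightarrow> (\<lambda>y. p y ^ n) \<in> pfun Y"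
proof (induction n)
  case (Suc n)
  then show ?case using pfun_mult[OF Suc.prems Suc.IH] by simp
qed (simp add: pfun_const)

lemma meval_pfun: "meval p \<in> pfun Y"
proof -
  have "(\<lambda>x. \<Sum>m\<in>Poly_Mapping.keys p. Poly_Mapping.lookup p m * monom_eval m x) \<in> pfun Y"
    unfolding monom_eval_def
    by (rule pfun_sum, rule pfun_cmult, rule pfun_prod, rule pfun_power, rule pfun_lin, rule linear_fun_proj)
  then show ?thesis by (simp add: meval_def[abs_def])
qed

lemma partial_deriv_linear_form:
  assumes "k < N" shows "partial_deriv k (linear_form N a) = Poly_Mapping.single 0 (a k)"
proof -
  let ?s = "\<lambda>j::nat. Poly_Mapping.single j (1::nat)"
  let ?p = "linear_form N a"
  have inj: "inj_on ?s {..<N}" by (rule inj_onI) (metis keys_single one_neq_zero singleton_inject)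
  have lk: "Poly_Mapping.lookup ?p (?s j) = a j" if "j < N" for j
  proof -
    have "Poly_Mapping.lookup ?p (?s j) = (\<Sum>i<N. if i = j then a i else 0)"
      unfolding linear_form_def lookup_sum
      by (rule sum.cong[OF refl]) (use inj that in \<open>auto simp: lookup_single when_def inj_on_def\<close>)
    then show ?thesis using that by simp
  qed
  have "Poly_Mapping.keys ?p \<subseteq> ?s ` {..<N}"
    unfolding linear_form_def by (rule order_trans[OF Poly_Mapping.keys_sum]) auto
  then have "partial_deriv k ?p = (\<Sum>m\<in>?s ` {..<N}. Poly_Mapping.single (m - ?s k)
        (of_nat (Poly_Mapping.lookup m k) * Poly_Mapping.lookup ?p m))"
    unfolding partial_deriv_def by (intro sum.mono_neutral_left) (auto simp: in_keys_iff)
  also have "\<dots> = (\<Sum>j<N. Poly_Mapping.single (?s j - ?s k) (of_nat (Poly_Mapping.lookup (?s j) k) * a j))"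
    unfolding sum.reindex[OF inj] by (rule sum.cong) (auto simp: lk simp del: One_nat_def)
  also have "\<dots> = (\<Sum>j<N. if j = k then Poly_Mapping.single 0 (a k) else 0)"
    by (rule sum.cong) (auto simp: lookup_single when_def)
  finally show ?thesis using assms by simp
qed

lemma meval_apply_deriv:
  "meval (apply_deriv N \<theta> (linear_form N a)) x = (\<Sum>k<N. a k * meval (\<theta> k) x)"
  by (simp add: apply_deriv_def meval_sum partial_deriv_linear_form mult.commute)

lemma apply_deriv_poly_ring:
  assumes "\<theta> \<in> derivations N" shows "apply_deriv N \<theta> (linear_form N a) \<in> poly_ring N"
  unfolding apply_deriv_def
  by (intro poly_ring_sum poly_ring_mult)
    (use assms in \<open>auto simp: derivations_def partial_deriv_linear_form intro!: poly_ring_single\<close>)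

section \<open>Comparison with polynomial derivations\<close>

text \<open>Both directions are given by maps linear on the whole ambient space, so that polynomial
  functions can be pulled back along either.\<close>

definition lin_iso ::
  "('i \<Rightarrow> 'k::field) set \<Rightarrow> ('j \<Rightarrow> 'k) set \<Rightarrow> (('i \<Rightarrow> 'k) \<Rightarrow> ('j \<Rightarrow> 'k)) \<Rightarrow> (('j \<Rightarrow> 'k) \<Rightarrow> ('i \<Rightarrow> 'k)) \<Rightarrow> bool" where
  "lin_iso Y X f g \<longleftrightarrow> linear_map f \<and> linear_map g \<and>
     (\<forall>y\<in>Y. f y \<in> X \<and> g (f y) = y) \<and> (\<forall>x\<in>X. g x \<in> Y \<and> f (g x) = x)"

lemma lin_iso_sym: "lin_iso Y X f g \<Longrightarrow> lin_iso X Y g f"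
  by (auto simp: lin_iso_def)

lemma lin_isoD:
  assumes "lin_iso Y X f g"
  shows "linear_map f" "linear_map g" "y \<in> Y \<Longrightarrow> f y \<in> X" "y \<in> Y \<Longrightarrow> g (f y) = y"
    "x \<in> X \<Longrightarrow> g x \<in> Y" "x \<in> X \<Longrightarrow> f (g x) = x"
  using assms by (auto simp: lin_iso_def)

lemma lin_iso_image_image:
  assumes "lin_iso Y X f g" "\<forall>h\<in>A. h \<subseteq> Y" shows "(`) g ` (`) f ` A = A"
proof -
  have "g ` f ` h = h" if "h \<in> A" for h
  proof -
    have "g (f y) = y" if "y \<in> h" for y using that \<open>h \<in> A\<close> assms by (auto simp: lin_iso_def)
    then show ?thesis by (simp add: image_image)
  qed
  then have "(`) g ` (`) f ` A = (\<lambda>h. h) ` A" unfolding image_image[of "(`) g"] by (rule image_cong[OF refl])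
  then show ?thesis by simp
qed

lemma lin_iso_hyperplane:
  assumes iso: "lin_iso Y X f g" and H: "hyperplane Y H" shows "hyperplane X (f ` H)"
proof -
  obtain \<alpha> where \<alpha>: "is_form Y H \<alpha>" using H by (auto simp: hyperplane_def)
  have "linear_fun (\<lambda>x. \<alpha> (g x))" by (rule linear_fun_comp[OF is_form_linear[OF \<alpha>] lin_isoD(2)[OF iso]])
  moreover have "\<exists>e\<in>X. \<alpha> (g e) \<noteq> 0"
    using is_form_nonzero[OF \<alpha>] lin_isoD(3,4)[OF iso] by metis
  moreover have "f ` H = {x\<in>X. \<alpha> (g x) = 0}"
    using is_form_iff[OF \<alpha>] lin_isoD(3-6)[OF iso] by (force simp: image_iff)
  ultimately show ?thesis unfolding hyperplane_def is_form_def by blast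
qed

lemma lder_transport:
  assumes iso: "lin_iso Y X f g" and A: "\<forall>h\<in>A. h \<subseteq> Y" and \<theta>: "\<theta> \<in> lder Y A"
  shows "(\<lambda>x. f (\<theta> (g x))) \<in> lder X ((`) f ` A)"
proof -
  note i = lin_isoD[OF iso]
  have "(\<lambda>x. f (\<theta> (g x))) \<in> pmap X"
  proof (rule pmapI)
    show "f (\<theta> (g x)) \<in> X" if "x \<in> X" for x using that i \<theta> by (auto dest!: lder_pmap pmapD)
    show "(\<lambda>x. \<phi> (f (\<theta> (g x)))) \<in> pfun X" if "linear_fun \<phi>" for \<phi>
      by (rule pfun_comp[OF pmap_pfun[OF lder_pmap[OF \<theta>] linear_fun_comp[OF that i(1)]] i(2,5)])
  qed
  moreover have "f (\<theta> (g x)) \<in> f ` h" if h: "h \<in> A" and x: "x \<in> f ` h" for h x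
  proof -
    obtain y where y: "y \<in> h" "x = f y" using x by blast
    then have "g x = y" using A h i(4) by auto
    then show ?thesis using lderD[OF \<theta> h y(1)] by auto
  qed
  ultimately show ?thesis by (auto simp: lder_def)
qed

lemma lder_basis_transport:
  assumes iso: "lin_iso Y X f g" and A: "\<forall>h\<in>A. h \<subseteq> Y" and bas: "lder_basis Y A I \<theta>"
  shows "lder_basis X ((`) f ` A) I (\<lambda>i x. f (\<theta> i (g x)))"
proof -
  note i = lin_isoD[OF iso]
  have fsum: "f (\<Sum>i\<in>I. fscale (c i) (x i)) = (\<Sum>i\<in>I. fscale (c i) (f (x i)))" for c x
    by (simp add: linear_map_sum[OF i(1)] linear_map_scale[OF i(1)])
  have th: "\<theta> j \<in> lder Y A" if "j \<in> I" for j using bas that by (simp add: lder_basis_def)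
  show ?thesis
    unfolding lder_basis_def
  proof (intro conjI ballI allI impI)
    show "finite I" using bas by (simp add: lder_basis_def)
    show "(\<lambda>x. f (\<theta> j (g x))) \<in> lder X ((`) f ` A)" if "j \<in> I" for j
      by (rule lder_transport[OF iso A th[OF that]])
  next
    fix \<eta> assume \<eta>: "\<eta> \<in> lder X ((`) f ` A)"
    have AX: "\<forall>h\<in>(`) f ` A. h \<subseteq> X" using A i(3) by auto
    have "(\<lambda>y. g (\<eta> (f y))) \<in> lder Y A"
      using lder_transport[OF lin_iso_sym[OF iso] AX \<eta>] by (simp add: lin_iso_image_image[OF iso A])
    from lder_basis_span[OF bas this] obtain c where c: "\<forall>i\<in>I. c i \<in> pfun Y"
      "\<forall>y\<in>Y. g (\<eta> (f y)) = (\<Sum>i\<in>I. fscale (c i y) (\<theta> i y))" by blast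
    have "\<forall>j\<in>I. (\<lambda>x. c j (g x)) \<in> pfun X"
      using pfun_comp[OF _ i(2,5)] c(1) by blast
    moreover have "\<forall>x\<in>X. \<eta> x = (\<Sum>i\<in>I. fscale (c i (g x)) (f (\<theta> i (g x))))"
    proof
      fix x assume x: "x \<in> X"
      have "g (\<eta> x) = (\<Sum>i\<in>I. fscale (c i (g x)) (\<theta> i (g x)))" using c(2) i(5,6)[OF x] by metis
      then have "f (g (\<eta> x)) = (\<Sum>i\<in>I. fscale (c i (g x)) (f (\<theta> i (g x))))" by (simp add: fsum)
      then show "\<eta> x = (\<Sum>i\<in>I. fscale (c i (g x)) (f (\<theta> i (g x))))"
        using i(6)[OF pmapD[OF lder_pmap[OF \<eta>] x]] by simp
    qed
    ultimately show "\<exists>c. (\<forall>i\<in>I. c i \<in> pfun X) \<and> (\<forall>x\<in>X. \<eta> x = (\<Sum>i\<in>I. fscale (c i x) (f (\<theta> i (g x)))))"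
      by (intro exI[of _ "\<lambda>i x. c i (g x)"] conjI)
  next
    fix c j x assume c: "\<forall>i\<in>I. c i \<in> pfun X" and rel: "\<forall>x\<in>X. (\<Sum>i\<in>I. fscale (c i x) (f (\<theta> i (g x)))) = 0"
      and j: "j \<in> I" and x: "x \<in> X"
    have c': "\<forall>j\<in>I. (\<lambda>y. c j (f y)) \<in> pfun Y"
      using pfun_comp[OF _ i(1,3)] c by blast
    have "\<forall>y\<in>Y. (\<Sum>i\<in>I. fscale (c i (f y)) (\<theta> i y)) = 0"
    proof
      fix y assume y: "y \<in> Y"
      have gsum: "g (\<Sum>i\<in>I. fscale (c i) (x i)) = (\<Sum>i\<in>I. fscale (c i) (g (x i)))" for c x
        by (simp add: linear_map_sum[OF i(2)] linear_map_scale[OF i(2)])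
      have "(\<Sum>i\<in>I. fscale (c i (f y)) (f (\<theta> i y))) = 0" using rel i(3,4)[OF y] by metis
      then have "(\<Sum>i\<in>I. fscale (c i (f y)) (g (f (\<theta> i y)))) = 0"
        using gsum[of "\<lambda>i. c i (f y)" "\<lambda>i. f (\<theta> i y)"] linear_map_0[OF i(2)] by simp
      moreover have "g (f (\<theta> j y)) = \<theta> j y" if "j \<in> I" for j
        by (rule i(4)[OF pmapD[OF lder_pmap[OF th[OF that]] y]])
      ultimately show "(\<Sum>i\<in>I. fscale (c i (f y)) (\<theta> i y)) = 0" by simp
    qed
    from lder_basis_indep[OF bas c' this] have "c j (f (g x)) = 0" using j i(5)[OF x] by blast
    then show "c j x = 0" by (simp add: i(6)[OF x])
  qed
qed

lemma coordinates_iso: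
  assumes Y: "subsp Y" and c: "coordinates Y N f"
  obtains g where "lin_iso Y (std N) f g"
proof -
  obtain b where b: "\<forall>k<N. b k \<in> Y" "\<forall>y\<in>Y. y = (\<Sum>k<N. fscale (f y k) (b k))"
    "\<forall>x\<in>std N. f (\<Sum>k<N. fscale (x k) (b k)) = x"
    using coordinates_basis[OF Y c] by blast
  define g where "g x = (\<Sum>k<N. fscale (x k) (b k))" for x
  have "linear_map g"
    by (auto simp: linear_map_iff g_def fun_eq_iff sum_fun_apply distrib_right sum.distrib sum_distrib_left mult.assoc)
  moreover have "g x \<in> Y" for x unfolding g_def using b(1) by (intro subsp_sum[OF Y] subsp_scale[OF Y]) auto
  moreover have "\<forall>y\<in>Y. g (f y) = y" using b(2) by (simp add: g_def)
  moreover have "\<forall>x\<in>std N. f (g x) = x" using b(3) by (simp add: g_def)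
  moreover have "\<forall>y\<in>Y. f y \<in> std N" "linear_map f" using c by (auto simp: coordinates_def bij_betw_def)
  ultimately show ?thesis by (intro that[of g]) (auto simp: lin_iso_def)
qed

definition vfield :: "(nat \<Rightarrow> 'k::comm_ring_1 mpoly) \<Rightarrow> (nat \<Rightarrow> 'k) \<Rightarrow> (nat \<Rightarrow> 'k)" where
  "vfield \<theta> x = (\<lambda>k. meval (\<theta> k) x)"

lemma vfield_inject:
  fixes \<theta> :: "nat \<Rightarrow> 'k::field_char_0 mpoly"
  assumes "\<theta> \<in> derivations N" "\<theta>' \<in> derivations N" "\<forall>x\<in>std N. vfield \<theta> x = vfield \<theta>' x"
  shows "\<theta> = \<theta>'"
proof
  fix k show "\<theta> k = \<theta>' k"
  proof (cases "k < N")
    case True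
    then show ?thesis using assms
      by (intro meval_inject[of _ N]) (auto simp: derivations_def vfield_def fun_eq_iff)
  next
    case False
    then show ?thesis using assms by (auto simp: derivations_def coord_space_def)
  qed
qed

lemma vfield_sum: "vfield (\<Sum>i\<in>I. fscale (c i) (\<theta> i)) x = (\<Sum>i\<in>I. fscale (meval (c i) x) (vfield (\<theta> i) x))"
  by (simp add: vfield_def fun_eq_iff sum_fun_apply meval_sum)

lemma derivations_sum:
  assumes "\<And>i. i \<in> I \<Longrightarrow> c i \<in> poly_ring N" "\<And>i. i \<in> I \<Longrightarrow> \<theta> i \<in> derivations N"
  shows "(\<Sum>i\<in>I. fscale (c i) (\<theta> i)) \<in> derivations N"
  using assms unfolding derivations_def coord_space_def
  by (auto simp: sum_fun_apply intro!: sum.neutral poly_ring_sum poly_ring_mult)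

lemma vfield_pmap:
  fixes \<theta> :: "nat \<Rightarrow> 'k::field mpoly"
  assumes "\<theta> \<in> derivations N" shows "vfield \<theta> \<in> pmap (std N)"
proof (rule pmapI)
  show s: "vfield \<theta> y \<in> std N" for y using assms by (auto simp: vfield_def derivations_def coord_space_def)
  fix \<phi> :: "(nat \<Rightarrow> 'k) \<Rightarrow> 'k" assume \<phi>: "linear_fun \<phi>"
  have "(\<lambda>y. \<Sum>k<N. \<phi> (unit_vec k) * meval (\<theta> k) y) \<in> pfun (std N)"
    by (rule pfun_sum, rule pfun_cmult, rule meval_pfun)
  then show "(\<lambda>y. \<phi> (vfield \<theta> y)) \<in> pfun (std N)"
    by (elim pfun_cong) (simp add: linear_fun_std[OF \<phi> s], simp add: vfield_def)
qed

text \<open>Evaluating \<open>\<theta>(\<alpha>) = \<alpha> g\<close> on the hyperplane gives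
  tangency. Conversely tangency makes \<open>\<theta>(\<alpha>)\<close> vanish on the kernel of
  \<alpha>, and the quotient from \<open>pfun_divide\<close> is lifted to a formal
  polynomial.\<close>

lemma log_derivations_iff:
  fixes \<theta> :: "nat \<Rightarrow> 'k::field_char_0 mpoly"
  assumes \<theta>: "\<theta> \<in> derivations N" and A: "\<forall>h\<in>A. hyperplane (std N) h"
  shows "\<theta> \<in> log_derivations N A \<longleftrightarrow> vfield \<theta> \<in> lder (std N) A"
proof
  assume L: "\<theta> \<in> log_derivations N A"
  show "vfield \<theta> \<in> lder (std N) A"
    unfolding lder_def
  proof (intro CollectI conjI ballI)
    fix h x assume h: "h \<in> A" and x: "x \<in> h"
    obtain \<alpha> where \<alpha>: "is_form (std N) h \<alpha>" using A h by (auto simp: hyperplane_def)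
    define a where "a k = \<alpha> (unit_vec k)" for k
    have \<alpha>eq: "\<alpha> x = (\<Sum>k<N. a k * x k)" if "x \<in> std N" for x
      unfolding a_def by (rule linear_fun_std[OF is_form_linear[OF \<alpha>] that])
    have hk: "h = kernel_form N a" using is_form_iff[OF \<alpha>] \<alpha>eq by (auto simp: kernel_form_def)
    then obtain g where "apply_deriv N \<theta> (linear_form N a) = linear_form N a * g"
      using L h unfolding log_derivations_def by blast
    then have "(\<Sum>k<N. a k * meval (\<theta> k) x) = (\<Sum>k<N. a k * x k) * meval g x"
      by (metis meval_apply_deriv meval_mult meval_linear_form)
    also have "\<dots> = 0" using x hk by (simp add: kernel_form_def)
    finally show "vfield \<theta> x \<in> h" using pmapD[OF vfield_pmap[OF \<theta>]] x hk
      by (auto simp: kernel_form_def vfield_def)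
  qed (rule vfield_pmap[OF \<theta>])
next
  assume L: "vfield \<theta> \<in> lder (std N) A"
  show "\<theta> \<in> log_derivations N A"
    unfolding log_derivations_def
  proof (intro CollectI conjI ballI allI impI \<theta>)
    fix h a assume h: "h \<in> A" and hk: "h = kernel_form N a"
    define \<alpha> where "\<alpha> x = (\<Sum>k<N. a k * x k)" for x :: "nat \<Rightarrow> 'k"
    have lin: "linear_fun \<alpha>" unfolding \<alpha>_def by (rule linear_fun_form)
    have sstd: "subsp (std N :: (nat \<Rightarrow> 'k) set)"
      by (auto simp: fun_space.subspace_def coord_space_def)
    obtain \<beta> where \<beta>: "is_form (std N) h \<beta>" using A h by (auto simp: hyperplane_def)
    \<comment> \<open>\<open>a\<close> is an arbitrary form with kernel \<open>h\<close>; it is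
      nonzero because \<open>h\<close> is a proper subspace.\<close>
    obtain e where "e \<in> std N" "\<beta> e \<noteq> 0" using is_form_nonzero[OF \<beta>] by blast
    then have "e \<in> std N" "e \<notin> h" using is_form_iff[OF \<beta>] by auto
    then have e: "e \<in> std N" "\<alpha> e \<noteq> 0" using hk by (auto simp: kernel_form_def \<alpha>_def)
    have p: "(\<lambda>x. \<alpha> (vfield \<theta> x)) \<in> pfun (std N)" by (rule pmap_pfun[OF vfield_pmap[OF \<theta>] lin])
    have "\<forall>x\<in>std N. \<alpha> x = 0 \<longrightarrow> \<alpha> (vfield \<theta> x) = 0"
      using lderD[OF L h] hk by (auto simp: kernel_form_def \<alpha>_def)
    from pfun_divide[OF sstd p lin e this] obtain q where
      q: "q \<in> pfun (std N)" "\<forall>x\<in>std N. \<alpha> (vfield \<theta> x) = \<alpha> x * q x" by blast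
    obtain g where g: "g \<in> poly_ring N" "\<forall>x\<in>std N. q x = meval g x" using pfun_meval[OF q(1)] by blast
    have "apply_deriv N \<theta> (linear_form N a) = linear_form N a * g"
    proof (rule meval_inject)
      show "apply_deriv N \<theta> (linear_form N a) \<in> poly_ring N" by (rule apply_deriv_poly_ring[OF \<theta>])
      show "linear_form N a * g \<in> poly_ring N" by (rule poly_ring_mult[OF poly_ring_linear_form g(1)])
      show "\<forall>x\<in>std N. meval (apply_deriv N \<theta> (linear_form N a)) x = meval (linear_form N a * g) x"
        using q(2) g(2) by (simp add: meval_apply_deriv meval_linear_form \<alpha>_def vfield_def)
    qed
    then show "\<exists>g\<in>poly_ring N. apply_deriv N \<theta> (linear_form N a) = linear_form N a * g" using g(1) by blast
  qed
qed

lemma lder_cong: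
  assumes "\<eta> \<in> lder Y A" "\<forall>h\<in>A. h \<subseteq> Y" "\<forall>y\<in>Y. \<eta>' y = \<eta> y" shows "\<eta>' \<in> lder Y A"
proof -
  have "\<eta>' \<in> pmap Y"
  proof (rule pmapI)
    show "\<eta>' y \<in> Y" if "y \<in> Y" for y using pmapD[OF lder_pmap[OF assms(1)] that] assms(3) that by simp
    show "(\<lambda>y. \<phi> (\<eta>' y)) \<in> pfun Y" if "linear_fun \<phi>" for \<phi>
      using pmap_pfun[OF lder_pmap[OF assms(1)] that] by (rule pfun_cong) (simp add: assms(3))
  qed
  moreover have "\<eta>' y \<in> h" if "h \<in> A" "y \<in> h" for h y
  proof -
    have "y \<in> Y" using assms(2) that by blast
    then show ?thesis using lderD[OF assms(1) that] assms(3) by simp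
  qed
  ultimately show ?thesis by (auto simp: lder_def)
qed

lemma lder_std_lift:
  fixes A :: "(nat \<Rightarrow> 'k::field_char_0) set set"
  assumes A: "\<forall>h\<in>A. hyperplane (std N) h" and \<eta>: "\<eta> \<in> lder (std N) A"
  shows "\<exists>\<theta>\<in>log_derivations N A. \<forall>x\<in>std N. vfield \<theta> x = \<eta> x"
proof -
  have "\<exists>p\<in>poly_ring N. \<forall>x\<in>std N. \<eta> x k = meval p x" for k
    by (rule pfun_meval) (rule pmap_pfun[OF lder_pmap[OF \<eta>] linear_fun_proj])
  then obtain P where P: "\<And>k. P k \<in> poly_ring N" "\<And>k x. x \<in> std N \<Longrightarrow> \<eta> x k = meval (P k) x" by metis
  define \<theta> where "\<theta> k = (if k < N then P k else 0)" for k
  have th: "\<theta> \<in> derivations N" using P(1) by (auto simp: derivations_def \<theta>_def coord_space_def)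
  have eq: "vfield \<theta> x = \<eta> x" if x: "x \<in> std N" for x
  proof
    fix k show "vfield \<theta> x k = \<eta> x k"
      using P(2)[OF x] pmapD[OF lder_pmap[OF \<eta>] x] by (auto simp: vfield_def \<theta>_def coord_space_def)
  qed
  have "vfield \<theta> \<in> lder (std N) A"
    using lder_cong[OF \<eta>] eq A hyperplane_subset by blast
  then show ?thesis using log_derivations_iff[OF th A] eq by blast
qed

lemma ex1_unique: "\<exists>!x. P x \<Longrightarrow> P a \<Longrightarrow> P b \<Longrightarrow> a = b"
  by blast

lemma sum_support:
  fixes c :: "'b \<Rightarrow> 'r::comm_ring_1"
  assumes "finite B" "{b. c b \<noteq> 0} \<subseteq> B"
  shows "(\<Sum>b | c b \<noteq> 0. fscale (c b) (x b)) = (\<Sum>b\<in>B. fscale (c b) (x b))"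
  using assms by (intro sum.mono_neutral_left) (auto simp: fun_eq_iff)

lemma lder_basis_std_exponents:
  fixes A :: "(nat \<Rightarrow> 'k::field_char_0) set set"
  assumes A: "\<forall>h\<in>A. hyperplane (std N) h" and bas: "lder_basis (std N) A I \<eta>"
    and d: "\<forall>i\<in>I. homog (std N) (d i) (\<eta> i)"
  shows "std_has_exponents N A (image_mset d (mset_set I))"
proof -
  have finI: "finite I" using bas by (simp add: lder_basis_def)
  have "\<exists>\<theta>\<in>log_derivations N A. \<forall>x\<in>std N. vfield \<theta> x = \<eta> i x" if "i \<in> I" for i
  proof (rule lder_std_lift[OF A])
    show "\<eta> i \<in> lder (std N) A" using bas that by (simp add: lder_basis_def)
  qed
  then obtain th where th: "\<And>i. i \<in> I \<Longrightarrow> th i \<in> log_derivations N A"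
    "\<And>i x. i \<in> I \<Longrightarrow> x \<in> std N \<Longrightarrow> vfield (th i) x = \<eta> i x" by metis
  have thd: "th i \<in> derivations N" if "i \<in> I" for i using th(1)[OF that] by (simp add: log_derivations_def)
  have z: "(0 :: nat \<Rightarrow> 'k) \<in> std N" by (simp add: coord_space_def)
  \<comment> \<open>\<open>module_basis\<close> speaks of a set, so the lifts must be distinct for
    the degrees to keep their multiplicities.\<close>
  have inj: "inj_on th I"
  proof (rule inj_onI, rule ccontr)
    fix i j assume ij: "i \<in> I" "j \<in> I" "th i = th j" "i \<noteq> j"
    define c where "c l = (\<lambda>_::nat \<Rightarrow> 'k. if l = i then (1::'k) else if l = j then -1 else 0)" for l
    have cp: "\<forall>l\<in>I. c l \<in> pfun (std N)" by (auto simp: c_def pfun_const)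
    have "\<forall>y\<in>std N. (\<Sum>l\<in>I. fscale (c l y) (\<eta> l y)) = 0"
    proof
      fix y :: "nat \<Rightarrow> 'k" assume y: "y \<in> std N"
      have "(\<Sum>l\<in>I. fscale (c l y) (\<eta> l y)) = (\<Sum>l\<in>{i,j}. fscale (c l y) (\<eta> l y))"
        using ij finI by (intro sum.mono_neutral_right) (auto simp: c_def)
      moreover have "\<eta> i y = \<eta> j y" using th(2)[OF ij(1) y] th(2)[OF ij(2) y] ij(3) by simp
      moreover from this have "(\<Sum>l\<in>{i,j}. fscale (c l y) (\<eta> l y)) = 0" using ij(4) by (auto simp: c_def fun_eq_iff)
      ultimately show "(\<Sum>l\<in>I. fscale (c l y) (\<eta> l y)) = 0" by simp
    qed
    from lder_basis_indep[OF bas cp this] ij(1) z have "c i 0 = 0" by blast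
    then show False by (simp add: c_def)
  qed
  define B where "B = th ` I"
  have finB: "finite B" using finI by (simp add: B_def)
  have reidx: "(\<Sum>b | c b \<noteq> 0. fscale (c b) b) = (\<Sum>i\<in>I. fscale (c (th i)) (th i))"
    if "{b. c b \<noteq> 0} \<subseteq> B" for c :: "_ \<Rightarrow> 'k mpoly"
    using sum_support[OF finB that, of "\<lambda>b. b"] unfolding B_def sum.reindex[OF inj] by simp
  have basis: "module_basis (poly_ring N) (log_derivations N A) B"
    unfolding module_basis_def
  proof (intro conjI ballI)
    show "B \<subseteq> log_derivations N A" using th(1) by (auto simp: B_def)
    fix \<theta> assume \<theta>: "\<theta> \<in> log_derivations N A"
    then have \<theta>d: "\<theta> \<in> derivations N" by (simp add: log_derivations_def)
    have "vfield \<theta> \<in> lder (std N) A" using \<theta> log_derivations_iff[OF \<theta>d A] by simp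
    from lder_basis_span[OF bas this] obtain c where c: "\<forall>i\<in>I. c i \<in> pfun (std N)"
      "\<forall>x\<in>std N. vfield \<theta> x = (\<Sum>i\<in>I. fscale (c i x) (\<eta> i x))" by blast
    have "\<exists>p\<in>poly_ring N. \<forall>x\<in>std N. c i x = meval p x" if "i \<in> I" for i using pfun_meval c(1) that by blast
    then obtain C where C: "\<And>i. i \<in> I \<Longrightarrow> C i \<in> poly_ring N" "\<And>i x. i \<in> I \<Longrightarrow> x \<in> std N \<Longrightarrow> c i x = meval (C i) x"
      by metis
    define cc where "cc b = (if b \<in> B then C (the_inv_into I th b) else 0)" for b
    have ccth: "cc (th i) = C i" if "i \<in> I" for i using that inj by (simp add: cc_def B_def the_inv_into_f_f)
    have ccS: "cc b \<in> poly_ring N" for b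
      using C(1) inj by (auto simp: cc_def B_def the_inv_into_f_f)
    have supp: "{b. cc b \<noteq> 0} \<subseteq> B" by (auto simp: cc_def)
    have eq: "\<theta> = (\<Sum>b | cc b \<noteq> 0. fscale (cc b) b)"
      unfolding reidx[OF supp]
    proof (rule vfield_inject[OF \<theta>d])
      show "(\<Sum>i\<in>I. fscale (cc (th i)) (th i)) \<in> derivations N" by (rule derivations_sum[OF ccS thd])
      show "\<forall>x\<in>std N. vfield \<theta> x = vfield (\<Sum>i\<in>I. fscale (cc (th i)) (th i)) x"
        using c(2) C(2) ccth th(2) by (simp add: vfield_sum)
    qed
    show "\<exists>!c. (\<forall>b. c b \<in> poly_ring N) \<and> finite {b. c b \<noteq> 0} \<and> {b. c b \<noteq> 0} \<subseteq> B \<and>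
        \<theta> = (\<Sum>b | c b \<noteq> 0. fscale (c b) b)"
    proof (rule ex1I[of _ cc])
      show "(\<forall>b. cc b \<in> poly_ring N) \<and> finite {b. cc b \<noteq> 0} \<and> {b. cc b \<noteq> 0} \<subseteq> B \<and>
        \<theta> = (\<Sum>b | cc b \<noteq> 0. fscale (cc b) b)" using ccS supp eq finB finite_subset by blast
      fix c' assume c': "(\<forall>b. c' b \<in> poly_ring N) \<and> finite {b. c' b \<noteq> 0} \<and> {b. c' b \<noteq> 0} \<subseteq> B \<and>
        \<theta> = (\<Sum>b | c' b \<noteq> 0. fscale (c' b) b)"
      then have c'S: "\<And>b. c' b \<in> poly_ring N" and supp': "{b. c' b \<noteq> 0} \<subseteq> B"
        and "\<theta> = (\<Sum>b | c' b \<noteq> 0. fscale (c' b) b)" by blast+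
      then have eq': "\<theta> = (\<Sum>i\<in>I. fscale (c' (th i)) (th i))" using reidx[OF supp'] by simp
      have eqc: "\<theta> = (\<Sum>i\<in>I. fscale (cc (th i)) (th i))" using eq reidx[OF supp] by simp
      have cp: "\<forall>i\<in>I. (\<lambda>x. meval (c' (th i)) x - meval (cc (th i)) x) \<in> pfun (std N)"
        by (intro ballI pfun_diff meval_pfun)
      have "\<forall>x\<in>std N. (\<Sum>i\<in>I. fscale (meval (c' (th i)) x - meval (cc (th i)) x) (\<eta> i x)) = 0"
      proof
        fix x :: "nat \<Rightarrow> 'k" assume x: "x \<in> std N"
        have "(\<Sum>i\<in>I. fscale (meval (c' (th i)) x) (vfield (th i) x)) = (\<Sum>i\<in>I. fscale (meval (cc (th i)) x) (vfield (th i) x))"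
          unfolding vfield_sum[symmetric] using eq' eqc by simp
        then show "(\<Sum>i\<in>I. fscale (meval (c' (th i)) x - meval (cc (th i)) x) (\<eta> i x)) = 0"
          using th(2)[OF _ x] by (simp add: fun_eq_iff sum_fun_apply left_diff_distrib sum_subtractf)
      qed
      from lder_basis_indep[OF bas cp this]
      have "\<forall>x\<in>std N. meval (c' (th i)) x = meval (cc (th i)) x" if "i \<in> I" for i using that by auto
      then have on: "c' (th i) = cc (th i)" if "i \<in> I" for i using meval_inject[OF c'S ccS] that by blast
      show "c' = cc"
      proof
        fix b show "c' b = cc b"
        proof (cases "b \<in> B")
          case False
          then have "c' b = 0" "cc b = 0" using supp supp' by blast+
          then show ?thesis by simp
        qed (use on in \<open>auto simp: B_def\<close>)
      qed
    qed
  qed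
  define d' where "d' b = d (the_inv_into I th b)" for b
  have d'th: "d' (th i) = d i" if "i \<in> I" for i using that inj by (simp add: d'_def the_inv_into_f_f)
  have hom: "\<forall>b\<in>B. \<forall>k<N. homogeneous (d' b) (b k)"
  proof (intro ballI allI impI)
    fix b k assume b: "b \<in> B" and k: "k < N"
    then obtain i where i: "i \<in> I" "b = th i" by (auto simp: B_def)
    show "homogeneous (d' b) (b k)"
    proof (rule meval_homogeneous)
      show "b k \<in> poly_ring N" using thd[OF i(1)] i(2) k by (simp add: derivations_def)
      show "\<forall>x\<in>std N. meval (b k) (fscale 2 x) = 2 ^ d' b * meval (b k) x"
      proof
        fix x :: "nat \<Rightarrow> 'k" assume x: "x \<in> std N"
        have x2: "fscale 2 x \<in> std N" using x by (auto simp: coord_space_def)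
        have "\<eta> i (fscale 2 x) = fscale (2 ^ d i) (\<eta> i x)" using d i(1) x by (simp add: homog_def)
        then have "vfield b (fscale 2 x) k = 2 ^ d i * vfield b x k"
          using th(2)[OF i(1) x] th(2)[OF i(1) x2] i(2) by simp
        then show "meval (b k) (fscale 2 x) = 2 ^ d' b * meval (b k) x"
          using d'th[OF i(1)] i(2) by (simp add: vfield_def)
      qed
    qed
  qed
  have "image_mset d (mset_set I) = image_mset d' (mset_set B)"
    unfolding B_def image_mset_mset_set[OF inj, symmetric] image_mset.compositionality
    using finI by (intro image_mset_cong) (auto simp: d'th)
  then show ?thesis unfolding std_has_exponents_def using finB basis hom by blast
qed

text \<open>\<open>B\<close> is not assumed finite. Its independence makes elimination applicable:
  more than \<open>N\<close> fields with \<open>N\<close> components would satisfy a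
  relation.\<close>

lemma module_basis_lder_basis:
  fixes A :: "(nat \<Rightarrow> 'k::field_char_0) set set"
  assumes A: "\<forall>h\<in>A. hyperplane (std N) h" and B: "module_basis (poly_ring N) (log_derivations N A) B"
  shows "lder_basis (std N) A B vfield"
proof -
  have BM: "B \<subseteq> log_derivations N A" and ex1: "\<And>\<theta>. \<theta> \<in> log_derivations N A \<Longrightarrow>
      \<exists>!c. (\<forall>b. c b \<in> poly_ring N) \<and> finite {b. c b \<noteq> 0} \<and> {b. c b \<noteq> 0} \<subseteq> B \<and> \<theta> = (\<Sum>b | c b \<noteq> 0. fscale (c b) b)"
    using B by (auto simp: module_basis_def)
  have bd: "b \<in> derivations N" if "b \<in> B" for b using BM that by (auto simp: log_derivations_def)
  have bl: "vfield b \<in> lder (std N) A" if "b \<in> B" for b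
    using BM that log_derivations_iff[OF bd[OF that] A] by blast
  have sstd: "subsp (std N :: (nat \<Rightarrow> 'k) set)" by (auto simp: fun_space.subspace_def coord_space_def)
  have zd: "(0 :: nat \<Rightarrow> 'k mpoly) \<in> derivations N" by (simp add: derivations_def coord_space_def)
  have "(\<lambda>_. 0 :: nat \<Rightarrow> 'k) \<in> lder (std N) A"
    using A hyperplane_subsp[OF sstd] pmap_const[OF subsp_0[OF sstd]] by (auto simp: lder_def subsp_0)
  moreover have "vfield 0 = (\<lambda>_. 0 :: nat \<Rightarrow> 'k)" by (auto simp: vfield_def fun_eq_iff)
  ultimately have zM: "0 \<in> log_derivations N A" using log_derivations_iff[OF zd A] by simp
  \<comment> \<open>Independence is the uniqueness of the coefficients of the zero
    derivation.\<close>
  have indep: "c b x = 0"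
    if B': "B' \<subseteq> B" "finite B'" and c: "\<forall>b\<in>B'. c b \<in> pfun (std N)"
      and rel: "\<forall>x\<in>std N. (\<Sum>b\<in>B'. fscale (c b x) (vfield b x)) = 0" and b: "b \<in> B'" and x: "x \<in> std N"
    for B' c b x
  proof -
    have "\<exists>p\<in>poly_ring N. \<forall>x\<in>std N. c i x = meval p x" if "i \<in> B'" for i using pfun_meval c that by blast
    then obtain C where C: "\<And>i. i \<in> B' \<Longrightarrow> C i \<in> poly_ring N" "\<And>i x. i \<in> B' \<Longrightarrow> x \<in> std N \<Longrightarrow> c i x = meval (C i) x"
      by metis
    define cc where "cc b = (if b \<in> B' then C b else 0)" for b
    have supp: "{b. cc b \<noteq> 0} \<subseteq> B'" by (auto simp: cc_def)
    have ccS: "cc b \<in> poly_ring N" for b using C(1) by (simp add: cc_def)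
    have "(0 :: nat \<Rightarrow> 'k mpoly) = (\<Sum>b\<in>B'. fscale (cc b) b)"
    proof (rule vfield_inject[OF zd])
      show "(\<Sum>b\<in>B'. fscale (cc b) b) \<in> derivations N" by (rule derivations_sum[OF ccS bd]) (use B' in auto)
      show "\<forall>x\<in>std N. vfield 0 x = vfield (\<Sum>b\<in>B'. fscale (cc b) b) x"
      proof
        fix x :: "nat \<Rightarrow> 'k" assume x: "x \<in> std N"
        have "(\<Sum>b\<in>B'. fscale (meval (cc b) x) (vfield b x)) = (\<Sum>b\<in>B'. fscale (c b x) (vfield b x))"
          using C(2) x by (intro sum.cong) (auto simp: cc_def)
        then show "vfield 0 x = vfield (\<Sum>b\<in>B'. fscale (cc b) b) x"
          using rel x by (simp add: vfield_sum) (simp add: vfield_def fun_eq_iff)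
      qed
    qed
    then have "0 = (\<Sum>b | cc b \<noteq> 0. fscale (cc b) b)" using sum_support[OF B'(2) supp, of "\<lambda>b. b"] by simp
    moreover have "finite {b. cc b \<noteq> 0}" using supp B'(2) finite_subset by blast
    ultimately have "cc = (\<lambda>_. 0)"
      using supp B'(1) ccS by (intro ex1_unique[OF ex1[OF zM]]) auto
    then have "C b = 0" using b by (metis cc_def)
    then show ?thesis using C(2)[OF b x] by simp
  qed
  have small: "card B' \<le> N" if B': "B' \<subseteq> B" "finite B'" for B'
  proof (rule ccontr)
    assume "\<not> card B' \<le> N"
    then have lt: "card {..<N} < card B'" by simp
    have "\<exists>c. (\<forall>b\<in>B'. c b \<in> pfun (std N)) \<and> (\<exists>b\<in>B'. \<exists>y\<in>std N. c b y \<noteq> 0) \<and>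
        (\<forall>j\<in>{..<N}. \<forall>y\<in>std N. (\<Sum>b\<in>B'. c b y * meval (b j) y) = 0)"
      by (rule pfun_elimination[OF sstd _ B'(2) lt]) (auto intro: meval_pfun)
    then obtain c where c: "\<forall>b\<in>B'. c b \<in> pfun (std N)" "\<exists>b\<in>B'. \<exists>y\<in>std N. c b y \<noteq> 0"
      "\<forall>j\<in>{..<N}. \<forall>y\<in>std N. (\<Sum>b\<in>B'. c b y * meval (b j) y) = 0" by blast
    have "\<forall>x\<in>std N. (\<Sum>b\<in>B'. fscale (c b x) (vfield b x)) = 0"
    proof (intro ballI ext)
      fix x :: "nat \<Rightarrow> 'k" and j assume x: "x \<in> std N"
      show "(\<Sum>b\<in>B'. fscale (c b x) (vfield b x)) j = 0 j"
      proof (cases "j < N")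
        case True
        then show ?thesis using c(3) x by (simp add: sum_fun_apply vfield_def)
      next
        case False
        have "c b x * meval (b j) x = 0" if "b \<in> B'" for b
        proof -
          have "b j = 0" using bd[of b] B'(1) that False by (auto simp: derivations_def coord_space_def)
          then show ?thesis by simp
        qed
        then have "(\<Sum>b\<in>B'. c b x * meval (b j) x) = 0" by (intro sum.neutral ballI)
        then show ?thesis by (simp add: sum_fun_apply vfield_def)
      qed
    qed
    from indep[OF B' c(1) this] c(2) show False by blast
  qed
  have finB: "finite B"
  proof (rule ccontr)
    assume "infinite B"
    then obtain B' where B': "finite B'" "card B' = Suc N" "B' \<subseteq> B" using infinite_arbitrarily_large by blast
    from small[OF B'(3,1)] B'(2) show False by simp
  qed
  show ?thesis
    unfolding lder_basis_def
  proof (intro conjI ballI allI impI)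
    show "finite B" by (rule finB)
    show "vfield b \<in> lder (std N) A" if "b \<in> B" for b by (rule bl[OF that])
    show "c b y = 0" if "\<forall>i\<in>B. c i \<in> pfun (std N)" "\<forall>y\<in>std N. (\<Sum>i\<in>B. fscale (c i y) (vfield i y)) = 0" "b \<in> B" "y \<in> std N"
      for c b y using indep[OF order_refl finB that] .
    fix \<eta> assume \<eta>: "\<eta> \<in> lder (std N) A"
    obtain \<theta> where \<theta>: "\<theta> \<in> log_derivations N A" "\<forall>x\<in>std N. vfield \<theta> x = \<eta> x" using lder_std_lift[OF A \<eta>] by blast
    obtain c where c: "\<forall>b. c b \<in> poly_ring N" "{b. c b \<noteq> 0} \<subseteq> B" "\<theta> = (\<Sum>b | c b \<noteq> 0. fscale (c b) b)"
      using ex1[OF \<theta>(1)] by blast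
    have "\<theta> = (\<Sum>b\<in>B. fscale (c b) b)" using c(3) sum_support[OF finB c(2), of "\<lambda>b. b"] by simp
    then have "vfield \<theta> x = (\<Sum>b\<in>B. fscale (meval (c b) x) (vfield b x))" for x by (simp add: vfield_sum)
    then have "\<forall>x\<in>std N. \<eta> x = (\<Sum>b\<in>B. fscale (meval (c b) x) (vfield b x))" using \<theta>(2) by simp
    then show "\<exists>c. (\<forall>i\<in>B. c i \<in> pfun (std N)) \<and> (\<forall>y\<in>std N. \<eta> y = (\<Sum>i\<in>B. fscale (c i y) (vfield i y)))"
      by (intro exI[of _ "\<lambda>b. meval (c b)"]) (auto intro: meval_pfun)
  qed
qed

text \<open>This direction serves to refute freeness; the basis obtained need not be
  homogeneous.\<close>

lemma free_arrangement_lder_basis: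
  fixes Y :: "('i \<Rightarrow> 'k::field_char_0) set"
  assumes Y: "subsp Y" and A: "\<forall>h\<in>A. hyperplane Y h" and "free_arrangement Y A"
  shows "\<exists>(I :: (nat \<Rightarrow> 'k mpoly) set) \<theta>. lder_basis Y A I \<theta>"
proof -
  obtain N f where c: "coordinates Y N f" and fr: "std_free N ((`) f ` A)"
    using assms(3) by (auto simp: free_arrangement_def)
  obtain g where iso: "lin_iso Y (std N) f g" using coordinates_iso[OF Y c] .
  have sub: "\<forall>h\<in>A. h \<subseteq> Y" using A hyperplane_subset by blast
  have A': "\<forall>h\<in>(`) f ` A. hyperplane (std N) h" using A lin_iso_hyperplane[OF iso] by blast
  then have sub': "\<forall>h\<in>(`) f ` A. h \<subseteq> std N" using hyperplane_subset by blast
  obtain B where "module_basis (poly_ring N) (log_derivations N ((`) f ` A)) B" using fr by (auto simp: std_free_def)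
  then have "lder_basis (std N) ((`) f ` A) B vfield" by (rule module_basis_lder_basis[OF A'])
  from lder_basis_transport[OF lin_iso_sym[OF iso] sub' this] show ?thesis
    unfolding lin_iso_image_image[OF iso sub] by blast
qed

lemma lder_basis_has_exponents:
  fixes Y :: "('i \<Rightarrow> 'k::field_char_0) set"
  assumes Y: "fin_coords Y" and A: "\<forall>h\<in>A. hyperplane Y h" and bas: "lder_basis Y A I \<theta>"
    and d: "\<forall>i\<in>I. homog Y (d i) (\<theta> i)"
  shows "has_exponents Y A (image_mset d (mset_set I))"
proof -
  obtain N f where sY: "subsp Y" and c: "coordinates Y N f" using Y by (auto simp: fin_coords_def)
  obtain g where iso: "lin_iso Y (std N) f g" using coordinates_iso[OF sY c] .
  note i = lin_isoD[OF iso]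
  have sub: "\<forall>h\<in>A. h \<subseteq> Y" using A hyperplane_subset by blast
  have A': "\<forall>h\<in>(`) f ` A. hyperplane (std N) h" using A lin_iso_hyperplane[OF iso] by blast
  have "\<forall>j\<in>I. homog (std N) (d j) (\<lambda>x. f (\<theta> j (g x)))"
    using d i(5) by (simp add: homog_def linear_map_scale[OF i(1)] linear_map_scale[OF i(2)])
  from lder_basis_std_exponents[OF A' lder_basis_transport[OF iso sub bas] this] c
  show ?thesis unfolding has_exponents_def by blast
qed

lemma has_exponents_free: "has_exponents Y A e \<Longrightarrow> free_arrangement Y A"
  unfolding has_exponents_def free_arrangement_def std_has_exponents_def std_free_def by blast

section \<open>Inductively free arrangements with known exponents\<close>

text \<open>Index sets are taken in \<open>nat\<close> because a definition cannot quantify over the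
  type of indices.\<close>

definition lder_exponents :: "('i \<Rightarrow> 'k::field) set \<Rightarrow> ('i \<Rightarrow> 'k) set set \<Rightarrow> nat multiset \<Rightarrow> bool" where
  "lder_exponents Y A e \<longleftrightarrow> (\<exists>(I :: nat set) \<theta> d. lder_basis Y A I \<theta> \<and> (\<forall>i\<in>I. homog Y (d i) (\<theta> i)) \<and>
     e = image_mset d (mset_set I))"

text \<open>The cardinality condition, which holds for every free arrangement by Saito's criterion, is
  carried along so that the criterion itself is never needed.\<close>

definition good :: "('i \<Rightarrow> 'k::field) set \<Rightarrow> ('i \<Rightarrow> 'k) set set \<Rightarrow> nat multiset \<Rightarrow> bool" where
  "good Y A e \<longleftrightarrow> fin_coords Y \<and> finite A \<and> (\<forall>h\<in>A. hyperplane Y h) \<and> lder_exponents Y A e \<and> card A = \<Sum>\<^sub># e"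

definition ind_exps :: "('i \<Rightarrow> 'k::field) set \<Rightarrow> ('i \<Rightarrow> 'k) set set \<Rightarrow> nat multiset \<Rightarrow> bool" where
  "ind_exps Y A e \<longleftrightarrow> inductively_free Y A \<and> good Y A e"

lemma good_has_exponents:
  fixes Y :: "('i \<Rightarrow> 'k::field_char_0) set"
  shows "good Y A e \<Longrightarrow> has_exponents Y A e"
  using lder_basis_has_exponents unfolding good_def lder_exponents_def by blast

text \<open>The cardinalities stored in \<open>good\<close> supply the numerical hypothesis of
  \<open>addition\<close>, and they persist: one hyperplane more, one exponent larger by
  one.\<close>

lemma good_add:
  fixes Y :: "('i \<Rightarrow> 'k::field_char_0) set"
  assumes HA: "H \<in> A" and H: "hyperplane Y H"
    and g1: "good Y (A - {H}) (add_mset \<delta> e)" and g2: "good H (restriction A H) e"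
  shows "good Y A (add_mset (Suc \<delta>) e)"
proof -
  have Y: "fin_coords Y" and fin: "finite A" and A: "\<forall>h\<in>A. hyperplane Y h"
    using g1 H by (auto simp: good_def)
  obtain I :: "nat set" and \<theta> d where 1: "lder_basis Y (A - {H}) I \<theta>" "\<forall>i\<in>I. homog Y (d i) (\<theta> i)"
    "add_mset \<delta> e = image_mset d (mset_set I)" using g1 by (auto simp: good_def lder_exponents_def)
  obtain J :: "nat set" and \<eta> d2 where 2: "lder_basis H (restriction A H) J \<eta>" "\<forall>i\<in>J. homog H (d2 i) (\<eta> i)"
    "e = image_mset d2 (mset_set J)" using g2 by (auto simp: good_def lder_exponents_def)
  have m: "image_mset d (mset_set I) = add_mset \<delta> (image_mset d2 (mset_set J))" using 1(3) 2(3) by simp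
  have c: "card (A - {H}) = card (restriction A H) + \<delta>" using g1 g2 by (simp add: good_def)
  from addition[OF Y fin HA A 1(1,2) 2(1,2) m c] obtain k \<theta>' where k: "k \<in> I" "d k = \<delta>"
    and b: "lder_basis Y A I \<theta>'" "\<forall>i\<in>I. homog Y ((d(k := Suc \<delta>)) i) (\<theta>' i)" by blast
  have finI: "finite I" using b(1) by (simp add: lder_basis_def)
  have "mset_set I = add_mset k (mset_set (I - {k}))" using k(1) finI by (simp add: mset_set.remove)
  then have s: "image_mset d' (mset_set I) = add_mset (d' k) (image_mset d' (mset_set (I - {k})))" for d' :: "nat \<Rightarrow> nat"
    by simp
  have "image_mset (d(k := Suc \<delta>)) (mset_set (I - {k})) = image_mset d (mset_set (I - {k}))"
    using finI by (intro image_mset_cong) auto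
  moreover have "image_mset d (mset_set (I - {k})) = e" using s[of d] 1(3) k(2) by simp
  ultimately have "image_mset (d(k := Suc \<delta>)) (mset_set I) = add_mset (Suc \<delta>) e" using s[of "d(k := Suc \<delta>)"] by simp
  then have "lder_exponents Y A (add_mset (Suc \<delta>) e)" unfolding lder_exponents_def using b by metis
  moreover have "card A = \<Sum>\<^sub># (add_mset (Suc \<delta>) e)"
    using g1 fin HA card_Suc_Diff1[OF fin HA] by (simp add: good_def)
  ultimately show ?thesis using Y fin A by (simp add: good_def)
qed

lemma fin_coords_span:
  assumes "fin_coords Y" shows "\<exists>B. finite B \<and> Y = fun_space.span B"
proof -
  obtain N f where sY: "subsp Y" and c: "coordinates Y N f" using assms by (auto simp: fin_coords_def)
  obtain b where b: "\<forall>k<N. b k \<in> Y" "\<forall>y\<in>Y. y = (\<Sum>k<N. fscale (f y k) (b k))"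
    using coordinates_basis[OF sY c] by blast
  have "Y = fun_space.span (b ` {..<N})"
  proof
    show "Y \<subseteq> fun_space.span (b ` {..<N})"
    proof
      fix y assume "y \<in> Y"
      then have "y = (\<Sum>k<N. fscale (f y k) (b k))" using b(2) by blast
      also have "\<dots> \<in> fun_space.span (b ` {..<N})"
        by (intro fun_space.span_sum fun_space.span_scale fun_space.span_base) auto
      finally show "y \<in> fun_space.span (b ` {..<N})" .
    qed
    show "fun_space.span (b ` {..<N}) \<subseteq> Y"
      by (rule fun_space.span_minimal[OF _ sY]) (use b(1) in auto)
  qed
  then show ?thesis by blast
qed

lemma hyperplane_dim:
  assumes Y: "fin_coords Y" and H: "hyperplane Y H" shows "fun_space.dim Y = fun_space.dim H + 1"
proof -
  have sY: "subsp Y" using Y by (simp add: fin_coords_def)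
  obtain \<alpha> where \<alpha>: "is_form Y H \<alpha>" using H by (auto simp: hyperplane_def)
  obtain e where e: "e \<in> Y" "\<alpha> e = 1" "\<And>y. y \<in> Y \<Longrightarrow> y - fscale (\<alpha> y) e \<in> H"
    using is_form_proj[OF sY \<alpha>] by metis
  have sH: "subsp H" by (rule hyperplane_subsp[OF sY H])
  obtain B where B: "B \<subseteq> H" "fun_space.independent B" "H \<subseteq> fun_space.span B" "card B = fun_space.dim H"
    using fun_space.basis_exists by blast
  obtain C where C: "finite C" "Y = fun_space.span C" using fin_coords_span[OF Y] by blast
  have HY: "H \<subseteq> Y" by (rule hyperplane_subset[OF H])
  have finB: "finite B" using fun_space.independent_span_bound[OF C(1) B(2)] B(1) HY C(2) by auto
  have spanB: "fun_space.span B = H" using fun_space.span_minimal[OF B(1) sH] B(3) by blast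
  have eH: "e \<notin> H" using e(2) is_form_iff[OF \<alpha>] by auto
  have "fun_space.independent (insert e B)"
    using fun_space.independent_insertI[OF _ B(2), of e] eH spanB by simp
  moreover have "Y \<subseteq> fun_space.span (insert e B)"
  proof
    fix y assume y: "y \<in> Y"
    have "y - fscale (\<alpha> y) e \<in> fun_space.span (insert e B)"
      using e(3)[OF y] spanB fun_space.span_mono[of B "insert e B"] by blast
    moreover have "fscale (\<alpha> y) e \<in> fun_space.span (insert e B)"
      by (intro fun_space.span_scale fun_space.span_base) simp
    ultimately have "(y - fscale (\<alpha> y) e) + fscale (\<alpha> y) e \<in> fun_space.span (insert e B)"
      by (rule fun_space.span_add)
    then show "y \<in> fun_space.span (insert e B)" by simp
  qed
  moreover have "insert e B \<subseteq> Y" using e(1) B(1) HY by auto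
  moreover have "card (insert e B) = fun_space.dim H + 1" using finB eH B(1,4) by (subst card_insert_disjoint) auto
  ultimately show ?thesis by (intro fun_space.dim_unique[of "insert e B"])
qed

lemma central_arrangementI:
  assumes Y: "fin_coords Y" and "finite A" and A: "\<forall>h\<in>A. hyperplane Y h"
  shows "central_arrangement Y A"
proof -
  have sY: "subsp Y" using Y by (simp add: fin_coords_def)
  show ?thesis
    unfolding central_arrangement_def fin_dim_subspace_def
    using assms fin_coords_span[OF Y] hyperplane_dim[OF Y] hyperplane_subsp[OF sY] hyperplane_subset by blast
qed

lemma ind_exps_add:
  fixes Y :: "('i \<Rightarrow> 'k::field_char_0) set"
  assumes HA: "H \<in> A" and H: "hyperplane Y H"
    and g1: "ind_exps Y (A - {H}) (add_mset \<delta> e)" and g2: "ind_exps H (restriction A H) e"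
  shows "ind_exps Y A (add_mset (Suc \<delta>) e)"
proof -
  have g: "good Y A (add_mset (Suc \<delta>) e)" using good_add[OF HA H] g1 g2 by (simp add: ind_exps_def)
  have "central_arrangement Y A" using g by (intro central_arrangementI) (auto simp: good_def)
  then have "inductively_free Y A"
    using HA g1 g2 good_has_exponents by (intro inductively_free.add[of Y A H "add_mset \<delta> e" e]) (auto simp: ind_exps_def)
  then show ?thesis using g by (simp add: ind_exps_def)
qed

lemma ind_exps_empty:
  fixes Y :: "('i \<Rightarrow> 'k::field_char_0) set"
  assumes sY: "subsp Y" and c: "coordinates Y N f"
  shows "ind_exps Y {} (replicate_mset N 0)"
proof -
  obtain b where b: "\<forall>k<N. b k \<in> Y" "\<forall>y\<in>Y. y = (\<Sum>k<N. fscale (f y k) (b k))"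
    "\<forall>x\<in>std N. f (\<Sum>k<N. fscale (x k) (b k)) = x"
    using coordinates_basis[OF sY c] by blast
  have f: "linear_map f" using c by (simp add: coordinates_def)
  have Y: "fin_coords Y" using sY c by (auto simp: fin_coords_def)
  have "lder_basis Y {} {..<N} (\<lambda>k _. b k)"
    unfolding lder_basis_def
  proof (intro conjI ballI allI impI)
    show "(\<lambda>_. b k) \<in> lder Y {}" if "k \<in> {..<N}" for k using pmap_const b(1) that by (auto simp: lder_def)
    fix \<eta> assume \<eta>: "\<eta> \<in> lder Y {}"
    have "\<forall>k\<in>{..<N}. (\<lambda>y. f (\<eta> y) k) \<in> pfun Y"
      using pmap_pfun[OF lder_pmap[OF \<eta>] linear_fun_component[OF f]] by blast
    moreover have "\<forall>y\<in>Y. \<eta> y = (\<Sum>k<N. fscale (f (\<eta> y) k) (b k))"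
      using b(2) pmapD[OF lder_pmap[OF \<eta>]] by blast
    ultimately show "\<exists>c. (\<forall>i\<in>{..<N}. c i \<in> pfun Y) \<and> (\<forall>y\<in>Y. \<eta> y = (\<Sum>i<N. fscale (c i y) (b i)))"
      by (intro exI[of _ "\<lambda>k y. f (\<eta> y) k"] conjI)
  next
    fix c k y assume rel: "\<forall>y\<in>Y. (\<Sum>i<N. fscale (c i y) (b i)) = 0" and k: "k \<in> {..<N}" and y: "y \<in> Y"
    define x where "x i = (if i < N then c i y else 0)" for i
    have "x \<in> std N" by (auto simp: x_def coord_space_def)
    then have "f (\<Sum>i<N. fscale (x i) (b i)) = x" using b(3) by blast
    moreover have "(\<Sum>i<N. fscale (x i) (b i)) = (\<Sum>i<N. fscale (c i y) (b i))"
      by (rule sum.cong) (auto simp: x_def)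
    ultimately have "x = 0" using rel y linear_map_0[OF f] by simp
    then show "c k y = 0" using k by (auto simp: x_def fun_eq_iff split: if_splits)
  qed simp
  moreover have "\<forall>k\<in>{..<N}. homog Y 0 (\<lambda>_. b k)" by (auto simp: homog_def)
  moreover have "replicate_mset N 0 = image_mset (\<lambda>_. 0) (mset_set {..<N})" by (simp add: image_mset_const_eq)
  ultimately have "lder_exponents Y {} (replicate_mset N 0)"
    unfolding lder_exponents_def by (intro exI[of _ "{..<N}"] exI[of _ "\<lambda>k _. b k"] exI[of _ "\<lambda>_. 0"] conjI)
  then have "good Y {} (replicate_mset N 0)" using Y by (simp add: good_def)
  moreover have "inductively_free Y {}"
    by (rule inductively_free.empty) (use fin_coords_span[OF Y] in \<open>simp add: fin_dim_subspace_def\<close>)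
  ultimately show ?thesis by (simp add: ind_exps_def)
qed

lemma ind_exps_free:
  fixes Y :: "('i \<Rightarrow> 'k::field_char_0) set"
  shows "ind_exps Y A e \<Longrightarrow> free_arrangement Y A"
  unfolding ind_exps_def using good_has_exponents has_exponents_free by blast

section \<open>Deformations of the braid arrangement in coordinates\<close>

text \<open>\<open>f\<close> identifies \<open>Y\<close> with the space of coordinates
  \<open>x_w\<close> at \<open>Some w\<close> and, for \<open>T = {None}\<close>, of
  \<open>z\<close>. The case \<open>T = {}\<close> arises for flats inside \<open>z = 0\<close>;
  there \<open>f y None = 0\<close>, and \<open>hp\<close> is the same for all constants
  \<open>c\<close>.\<close>

definition rep :: "('i \<Rightarrow> 'k::field) set \<Rightarrow> (('i \<Rightarrow> 'k) \<Rightarrow> ('a option \<Rightarrow> 'k)) \<Rightarrow> 'a option set \<Rightarrow> 'a set \<Rightarrow> bool" where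
  "rep Y f T W \<longleftrightarrow> subsp Y \<and> linear_map f \<and> finite W \<and> T \<subseteq> {None} \<and> bij_betw f Y (coord_space (T \<union> Some ` W))"

definition hz :: "('i \<Rightarrow> 'k::field) set \<Rightarrow> (('i \<Rightarrow> 'k) \<Rightarrow> ('a option \<Rightarrow> 'k)) \<Rightarrow> ('i \<Rightarrow> 'k) set" where
  "hz Y f = {y\<in>Y. f y None = 0}"

definition hp :: "('i \<Rightarrow> 'k::field) set \<Rightarrow> (('i \<Rightarrow> 'k) \<Rightarrow> ('a option \<Rightarrow> 'k)) \<Rightarrow> 'a \<times> 'a \<times> int \<Rightarrow> ('i \<Rightarrow> 'k) set" where
  "hp Y f = (\<lambda>(u, v, c). {y\<in>Y. f y (Some u) - f y (Some v) = of_int c * f y None})"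

definition arr :: "('i \<Rightarrow> 'k::field) set \<Rightarrow> (('i \<Rightarrow> 'k) \<Rightarrow> ('a option \<Rightarrow> 'k)) \<Rightarrow> 'a option set \<Rightarrow> ('a \<times> 'a \<times> int) set \<Rightarrow> ('i \<Rightarrow> 'k) set set" where
  "arr Y f T P = (if None \<in> T then {hz Y f} else {}) \<union> hp Y f ` P"

definition dpairs :: "'a set \<Rightarrow> ('a \<times> 'a \<times> int) set" where
  "dpairs W = {(u, v, c). u \<in> W \<and> v \<in> W \<and> u \<noteq> v}"

text \<open>The bound \<open>L u v\<close> is the paper's \<open>n\<^sub>u + \<epsilon>\<^sub>G(u, v)\<close>.\<close>

definition pairs :: "'a set \<Rightarrow> ('a \<Rightarrow> 'a \<Rightarrow> int) \<Rightarrow> ('a \<times> 'a \<times> int) set" where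
  "pairs W L = {(u, v, c). u \<in> W \<and> v \<in> W \<and> u \<noteq> v \<and> - L u v \<le> c \<and> c \<le> L v u}"

lemma pairs_dpairs: "pairs W L \<subseteq> dpairs W"
  by (auto simp: pairs_def dpairs_def)

lemma pairs_cong: "(\<And>u v. u \<in> W \<Longrightarrow> v \<in> W \<Longrightarrow> u \<noteq> v \<Longrightarrow> L u v = L' u v) \<Longrightarrow> pairs W L = pairs W L'"
  by (auto simp: pairs_def)

lemma repD:
  assumes "rep Y f T W"
  shows "subsp Y" "linear_map f" "finite W" "T \<subseteq> {None}" "bij_betw f Y (coord_space (T \<union> Some ` W))"
  using assms by (auto simp: rep_def)

lemma rep_vec:
  assumes "rep Y f T W" "x \<in> coord_space (T \<union> Some ` W)" obtains y where "y \<in> Y" "f y = x"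
proof -
  have "x \<in> f ` Y" using assms by (simp add: rep_def bij_betw_def)
  then show ?thesis using that by blast
qed

lemma rep_coord: "rep Y f T W \<Longrightarrow> y \<in> Y \<Longrightarrow> f y \<in> coord_space (T \<union> Some ` W)"
  by (auto simp: rep_def bij_betw_def)

lemma rep_None: "rep Y f T W \<Longrightarrow> None \<notin> T \<Longrightarrow> y \<in> Y \<Longrightarrow> f y None = 0"
  using rep_coord[of Y f T W y] by (auto simp: coord_space_def)

lemma rep_coordinates:
  fixes Y :: "('i \<Rightarrow> 'k::field) set"
  assumes r: "rep Y f T W" shows "\<exists>F. coordinates Y (card (T \<union> Some ` W)) F"
proof -
  define S where "S = T \<union> Some ` W"
  have finS: "finite S" using repD(3,4)[OF r] finite_subset[of T "{None}"] by (auto simp: S_def)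
  then obtain h where h: "bij_betw h {..<card S} S" using ex_bij_betw_nat_finite by (metis atLeast0LessThan)
  define F where "F y k = (if k < card S then f y (h k) else 0)" for y k
  have lin: "linear_map F"
    using repD(2)[OF r] by (auto simp: linear_map_iff F_def fun_eq_iff)
  have "bij_betw F Y (std (card S))"
    unfolding bij_betw_def
  proof (intro conjI inj_onI set_eqI iffI)
    fix y y' assume y: "y \<in> Y" "y' \<in> Y" and eq: "F y = F y'"
    have "f y = f y'"
    proof
      fix i show "f y i = f y' i"
      proof (cases "i \<in> S")
        case True
        then have "i \<in> h ` {..<card S}" using h by (simp add: bij_betw_def)
        then obtain k where "k < card S" "h k = i" by blast
        then show ?thesis using fun_cong[OF eq, of k] by (simp add: F_def)
      next
        case False
        then show ?thesis using rep_coord[OF r] y by (auto simp: coord_space_def S_def)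
      qed
    qed
    then show "y = y'" using repD(5)[OF r] y by (auto simp: bij_betw_def inj_on_def)
  next
    fix x assume "x \<in> F ` Y" then show "x \<in> std (card S)" by (auto simp: F_def coord_space_def)
  next
    fix x :: "nat \<Rightarrow> 'k" assume x: "x \<in> std (card S)"
    define x' where "x' i = (if i \<in> S then x (inv_into {..<card S} h i) else 0)" for i
    have "x' \<in> coord_space (T \<union> Some ` W)" by (auto simp: x'_def coord_space_def S_def)
    then obtain y where y: "y \<in> Y" "f y = x'" by (rule rep_vec[OF r])
    have "F y = x"
    proof
      fix k show "F y k = x k"
      proof (cases "k < card S")
        case True
        then have "h k \<in> S" "inv_into {..<card S} h (h k) = k" using h by (auto simp: bij_betw_def)
        then show ?thesis using True y(2) by (simp add: F_def x'_def)
      next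
        case False
        then show ?thesis using x by (simp add: F_def coord_space_def)
      qed
    qed
    then show "x \<in> F ` Y" using y(1) by blast
  qed
  then show ?thesis using lin by (auto simp: coordinates_def S_def)
qed

lemma hz_form:
  fixes Y :: "('i \<Rightarrow> 'k::field) set" and W :: "'a set"
  assumes r: "rep Y f T W" and T: "None \<in> T" shows "is_form Y (hz Y f) (\<lambda>y. f y None)"
proof -
  define x :: "'a option \<Rightarrow> 'k" where "x i = (if i = None then 1 else 0)" for i
  have "x \<in> coord_space (T \<union> Some ` W)" using T by (auto simp: x_def coord_space_def)
  then obtain y where "y \<in> Y" "f y = x" by (rule rep_vec[OF r])
  then have "\<exists>e\<in>Y. f e None \<noteq> 0" by (intro bexI[of _ y]) (simp_all add: x_def)
  then show ?thesis using linear_fun_component[OF repD(2)[OF r]] by (auto simp: is_form_def hz_def)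
qed

lemma hp_form:
  fixes Y :: "('i \<Rightarrow> 'k::field) set" and W :: "'a set"
  assumes r: "rep Y f T W" and uv: "u \<in> W" "u \<noteq> v"
  shows "is_form Y (hp Y f (u, v, c)) (\<lambda>y. f y (Some u) - f y (Some v) - of_int c * f y None)"
proof -
  define x :: "'a option \<Rightarrow> 'k" where "x i = (if i = Some u then 1 else 0)" for i
  have "x \<in> coord_space (T \<union> Some ` W)" using uv by (auto simp: x_def coord_space_def)
  then obtain y where "y \<in> Y" "f y = x" by (rule rep_vec[OF r])
  then have "\<exists>e\<in>Y. f e (Some u) - f e (Some v) - of_int c * f e None \<noteq> 0"
    using uv by (intro bexI[of _ y]) (simp_all add: x_def)
  moreover have "linear_fun (\<lambda>y. f y (Some u) - f y (Some v) - of_int c * f y None)"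
    using repD(2)[OF r] by (auto simp: linear_fun_def linear_map_iff algebra_simps)
  ultimately show ?thesis by (auto simp: is_form_def hp_def)
qed

lemma arr_hyperplanes:
  assumes r: "rep Y f T W" and P: "P \<subseteq> dpairs W" shows "\<forall>h\<in>arr Y f T P. hyperplane Y h"
proof
  fix h assume "h \<in> arr Y f T P"
  then consider "None \<in> T" "h = hz Y f" | u v c where "(u, v, c) \<in> P" "h = hp Y f (u, v, c)"
    by (auto simp: arr_def split: if_splits)
  then show "hyperplane Y h"
  proof cases
    case 1
    then show ?thesis using is_form_hyperplane[OF hz_form[OF r]] by blast
  next
    case 2
    then have "u \<in> W" "u \<noteq> v" using P by (auto simp: dpairs_def)
    then show ?thesis using is_form_hyperplane[OF hp_form[OF r]] 2(2) by blast
  qed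
qed

lemma hp_sym:
  fixes Y :: "('i \<Rightarrow> 'k::field) set"
  shows "hp Y f (u, v, c) = hp Y f (v, u, - c)"
proof -
  have "a - b = c' \<longleftrightarrow> b - a = - c'" for a b c' :: 'k by (metis minus_diff_eq minus_minus)
  then show ?thesis by (auto simp: hp_def)
qed

text \<open>Unit vectors detect which two coordinates occur in the equation; a vector with
  \<open>z = 1\<close> on the first hyperplane then compares the constants, which is possible only
  if \<open>None \<in> T\<close>.\<close>

lemma hp_eqD:
  fixes Y :: "('i \<Rightarrow> 'k::field_char_0) set" and W :: "'a set"
  assumes r: "rep Y f T W" and uv: "u \<in> W" "v \<in> W" "u \<noteq> v" and xy: "x \<in> W" "y \<in> W" "x \<noteq> y"
    and eq: "hp Y f (u, v, c) = hp Y f (x, y, d)"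
  shows "(x = u \<and> y = v \<and> (None \<in> T \<longrightarrow> d = c)) \<or> (x = v \<and> y = u \<and> (None \<in> T \<longrightarrow> d = - c))"
proof -
  have mem: "s (Some u) - s (Some v) = of_int c * s None \<longleftrightarrow> s (Some x) - s (Some y) = of_int d * s None"
    if s: "s \<in> coord_space (T \<union> Some ` W)" for s :: "'a option \<Rightarrow> 'k"
  proof -
    obtain z where "z \<in> Y" "f z = s" by (rule rep_vec[OF r s])
    then show ?thesis using eq by (auto simp: hp_def set_eq_iff)
  qed
  define e :: "'a \<Rightarrow> 'a option \<Rightarrow> 'k" where "e w i = (if i = Some w then 1 else 0)" for w i
  have e: "e w \<in> coord_space (T \<union> Some ` W)" if "w \<in> W" for w using that by (auto simp: e_def coord_space_def)
  have "x \<in> {u, v}" using mem[OF e[OF xy(1)]] xy uv by (auto simp: e_def split: if_splits)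
  moreover have "y \<in> {u, v}" using mem[OF e[OF xy(2)]] xy uv by (auto simp: e_def split: if_splits)
  moreover have "(x = u \<longrightarrow> d = c) \<and> (x = v \<longrightarrow> d = - c)" if T: "None \<in> T"
  proof -
    define s :: "'a option \<Rightarrow> 'k" where "s i = (if i = None then 1 else if i = Some u then of_int c else 0)" for i
    have "s \<in> coord_space (T \<union> Some ` W)" using T uv by (auto simp: s_def coord_space_def)
    from mem[OF this] have "of_int d = s (Some x) - s (Some y)" using uv by (auto simp: s_def)
    then have "of_int d = (of_int (if x = u then c else - c) :: 'k)"
      using calculation xy uv by (auto simp: s_def)
    then show ?thesis using uv by (auto simp: of_int_eq_iff simp del: of_int_minus)
  qed
  ultimately show ?thesis using xy by blast
qed

lemma hz_neq_hp:
  fixes Y :: "('i \<Rightarrow> 'k::field_char_0) set" and W :: "'a set"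
  assumes r: "rep Y f T W" and uv: "u \<in> W" "u \<noteq> v" shows "hz Y f \<noteq> hp Y f (u, v, c)"
proof
  assume eq: "hz Y f = hp Y f (u, v, c)"
  define x :: "'a option \<Rightarrow> 'k" where "x i = (if i = Some u then 1 else 0)" for i
  have "x \<in> coord_space (T \<union> Some ` W)" using uv by (auto simp: x_def coord_space_def)
  then obtain y where y: "y \<in> Y" "f y = x" by (rule rep_vec[OF r])
  then have "y \<in> hz Y f" by (simp add: hz_def x_def)
  moreover have "y \<notin> hp Y f (u, v, c)" using y uv by (simp add: hp_def x_def)
  ultimately show False using eq by simp
qed

text \<open>The equation \<open>x_u = x_v + c z\<close> determines coordinate \<open>u\<close>, so
  it is discarded by setting it to 0.\<close>

lemma rep_hp:
  fixes Y :: "('i \<Rightarrow> 'k::field) set" and W :: "'a set"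
  assumes r: "rep Y f T W" and uv: "u \<in> W" "v \<in> W" "u \<noteq> v"
  shows "rep (hp Y f (u, v, c)) (\<lambda>y. (f y)(Some u := 0)) T (W - {u})"
proof -
  let ?H = "hp Y f (u, v, c)"
  have HY: "?H \<subseteq> Y" by (auto simp: hp_def)
  have fu: "f y (Some u) = f y (Some v) + of_int c * f y None" if "y \<in> ?H" for y
    using that by (simp add: hp_def algebra_simps)
  have "bij_betw (\<lambda>y. (f y)(Some u := 0)) ?H (coord_space (T \<union> Some ` (W - {u})))"
    unfolding bij_betw_def
  proof (intro conjI inj_onI set_eqI iffI)
    fix y y' assume y: "y \<in> ?H" "y' \<in> ?H" and eq: "(f y)(Some u := 0) = (f y')(Some u := 0)"
    have ne: "f y i = f y' i" if "i \<noteq> Some u" for i using fun_cong[OF eq, of i] that by simp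
    have "f y i = f y' i" for i
    proof (cases "i = Some u")
      case True
      then show ?thesis using fu[OF y(1)] fu[OF y(2)] ne[of "Some v"] ne[of None] uv(3) by simp
    qed (rule ne)
    then have "f y = f y'" by blast
    then show "y = y'" using repD(5)[OF r] y HY by (auto simp: bij_betw_def inj_on_def)
  next
    fix x assume "x \<in> (\<lambda>y. (f y)(Some u := 0)) ` ?H"
    then obtain y where y: "y \<in> ?H" "x = (f y)(Some u := 0)" by blast
    have "f y \<in> coord_space (T \<union> Some ` W)" using rep_coord[OF r] y(1) HY by blast
    then show "x \<in> coord_space (T \<union> Some ` (W - {u}))" by (auto simp: y(2) coord_space_def)
  next
    fix x :: "'a option \<Rightarrow> 'k" assume x: "x \<in> coord_space (T \<union> Some ` (W - {u}))"
    have "x(Some u := x (Some v) + of_int c * x None) \<in> coord_space (T \<union> Some ` W)"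
      using x uv(1) by (auto simp: coord_space_def)
    then obtain y where y: "y \<in> Y" "f y = x(Some u := x (Some v) + of_int c * x None)" by (rule rep_vec[OF r])
    have "y \<in> ?H" using y uv(3) by (simp add: hp_def)
    moreover have "Some u \<notin> T \<union> Some ` (W - {u})" using repD(4)[OF r] by auto
    then have "x (Some u) = 0" using x by (simp add: coord_space_def)
    then have "(f y)(Some u := 0) = x" unfolding y(2) by auto
    ultimately show "x \<in> (\<lambda>y. (f y)(Some u := 0)) ` ?H" by blast
  qed
  moreover have "linear_map (\<lambda>y. (f y)(Some u := 0))"
    using repD(2)[OF r] by (auto simp: linear_map_iff fun_eq_iff)
  moreover have "subsp ?H" by (rule hyperplane_subsp[OF repD(1)[OF r] is_form_hyperplane[OF hp_form[OF r uv(1,3)]]])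
  ultimately show ?thesis using repD(3,4)[OF r] by (simp add: rep_def)
qed

lemma rep_hz:
  assumes r: "rep Y f T W" and T: "None \<in> T"
  shows "rep (hz Y f) (\<lambda>y. (f y)(None := 0)) {} W"
proof -
  have HY: "hz Y f \<subseteq> Y" by (auto simp: hz_def)
  have f0: "(f y)(None := 0) = f y" if "y \<in> hz Y f" for y using that by (auto simp: hz_def fun_eq_iff)
  have "bij_betw f (hz Y f) (coord_space (Some ` W))"
    unfolding bij_betw_def
  proof (intro conjI set_eqI iffI)
    show "inj_on f (hz Y f)" using repD(5)[OF r] HY inj_on_subset by (auto simp: bij_betw_def)
    show "x \<in> coord_space (Some ` W)" if x: "x \<in> f ` hz Y f" for x
    proof -
      obtain y where y: "y \<in> hz Y f" "x = f y" using x by blast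
      have "x i = 0" if "i \<notin> Some ` W" for i
        using rep_coord[OF r] y HY that repD(4)[OF r] by (cases i) (auto simp: coord_space_def hz_def)
      then show ?thesis by (simp add: coord_space_def)
    qed
    show "x \<in> f ` hz Y f" if x: "x \<in> coord_space (Some ` W)" for x
    proof -
      have "x \<in> coord_space (T \<union> Some ` W)" using x by (auto simp: coord_space_def)
      then obtain y where y: "y \<in> Y" "f y = x" by (rule rep_vec[OF r])
      moreover have "x None = 0" using x by (auto simp: coord_space_def)
      ultimately show ?thesis by (auto simp: hz_def)
    qed
  qed
  then have "bij_betw (\<lambda>y. (f y)(None := 0)) (hz Y f) (coord_space (Some ` W))"
    using bij_betw_cong[of "hz Y f" "\<lambda>y. (f y)(None := 0)" f] f0 by blast
  moreover have "linear_map (\<lambda>y. (f y)(None := 0))"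
    using repD(2)[OF r] by (auto simp: linear_map_iff fun_eq_iff)
  moreover have "subsp (hz Y f)" by (rule hyperplane_subsp[OF repD(1)[OF r] is_form_hyperplane[OF hz_form[OF r T]]])
  ultimately show ?thesis using repD(3)[OF r] by (simp add: rep_def)
qed

text \<open>Substituting \<open>x_u = x_v + c z\<close> renames \<open>u\<close> to \<open>v\<close>
  and shifts the constants by \<open>s\<close>. Triples on the pair \<open>{u, v}\<close> are left
  out: they give \<open>H\<close> itself or, being parallel to \<open>H\<close>, cut it in the trace
  of \<open>z = 0\<close>, which is listed anyway.\<close>

lemma restriction_arr_hp:
  fixes Y :: "('i \<Rightarrow> 'k::field_char_0) set" and c :: int
  assumes r: "rep Y f T W" and uv: "u \<in> W" "v \<in> W" "u \<noteq> v" and P: "P \<subseteq> dpairs W"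
  defines "H \<equiv> hp Y f (u, v, c)" and "f' \<equiv> (\<lambda>y. (f y)(Some u := 0))"
    and "\<sigma> \<equiv> (\<lambda>k. if k = u then v else k)" and "s \<equiv> (\<lambda>k. if k = u then c else 0)"
  shows "restriction (arr Y f T P) H =
    arr H f' T {(\<sigma> k, \<sigma> l, d - s k + s l) | k l d. (k, l, d) \<in> P \<and> {k, l} \<noteq> {u, v}}"
proof -
  have sY: "subsp Y" by (rule repD(1)[OF r])
  have H: "hyperplane Y H" unfolding H_def by (rule is_form_hyperplane[OF hp_form[OF r uv(1,3)]])
  have HY: "H \<subseteq> Y" by (rule hyperplane_subset[OF H])
  have rH: "rep H f' T (W - {u})" unfolding H_def f'_def by (rule rep_hp[OF r uv])
  have hyp: "\<forall>h\<in>arr Y f T P. hyperplane Y h" by (rule arr_hyperplanes[OF r P])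
  have fk: "f y (Some k) = f' y (Some (\<sigma> k)) + of_int (s k) * f y None" if "y \<in> H" for y k
    using that uv(3) by (auto simp: H_def hp_def f'_def \<sigma>_def s_def algebra_simps)
  have fN: "f' y None = f y None" for y by (simp add: f'_def)
  have int1: "hp Y f (k, l, d) \<inter> H = hp H f' (\<sigma> k, \<sigma> l, d - s k + s l)" for k l d
  proof -
    have "f y (Some k) - f y (Some l) = of_int d * f y None \<longleftrightarrow>
        f' y (Some (\<sigma> k)) - f' y (Some (\<sigma> l)) = of_int (d - s k + s l) * f y None" if "y \<in> H" for y
      unfolding fk[OF that] by (simp add: algebra_simps)
    then show ?thesis using HY by (auto simp: hp_def fN)
  qed
  have int0: "hz Y f \<inter> H = hz H f'" using HY by (auto simp: hz_def fN)
  have R: "restriction (arr Y f T P) H = (\<lambda>h. h \<inter> H) ` (arr Y f T P - {H})"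
    by (rule restriction_hyperplanes[OF sY hyp H])
  have spec: "hp Y f (k, l, d) = H \<or> (None \<in> T \<and> hp Y f (k, l, d) \<inter> H = hz H f')"
    if t: "(k, l, d) \<in> P" and kl: "{k, l} = {u, v}" for k l d
  proof -
    have "\<sigma> k = \<sigma> l" using kl uv(3) by (auto simp: \<sigma>_def doubleton_eq_iff)
    then have eq: "hp Y f (k, l, d) \<inter> H = {y\<in>H. of_int (d - s k + s l) * f y None = 0}"
      unfolding int1 by (auto simp: hp_def fN simp del: of_int_add of_int_diff)
    have hk: "hyperplane Y (hp Y f (k, l, d))" using hyp t by (auto simp: arr_def)
    show ?thesis
    proof (cases "None \<in> T \<and> d - s k + s l \<noteq> 0")
      case True
      then have "(of_int (d - s k + s l) :: 'k) \<noteq> 0" by (simp only: of_int_eq_0_iff) simp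
      then have "hp Y f (k, l, d) \<inter> H = hz H f'" unfolding eq by (auto simp: hz_def fN)
      then show ?thesis using True by blast
    next
      case False
      have "(of_int (d - s k + s l) :: 'k) * f y None = 0" if "y \<in> H" for y
      proof (cases "None \<in> T")
        case True
        then have "d - s k + s l = 0" using False by blast
        then show ?thesis by (simp only: of_int_0 mult_zero_left)
      next
        case False
        then have "f y None = 0" using rep_None[OF r] HY that by blast
        then show ?thesis by simp
      qed
      then have "H \<subseteq> hp Y f (k, l, d) \<inter> H" unfolding eq by blast
      then have "H \<subseteq> hp Y f (k, l, d)" by blast
      then show ?thesis using hyperplane_subset_eq[OF sY H hk] by auto
    qed
  qed
  have neq: "hp Y f (k, l, d) \<noteq> H" if t: "(k, l, d) \<in> P" and kl: "{k, l} \<noteq> {u, v}" for k l d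
  proof
    assume eq: "hp Y f (k, l, d) = H"
    have "k \<in> W" "l \<in> W" "k \<noteq> l" using t P by (auto simp: dpairs_def)
    from hp_eqD[OF r uv this] eq kl show False by (auto simp: H_def)
  qed
  show ?thesis
  proof (intro set_eqI iffI)
    fix K assume "K \<in> restriction (arr Y f T P) H"
    then obtain h where h: "h \<in> arr Y f T P" "h \<noteq> H" "K = h \<inter> H" unfolding R by blast
    then consider "None \<in> T" "h = hz Y f" | k l d where "(k, l, d) \<in> P" "h = hp Y f (k, l, d)"
      by (auto simp: arr_def split: if_splits)
    then show "K \<in> arr H f' T {(\<sigma> k, \<sigma> l, d - s k + s l) | k l d. (k, l, d) \<in> P \<and> {k, l} \<noteq> {u, v}}"
    proof cases
      case 1
      then show ?thesis using h(3) int0 by (simp add: arr_def)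
    next
      case 2
      show ?thesis
      proof (cases "{k, l} = {u, v}")
        case True
        then show ?thesis using spec[OF 2(1) True] h 2 by (auto simp: arr_def)
      next
        case False
        have "K = hp H f' (\<sigma> k, \<sigma> l, d - s k + s l)" using h(3) 2(2) int1 by simp
        then show ?thesis unfolding arr_def using 2(1) False by blast
      qed
    qed
  next
    fix K assume "K \<in> arr H f' T {(\<sigma> k, \<sigma> l, d - s k + s l) | k l d. (k, l, d) \<in> P \<and> {k, l} \<noteq> {u, v}}"
    then consider "None \<in> T" "K = hz H f'" |
      k l d where "(k, l, d) \<in> P" "{k, l} \<noteq> {u, v}" "K = hp H f' (\<sigma> k, \<sigma> l, d - s k + s l)"
      by (auto simp: arr_def split: if_splits)
    then show "K \<in> restriction (arr Y f T P) H"
    proof cases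
      case 1
      have "hz Y f \<noteq> H" unfolding H_def by (rule hz_neq_hp[OF r uv(1,3)])
      then show ?thesis unfolding R using 1 int0 by (auto simp: arr_def intro!: image_eqI[of _ _ "hz Y f"])
    next
      case 2
      then show ?thesis unfolding R using neq[OF 2(1,2)] int1
        by (intro image_eqI[of _ _ "hp Y f (k, l, d)"]) (auto simp: arr_def)
    qed
  qed
qed

lemma restriction_arr_hz:
  fixes Y :: "('i \<Rightarrow> 'k::field_char_0) set"
  assumes r: "rep Y f T W" and T: "None \<in> T" and P: "P \<subseteq> dpairs W"
  shows "restriction (arr Y f T P) (hz Y f) =
    arr (hz Y f) (\<lambda>y. (f y)(None := 0)) {} {(k, l, 0) | k l. \<exists>d. (k, l, d) \<in> P}"
proof -
  let ?H = "hz Y f"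
  have sY: "subsp Y" by (rule repD(1)[OF r])
  have H: "hyperplane Y ?H" by (rule is_form_hyperplane[OF hz_form[OF r T]])
  have hyp: "\<forall>h\<in>arr Y f T P. hyperplane Y h" by (rule arr_hyperplanes[OF r P])
  have int: "hp Y f (k, l, d) \<inter> ?H = hp ?H (\<lambda>y. (f y)(None := 0)) (k, l, 0)" for k l d
    by (auto simp: hp_def hz_def)
  have "arr Y f T P - {?H} = hp Y f ` P"
    using T hz_neq_hp[OF r, THEN not_sym] P by (auto simp: arr_def dpairs_def)
  then have "restriction (arr Y f T P) ?H = (\<lambda>h. h \<inter> ?H) ` hp Y f ` P"
    unfolding restriction_hyperplanes[OF sY hyp H] by simp
  also have "\<dots> = (\<lambda>(k, l, d). hp ?H (\<lambda>y. (f y)(None := 0)) (k, l, 0)) ` P"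
    unfolding image_image
  proof (rule image_cong[OF refl])
    fix t assume "t \<in> P"
    obtain k l d where "t = (k, l, d)" by (cases t)
    then show "hp Y f t \<inter> ?H = (case t of (k, l, d) \<Rightarrow> hp ?H (\<lambda>y. (f y)(None := 0)) (k, l, 0))"
      by (simp only: int prod.case)
  qed
  also have "\<dots> = hp ?H (\<lambda>y. (f y)(None := 0)) ` {(k, l, 0) | k l. \<exists>d. (k, l, d) \<in> P}"
    by (force simp: image_iff)
  finally show ?thesis by (simp add: arr_def)
qed

text \<open>This makes merging possible: two ranges of integers that get united overlap or are
  adjacent, so the union is a range again.\<close>

definition tri :: "'a set \<Rightarrow> ('a \<Rightarrow> 'a \<Rightarrow> int) \<Rightarrow> bool" where
  "tri W L \<longleftrightarrow> (\<forall>x\<in>W. \<forall>y\<in>W. \<forall>z\<in>W. x \<noteq> y \<longrightarrow> y \<noteq> z \<longrightarrow> x \<noteq> z \<longrightarrow> L x z \<le> L x y + L y z + 1)"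

text \<open>In terms of intervals: \<open>u\<close> is translated by \<open>c\<close> and united
  with \<open>v\<close>.\<close>

definition merge :: "('a \<Rightarrow> 'a \<Rightarrow> int) \<Rightarrow> 'a \<Rightarrow> 'a \<Rightarrow> int \<Rightarrow> 'a \<Rightarrow> 'a \<Rightarrow> int" where
  "merge L u v c x y = (if x = v then max (L v y) (L u y + c) else if y = v then max (L x v) (L x u - c) else L x y)"

lemma subst_pairs:
  assumes t: "(u, v, c) \<in> pairs W L" and tri: "tri W L"
  shows "{((if k = u then v else k), (if l = u then v else l), d - (if k = u then c else 0) + (if l = u then c else 0)) |
      k l d. (k, l, d) \<in> pairs W L \<and> {k, l} \<noteq> {u, v}} = pairs (W - {u}) (merge L u v c)" (is "?S = ?R")
proof -
  have uv: "u \<in> W" "v \<in> W" "u \<noteq> v" "- L u v \<le> c" "c \<le> L v u" using t by (auto simp: pairs_def)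
  have tr: "L x z \<le> L x y + L y z + 1" if "x \<in> W" "y \<in> W" "z \<in> W" "x \<noteq> y" "y \<noteq> z" "x \<noteq> z" for x y z
    using tri that unfolding tri_def by blast
  show ?thesis
  proof (intro set_eqI iffI)
    fix q assume "q \<in> ?S"
    then obtain k l d where q: "q = ((if k = u then v else k), (if l = u then v else l), d - (if k = u then c else 0) + (if l = u then c else 0))"
      and kl: "k \<in> W" "l \<in> W" "k \<noteq> l" "- L k l \<le> d" "d \<le> L l k" "{k, l} \<noteq> {u, v}"
      by (auto simp: pairs_def)
    show "q \<in> ?R" using kl uv unfolding q pairs_def merge_def by (auto simp: doubleton_eq_iff)
  next
    fix q assume "q \<in> ?R"
    then obtain k l d where q: "q = (k, l, d)" and kl: "k \<in> W" "l \<in> W" "k \<noteq> l" "k \<noteq> u" "l \<noteq> u"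
      "- merge L u v c k l \<le> d" "d \<le> merge L u v c l k" by (auto simp: pairs_def)
    consider "k \<noteq> v" "l \<noteq> v" | "k = v" | "l = v" by blast
    then show "q \<in> ?S"
    proof cases
      case 1
      then have "(k, l, d) \<in> pairs W L \<and> {k, l} \<noteq> {u, v}" using kl by (auto simp: pairs_def merge_def)
      then show ?thesis using kl q by (intro CollectI exI[of _ k] exI[of _ l] exI[of _ d]) auto
    next
      case 2
      have l: "l \<noteq> v" using kl 2 by auto
      have b: "- max (L v l) (L u l + c) \<le> d" "d \<le> max (L l v) (L l u - c)" using kl l 2 by (auto simp: merge_def)
      \<comment> \<open>The constants between \<open>v\<close> and \<open>l\<close> fill
        \<open>[- L v l, L l v]\<close>, those from \<open>u\<close> fill
        \<open>[- L u l - c, L l u - c]\<close>. With \<open>- L u v \<le> c \<le> L v u\<close>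
        these two inequalities exclude a gap on either side, so a constant outside the first range
        lies in the second.\<close>
      have t1: "L v u \<le> L v l + L l u + 1" by (rule tr) (use uv kl l in auto)
      have t2: "L u v \<le> L u l + L l v + 1" by (rule tr) (use uv kl l in auto)
      show ?thesis
      proof (cases "- L v l \<le> d \<and> d \<le> L l v")
        case True
        then have "(v, l, d) \<in> pairs W L \<and> {v, l} \<noteq> {u, v}" using kl uv l by (auto simp: pairs_def)
        then show ?thesis using kl q 2 uv by (intro CollectI exI[of _ v] exI[of _ l] exI[of _ d]) auto
      next
        case False
        then have "- L u l \<le> d + c \<and> d + c \<le> L l u" using b t1 t2 uv by (auto simp: max_def split: if_splits)
        then have "(u, l, d + c) \<in> pairs W L \<and> {u, l} \<noteq> {u, v}" using kl uv l by (auto simp: pairs_def doubleton_eq_iff)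
        then show ?thesis using kl q 2 uv by (intro CollectI exI[of _ u] exI[of _ l] exI[of _ "d + c"]) auto
      qed
    next
      case 3
      have k: "k \<noteq> v" using kl 3 by auto
      have b: "- max (L k v) (L k u - c) \<le> d" "d \<le> max (L v k) (L u k + c)" using kl k 3 by (auto simp: merge_def)
      have t1: "L v u \<le> L v k + L k u + 1" by (rule tr) (use uv kl k in auto)
      have t2: "L u v \<le> L u k + L k v + 1" by (rule tr) (use uv kl k in auto)
      show ?thesis
      proof (cases "- L k v \<le> d \<and> d \<le> L v k")
        case True
        then have "(k, v, d) \<in> pairs W L \<and> {k, v} \<noteq> {u, v}" using kl uv k by (auto simp: pairs_def)
        then show ?thesis using kl q 3 uv by (intro CollectI exI[of _ k] exI[of _ v] exI[of _ d]) auto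
      next
        case False
        then have "- L k u \<le> d - c \<and> d - c \<le> L u k" using b t1 t2 uv by (auto simp: max_def split: if_splits)
        then have "(k, u, d - c) \<in> pairs W L \<and> {k, u} \<noteq> {u, v}" using kl uv k by (auto simp: pairs_def doubleton_eq_iff)
        then show ?thesis using kl q 3 uv by (intro CollectI exI[of _ k] exI[of _ u] exI[of _ "d - c"]) auto
      qed
    qed
  qed
qed

lemma restriction_arr_pairs:
  fixes Y :: "('i \<Rightarrow> 'k::field_char_0) set"
  assumes r: "rep Y f T W" and t: "(u, v, c) \<in> pairs W L" and tri: "tri W L"
  shows "restriction (arr Y f T (pairs W L)) (hp Y f (u, v, c)) =
    arr (hp Y f (u, v, c)) (\<lambda>y. (f y)(Some u := 0)) T (pairs (W - {u}) (merge L u v c))"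
proof -
  have uv: "u \<in> W" "v \<in> W" "u \<noteq> v" using t by (auto simp: pairs_def)
  show ?thesis
    unfolding restriction_arr_hp[OF r uv pairs_dpairs] subst_pairs[OF t tri] ..
qed

section \<open>Families of inductively free deformations\<close>

lemma hp_notin_arr:
  fixes Y :: "('i \<Rightarrow> 'k::field_char_0) set"
  assumes r: "rep Y f T W" and uv: "u \<in> W" "v \<in> W" "u \<noteq> v" and P: "P \<subseteq> dpairs W"
    and no: "\<And>x y d. (x, y, d) \<in> P \<Longrightarrow> {x, y} = {u, v} \<Longrightarrow>
      None \<in> T \<and> \<not> (x = u \<and> d = c) \<and> \<not> (x = v \<and> d = - c)"
  shows "hp Y f (u, v, c) \<notin> arr Y f T P"
proof
  assume "hp Y f (u, v, c) \<in> arr Y f T P"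
  then consider "hp Y f (u, v, c) = hz Y f" | x y d where "(x, y, d) \<in> P" "hp Y f (u, v, c) = hp Y f (x, y, d)"
    by (auto simp: arr_def split: if_splits)
  then show False
  proof cases
    case 1
    then show ?thesis using hz_neq_hp[OF r uv(1,3)] by metis
  next
    case 2
    have xy: "x \<in> W" "y \<in> W" "x \<noteq> y" using 2(1) P by (auto simp: dpairs_def)
    have h: "(x = u \<and> y = v \<and> (None \<in> T \<longrightarrow> d = c)) \<or> (x = v \<and> y = u \<and> (None \<in> T \<longrightarrow> d = - c))"
      by (rule hp_eqD[OF r uv xy 2(2)])
    then have "{x, y} = {u, v}" by auto
    from no[OF 2(1) this] h show ?thesis by blast
  qed
qed

definition tpart :: "'a option set \<Rightarrow> nat multiset" where
  "tpart T = (if None \<in> T then {#1#} else {#})"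

lemma ind_exps_isolated:
  fixes Y :: "('i \<Rightarrow> 'k::field_char_0) set" and W :: "'a set"
  assumes r: "rep Y f T W"
  shows "ind_exps Y (arr Y f T {}) (tpart T + replicate_mset (card W) 0)"
proof (cases "None \<in> T")
  case False
  then have "T = {}" using repD(4)[OF r] by auto
  then obtain F where "coordinates Y (card W) F"
    using rep_coordinates[OF r] by (auto simp: card_image)
  from ind_exps_empty[OF repD(1)[OF r] this] show ?thesis using False by (simp add: arr_def tpart_def)
next
  case True
  then have T: "T = {None}" using repD(4)[OF r] by auto
  have c: "card (T \<union> Some ` W) = Suc (card W)" using T repD(3)[OF r] by (simp add: card_image)
  obtain F where "coordinates Y (Suc (card W)) F" using rep_coordinates[OF r] c by auto
  from ind_exps_empty[OF repD(1)[OF r] this]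
  have 1: "ind_exps Y {} (add_mset 0 (replicate_mset (card W) 0))" by simp
  let ?H = "hz Y f"
  have rH: "rep ?H (\<lambda>y. (f y)(None := 0)) {} W" by (rule rep_hz[OF r True])
  then obtain F where "coordinates ?H (card W) F" using rep_coordinates[OF rH] by (auto simp: card_image)
  from ind_exps_empty[OF repD(1)[OF rH] this] have 2: "ind_exps ?H {} (replicate_mset (card W) 0)" .
  have H: "hyperplane Y ?H" by (rule is_form_hyperplane[OF hz_form[OF r True]])
  have "ind_exps Y {?H} (add_mset (Suc 0) (replicate_mset (card W) 0))"
    by (rule ind_exps_add[OF _ H]) (use 1 2 in \<open>auto simp: restriction_def\<close>)
  then show ?thesis using True by (simp add: arr_def tpart_def)
qed

text \<open>The case in which the vertices carry points \<open>A v\<close> instead of intervals.\<close>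

definition point_pairs :: "('a \<Rightarrow> int) \<Rightarrow> 'a set \<Rightarrow> ('a \<times> 'a \<times> int) set" where
  "point_pairs A W = {(u, v, A v - A u) | u v. u \<in> W \<and> v \<in> W \<and> u \<noteq> v}"

lemma point_pairs_subset: "W' \<subseteq> W \<Longrightarrow> point_pairs A W' \<subseteq> dpairs W"
  by (auto simp: point_pairs_def dpairs_def)

text \<open>In the coordinates \<open>x_v + A v z\<close> this is the braid arrangement on
  \<open>W'\<close> with free extra coordinates. A vertex \<open>o'\<close> is joined to the others
  edge by edge. Restricting to a new edge identifies \<open>o'\<close> with an old vertex and leaves
  the braid arrangement on \<open>W'\<close>, with the same exponents \<open>E\<close> each time,
  while one exponent counts the edges.\<close>

lemma ind_exps_points:
  fixes Y :: "('i \<Rightarrow> 'k::field_char_0) set" and W :: "'a set"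
  assumes r: "rep Y f T W" and W': "W' \<subseteq> W"
  shows "ind_exps Y (arr Y f T (point_pairs A W')) (tpart T + mset [0..<card W'] + replicate_mset (card W - card W') 0)"
  using assms
proof (induction "card W" arbitrary: Y f W W' rule: less_induct)
  case less
  note r = less.prems(1)
  have finW: "finite W" by (rule repD(3)[OF r])
  have finW': "finite W'" using less.prems(2) finW finite_subset by blast
  show ?case using finW' less.prems(2)
  proof (induction W' rule: finite_induct)
    case empty
    then show ?case using ind_exps_isolated[OF r] by (simp add: point_pairs_def)
  next
    case (insert o' W')
    have oW: "o' \<in> W" "o' \<notin> W'" "W' \<subseteq> W" using insert by auto
    define star where "star J = point_pairs A W' \<union> {(o', v, A v - A o') | v. v \<in> J}" for J
    define E where "E = tpart T + mset [0..<card W'] + replicate_mset (card W - card W' - 1) 0"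
    have cW: "card W = Suc (card W - 1)" "card W' \<le> card W - 1"
    proof -
      have "card (insert o' W') \<le> card W" using insert.prems finW by (intro card_mono) auto
      then show "card W = Suc (card W - 1)" "card W' \<le> card W - 1" using insert.hyps by auto
    qed
    have "ind_exps Y (arr Y f T (star J)) (add_mset (card J) E)" if "J \<subseteq> W'" for J
      using finite_subset[OF that insert.hyps(1)] that
    proof (induction J rule: finite_induct)
      case empty
      have "card W - card W' = Suc (card W - card W' - 1)" using cW by auto
      then have "add_mset 0 E = tpart T + mset [0..<card W'] + replicate_mset (card W - card W') 0"
        unfolding E_def by (metis replicate_mset_Suc union_mset_add_mset_right)
      then show ?case using insert.IH oW(3) by (simp add: star_def)
    next
      case (insert v J)
      have v: "v \<in> W'" "v \<in> W" "v \<noteq> o'" using insert.prems oW by auto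
      let ?c = "A v - A o'"
      let ?H = "hp Y f (o', v, ?c)"
      have sd: "star K \<subseteq> dpairs W" if "K \<subseteq> W'" for K
        using point_pairs_subset[OF oW(3)] that oW by (auto simp: star_def dpairs_def)
      have arr: "arr Y f T (star (insert v J)) = insert ?H (arr Y f T (star J))"
        by (auto simp: arr_def star_def)
      have notin: "?H \<notin> arr Y f T (star J)"
        by (rule hp_notin_arr[OF r oW(1) v(2) v(3)[symmetric] sd])
          (use insert oW in \<open>auto simp: star_def point_pairs_def doubleton_eq_iff\<close>)
      have rH: "rep ?H (\<lambda>y. (f y)(Some o' := 0)) T (W - {o'})" by (rule rep_hp[OF r oW(1) v(2) v(3)[symmetric]])
      have "{((if k = o' then v else k), (if l = o' then v else l), d - (if k = o' then ?c else 0) + (if l = o' then ?c else 0)) |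
          k l d. (k, l, d) \<in> star (insert v J) \<and> {k, l} \<noteq> {o', v}} = point_pairs A W'" (is "?S = _")
      proof (intro set_eqI iffI)
        fix q assume "q \<in> ?S"
        then show "q \<in> point_pairs A W'" using insert.prems v oW by (auto simp: star_def point_pairs_def doubleton_eq_iff)
      next
        fix q assume "q \<in> point_pairs A W'"
        then obtain k l where q: "q = (k, l, A l - A k)" "k \<in> W'" "l \<in> W'" "k \<noteq> l" by (auto simp: point_pairs_def)
        then show "q \<in> ?S"
          using oW(2) by (intro CollectI exI[of _ k] exI[of _ l] exI[of _ "A l - A k"])
            (auto simp: star_def point_pairs_def doubleton_eq_iff)
      qed
      then have restr: "restriction (arr Y f T (star (insert v J))) ?H = arr ?H (\<lambda>y. (f y)(Some o' := 0)) T (point_pairs A W')"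
        unfolding restriction_arr_hp[OF r oW(1) v(2) v(3)[symmetric] sd[OF insert.prems]] by simp
      have "ind_exps ?H (arr ?H (\<lambda>y. (f y)(Some o' := 0)) T (point_pairs A W'))
          (tpart T + mset [0..<card W'] + replicate_mset (card (W - {o'}) - card W') 0)"
        by (rule less.hyps[OF _ rH]) (use oW finW cW in auto)
      also have "tpart T + mset [0..<card W'] + replicate_mset (card (W - {o'}) - card W') 0 = E"
        using oW(1) finW by (simp add: E_def)
      finally have e2: "ind_exps ?H (restriction (arr Y f T (star (insert v J))) ?H) E" unfolding restr .
      have e1: "ind_exps Y (arr Y f T (star (insert v J)) - {?H}) (add_mset (card J) E)"
        using insert.IH insert.prems notin by (simp add: arr)
      have "ind_exps Y (arr Y f T (star (insert v J))) (add_mset (Suc (card J)) E)"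
        by (rule ind_exps_add[OF _ _ e1 e2])
          (use arr is_form_hyperplane[OF hp_form[OF r oW(1) v(3)[symmetric]]] in auto)
      then show ?case using insert.hyps by simp
    qed
    from this[OF order_refl] have "ind_exps Y (arr Y f T (star W')) (add_mset (card W') E)" .
    moreover have "arr Y f T (star W') = arr Y f T (point_pairs A (insert o' W'))"
    proof -
      have "hp Y f ` star W' = hp Y f ` point_pairs A (insert o' W')"
      proof (intro set_eqI iffI)
        fix h assume "h \<in> hp Y f ` star W'"
        then show "h \<in> hp Y f ` point_pairs A (insert o' W')" using oW by (force simp: star_def point_pairs_def)
      next
        fix h assume "h \<in> hp Y f ` point_pairs A (insert o' W')"
        then obtain k l where kl: "h = hp Y f (k, l, A l - A k)" "k \<in> insert o' W'" "l \<in> insert o' W'" "k \<noteq> l"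
          by (auto simp: point_pairs_def)
        have "(k, l, A l - A k) \<in> star W' \<or> (l, k, A k - A l) \<in> star W'"
          using kl by (auto simp: star_def point_pairs_def)
        moreover have "h = hp Y f (l, k, A k - A l)" unfolding kl(1) by (subst hp_sym) simp
        ultimately show "h \<in> hp Y f ` star W'" using kl(1) by blast
      qed
      then show ?thesis by (simp add: arr_def)
    qed
    moreover have "add_mset (card W') E = tpart T + mset [0..<card (insert o' W')] + replicate_mset (card W - card (insert o' W')) 0"
      using insert.hyps by (simp add: E_def)
    ultimately show ?case by simp
  qed
qed

text \<open>Raising \<open>L w v\<close> by one admits exactly the constant \<open>L w v\<close> for
  \<open>(v, w)\<close>; the reversed triple, also new, is the same hyperplane by
  \<open>hp_sym\<close>. Hypothesis \<open>c\<close> says that the range is nonempty, so that it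
  does contain the constant.\<close>

lemma arr_pairs_raise:
  fixes Y :: "('i \<Rightarrow> 'k::field_char_0) set" and W :: "'a set"
  assumes r: "rep Y f {None} W" and ov: "w \<in> W" "v \<in> W" "w \<noteq> v"
    and c: "- L v w \<le> L w v" and L0: "L0 = L(w := (L w)(v := L w v - 1))"
  shows "arr Y f {None} (pairs W L) = insert (hp Y f (v, w, L w v)) (arr Y f {None} (pairs W L0)) \<and>
    hp Y f (v, w, L w v) \<notin> arr Y f {None} (pairs W L0)"
proof -
  let ?c = "L w v"
  let ?H = "hp Y f (v, w, ?c)"
  have t: "(v, w, ?c) \<in> pairs W L" using ov c by (auto simp: pairs_def)
  have notin: "?H \<notin> arr Y f {None} (pairs W L0)"
    by (rule hp_notin_arr[OF r ov(2,1) ov(3)[symmetric] pairs_dpairs])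
      (use ov in \<open>auto simp: pairs_def L0 doubleton_eq_iff\<close>)
  have hp: "hp Y f ` pairs W L = insert ?H (hp Y f ` pairs W L0)"
  proof (intro set_eqI iffI)
    fix h assume "h \<in> hp Y f ` pairs W L"
    then obtain k l d where h: "h = hp Y f (k, l, d)" "(k, l, d) \<in> pairs W L" by auto
    show "h \<in> insert ?H (hp Y f ` pairs W L0)"
    proof (cases "(k, l, d) \<in> pairs W L0")
      case False
      then have "(k = v \<and> l = w \<and> d = ?c) \<or> (k = w \<and> l = v \<and> d = - ?c)"
        using h(2) by (auto simp: pairs_def L0 split: if_splits)
      then have "h = ?H" using h(1) hp_sym[of Y f w v "- ?c"] by auto
      then show ?thesis by simp
    qed (use h in auto)
  next
    fix h assume "h \<in> insert ?H (hp Y f ` pairs W L0)"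
    moreover have "pairs W L0 \<subseteq> pairs W L" by (auto simp: pairs_def L0 split: if_splits)
    ultimately show "h \<in> hp Y f ` pairs W L" using t by blast
  qed
  have "arr Y f {None} (pairs W L) = insert ?H (arr Y f {None} (pairs W L0))"
    using hp by (auto simp: arr_def)
  then show ?thesis using notin by blast
qed

text \<open>The restriction to the one new hyperplane merges \<open>v\<close> into \<open>w\<close>; the inequalities on \<open>L\<close>
  decide all maxima occurring in \<open>merge\<close>, with result \<open>L2\<close>.\<close>

lemma ind_exps_step:
  fixes Y :: "('i \<Rightarrow> 'k::field_char_0) set" and W :: "'a set"
  assumes r: "rep Y f {None} W" and ov: "w \<in> W" "v \<in> W" "w \<noteq> v" and tri: "tri W L"
    and c: "- L v w \<le> L w v" and L0: "L0 = L(w := (L w)(v := L w v - 1))"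
    and L2: "\<And>k. k \<in> W - {w, v} \<Longrightarrow> L k v - L w v \<le> L k w \<and> L w k \<le> L v k + L w v"
      "\<And>k. k \<in> W - {w, v} \<Longrightarrow> L2 w k = L v k + L w v \<and> L2 k w = L k w"
      "\<And>k l. k \<in> W - {w, v} \<Longrightarrow> l \<in> W - {w, v} \<Longrightarrow> L2 k l = L k l"
    and e1: "ind_exps Y (arr Y f {None} (pairs W L0)) (add_mset \<delta> e)"
    and e2: "\<And>H (g :: ('i \<Rightarrow> 'k) \<Rightarrow> ('a option \<Rightarrow> 'k)). rep H g {None} (W - {v}) \<Longrightarrow> ind_exps H (arr H g {None} (pairs (W - {v}) L2)) e"
  shows "ind_exps Y (arr Y f {None} (pairs W L)) (add_mset (Suc \<delta>) e)"
proof -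
  let ?c = "L w v"
  let ?H = "hp Y f (v, w, ?c)"
  have t: "(v, w, ?c) \<in> pairs W L" using ov c by (auto simp: pairs_def)
  have m: "pairs (W - {v}) (merge L v w ?c) = pairs (W - {v}) L2"
  proof (rule pairs_cong)
    fix x y assume xy: "x \<in> W - {v}" "y \<in> W - {v}" "x \<noteq> y"
    consider "x = w" "y \<in> W - {w, v}" | "y = w" "x \<in> W - {w, v}" | "x \<in> W - {w, v}" "y \<in> W - {w, v}" using xy by blast
    then show "merge L v w ?c x y = L2 x y"
    proof cases
      case 1
      then show ?thesis using L2(1,2)[of y] by (auto simp: merge_def)
    next
      case 2
      then show ?thesis using L2(1,2)[of x] xy by (auto simp: merge_def)
    next
      case 3
      then show ?thesis using L2(3)[of x y] by (auto simp: merge_def)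
    qed
  qed
  have restr: "restriction (arr Y f {None} (pairs W L)) ?H = arr ?H (\<lambda>y. (f y)(Some v := 0)) {None} (pairs (W - {v}) L2)"
    unfolding restriction_arr_pairs[OF r t tri] m ..
  have rH: "rep ?H (\<lambda>y. (f y)(Some v := 0)) {None} (W - {v})" by (rule rep_hp[OF r ov(2,1) ov(3)[symmetric]])
  have arr: "arr Y f {None} (pairs W L) = insert ?H (arr Y f {None} (pairs W L0))"
    and notin: "?H \<notin> arr Y f {None} (pairs W L0)"
    using arr_pairs_raise[OF r ov c L0] by blast+
  show ?thesis
  proof (rule ind_exps_add)
    show "?H \<in> arr Y f {None} (pairs W L)" by (simp add: arr)
    show "hyperplane Y ?H" by (rule is_form_hyperplane[OF hp_form[OF r ov(2) ov(3)[symmetric]]])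
    show "ind_exps Y (arr Y f {None} (pairs W L) - {?H}) (add_mset \<delta> e)" using e1 notin by (simp add: arr)
    show "ind_exps ?H (restriction (arr Y f {None} (pairs W L)) ?H) e" unfolding restr by (rule e2[OF rH])
  qed
qed

section \<open>Intervals with integer ends, and the case of two vertices\<close>

lemma mset_upt_Suc: "i < j \<Longrightarrow> mset [i..<j] = add_mset i (mset [Suc i..<j])"
  by (simp add: upt_conv_Cons)

text \<open>An intermediate stage in raising the top of \<open>w\<close> by one: the raise is in
  force only against the vertices of \<open>J\<close>.\<close>

definition cat_bound :: "('a \<Rightarrow> int) \<Rightarrow> ('a \<Rightarrow> int) \<Rightarrow> 'a \<Rightarrow> 'a set \<Rightarrow> 'a \<Rightarrow> 'a \<Rightarrow> int" where
  "cat_bound A B w J u v = B u - A v + (if u = w \<and> v \<in> J then 1 else 0)"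

text \<open>For total length \<open>n\<close> the exponents besides \<open>0, 1\<close> are
  \<open>n + 1, ..., n + card W - 1\<close>. Raising one top by one adds a hyperplane for each other
  vertex. Every restriction met on the way has the exponents
  \<open>0, 1, n + 2, ..., n + card W - 1\<close>, so the same exponent is raised each time, from
  \<open>n + 1\<close> to \<open>n + card W\<close>.\<close>

lemma ind_exps_catalan:
  fixes Y :: "('i \<Rightarrow> 'k::field_char_0) set" and W :: "'a set"
  assumes r: "rep Y f {None} W" and W: "W \<noteq> {}" and AB: "\<And>v. v \<in> W \<Longrightarrow> A v \<le> B v"
  shows "ind_exps Y (arr Y f {None} (pairs W (\<lambda>u v. B u - A v)))
    ({#0, 1#} + mset [Suc (\<Sum>v\<in>W. nat (B v - A v))..<(\<Sum>v\<in>W. nat (B v - A v)) + card W])"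
  using assms
proof (induction "card W" arbitrary: Y f W A B rule: less_induct)
  case less
  have finW: "finite W" by (rule repD(3)[OF less.prems(1)])
  have cW: "card W > 0" using less.prems(2) finW by (simp add: card_gt_0_iff)
  have "ind_exps Y (arr Y f {None} (pairs W (\<lambda>u v. B u - A v))) ({#0, 1#} + mset [Suc n..<n + card W])"
    if "n = (\<Sum>v\<in>W. nat (B v - A v))" "\<And>v. v \<in> W \<Longrightarrow> A v \<le> B v" for n B
    using that
  proof (induction n arbitrary: B)
    case 0
    have BA: "B v = A v" if "v \<in> W" for v using 0 that finW by force
    have "pairs W (\<lambda>u v. B u - A v) = point_pairs A W"
      by (auto simp: pairs_def point_pairs_def BA)
    moreover have "tpart ({None} :: 'a option set) + mset [0..<card W] + replicate_mset (card W - card W) 0 = {#0, 1#} + mset [Suc 0..<0 + card W]"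
      using cW mset_upt_Suc[of 0 "card W"] by (simp add: tpart_def)
    ultimately show ?case using ind_exps_points[OF less.prems(1) order_refl, of A] by simp
  next
    case (Suc n)
    have "\<exists>w\<in>W. A w < B w"
    proof (rule ccontr)
      assume "\<not> ?thesis"
      then have "(\<Sum>v\<in>W. nat (B v - A v)) = 0" by (intro sum.neutral) auto
      then show False using Suc.prems(1) by simp
    qed
    then obtain w where w: "w \<in> W" "A w < B w" by blast
    define B0 where "B0 = B(w := B w - 1)"
    have B0: "A v \<le> B0 v" if "v \<in> W" for v using Suc.prems(2)[OF that] w by (auto simp: B0_def)
    have sum_eq: "(\<Sum>v\<in>W - S. nat (B v - A v)) = (\<Sum>v\<in>W - S. nat (B0 v - A v))" if "w \<in> S" for S
      by (rule sum.cong) (use that in \<open>auto simp: B0_def\<close>)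
    have n: "n = (\<Sum>v\<in>W. nat (B0 v - A v))"
    proof -
      have "Suc n = nat (B w - A w) + (\<Sum>v\<in>W - {w}. nat (B0 v - A v))"
        unfolding Suc.prems(1) sum.remove[OF finW w(1)] using sum_eq[of "{w}"] by simp
      also have "nat (B w - A w) = Suc (nat (B0 w - A w))" using w by (simp add: B0_def)
      finally show ?thesis by (simp add: sum.remove[OF finW w(1)])
    qed
    have star: "ind_exps Y (arr Y f {None} (pairs W (cat_bound A B0 w J)))
        (add_mset (n + 1 + card J) ({#0, 1#} + mset [n + 2..<n + card W]))"
      if J: "J \<subseteq> W - {w}" "W \<noteq> {w}" for J
      using finite_subset[OF J(1)] finW J(1)
    proof (induction "card J" arbitrary: J)
      case 0
      then have "J = {}" using finite_subset[of J W] by auto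
      have "card W > 1"
      proof -
        have "card {w} < card W" using J(2) w(1) finW by (intro psubset_card_mono) auto
        then show ?thesis by simp
      qed
      then have "{#0, 1#} + mset [Suc n..<n + card W] = add_mset (n + 1 + card J) ({#0, 1#} + mset [n + 2..<n + card W])"
        using mset_upt_Suc[of "Suc n" "n + card W"] \<open>J = {}\<close> by simp
      then show ?case using Suc.IH[OF n B0] \<open>J = {}\<close> by (simp add: cat_bound_def[abs_def])
    next
      case (Suc j)
      then obtain v where v: "v \<in> J" by (metis card.empty equals0I nat.distinct(1))
      have finJ: "finite J" using Suc.prems finW finite_subset by blast
      have vW: "v \<in> W" "v \<noteq> w" using v Suc.prems by auto
      have IH: "ind_exps Y (arr Y f {None} (pairs W (cat_bound A B0 w (J - {v}))))
          (add_mset (n + 1 + card (J - {v})) ({#0, 1#} + mset [n + 2..<n + card W]))"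
        by (rule Suc.hyps(1)) (use Suc.prems Suc.hyps(2) v finJ finW finite_subset in auto)
      \<comment> \<open>The bottom of \<open>v\<close> is translated to the new top
        \<open>B0 w + 1\<close> of \<open>w\<close>. The union has the sum of both lengths plus one,
        so the total becomes \<open>Suc n\<close> on one vertex less, whatever \<open>J\<close>
        is.\<close>
      define B2 where "B2 = B0(w := B0 v + B0 w + 1 - A v)"
      have B2: "A x \<le> B2 x" if "x \<in> W" for x using B0[OF that] B0[OF vW(1)] B0[OF w(1)] by (auto simp: B2_def)
      have s2: "(\<Sum>x\<in>W - {v}. nat (B2 x - A x)) = Suc n"
      proof -
        have w': "w \<in> W - {v}" using w vW by auto
        have "(\<Sum>x\<in>W - {v} - {w}. nat (B2 x - A x)) = (\<Sum>x\<in>W - {v} - {w}. nat (B0 x - A x))"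
          by (rule sum.cong) (auto simp: B2_def)
        moreover have "nat (B2 w - A w) = Suc (nat (B0 v - A v) + nat (B0 w - A w))"
          using B0[OF vW(1)] B0[OF w(1)] by (simp add: B2_def)
        ultimately show ?thesis
          using n sum.remove[OF finW vW(1), of "\<lambda>x. nat (B0 x - A x)"] finW
            sum.remove[OF _ w', of "\<lambda>x. nat (B0 x - A x)"] sum.remove[OF _ w', of "\<lambda>x. nat (B2 x - A x)"] by simp
      qed
      have c1: "card (W - {v}) = card W - 1" using vW finW by simp
      have e2: "ind_exps H (arr H g {None} (pairs (W - {v}) (\<lambda>u v. B2 u - A v))) ({#0, 1#} + mset [n + 2..<n + card W])"
        if "rep H g {None} (W - {v})" for H and g :: "('i \<Rightarrow> 'k) \<Rightarrow> ('a option \<Rightarrow> 'k)"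
      proof -
        have "ind_exps H (arr H g {None} (pairs (W - {v}) (\<lambda>u v. B2 u - A v)))
          ({#0, 1#} + mset [Suc (\<Sum>x\<in>W - {v}. nat (B2 x - A x))..<(\<Sum>x\<in>W - {v}. nat (B2 x - A x)) + card (W - {v})])"
          by (rule less.hyps[OF _ that]) (use vW w finW B2 c1 cW in auto)
        then show ?thesis using c1 cW unfolding s2 by simp
      qed
      have "ind_exps Y (arr Y f {None} (pairs W (cat_bound A B0 w J)))
          (add_mset (Suc (n + 1 + card (J - {v}))) ({#0, 1#} + mset [n + 2..<n + card W]))"
      proof (rule ind_exps_step[OF less.prems(1) w(1) vW(1) vW(2)[symmetric] _ _ _ _ _ _ IH e2])
        show "tri W (cat_bound A B0 w J)"
          unfolding tri_def cat_bound_def using B0 by (auto simp: algebra_simps) (smt (verit))+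
        show "- cat_bound A B0 w J v w \<le> cat_bound A B0 w J w v"
          using v vW B0[OF vW(1)] B0[OF w(1)] by (auto simp: cat_bound_def)
        show "cat_bound A B0 w (J - {v}) = (cat_bound A B0 w J)(w := (cat_bound A B0 w J w)(v := cat_bound A B0 w J w v - 1))"
          using v by (auto simp: cat_bound_def fun_eq_iff)
        fix k l assume k: "k \<in> W - {w, v}"
        show "cat_bound A B0 w J k v - cat_bound A B0 w J w v \<le> cat_bound A B0 w J k w \<and>
            cat_bound A B0 w J w k \<le> cat_bound A B0 w J v k + cat_bound A B0 w J w v"
          using k v vW B0[OF vW(1)] B0[OF w(1)] by (auto simp: cat_bound_def)
        show "B2 w - A k = cat_bound A B0 w J v k + cat_bound A B0 w J w v \<and> B2 k - A w = cat_bound A B0 w J k w"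
          using k v vW by (auto simp: cat_bound_def B2_def)
        assume l: "l \<in> W - {w, v}"
        show "B2 k - A l = cat_bound A B0 w J k l" using k by (auto simp: cat_bound_def B2_def)
      qed
      moreover have E: "Suc (n + 1 + card (J - {v})) = n + 1 + card J"
        using v finJ card_Suc_Diff1[of J v] by simp
      ultimately show ?case by (simp only: E)
    qed
    show ?case
    proof (cases "W = {w}")
      case True
      then have "pairs W (\<lambda>u v. B u - A v) = pairs W (\<lambda>u v. B0 u - A v)" by (auto simp: pairs_def)
      then show ?thesis using Suc.IH[OF n B0] True by simp
    next
      case False
      have E1: "pairs W (cat_bound A B0 w (W - {w})) = pairs W (\<lambda>u v. B u - A v)"
        by (rule pairs_cong) (auto simp: cat_bound_def B0_def)
      have E2: "add_mset (n + 1 + card (W - {w})) ({#0, 1#} + mset [n + 2..<n + card W]) =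
          {#0, 1#} + mset [Suc (Suc n)..<Suc n + card W]"
      proof -
        have "card (W - {w}) = card W - 1" using w finW by simp
        moreover have "card W > 1"
          using psubset_card_mono[OF finW, of "{w}"] False w(1) by auto
        ultimately show ?thesis by (simp add: upt_Suc_append)
      qed
      from star[OF order_refl False] show ?thesis unfolding E1 E2 .
    qed
  qed
  from this[OF refl less.prems(3)] show ?case .
qed

text \<open>Each hyperplane between \<open>u\<close> and \<open>v\<close> restricts to a single
  vertex with exponents \<open>0, 1\<close>, so the third exponent just counts these
  hyperplanes.\<close>

lemma ind_exps_two:
  fixes Y :: "('i \<Rightarrow> 'k::field_char_0) set" and W :: "'a set"
  assumes r: "rep Y f {None} W" and W: "W = {u, v}" "u \<noteq> v" and m: "int m = L u v + L v u + 1"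
  shows "ind_exps Y (arr Y f {None} (pairs W L)) {#0, 1, m#}"
  using m
proof (induction m arbitrary: L)
  case 0
  then have "pairs W L = {}" using W by (auto simp: pairs_def)
  then show ?case using ind_exps_isolated[OF r] W by (simp add: tpart_def numeral_2_eq_2 add_mset_commute)
next
  case (Suc m)
  have IH: "ind_exps Y (arr Y f {None} (pairs W (L(u := (L u)(v := L u v - 1))))) (add_mset m {#0, 1#})"
  proof -
    have "int m = (L(u := (L u)(v := L u v - 1))) u v + (L(u := (L u)(v := L u v - 1))) v u + 1"
      using Suc.prems W by simp
    moreover have "{#0, 1, m#} = add_mset m {#0, 1#}" by (simp add: add_mset_commute)
    ultimately show ?thesis using Suc.IH[of "L(u := (L u)(v := L u v - 1))"] by metis
  qed
  have e2: "ind_exps H (arr H g {None} (pairs (W - {v}) L)) {#0, 1#}"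
    if "rep H g {None} (W - {v})" for H and g :: "('i \<Rightarrow> 'k) \<Rightarrow> ('a option \<Rightarrow> 'k)"
  proof -
    have "pairs (W - {v}) L = {}" using W by (auto simp: pairs_def)
    then show ?thesis using ind_exps_isolated[OF that] W by (simp add: tpart_def insert_Diff_if add_mset_commute)
  qed
  have "ind_exps Y (arr Y f {None} (pairs W L)) (add_mset (Suc m) {#0, 1#})"
    by (rule ind_exps_step[OF r _ _ W(2) _ _ refl _ _ _ IH e2]) (use W Suc.prems in \<open>auto simp: tri_def\<close>)
  then show ?case by (simp add: add_mset_commute)
qed

text \<open>Interval model: with an interval \<open>[a u, b u]\<close> attached to every vertex, the hyperplane
  \<open>x\<^sub>u - x\<^sub>v = c z\<close> is present iff the \<open>c\<close>-translate of the interval of \<open>u\<close> meets that of \<open>v\<close>.\<close>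

definition ibound :: "('a \<Rightarrow> real) \<Rightarrow> ('a \<Rightarrow> real) \<Rightarrow> 'a \<Rightarrow> 'a \<Rightarrow> int" where
  "ibound a b u v = \<lfloor>b u - a v\<rfloor>"

text \<open>Since the interval of \<open>y\<close> is nonempty,
  \<open>b x - a z \<le> (b x - a y) + (b y - a z)\<close>, and the floor of a sum exceeds the sum
  of floors by at most one.\<close>

lemma tri_ibound:
  assumes "\<And>y. y \<in> W \<Longrightarrow> a y \<le> b y" shows "tri W (ibound a b)"
  unfolding tri_def ibound_def
proof (intro ballI impI)
  fix x y z assume "y \<in> W"
  then have "a y \<le> b y" by (rule assms)
  then show "\<lfloor>b x - a z\<rfloor> \<le> \<lfloor>b x - a y\<rfloor> + \<lfloor>b y - a z\<rfloor> + 1" by linarith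
qed

text \<open>One interval, that of \<open>w\<close>, is arbitrary, the others have integral length,
  and bottoms are in general position modulo 1. Genericity lets hyperplanes disappear one at a time
  while the top of \<open>w\<close> is lowered.\<close>

definition special :: "'a set \<Rightarrow> 'a \<Rightarrow> ('a \<Rightarrow> real) \<Rightarrow> ('a \<Rightarrow> real) \<Rightarrow> ('a \<Rightarrow> nat) \<Rightarrow> bool" where
  "special W w a b k \<longleftrightarrow> w \<in> W \<and> (\<forall>v\<in>W - {w}. b v = a v + real (k v)) \<and> a w \<le> b w \<and>
     (\<forall>u\<in>W. \<forall>v\<in>W. u \<noteq> v \<longrightarrow> a u - a v \<notin> \<int>)"

text \<open>The number of points of \<open>a v + \<int>\<close> in the interval of \<open>w\<close>.\<close>

definition crossings :: "'a \<Rightarrow> ('a \<Rightarrow> real) \<Rightarrow> ('a \<Rightarrow> real) \<Rightarrow> 'a \<Rightarrow> nat" where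
  "crossings w a b v = nat (\<lfloor>b w - a v\<rfloor> - \<lfloor>a w - a v\<rfloor>)"

text \<open>One exponent for each vertex other than \<open>w\<close>. Lowering the top of
  \<open>w\<close> past one crossing changes a single one of them.\<close>

definition special_exps :: "'a set \<Rightarrow> 'a \<Rightarrow> ('a \<Rightarrow> real) \<Rightarrow> ('a \<Rightarrow> real) \<Rightarrow> ('a \<Rightarrow> nat) \<Rightarrow> nat multiset" where
  "special_exps W w a b k = image_mset (\<lambda>v. (\<Sum>u\<in>W - {w}. k u) + crossings w a b v) (mset_set (W - {w}))"

lemma floor_diff_nonint: "x - y \<notin> \<int> \<Longrightarrow> \<lfloor>x - y\<rfloor> = - 1 - \<lfloor>y - x\<rfloor>" for x y :: real
proof -
  assume "x - y \<notin> \<int>"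
  then have "of_int \<lfloor>x - y\<rfloor> \<noteq> x - y" by (metis Ints_of_int)
  then have "of_int \<lfloor>x - y\<rfloor> < x - y" using of_int_floor_le[of "x - y"] by linarith
  moreover have "x - y < of_int \<lfloor>x - y\<rfloor> + 1" by linarith
  ultimately have "\<lfloor>y - x\<rfloor> = - \<lfloor>x - y\<rfloor> - 1" by linarith
  then show ?thesis by simp
qed

text \<open>Lowering the top of \<open>w\<close> past its highest crossing, say with
  \<open>v\<close>, deletes one hyperplane. The restriction absorbs \<open>v\<close> into
  \<open>w\<close>: the length \<open>k v\<close> leaves the sum but reappears as \<open>k v\<close>
  new crossings with every other vertex, so the remaining exponents agree. When no crossing is left,
  \<open>w\<close> can be shrunk to a point and another interval takes over its role.\<close>

lemma ind_exps_special:
  fixes Y :: "('i \<Rightarrow> 'k::field_char_0) set" and W :: "'a set"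
  assumes "rep Y f {None} W" "special W w a b k"
  shows "ind_exps Y (arr Y f {None} (pairs W (ibound a b))) ({#0, 1#} + special_exps W w a b k)"
  using assms
proof (induction "\<Sum>\<^sub># (special_exps W w a b k)" arbitrary: Y f W w a b k rule: less_induct)
  case (less W w a b k Y f)
  note r = less.prems(1)
  have finW: "finite W" by (rule repD(3)[OF r])
  have step: "ind_exps Y (arr Y f {None} (pairs W (ibound a b))) ({#0, 1#} + special_exps W w a b k)"
    if sp: "special W w a b k" and m: "\<Sum>\<^sub># (special_exps W w a b k) \<le> m" and v1: "v1 \<in> W - {w}" "crossings w a b v1 > 0"
      and IH: "\<And>(W :: 'a set) w a b k (Y :: ('i \<Rightarrow> 'k) set) f. \<Sum>\<^sub># (special_exps W w a b k) < m \<Longrightarrow> rep Y f {None} W \<Longrightarrow> special W w a b k \<Longrightarrow>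
        ind_exps Y (arr Y f {None} (pairs W (ibound a b))) ({#0, 1#} + special_exps W w a b k)"
    for w a b k m v1
  proof -
    have wW: "w \<in> W" and bk: "\<And>v. v \<in> W - {w} \<Longrightarrow> b v = a v + real (k v)" and ab: "a w \<le> b w"
      and gen: "\<And>u v. u \<in> W \<Longrightarrow> v \<in> W \<Longrightarrow> u \<noteq> v \<Longrightarrow> a u - a v \<notin> \<int>"
      using sp by (auto simp: special_def)
    have ab': "a v \<le> b v" if "v \<in> W" for v using bk[of v] ab that by (cases "v = w") auto
    \<comment> \<open>The highest point of \<open>a v + \<int>\<close> not above \<open>b w\<close>.
      The maximum of these over \<open>v\<close> is the first crossing met from above.\<close>
    define p where "p v = a v + of_int \<lfloor>b w - a v\<rfloor>" for v
    have finS: "finite (W - {w})" using finW by simp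
    have "Max (p ` (W - {w})) \<in> p ` (W - {w})" using finS v1(1) by (intro Max_in) auto
    then obtain v where v: "v \<in> W - {w}" "Max (p ` (W - {w})) = p v" by (auto simp: image_iff)
    have pv: "p u \<le> p v" if "u \<in> W - {w}" for u unfolding v(2)[symmetric] using finS that by (intro Max_ge) auto
    have "p v1 > a w" using v1(2) unfolding p_def crossings_def by linarith
    then have pva: "p v > a w" using pv[OF v1(1)] by linarith
    have pvb: "p v \<le> b w" unfolding p_def by linarith
    have vW: "v \<in> W" "w \<noteq> v" using v by auto
    have plt: "p u < p v" if u: "u \<in> W - {w, v}" for u
    proof -
      have "p u \<noteq> p v"
      proof
        assume "p u = p v"
        then have "a u - a v = of_int (\<lfloor>b w - a v\<rfloor> - \<lfloor>b w - a u\<rfloor>)" by (simp add: p_def)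
        then have "a u - a v \<in> \<int>" by (metis Ints_of_int)
        then show False using gen[of u v] u vW by auto
      qed
      then show ?thesis using pv[of u] u by auto
    qed
    define c where "c = \<lfloor>b w - a v\<rfloor>"
    have pvc: "p v = a v + of_int c" by (simp add: p_def c_def)
    \<comment> \<open>The new top must stay above \<open>a w\<close> and above the other crossings,
      weakly, and must not fall below \<open>p v - 1\<close>, where a second point of
      \<open>a v + \<int>\<close> would start to be lost. All these bounds lie strictly below
      \<open>p v\<close>.\<close>
    define S where "S = {a w, p v - 1} \<union> p ` (W - {w, v})"
    define \<beta> where "\<beta> = Max S"
    have finS2: "finite S" "S \<noteq> {}" using finW by (auto simp: S_def)
    have \<beta>ge: "s \<le> \<beta>" if "s \<in> S" for s unfolding \<beta>_def using finS2 that by (intro Max_ge) auto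
    have "\<beta> \<in> S" unfolding \<beta>_def using finS2 by (intro Max_in)
    then have \<beta>lt: "\<beta> < p v" using pva plt by (auto simp: S_def)
    have \<beta>a: "a w \<le> \<beta>" and \<beta>v: "p v - 1 \<le> \<beta>" and \<beta>p: "\<And>u. u \<in> W - {w, v} \<Longrightarrow> p u \<le> \<beta>"
      by (rule \<beta>ge, simp add: S_def)+
    have fl_u: "\<lfloor>\<beta> - a u\<rfloor> = \<lfloor>b w - a u\<rfloor>" if u: "u \<in> W - {w, v}" for u
      using \<beta>p[OF u] \<beta>lt pvb unfolding p_def by linarith
    have fl_v: "\<lfloor>\<beta> - a v\<rfloor> = c - 1" using \<beta>v \<beta>lt unfolding pvc by linarith
    define b0 where "b0 = b(w := \<beta>)"
    define L where "L = ibound a b"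
    define L0 where "L0 = L(w := (L w)(v := L w v - 1))"
    have P0: "pairs W (ibound a b0) = pairs W L0"
    proof (rule pairs_cong)
      fix x y assume "x \<in> W" "y \<in> W" "x \<noteq> y"
      then show "ibound a b0 x y = L0 x y"
        using fl_u[of y] fl_v by (auto simp: ibound_def b0_def L0_def L_def c_def)
    qed
    have sp0: "special W w a b0 k" using sp \<beta>a by (auto simp: special_def b0_def)
    define K where "K = (\<Sum>u\<in>W - {w}. k u)"
    define E where "E = image_mset (\<lambda>u. K + crossings w a b u) (mset_set (W - {w, v}))"
    have ms: "mset_set (W - {w}) = add_mset v (mset_set (W - {w, v}))"
      using v(1) finS mset_set.remove[of "W - {w}" v] by (simp add: Diff_insert2[symmetric] insert_commute)
    have e: "special_exps W w a b k = add_mset (K + crossings w a b v) E"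
      unfolding special_exps_def ms by (simp add: K_def E_def)
    have Nv: "crossings w a b v = Suc (crossings w a b0 v)"
    proof -
      have "\<lfloor>a w - a v\<rfloor> < c" using pva unfolding pvc by linarith
      then show ?thesis using fl_v by (simp add: crossings_def b0_def c_def[symmetric] vW)
    qed
    have Nu: "crossings w a b0 u = crossings w a b u" if "u \<in> W - {w, v}" for u
      using fl_u[OF that] by (simp add: crossings_def b0_def)
    have E0: "image_mset (\<lambda>u. K + crossings w a b0 u) (mset_set (W - {w, v})) = E"
      unfolding E_def using finW by (intro image_mset_cong) (auto simp: Nu)
    have e0: "special_exps W w a b0 k = add_mset (K + crossings w a b0 v) E"
      unfolding special_exps_def ms using E0 by (simp add: K_def)
    \<comment> \<open>The top of the translated interval of \<open>v\<close>, equal to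
      \<open>p v + k v\<close>. Even if \<open>b w\<close> lies higher it may serve as top of the
      union, because there is no crossing above \<open>p v\<close>.\<close>
    define b2 where "b2 = b(w := b v + of_int c)"
    have sp2: "special (W - {v}) w a b2 k"
      using sp vW pva bk[OF v(1)] unfolding pvc by (auto simp: special_def b2_def)
    have K2: "K = k v + (\<Sum>u\<in>W - {v} - {w}. k u)"
      unfolding K_def using sum.remove[OF finS v(1), of k] by (simp add: Diff_insert2[symmetric] insert_commute)
    have N2: "crossings w a b2 u = crossings w a b u + k v" if u: "u \<in> W - {w, v}" for u
    proof -
      have "\<lfloor>p v - a u\<rfloor> = \<lfloor>b w - a u\<rfloor>" using plt[OF u] pvb unfolding p_def by linarith
      moreover have "b2 w - a u = p v - a u + of_int (int (k v))" using bk[OF v(1)] by (simp add: b2_def pvc)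
      ultimately have "\<lfloor>b2 w - a u\<rfloor> = \<lfloor>b w - a u\<rfloor> + int (k v)" by (metis floor_add_int)
      moreover have "\<lfloor>a w - a u\<rfloor> \<le> \<lfloor>b w - a u\<rfloor>" using ab by (intro floor_mono) simp
      ultimately show ?thesis by (simp add: crossings_def nat_add_distrib[symmetric] algebra_simps)
    qed
    have Wvw: "W - {v} - {w} = W - {w, v}" by auto
    have e2: "special_exps (W - {v}) w a b2 k = E"
      unfolding special_exps_def E_def Wvw
      using finW by (intro image_mset_cong) (auto simp: N2 K2 Wvw)
    have s0: "\<Sum>\<^sub># (special_exps W w a b0 k) < m" and s2: "\<Sum>\<^sub># (special_exps (W - {v}) w a b2 k) < m"
      using m unfolding e e0 e2 Nv by auto
    have r1: "ind_exps Y (arr Y f {None} (pairs W L0)) (add_mset (K + crossings w a b0 v) ({#0, 1#} + E))"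
      using IH[OF s0 r sp0] unfolding P0 e0 by simp
    have r2: "ind_exps H (arr H g {None} (pairs (W - {v}) (ibound a b2))) ({#0, 1#} + E)"
      if "rep H g {None} (W - {v})" for H and g :: "('i \<Rightarrow> 'k) \<Rightarrow> ('a option \<Rightarrow> 'k)"
      using IH[OF s2 that sp2] unfolding e2 .
    have "ind_exps Y (arr Y f {None} (pairs W L)) (add_mset (Suc (K + crossings w a b0 v)) ({#0, 1#} + E))"
    proof (rule ind_exps_step[OF r wW vW _ _ L0_def _ _ _ r1 r2])
      show "tri W L" unfolding L_def by (rule tri_ibound[OF ab'])
      have bv: "b v = a v + real (k v)" by (rule bk[OF v(1)])
      show "- L v w \<le> L w v" unfolding L_def ibound_def c_def[symmetric] using pva bv unfolding pvc by linarith
      have Lwv: "L w v = c" by (simp add: L_def ibound_def c_def)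
      fix x y assume x: "x \<in> W - {w, v}"
      have "\<lfloor>b x - a v\<rfloor> - c \<le> \<lfloor>b x - a w\<rfloor>" using pva unfolding pvc by linarith
      moreover have "\<lfloor>b w - a x\<rfloor> \<le> \<lfloor>b v - a x\<rfloor> + c" using plt[OF x] bv unfolding pvc unfolding p_def by linarith
      ultimately show "L x v - L w v \<le> L x w \<and> L w x \<le> L v x + L w v"
        unfolding Lwv by (simp add: L_def ibound_def)
      have "\<lfloor>b v + of_int c - a x\<rfloor> = \<lfloor>b v - a x\<rfloor> + c" by linarith
      then show "ibound a b2 w x = L v x + L w v \<and> ibound a b2 x w = L x w"
        unfolding Lwv using x by (auto simp: L_def ibound_def b2_def)
      assume "y \<in> W - {w, v}"
      then show "ibound a b2 x y = L x y" using x by (auto simp: L_def ibound_def b2_def)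
    qed
    then show ?thesis unfolding L_def[symmetric] e Nv by simp
  qed
  show ?case
  proof (cases "\<exists>v1\<in>W - {w}. crossings w a b v1 > 0")
    case True
    then obtain v1 where "v1 \<in> W - {w}" "crossings w a b v1 > 0" by blast
    from step[OF less.prems(2) order_refl this less.hyps] show ?thesis .
  next
    case False
    then have N0: "crossings w a b v = 0" if "v \<in> W - {w}" for v using that by auto
    have wW: "w \<in> W" and bk: "\<And>v. v \<in> W - {w} \<Longrightarrow> b v = a v + real (k v)" and ab: "a w \<le> b w"
      and gen: "\<And>u v. u \<in> W \<Longrightarrow> v \<in> W \<Longrightarrow> u \<noteq> v \<Longrightarrow> a u - a v \<notin> \<int>"
      using less.prems(2) by (auto simp: special_def)
    define K where "K = (\<Sum>u\<in>W - {w}. k u)"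
    \<comment> \<open>Without crossings the floors at \<open>a w\<close> and \<open>b w\<close>
      agree, so \<open>w\<close> may be taken to be a point.\<close>
    define b' where "b' = b(w := a w)"
    define k' where "k' = k(w := 0)"
    have bk': "b' v = a v + real (k' v)" if "v \<in> W" for v using bk[of v] that by (auto simp: b'_def k'_def)
    have Kk': "K = (\<Sum>u\<in>W. k' u)"
      unfolding K_def sum.remove[OF finW wW] by (simp add: k'_def)
    have P': "pairs W (ibound a b) = pairs W (ibound a b')"
    proof (rule pairs_cong)
      fix x y assume xy: "x \<in> W" "y \<in> W" "x \<noteq> y"
      show "ibound a b x y = ibound a b' x y"
      proof (cases "x = w")
        case True
        have "\<lfloor>a w - a y\<rfloor> \<le> \<lfloor>b w - a y\<rfloor>" using ab by (intro floor_mono) simp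
        then show ?thesis using N0[of y] xy True by (simp add: ibound_def b'_def crossings_def)
      qed (simp add: ibound_def b'_def)
    qed
    have ex: "special_exps W w a b k = replicate_mset (card W - 1) K"
    proof -
      have "special_exps W w a b k = image_mset (\<lambda>_. K) (mset_set (W - {w}))"
        unfolding special_exps_def using finW by (intro image_mset_cong) (auto simp: N0 K_def)
      then show ?thesis using finW wW by (simp add: image_mset_const_eq)
    qed
    show ?thesis
    proof (cases "K = 0")
      case True
      then have k0: "k' v = 0" if "v \<in> W" for v using that finW Kk' by simp
      have "pairs W (ibound a b') = {}"
      proof -
        have "\<not> - \<lfloor>a u - a v\<rfloor> \<le> \<lfloor>a v - a u\<rfloor>" if "u \<in> W" "v \<in> W" "u \<noteq> v" for u v
          using floor_diff_nonint[OF gen[OF that]] by simp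
        then show ?thesis using bk' k0 by (fastforce simp: pairs_def ibound_def)
      qed
      moreover have "{#0, 1#} + special_exps W w a b k = tpart ({None} :: 'a option set) + replicate_mset (card W) 0"
      proof -
        have "card W = Suc (card W - 1)" using wW finW by (metis Suc_pred' card_gt_0_iff empty_iff)
        then have "replicate_mset (card W) (0::nat) = add_mset 0 (replicate_mset (card W - 1) 0)"
          by (metis replicate_mset_Suc)
        then show ?thesis unfolding ex True by (simp add: tpart_def)
      qed
      ultimately show ?thesis using ind_exps_isolated[OF r] unfolding P' by metis
    next
      case False
      \<comment> \<open>With \<open>w\<close> a point, all exponents equal the total length
        \<open>K\<close> whichever interval is singled out. The interval of \<open>w'\<close> has
        positive integral length, hence crossings, and \<open>step\<close> applies to it.\<close>
      then obtain w' where w': "w' \<in> W" "k' w' > 0" using Kk' by (metis gr0I sum.neutral)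
      have w'w: "w' \<noteq> w" using w' by (auto simp: k'_def)
      have sp': "special W w' a b' k'" unfolding special_def using bk' w' gen by auto
      have cr: "crossings w' a b' v = k' w'" for v
      proof -
        have "b' w' - a v = a w' - a v + of_int (int (k' w'))" using bk'[OF w'(1)] by simp
        then have "\<lfloor>b' w' - a v\<rfloor> = \<lfloor>a w' - a v\<rfloor> + int (k' w')" by (metis floor_add_int)
        then show ?thesis by (simp add: crossings_def)
      qed
      have "special_exps W w' a b' k' = image_mset (\<lambda>_. K) (mset_set (W - {w'}))"
        unfolding special_exps_def cr Kk' sum.remove[OF finW w'(1)] by (simp add: add.commute)
      then have ex': "special_exps W w' a b' k' = special_exps W w a b k"
        using finW w'(1) unfolding ex by (simp add: image_mset_const_eq)
      have wv: "w \<in> W - {w'}" using wW w'w by auto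
      have m: "\<Sum>\<^sub># (special_exps W w' a b' k') \<le> \<Sum>\<^sub># (special_exps W w a b k)" unfolding ex' ..
      have c0: "crossings w' a b' w > 0" unfolding cr by (rule w'(2))
      from step[OF sp' m wv c0 less.hyps] show ?thesis unfolding P' ex' .
    qed
  qed
qed

section \<open>Three vertices, two of them with intervals of non-integral length\<close>

lemma floor_diff_frac:
  "\<lfloor>p - q\<rfloor> = \<lfloor>p - s\<rfloor> - \<lfloor>q - s\<rfloor> + (if frac (q - s) \<le> frac (p - s) then 0 else -1)" for p q s :: real
proof -
  have fp: "0 \<le> frac (p - s)" "frac (p - s) < 1" "0 \<le> frac (q - s)" "frac (q - s) < 1" by (simp_all add: frac_lt_1)
  have "p - q = of_int (\<lfloor>p - s\<rfloor> - \<lfloor>q - s\<rfloor>) + (frac (p - s) - frac (q - s))" by (simp add: frac_def)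
  then have eq: "p - q = of_int \<lfloor>p - s\<rfloor> - of_int \<lfloor>q - s\<rfloor> + (frac (p - s) - frac (q - s))" by simp
  show ?thesis
  proof (cases "frac (q - s) \<le> frac (p - s)")
    case True
    have "\<lfloor>p - q\<rfloor> = \<lfloor>p - s\<rfloor> - \<lfloor>q - s\<rfloor>"
      by (rule floor_unique; unfold of_int_diff; use eq fp True in linarith)
    then show ?thesis using True by simp
  next
    case False
    have "\<lfloor>p - q\<rfloor> = \<lfloor>p - s\<rfloor> - \<lfloor>q - s\<rfloor> - 1"
      by (rule floor_unique; unfold of_int_diff of_int_1; use eq fp False in linarith)
    then show ?thesis using False by simp
  qed
qed

lemma frac_eqD: "frac x = frac y \<Longrightarrow> x - y \<in> \<int>" for x y :: real
  by (auto simp: frac_def) (metis Ints_diff Ints_of_int add_diff_cancel_left' diff_diff_eq2 diff_add_cancel)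

text \<open>Both ends of \<open>y\<close> are moved inside their unit cells, measured from
  \<open>a x\<close>, to a common residue \<open>t\<close>; then only \<open>z\<close> may have
  non-integral length. By \<open>floor_diff_frac\<close> the bounds depend only on the cells and on
  the order of residues, and \<open>t1\<close>, \<open>t2\<close> say that the order relevant for
  \<open>z\<close> is kept. Against \<open>x\<close> only \<open>0 < t\<close> matters.\<close>

lemma ind_exps_three_aux:
  fixes Y :: "('i \<Rightarrow> 'k::field_char_0) set" and W :: "'a set"
  assumes r: "rep Y f {None} W" and W: "W = {x, y, z}" "x \<noteq> y" "x \<noteq> z" "y \<noteq> z"
    and bx: "b x = a x + real n" and ab: "a y \<le> b y" "a z \<le> b z"
    and az: "a z - a x \<notin> \<int>" and ay: "a y - a x \<notin> \<int>"
    and t: "0 < t" "t < 1" "t \<noteq> frac (a z - a x)"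
    and t1: "frac (a z - a x) \<le> t \<longleftrightarrow> frac (a z - a x) \<le> frac (b y - a x)"
    and t2: "t \<le> frac (b z - a x) \<longleftrightarrow> frac (a y - a x) \<le> frac (b z - a x)"
  shows "\<exists>e. ind_exps Y (arr Y f {None} (pairs W (ibound a b))) e"
proof -
  define A where "A = \<lfloor>a y - a x\<rfloor>"
  define B where "B = \<lfloor>b y - a x\<rfloor>"
  define a' where "a' = a(y := a x + of_int A + t)"
  define b' where "b' = b(y := a x + of_int B + t)"
  have AB: "A \<le> B" unfolding A_def B_def using ab by (intro floor_mono) simp
  have fa: "\<lfloor>a' y - a x\<rfloor> = A" "frac (a' y - a x) = t"
  proof -
    have "a' y - a x = of_int A + t" by (simp add: a'_def)
    moreover have "\<lfloor>of_int A + t\<rfloor> = A" using t by (intro floor_unique) auto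
    ultimately show "\<lfloor>a' y - a x\<rfloor> = A" "frac (a' y - a x) = t" by (simp_all add: frac_def)
  qed
  have fb: "\<lfloor>b' y - a x\<rfloor> = B" "frac (b' y - a x) = t"
  proof -
    have "b' y - a x = of_int B + t" by (simp add: b'_def)
    moreover have "\<lfloor>of_int B + t\<rfloor> = B" using t by (intro floor_unique) auto
    ultimately show "\<lfloor>b' y - a x\<rfloor> = B" "frac (b' y - a x) = t" by (simp_all add: frac_def)
  qed
  have fy: "frac (a y - a x) > 0" using ay by (simp add: frac_gt_0_iff)
  have fx0: "frac (b x - a x) = 0" by (simp add: bx)
  have same: "pairs W (ibound a b) = pairs W (ibound a' b')"
  proof (rule pairs_cong)
    fix u v assume uv: "u \<in> W" "v \<in> W" "u \<noteq> v"
    have "\<lfloor>b u - a v\<rfloor> = \<lfloor>b' u - a' v\<rfloor>"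
    proof (cases "u = y \<or> v = y")
      case False
      then show ?thesis by (simp add: a'_def b'_def)
    next
      case True
      consider "u = y" "v = x" | "u = y" "v = z" | "u = x" "v = y" | "u = z" "v = y" using True uv W by auto
      then show ?thesis
      proof cases
        case 1
        then show ?thesis using fb(1) W by (simp add: a'_def B_def)
      next
        case 2
        then show ?thesis
          unfolding floor_diff_frac[of "b u" "a v" "a x"] floor_diff_frac[of "b' u" "a' v" "a x"]
          using fb t1 W by (simp add: a'_def B_def)
      next
        case 3
        have bu: "b' u = b x" "b u = b x" using 3 W by (auto simp: b'_def)
        have n: "\<not> t \<le> frac (b x - a x)" "\<not> frac (a y - a x) \<le> frac (b x - a x)"
          unfolding fx0 not_le by (rule t(1), rule fy)
        show ?thesis
          unfolding floor_diff_frac[of "b u" "a v" "a x"] floor_diff_frac[of "b' u" "a' v" "a x"]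
          using fa n 3 bu by (simp add: A_def)
      next
        case 4
        have bu: "b' u = b z" "b u = b z" using 4 W by (auto simp: b'_def)
        show ?thesis
          unfolding floor_diff_frac[of "b u" "a v" "a x"] floor_diff_frac[of "b' u" "a' v" "a x"]
          using fa t2 4 bu by (simp add: A_def)
      qed
    qed
    then show "ibound a b u v = ibound a' b' u v" by (simp add: ibound_def)
  qed
  define k where "k v = (if v = x then n else nat (B - A))" for v
  have n1: "a' y - a x \<notin> \<int>" using fa(2) t(1) by (metis frac_eq_0_iff less_irrefl)
  have n2: "a' y - a z \<notin> \<int>"
  proof
    assume "a' y - a z \<in> \<int>"
    then obtain i where "a' y - a z = of_int i" by (auto elim: Ints_cases)
    then have "a' y - a x = (a z - a x) + of_int i" by simp
    then have "frac (a' y - a x) = frac ((a z - a x) + of_int i)" by (rule arg_cong)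
    also have "\<dots> = frac (a z - a x)" unfolding frac_def by simp
    finally have "frac (a' y - a x) = frac (a z - a x)" .
    then show False using fa(2) t(3) by simp
  qed
  have neg: "u - v \<notin> \<int> \<Longrightarrow> v - u \<notin> \<int>" for u v :: real by (metis Ints_minus minus_diff_eq)
  have "special W z a' b' k"
    unfolding special_def
  proof (intro conjI ballI impI)
    show "z \<in> W" using W by simp
    show "b' v = a' v + real (k v)" if "v \<in> W - {z}" for v
      using that W bx AB by (auto simp: a'_def b'_def k_def)
    show "a' z \<le> b' z" using ab W by (simp add: a'_def b'_def)
    fix u v assume "u \<in> W" "v \<in> W" "u \<noteq> v"
    then consider "u = x" "v = y" | "u = y" "v = x" | "u = x" "v = z" | "u = z" "v = x" | "u = y" "v = z" | "u = z" "v = y"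
      using W by auto
    then show "a' u - a' v \<notin> \<int>"
    proof cases
      case 1 then show ?thesis using neg[OF n1] W by (simp add: a'_def)
    next
      case 2 then show ?thesis using n1 W by (simp add: a'_def)
    next
      case 3 then show ?thesis using neg[OF az] W by (simp add: a'_def)
    next
      case 4 then show ?thesis using az W by (simp add: a'_def)
    next
      case 5 then show ?thesis using n2 W by (simp add: a'_def)
    next
      case 6 then show ?thesis using neg[OF n2] W by (simp add: a'_def)
    qed
  qed
  from ind_exps_special[OF r this] show ?thesis unfolding same by blast
qed

text \<open>A residue \<open>t\<close> for \<open>y\<close> has prescribed sides of
  \<open>az\<close> and \<open>bz\<close>. In two of the four cases these may be incompatible, but
  then \<open>ay < bz \<le> az < bY\<close> or \<open>bY < az \<le> bz < ay\<close>, and a residue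
  for \<open>z\<close> exists between \<open>ay\<close> and \<open>bY\<close> instead.\<close>

lemma ind_exps_three:
  fixes Y :: "('i \<Rightarrow> 'k::field_char_0) set" and W :: "'a set"
  assumes r: "rep Y f {None} W" and W: "W = {x, y, z}" "x \<noteq> y" "x \<noteq> z" "y \<noteq> z"
    and bx: "b x = a x + real n" and ab: "a y \<le> b y" "a z \<le> b z"
    and gx: "a y - a x \<notin> \<int>" "b y - a x \<notin> \<int>" "a z - a x \<notin> \<int>" "b z - a x \<notin> \<int>"
    and gyz: "a y - a z \<notin> \<int>" "a y - b z \<notin> \<int>" "b y - a z \<notin> \<int>" "b y - b z \<notin> \<int>"
  shows "\<exists>e. ind_exps Y (arr Y f {None} (pairs W (ibound a b))) e"
proof -
  define ay where "ay = frac (a y - a x)"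
  define bY where "bY = frac (b y - a x)"
  define az where "az = frac (a z - a x)"
  define bz where "bz = frac (b z - a x)"
  have rng: "0 < ay" "ay < 1" "0 < bY" "bY < 1" "0 < az" "az < 1" "0 < bz" "bz < 1"
    unfolding ay_def bY_def az_def bz_def using gx by (simp_all add: frac_gt_0_iff frac_lt_1)
  have fne: "frac (u - a x) \<noteq> frac (v - a x)" if "u - v \<notin> \<int>" for u v
    using frac_eqD[of "u - a x" "v - a x"] that by auto
  have ne: "ay \<noteq> az" "ay \<noteq> bz" "bY \<noteq> az" "bY \<noteq> bz"
    unfolding ay_def bY_def az_def bz_def using gyz by (auto dest: fne)
  have neg: "u - v \<notin> \<int> \<Longrightarrow> v - u \<notin> \<int>" for u v :: real by (metis Ints_minus minus_diff_eq)
  have aux1: ?thesis if "0 < t" "t < 1" "t \<noteq> az" "az \<le> t \<longleftrightarrow> az \<le> bY" "t \<le> bz \<longleftrightarrow> ay \<le> bz" for t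
    by (rule ind_exps_three_aux[OF r W bx ab gx(3,1) that(1,2)])
      (use that in \<open>auto simp: ay_def bY_def az_def bz_def\<close>)
  have W': "W = {x, z, y}" using W by auto
  have aux2: ?thesis if "0 < t" "t < 1" "t \<noteq> ay" "ay \<le> t \<longleftrightarrow> ay \<le> bz" "t \<le> bY \<longleftrightarrow> az \<le> bY" for t
    by (rule ind_exps_three_aux[OF r W' W(3,2) W(4)[symmetric] bx ab(2,1) gx(1,3) that(1,2)])
      (use that in \<open>auto simp: ay_def bY_def az_def bz_def\<close>)
  show ?thesis
  proof (cases "az < bY")
    case t1: True
    show ?thesis
    proof (cases "ay < bz")
      case t2: True
      show ?thesis
      proof (cases "az < bz")
        case True
        show ?thesis by (rule aux1[of "(az + bz) / 2"]) (use t1 t2 True rng in auto)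
      next
        case False
        show ?thesis by (rule aux2[of "(ay + bY) / 2"]) (use t1 t2 False rng ne in auto)
      qed
    next
      case False
      show ?thesis by (rule aux1[of "(max az bz + 1) / 2"]) (use t1 False rng ne in \<open>auto simp: max_def\<close>)
    qed
  next
    case t1: False
    show ?thesis
    proof (cases "ay < bz")
      case True
      show ?thesis by (rule aux1[of "min az bz / 2"]) (use t1 True rng ne in \<open>auto simp: min_def\<close>)
    next
      case t2: False
      show ?thesis
      proof (cases "bz < az")
        case True
        show ?thesis by (rule aux1[of "(az + bz) / 2"]) (use t1 t2 True rng ne in auto)
      next
        case False
        show ?thesis by (rule aux2[of "(ay + bY) / 2"]) (use t1 t2 False rng ne in auto)
      qed
    qed
  qed
qed

section \<open>Flats\<close>

lemma restriction_restriction: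
  assumes KY: "K \<subseteq> Y" shows "restriction (restriction A Y) K = restriction A K"
proof (intro set_eqI iffI)
  fix Z assume "Z \<in> restriction (restriction A Y) K"
  then obtain h where h: "h \<in> A" "\<not> K \<subseteq> h \<inter> Y" "Z = h \<inter> Y \<inter> K" by (auto simp: restriction_def)
  have "\<not> K \<subseteq> h" "Z = h \<inter> K" using h KY by auto
  then show "Z \<in> restriction A K" using h(1) by (auto simp: restriction_def)
next
  fix Z assume "Z \<in> restriction A K"
  then obtain h where h: "h \<in> A" "\<not> K \<subseteq> h" "Z = h \<inter> K" by (auto simp: restriction_def)
  have "\<not> Y \<subseteq> h" "\<not> K \<subseteq> h \<inter> Y" "Z = h \<inter> Y \<inter> K" using h KY by auto
  then show "Z \<in> restriction (restriction A Y) K" unfolding restriction_def using h(1) by blast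
qed

lemma restriction_in_lattice:
  assumes Y: "Y \<in> intersection_lattice X A" and K: "K \<in> restriction A Y"
  shows "K \<in> intersection_lattice X A"
proof -
  obtain B where B: "B \<subseteq> A" "Y = X \<inter> \<Inter> B" using Y by (auto simp: intersection_lattice_def)
  obtain h where h: "h \<in> A" "K = h \<inter> Y" using K by (auto simp: restriction_def)
  have "K = X \<inter> \<Inter> (insert h B)" using B h by auto
  then show ?thesis using B h unfolding intersection_lattice_def by blast
qed

text \<open>Flats not contained in \<open>z = 0\<close>: the coordinate \<open>None\<close> survives
  in \<open>rep\<close>.\<close>

definition flat_int :: "('i \<Rightarrow> 'k::field) set \<Rightarrow> ('i \<Rightarrow> 'k) set set \<Rightarrow> ('i \<Rightarrow> 'k) set \<Rightarrow>
    (('i \<Rightarrow> 'k) \<Rightarrow> ('a option \<Rightarrow> 'k)) \<Rightarrow> 'a set \<Rightarrow> ('a \<Rightarrow> real) \<Rightarrow> ('a \<Rightarrow> real) \<Rightarrow> bool" where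
  "flat_int X A Y f W a b \<longleftrightarrow> Y \<in> intersection_lattice X A \<and> W \<noteq> {} \<and> rep Y f {None} W \<and>
     (\<forall>v\<in>W. a v \<le> b v) \<and> restriction A Y = arr Y f {None} (pairs W (ibound a b))"

lemma flat_int_top:
  assumes r: "rep X f {None} V" and V: "V \<noteq> {}" and ab: "\<And>v. v \<in> V \<Longrightarrow> a v \<le> b v"
    and A: "A = arr X f {None} (pairs V (ibound a b))"
  shows "flat_int X A X f V a b"
proof -
  have hyp: "\<forall>h\<in>A. hyperplane X h" unfolding A by (rule arr_hyperplanes[OF r pairs_dpairs])
  have "X \<in> intersection_lattice X A" unfolding intersection_lattice_def by (auto intro!: exI[of _ "{}"])
  moreover have "restriction A X = A"
  proof -
    have "\<not> X \<subseteq> h" "h \<inter> X = h" if "h \<in> A" for h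
      using hyp that by (auto simp: hyperplane_def is_form_def)
    then show ?thesis by (force simp: restriction_def)
  qed
  ultimately show ?thesis using r V ab by (simp add: flat_int_def A)
qed

lemma floor_max: "\<lfloor>max x y\<rfloor> = max \<lfloor>x\<rfloor> \<lfloor>y\<rfloor>" for x y :: real
  using floor_mono[of x y] floor_mono[of y x] by (simp add: max_def) linarith

text \<open>Floors commute with maxima and with integer shifts, so \<open>merge\<close> of interval
  bounds is the bound of the convex hull. The hull is the union, as \<open>t\<close> says that the
  translated interval of \<open>u\<close> meets that of \<open>v\<close>.\<close>

lemma flat_int_merge:
  fixes Y :: "('i \<Rightarrow> 'k::field_char_0) set"
  assumes fl: "flat_int X A Y f W a b" and t: "(u, v, c) \<in> pairs W (ibound a b)"
  shows "flat_int X A (hp Y f (u, v, c)) (\<lambda>y. (f y)(Some u := 0)) (W - {u})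
    (a(v := min (a v) (a u + of_int c))) (b(v := max (b v) (b u + of_int c)))"
proof -
  let ?a = "a(v := min (a v) (a u + of_int c))" and ?b = "b(v := max (b v) (b u + of_int c))"
  let ?H = "hp Y f (u, v, c)"
  have Y: "Y \<in> intersection_lattice X A" and r: "rep Y f {None} W" and ab: "\<And>v. v \<in> W \<Longrightarrow> a v \<le> b v"
    and R: "restriction A Y = arr Y f {None} (pairs W (ibound a b))" using fl by (auto simp: flat_int_def)
  have uv: "u \<in> W" "v \<in> W" "u \<noteq> v" using t by (auto simp: pairs_def)
  have HY: "?H \<subseteq> Y" by (auto simp: hp_def)
  have H: "?H \<in> restriction A Y" unfolding R arr_def using t by blast
  have "pairs (W - {u}) (merge (ibound a b) u v c) = pairs (W - {u}) (ibound ?a ?b)"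
  proof (rule pairs_cong)
    fix x y assume "x \<in> W - {u}" "y \<in> W - {u}" "x \<noteq> y"
    have 1: "\<lfloor>max (b v) (b u + of_int c) - s\<rfloor> = max \<lfloor>b v - s\<rfloor> (\<lfloor>b u - s\<rfloor> + c)" for s
    proof -
      have "max (b v) (b u + of_int c) - s = max (b v - s) (b u - s + of_int c)" by (auto simp: max_def)
      then show ?thesis by (simp only: floor_max floor_add_int)
    qed
    have 2: "\<lfloor>s - min (a v) (a u + of_int c)\<rfloor> = max \<lfloor>s - a v\<rfloor> (\<lfloor>s - a u\<rfloor> - c)" for s
    proof -
      have "s - min (a v) (a u + of_int c) = max (s - a v) (s - a u - of_int c)" by (auto simp: max_def min_def)
      then show ?thesis by (simp only: floor_max floor_diff_of_int)
    qed
    consider "x = v" "y \<noteq> v" | "y = v" "x \<noteq> v" | "x \<noteq> v" "y \<noteq> v" using \<open>x \<noteq> y\<close> by blast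
    then show "merge (ibound a b) u v c x y = ibound ?a ?b x y"
      by cases (simp_all add: 1 2 merge_def ibound_def)
  qed
  then have "restriction A ?H = arr ?H (\<lambda>y. (f y)(Some u := 0)) {None} (pairs (W - {u}) (ibound ?a ?b))"
    using restriction_arr_pairs[OF r t tri_ibound[OF ab]] restriction_restriction[OF HY, of A] R by simp
  moreover have "?a x \<le> ?b x" if "x \<in> W - {u}" for x using ab[of x] ab[OF uv(2)] that by auto
  ultimately show ?thesis
    using restriction_in_lattice[OF Y H] rep_hp[OF r uv] uv by (auto simp: flat_int_def)
qed

lemma finite_pairs: assumes "finite W" shows "finite (pairs W L)"
proof -
  have "pairs W L \<subseteq> (SIGMA u:W. SIGMA v:W. {- L u v..L v u})" by (auto simp: pairs_def)
  moreover have "finite (SIGMA u:W. SIGMA v:W. {- L u v..L v u})" using assms by (intro finite_SigmaI) auto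
  ultimately show ?thesis by (rule finite_subset)
qed

text \<open>Induction over the hyperplanes that cut out the flat. Off \<open>z = 0\<close> each cut
  merges two intervals and \<open>Inv\<close> persists. Inside \<open>z = 0\<close> the constants
  disappear; as \<open>Iex\<close> gives a hyperplane for every pair, what remains is a full braid
  arrangement, which further cuts reproduce.\<close>

lemma flats_ind_exps:
  fixes X :: "('i \<Rightarrow> 'k::field_char_0) set" and V :: "'a set"
  assumes r: "rep X f0 {None} V" and V: "V \<noteq> {}" and A: "A = arr X f0 {None} (pairs V (ibound a0 b0))"
    and I0: "Inv V a0 b0"
    and Iab: "\<And>W a b v. Inv W a b \<Longrightarrow> v \<in> W \<Longrightarrow> a v \<le> b v"
    and Iex: "\<And>W a b u v. Inv W a b \<Longrightarrow> u \<in> W \<Longrightarrow> v \<in> W \<Longrightarrow> u \<noteq> v \<Longrightarrow> \<exists>c. (u, v, c) \<in> pairs W (ibound a b)"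
    and Imerge: "\<And>W a b u v c. Inv W a b \<Longrightarrow> (u, v, c) \<in> pairs W (ibound a b) \<Longrightarrow>
      Inv (W - {u}) (a(v := min (a v) (a u + of_int c))) (b(v := max (b v) (b u + of_int c)))"
    and Iind: "\<And>(Y :: ('i \<Rightarrow> 'k) set) f W a b. Inv W a b \<Longrightarrow> W \<noteq> {} \<Longrightarrow> rep Y f {None} (W :: 'a set) \<Longrightarrow>
      \<exists>e. ind_exps Y (arr Y f {None} (pairs W (ibound a b))) e"
    and Y: "Y \<in> intersection_lattice X A"
  shows "\<exists>e. ind_exps Y (restriction A Y) e"
proof -
  have finV: "finite V" by (rule repD(3)[OF r])
  have finA: "finite A" unfolding A arr_def using finite_pairs[OF finV] by auto
  obtain B where B: "B \<subseteq> A" "Y = X \<inter> \<Inter> B" using Y by (auto simp: intersection_lattice_def)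
  have "(\<exists>(f :: ('i \<Rightarrow> 'k) \<Rightarrow> ('a option \<Rightarrow> 'k)) W a b. flat_int X A (X \<inter> \<Inter> B) f W a b \<and> Inv W a b) \<or>
    (\<exists>(f :: ('i \<Rightarrow> 'k) \<Rightarrow> ('a option \<Rightarrow> 'k)) W. rep (X \<inter> \<Inter> B) f {} W \<and>
       restriction A (X \<inter> \<Inter> B) = arr (X \<inter> \<Inter> B) f {} (point_pairs (\<lambda>_. 0) W))"
    using finite_subset[OF B(1) finA] B(1)
  proof (induction B rule: finite_induct)
    case empty
    have "flat_int X A X f0 V a0 b0" by (rule flat_int_top[OF r V Iab[OF I0] A])
    then show ?case using I0 by auto
  next
    case (insert h B)
    define Z where "Z = X \<inter> \<Inter> B"
    define K where "K = X \<inter> \<Inter> (insert h B)"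
    have K: "K = h \<inter> Z" by (auto simp: K_def Z_def)
    have IH: "(\<exists>(f :: ('i \<Rightarrow> 'k) \<Rightarrow> ('a option \<Rightarrow> 'k)) W a b. flat_int X A Z f W a b \<and> Inv W a b) \<or>
      (\<exists>(f :: ('i \<Rightarrow> 'k) \<Rightarrow> ('a option \<Rightarrow> 'k)) W. rep Z f {} W \<and> restriction A Z = arr Z f {} (point_pairs (\<lambda>_. 0) W))"
      using insert unfolding Z_def by blast
    show ?case unfolding K_def[symmetric]
    proof (cases "Z \<subseteq> h")
      case True
      then have "K = Z" using K by auto
      then show "(\<exists>(f :: ('i \<Rightarrow> 'k) \<Rightarrow> ('a option \<Rightarrow> 'k)) W a b. flat_int X A K f W a b \<and> Inv W a b) \<or>
        (\<exists>(f :: ('i \<Rightarrow> 'k) \<Rightarrow> ('a option \<Rightarrow> 'k)) W. rep K f {} W \<and> restriction A K = arr K f {} (point_pairs (\<lambda>_. 0) W))"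
        using IH by simp
    next
      case False
      then have KR: "K \<in> restriction A Z" unfolding K restriction_def using insert.prems by blast
      have KZ: "K \<subseteq> Z" using K by auto
      from IH show "(\<exists>(f :: ('i \<Rightarrow> 'k) \<Rightarrow> ('a option \<Rightarrow> 'k)) W a b. flat_int X A K f W a b \<and> Inv W a b) \<or>
        (\<exists>(f :: ('i \<Rightarrow> 'k) \<Rightarrow> ('a option \<Rightarrow> 'k)) W. rep K f {} W \<and> restriction A K = arr K f {} (point_pairs (\<lambda>_. 0) W))"
      proof (elim disjE exE conjE)
        fix f :: "('i \<Rightarrow> 'k) \<Rightarrow> ('a option \<Rightarrow> 'k)" and W a b
        assume fl: "flat_int X A Z f W a b" and I: "Inv W a b"
        then have rZ: "rep Z f {None} W" and RZ: "restriction A Z = arr Z f {None} (pairs W (ibound a b))"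
          by (auto simp: flat_int_def)
        from KR consider "K = hz Z f" | u v c where "(u, v, c) \<in> pairs W (ibound a b)" "K = hp Z f (u, v, c)"
          unfolding RZ arr_def by auto
        then show ?thesis
        proof cases
          case 1
          have N: "None \<in> {None}" by simp
          have "{(k, l, 0) | k l. \<exists>d. (k, l, d) \<in> pairs W (ibound a b)} = point_pairs (\<lambda>_. 0) W"
            using Iex[OF I] pairs_dpairs[of W "ibound a b"] by (auto simp: point_pairs_def dpairs_def)
          then have "restriction A K = arr K (\<lambda>y. (f y)(None := 0)) {} (point_pairs (\<lambda>_. 0) W)"
            using restriction_arr_hz[OF rZ N pairs_dpairs, of "ibound a b"] restriction_restriction[OF KZ, of A] RZ 1 by simp
          then show ?thesis using rep_hz[OF rZ N] 1 by blast
        next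
          case 2
          show ?thesis using flat_int_merge[OF fl 2(1)] Imerge[OF I 2(1)] 2(2) by blast
        qed
      next
        fix f :: "('i \<Rightarrow> 'k) \<Rightarrow> ('a option \<Rightarrow> 'k)" and W
        assume rZ: "rep Z f {} W" and RZ: "restriction A Z = arr Z f {} (point_pairs (\<lambda>_. 0) W)"
        have pd: "point_pairs (\<lambda>_. 0) W \<subseteq> dpairs W" by (rule point_pairs_subset[OF order_refl])
        obtain u v where uv: "u \<in> W" "v \<in> W" "u \<noteq> v" "K = hp Z f (u, v, 0)"
          using KR unfolding RZ arr_def by (auto simp: point_pairs_def)
        have "{((if k = u then v else k), (if l = u then v else l), d - (if k = u then 0 else 0) + (if l = u then 0 else 0)) |
          k l d. (k, l, d) \<in> point_pairs (\<lambda>_. 0) W \<and> {k, l} \<noteq> {u, v}} = point_pairs (\<lambda>_. 0) (W - {u})" (is "?S = ?R")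
        proof (intro set_eqI iffI)
          fix q assume "q \<in> ?S"
          then show "q \<in> ?R" using uv by (auto simp: point_pairs_def doubleton_eq_iff)
        next
          fix q assume "q \<in> ?R"
          then obtain k l where "q = (k, l, 0)" "k \<in> W - {u}" "l \<in> W - {u}" "k \<noteq> l" by (auto simp: point_pairs_def)
          then show "q \<in> ?S"
            by (intro CollectI exI[of _ k] exI[of _ l] exI[of _ 0]) (auto simp: point_pairs_def doubleton_eq_iff)
        qed
        then have "restriction A K = arr K (\<lambda>y. (f y)(Some u := 0)) {} (point_pairs (\<lambda>_. 0) (W - {u}))"
          using restriction_arr_hp[OF rZ uv(1,2,3) pd, of 0] restriction_restriction[OF KZ, of A] RZ uv(4) by simp
        then show ?thesis using rep_hp[OF rZ uv(1,2,3)] uv(4) by blast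
      qed
    qed
  qed
  then show ?thesis
  proof (elim disjE exE conjE)
    fix f :: "('i \<Rightarrow> 'k) \<Rightarrow> ('a option \<Rightarrow> 'k)" and W a b
    assume "flat_int X A (X \<inter> \<Inter> B) f W a b" "Inv W a b"
    then show ?thesis using Iind[of W a b Y f] B(2) by (auto simp: flat_int_def)
  next
    fix f :: "('i \<Rightarrow> 'k) \<Rightarrow> ('a option \<Rightarrow> 'k)" and W
    assume "rep (X \<inter> \<Inter> B) f {} W" "restriction A (X \<inter> \<Inter> B) = arr (X \<inter> \<Inter> B) f {} (point_pairs (\<lambda>_. 0) W)"
    then show ?thesis using ind_exps_points[OF _ order_refl] B(2) by metis
  qed
qed

section \<open>The cone in coordinates, and digraphs without edges\<close>

lemma affine_hyperplane_eqD:
  assumes ij: "i \<in> V" "j \<in> V" "i \<noteq> j" and xy: "x \<in> V" "y \<in> V" "x \<noteq> y"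
    and eq: "(affine_hyperplane V i j c :: ('a \<Rightarrow> 'k::field_char_0) set) = affine_hyperplane V x y d"
  shows "(x = i \<and> y = j \<and> d = c) \<or> (x = j \<and> y = i \<and> d = - c)"
proof -
  have mem: "s i - s j = of_int c \<longleftrightarrow> s x - s y = of_int d" if "s \<in> coord_space V" for s :: "'a \<Rightarrow> 'k"
    using eq that by (auto simp: affine_hyperplane_def set_eq_iff)
  define s where "s k = (if k = i then of_int c else 0 :: 'k)" for k
  have s: "s \<in> coord_space V" using ij by (auto simp: s_def coord_space_def)
  have sd: "s x - s y = of_int d" using mem[OF s] ij by (simp add: s_def)
  have up: "s(k := s k + 1) \<in> coord_space V" if "k \<in> V" for k using s that by (auto simp: coord_space_def)
  have sc: "s i - s j = of_int c" using ij by (simp add: s_def)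
  have "x \<in> {i, j}"
  proof (rule ccontr)
    assume "x \<notin> {i, j}"
    then have "i \<noteq> x" "j \<noteq> x" by auto
    then have "s x + 1 - s y = of_int d" using mem[OF up[OF xy(1)]] sc xy(3) by simp
    then show False using sd by (simp add: algebra_simps)
  qed
  moreover have "y \<in> {i, j}"
  proof (rule ccontr)
    assume "y \<notin> {i, j}"
    then have "i \<noteq> y" "j \<noteq> y" by auto
    then have "s x - (s y + 1) = of_int d" using mem[OF up[OF xy(2)]] sc xy(3) by simp
    then show False using sd by (simp add: algebra_simps)
  qed
  ultimately consider "x = i" "y = j" | "x = j" "y = i" using xy by blast
  then show ?thesis
  proof cases
    case 1
    then have "(of_int c :: 'k) = of_int d" using sd ij by (simp add: s_def)
    then show ?thesis using 1 by simp
  next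
    case 2
    then have "(of_int (- c) :: 'k) = of_int d" using sd ij by (simp add: s_def)
    then show ?thesis using 2 by (simp only: of_int_eq_iff) simp
  qed
qed

lemma rep_cone_space: "finite V \<Longrightarrow> rep (cone_space V :: ('a option \<Rightarrow> 'k::field_char_0) set) (\<lambda>y. y) {None} V"
proof -
  assume "finite V"
  have "bij_betw (\<lambda>y. y) (cone_space V :: ('a option \<Rightarrow> 'k) set) (coord_space ({None} \<union> Some ` V))"
    by (simp add: cone_space_def bij_betw_def)
  then show ?thesis using \<open>finite V\<close>
    by (auto simp: rep_def linear_map_iff cone_space_def coord_space_def fun_space.subspace_def)
qed

text \<open>Membership in \<open>deformation\<close> is tested on the affine hyperplane as a set.
  \<open>affine_hyperplane_eqD\<close> recovers its triple up to reversal, and the condition in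
  \<open>pairs\<close> is symmetric under reversal.\<close>

lemma cone_deformation_arr:
  "(cone_deformation V n E :: ('a option \<Rightarrow> 'k::field_char_0) set set) =
    arr (cone_space V) (\<lambda>y. y) {None} (pairs V (\<lambda>u v. int (n u) + edge_ind E u v))" (is "?L = ?R")
proof -
  have iff: "(affine_hyperplane V i j c :: ('a \<Rightarrow> 'k) set) \<in> deformation V n E \<longleftrightarrow>
      (i, j, c) \<in> pairs V (\<lambda>u v. int (n u) + edge_ind E u v)" if ij: "i \<in> V" "j \<in> V" "i \<noteq> j" for i j c
  proof
    assume "(affine_hyperplane V i j c :: ('a \<Rightarrow> 'k) set) \<in> deformation V n E"
    then obtain x y d where xy: "x \<in> V" "y \<in> V" "x \<noteq> y"
      "(affine_hyperplane V i j c :: ('a \<Rightarrow> 'k) set) = affine_hyperplane V x y d"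
      "- int (n x) - edge_ind E x y \<le> d" "d \<le> int (n y) + edge_ind E y x" unfolding deformation_def by blast
    from affine_hyperplane_eqD[OF ij xy(1-4)] xy(5,6) ij
    show "(i, j, c) \<in> pairs V (\<lambda>u v. int (n u) + edge_ind E u v)" by (auto simp: pairs_def)
  next
    assume "(i, j, c) \<in> pairs V (\<lambda>u v. int (n u) + edge_ind E u v)"
    then show "(affine_hyperplane V i j c :: ('a \<Rightarrow> 'k) set) \<in> deformation V n E"
      unfolding deformation_def pairs_def by auto
  qed
  have "?L = insert (hz (cone_space V) (\<lambda>y. y)) {hp (cone_space V) (\<lambda>y. y) (i, j, c) | i j c.
      (i, j, c) \<in> pairs V (\<lambda>u v. int (n u) + edge_ind E u v)}"
  proof -
    have "i \<in> V \<and> j \<in> V \<and> i \<noteq> j \<and> (affine_hyperplane V i j c :: ('a \<Rightarrow> 'k) set) \<in> deformation V n E \<longleftrightarrow>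
        (i, j, c) \<in> pairs V (\<lambda>u v. int (n u) + edge_ind E u v)" for i j c
      using iff[of i j c] by (auto simp: pairs_def)
    then show ?thesis unfolding cone_deformation_def hz_def hp_def prod.case by (simp only:)
  qed
  also have "\<dots> = ?R" unfolding arr_def by auto
  finally show ?thesis .
qed

text \<open>Integrality of all ends survives minima, maxima and integer translation, so it can serve
  as the invariant.\<close>

lemma catalan_flats:
  assumes "finite V" "V \<noteq> {}" "Y \<in> intersection_lattice (cone_space V) (cone_deformation V n {})"
  shows "\<exists>e. ind_exps Y (restriction (cone_deformation V n {} :: ('a option \<Rightarrow> 'k::field_char_0) set set) Y) e"
proof (rule flats_ind_exps[OF rep_cone_space[OF assms(1)] assms(2), where Y = Y and
    Inv = "\<lambda>W a b. \<forall>v\<in>W. a v \<in> \<int> \<and> b v \<in> \<int> \<and> a v \<le> b v" and ?a0.0 = "\<lambda>_. 0" and ?b0.0 = "\<lambda>v. real (n v)"])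
  show "(cone_deformation V n {} :: ('a option \<Rightarrow> 'k) set set) =
      arr (cone_space V) (\<lambda>y. y) {None} (pairs V (ibound (\<lambda>_. 0) (\<lambda>v. real (n v))))"
    unfolding cone_deformation_arr by (intro arg_cong[where f = "arr _ _ _"] pairs_cong) (simp add: ibound_def edge_ind_def)
  show "\<forall>v\<in>V. (0::real) \<in> \<int> \<and> real (n v) \<in> \<int> \<and> 0 \<le> real (n v)" by simp
  show "Y \<in> intersection_lattice (cone_space V) (cone_deformation V n {})" by (rule assms(3))
next
  fix W :: "'a set" and a b :: "'a \<Rightarrow> real"
  assume I: "\<forall>v\<in>W. a v \<in> \<int> \<and> b v \<in> \<int> \<and> a v \<le> b v"
  show "a v \<le> b v" if "v \<in> W" for v using I that by blast
  show "\<exists>c. (u, v, c) \<in> pairs W (ibound a b)" if uv: "u \<in> W" "v \<in> W" "u \<noteq> v" for u v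
  proof (intro exI)
    \<comment> \<open>This constant moves the bottom of \<open>u\<close> onto the bottom of
      \<open>v\<close>, so the two intervals meet.\<close>
    have "a v - a u \<in> \<int>" using I uv by (intro Ints_diff) auto
    then have "of_int \<lfloor>a v - a u\<rfloor> = a v - a u" by (auto elim: Ints_cases)
    moreover have "a u \<le> b u" "a v \<le> b v" using I uv by auto
    ultimately have "- \<lfloor>b u - a v\<rfloor> \<le> \<lfloor>a v - a u\<rfloor>" "\<lfloor>a v - a u\<rfloor> \<le> \<lfloor>b v - a u\<rfloor>" by linarith+
    then show "(u, v, \<lfloor>a v - a u\<rfloor>) \<in> pairs W (ibound a b)" using uv by (simp add: pairs_def ibound_def)
  qed
  show "\<forall>x\<in>W - {u}. (a(v := min (a v) (a u + of_int c))) x \<in> \<int> \<and> (b(v := max (b v) (b u + of_int c))) x \<in> \<int> \<and>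
      (a(v := min (a v) (a u + of_int c))) x \<le> (b(v := max (b v) (b u + of_int c))) x"
    if t: "(u, v, c) \<in> pairs W (ibound a b)" for u v c
  proof -
    have uv: "u \<in> W" "v \<in> W" using t by (auto simp: pairs_def)
    show ?thesis using I uv by (auto simp: min_def max_def)
  qed
  fix Y :: "('a option \<Rightarrow> 'k) set" and f :: "('a option \<Rightarrow> 'k) \<Rightarrow> ('a option \<Rightarrow> 'k)"
  assume W: "W \<noteq> {}" and r: "rep Y f {None} W"
  have "pairs W (ibound a b) = pairs W (\<lambda>u v. \<lfloor>b u\<rfloor> - \<lfloor>a v\<rfloor>)"
    by (rule pairs_cong) (use I in \<open>auto simp: ibound_def elim!: Ints_cases\<close>)
  moreover have "\<lfloor>a v\<rfloor> \<le> \<lfloor>b v\<rfloor>" if "v \<in> W" for v using I that by (simp add: floor_mono)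
  ultimately show "\<exists>e. ind_exps Y (arr Y f {None} (pairs W (ibound a b))) e"
    using ind_exps_catalan[OF r W, of "\<lambda>v. \<lfloor>a v\<rfloor>" "\<lambda>v. \<lfloor>b v\<rfloor>"] by auto
qed

section \<open>The transitive tournament: residues of interval ends\<close>

definition residue :: "nat \<Rightarrow> nat \<Rightarrow> real" where
  "residue l i = real i / real (l + 1)"

lemma residue_less: "i < j \<Longrightarrow> residue l i < residue l j"
  by (simp add: residue_def divide_strict_right_mono)

lemma residue_range: "i \<in> {1..l} \<Longrightarrow> 0 < residue l i \<and> residue l i < 1"
  by (simp add: residue_def)

text \<open>Two different residues differ by a nonzero number strictly between -1 and 1.\<close>

lemma residue_distinct:
  assumes ij: "i \<in> {1..l}" "j \<in> {1..l}" "i \<noteq> j" and "x - residue l i \<in> \<int>" "y - residue l j \<in> \<int>"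
  shows "x - y \<notin> \<int>"
proof
  assume "x - y \<in> \<int>"
  then have "(y - residue l j) - (x - residue l i) + (x - y) \<in> \<int>" by (intro Ints_add[OF Ints_diff[OF assms(5,4)]])
  then obtain k where k: "residue l i - residue l j = of_int k" by (auto elim!: Ints_cases simp: algebra_simps)
  have "residue l i \<noteq> residue l j" using ij residue_less[of i j l] residue_less[of j i l] by (cases "i < j") auto
  then show False using k residue_range[OF ij(1)] residue_range[OF ij(2)] by (cases "k = 0") auto
qed

text \<open>\<open>p w\<close> and \<open>q w\<close> index the residues of bottom and top. Their
  disjointness between vertices is the genericity asked for by \<open>special\<close>; length at
  least 1 ensures that any two intervals meet after an integer translation.\<close>

definition shi_inv :: "nat \<Rightarrow> nat set \<Rightarrow> (nat \<Rightarrow> real) \<Rightarrow> (nat \<Rightarrow> real) \<Rightarrow> bool" where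
  "shi_inv l W a b \<longleftrightarrow> (\<exists>p q. (\<forall>w\<in>W. p w \<in> {1..l} \<and> q w \<in> {1..l} \<and> a w - residue l (p w) \<in> \<int> \<and>
     b w - residue l (q w) \<in> \<int> \<and> a w + 1 \<le> b w) \<and> (\<forall>u\<in>W. \<forall>v\<in>W. u \<noteq> v \<longrightarrow> {p u, q u} \<inter> {p v, q v} = {}))"

text \<open>All residues lie strictly between 0 and 1, so the floor of
  \<open>n u + 1 + (s u - s v)\<close> is \<open>n u + 1\<close> or \<open>n u\<close> by the sign
  of \<open>s u - s v\<close>. This reproduces \<open>edge_ind\<close>, since edges run from larger
  to smaller vertices.\<close>

lemma shi_arr:
  assumes "V = {1..l}" "E = {(j, i) | i j. i \<in> V \<and> j \<in> V \<and> i < j}"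
  shows "pairs V (\<lambda>u v. int (n u) + edge_ind E u v) =
    pairs V (ibound (residue l) (\<lambda>v. residue l v + real (n v + 1)))"
proof (rule pairs_cong)
  fix u v assume uv: "u \<in> V" "v \<in> V" "u \<noteq> v"
  have ru: "0 < residue l u" "residue l u < 1" "0 < residue l v" "residue l v < 1"
    using residue_range uv assms by blast+
  show "int (n u) + edge_ind E u v = ibound (residue l) (\<lambda>v. residue l v + real (n v + 1)) u v"
  proof (cases "v < u")
    case True
    have "\<lfloor>residue l u + real (n u + 1) - residue l v\<rfloor> = int (n u) + 1"
      using residue_less[OF True, of l] ru by (intro floor_unique) auto
    then show ?thesis using True uv assms(2) by (auto simp: ibound_def edge_ind_def)
  next
    case False
    then have "u < v" using uv by simp
    have "\<lfloor>residue l u + real (n u + 1) - residue l v\<rfloor> = int (n u)"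
      using residue_less[OF \<open>u < v\<close>, of l] ru by (intro floor_unique) auto
    then show ?thesis using \<open>u < v\<close> uv assms(2) by (auto simp: ibound_def edge_ind_def)
  qed
qed

text \<open>Each end of the union is an end of one of the two intervals up to an integer, so
  residues are only handed on.\<close>

lemma shi_inv_merge:
  assumes I: "shi_inv l W a b" and t: "(u, v, c) \<in> pairs W (ibound a b)"
  shows "shi_inv l (W - {u}) (a(v := min (a v) (a u + of_int c))) (b(v := max (b v) (b u + of_int c)))"
proof -
  obtain p q where inv: "\<forall>w\<in>W. p w \<in> {1..l} \<and> q w \<in> {1..l} \<and> a w - residue l (p w) \<in> \<int> \<and>
     b w - residue l (q w) \<in> \<int> \<and> a w + 1 \<le> b w" "\<forall>u\<in>W. \<forall>v\<in>W. u \<noteq> v \<longrightarrow> {p u, q u} \<inter> {p v, q v} = {}"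
    using I[unfolded shi_inv_def] by (elim exE conjE)
  have pq: "p w \<in> {1..l} \<and> q w \<in> {1..l} \<and> a w - residue l (p w) \<in> \<int> \<and>
     b w - residue l (q w) \<in> \<int> \<and> a w + 1 \<le> b w" if "w \<in> W" for w
    using inv(1) that by (rule bspec)
  have dis: "{p x, q x} \<inter> {p y, q y} = {}" if "x \<in> W" "y \<in> W" "x \<noteq> y" for x y
    using inv(2)[rule_format, OF that] .
  have uv: "u \<in> W" "v \<in> W" "u \<noteq> v" using t by (auto simp: pairs_def)
  define p' where "p' = p(v := if a v \<le> a u + of_int c then p v else p u)"
  define q' where "q' = q(v := if b v \<le> b u + of_int c then q u else q v)"
  have sh: "x + of_int c - r \<in> \<int>" if "x - r \<in> \<int>" for x r :: real
  proof -
    have "(x - r) + of_int c \<in> \<int>" using that by (intro Ints_add) auto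
    then show ?thesis by (simp add: algebra_simps)
  qed
  define a' where "a' = a(v := min (a v) (a u + of_int c))"
  define b' where "b' = b(v := max (b v) (b u + of_int c))"
  have P: "p' w \<in> {1..l} \<and> q' w \<in> {1..l} \<and> a' w - residue l (p' w) \<in> \<int> \<and>
     b' w - residue l (q' w) \<in> \<int> \<and> a' w + 1 \<le> b' w" if w: "w \<in> W - {u}" for w
  proof (cases "w = v")
    case False
    then show ?thesis using pq[of w] w by (simp add: a'_def b'_def p'_def q'_def)
  next
    case True
    have "a' v - residue l (p' v) \<in> \<int>"
      using pq[OF uv(1)] pq[OF uv(2)] sh by (auto simp: a'_def p'_def min_def)
    moreover have "b' v - residue l (q' v) \<in> \<int>"
      using pq[OF uv(1)] pq[OF uv(2)] sh by (auto simp: b'_def q'_def max_def)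
    moreover have "a' v + 1 \<le> b' v" using pq[OF uv(2)] by (auto simp: a'_def b'_def)
    ultimately show ?thesis using True pq[OF uv(1)] pq[OF uv(2)] by (simp add: p'_def q'_def)
  qed
  have Q: "{p' x, q' x} \<inter> {p' y, q' y} = {}" if xy: "x \<in> W - {u}" "y \<in> W - {u}" "x \<noteq> y" for x y
  proof -
    have sub: "{p' x, q' x} \<subseteq> (if x = v then {p u, q u} \<union> {p v, q v} else {p x, q x})" for x
      by (auto simp: p'_def q'_def)
    consider "x = v" "y \<noteq> v" | "y = v" "x \<noteq> v" | "x \<noteq> v" "y \<noteq> v" using xy(3) by blast
    then show ?thesis
    proof cases
      case 1
      then have "{p' x, q' x} \<subseteq> {p u, q u} \<union> {p v, q v}" "{p' y, q' y} \<subseteq> {p y, q y}" using sub[of x] sub[of y] by simp_all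
      then show ?thesis using dis[of u y] dis[of v y] uv xy 1 by blast
    next
      case 2
      then have "{p' y, q' y} \<subseteq> {p u, q u} \<union> {p v, q v}" "{p' x, q' x} \<subseteq> {p x, q x}" using sub[of x] sub[of y] by simp_all
      then show ?thesis using dis[of u x] dis[of v x] uv xy 2 by blast
    next
      case 3
      then have "{p' y, q' y} \<subseteq> {p y, q y}" "{p' x, q' x} \<subseteq> {p x, q x}" using sub[of x] sub[of y] by simp_all
      then show ?thesis using dis[of x y] xy by blast
    qed
  qed
  have "shi_inv l (W - {u}) a' b'"
    unfolding shi_inv_def by (rule exI[of _ p'], rule exI[of _ q']) (intro conjI[OF ballI ballI] ballI impI P Q; assumption)
  then show ?thesis unfolding a'_def b'_def .
qed

lemma shi_inv_ind_exps:
  fixes Y :: "('i \<Rightarrow> 'k::field_char_0) set"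
  assumes l: "l \<le> 5" and I: "shi_inv l W a b" and W: "W \<noteq> {}" and r: "rep Y f {None} W"
  shows "\<exists>e. ind_exps Y (arr Y f {None} (pairs W (ibound a b))) e"
proof -
  obtain p q where inv: "\<forall>w\<in>W. p w \<in> {1..l} \<and> q w \<in> {1..l} \<and> a w - residue l (p w) \<in> \<int> \<and>
     b w - residue l (q w) \<in> \<int> \<and> a w + 1 \<le> b w" "\<forall>u\<in>W. \<forall>v\<in>W. u \<noteq> v \<longrightarrow> {p u, q u} \<inter> {p v, q v} = {}"
    using I[unfolded shi_inv_def] by (elim exE conjE)
  have pq: "p w \<in> {1..l} \<and> q w \<in> {1..l} \<and> a w - residue l (p w) \<in> \<int> \<and>
     b w - residue l (q w) \<in> \<int> \<and> a w + 1 \<le> b w" if "w \<in> W" for w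
    using inv(1) that by (rule bspec)
  have dis: "{p x, q x} \<inter> {p y, q y} = {}" if "x \<in> W" "y \<in> W" "x \<noteq> y" for x y
    using inv(2)[rule_format, OF that] .
  have finW: "finite W" by (rule repD(3)[OF r])
  define D where "D = {w\<in>W. p w \<noteq> q w}"
  have finD: "finite D" using finW by (simp add: D_def)
  \<comment> \<open>Each vertex occupies one residue, each vertex of \<open>D\<close> a second one,
    and all these are different among the \<open>l\<close> available.\<close>
  have cWD: "card W + card D \<le> 5"
  proof -
    have "card (\<Union>w\<in>W. {p w, q w}) = (\<Sum>w\<in>W. card {p w, q w})"
      by (rule card_UN_disjoint[OF finW]) (use dis in auto)
    also have "\<dots> = (\<Sum>w\<in>W. 1 + (if p w \<noteq> q w then 1 else 0))" by (rule sum.cong) auto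
    also have "\<dots> = card W + card D" unfolding sum.distrib D_def using finW by (simp add: sum.If_cases Int_def)
    finally have "card W + card D = card (\<Union>w\<in>W. {p w, q w})" by simp
    also have "\<dots> \<le> card {1..l}" by (rule card_mono) (use pq in auto)
    finally show ?thesis using l by simp
  qed
  have aa: "a x - a y \<notin> \<int>" "a x - b y \<notin> \<int>" "b x - a y \<notin> \<int>" "b x - b y \<notin> \<int>"
    if xy: "x \<in> W" "y \<in> W" "x \<noteq> y" for x y
    using residue_distinct pq[OF xy(1)] pq[OF xy(2)] dis[OF xy] by blast+
  have single: "\<exists>k::nat. b w = a w + real k" if w: "w \<in> W - D" for w
  proof -
    have "(b w - residue l (q w)) - (a w - residue l (p w)) \<in> \<int>"
      using Ints_diff[of "b w - residue l (q w)" "a w - residue l (p w)"] pq[of w] w by blast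
    moreover have "p w = q w" using w by (auto simp: D_def)
    ultimately obtain i where i: "b w - a w = of_int i" by (auto elim!: Ints_cases)
    moreover have "0 \<le> b w - a w" using pq[of w] w by auto
    ultimately have "b w = a w + real (nat i)" by simp
    then show ?thesis ..
  qed
  then obtain k where k: "\<And>w. w \<in> W - D \<Longrightarrow> b w = a w + real (k w)" by metis
  consider "card D \<le> 1" | "card D = 2" | "card D \<ge> 3" by linarith
  then show ?thesis
  proof cases
    case 1
    obtain w where w: "w \<in> W" "D \<subseteq> {w}"
    proof (cases "D = {}")
      case True
      then show ?thesis using that W by blast
    next
      case False
      then have "card D = 1" using 1 finD card_gt_0_iff[of D] by linarith
      then obtain w where "D = {w}" by (auto simp: card_1_singleton_iff)
      then show ?thesis using that[of w] by (auto simp: D_def)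
    qed
    have "special W w a b k"
      unfolding special_def using w k pq[OF w(1)] aa by auto
    from ind_exps_special[OF r this] show ?thesis by blast
  next
    case 2
    then obtain y z where D: "D = {y, z}" "y \<noteq> z" by (auto simp: card_2_iff)
    have yz: "y \<in> W" "z \<in> W" using D by (auto simp: D_def)
    have "card (W - D) \<le> 1" using cWD 2 finD card_Diff_subset[of D W] by (auto simp: D_def)
    then consider "card (W - D) = 0" | "card (W - D) = 1" by linarith
    then consider "W - D = {}" | x where "W - D = {x}"
      using finW by cases (auto simp: card_1_singleton_iff)
    then show ?thesis
    proof cases
      case 1
      then have W2: "W = {y, z}" using D yz by auto
      \<comment> \<open>The number of hyperplanes between the two vertices; lengths of at least 1
        keep it non-negative.\<close>
      have "0 \<le> ibound a b y z + ibound a b z y + 1"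
        using pq[OF yz(1)] pq[OF yz(2)] unfolding ibound_def by linarith
      then have "int (nat (ibound a b y z + ibound a b z y + 1)) = ibound a b y z + ibound a b z y + 1" by simp
      from ind_exps_two[OF r W2 D(2) this] show ?thesis by blast
    next
      case (2 x)
      then have x: "x \<in> W" "x \<in> W - D" "x \<noteq> y" "x \<noteq> z" and W3: "W = {x, y, z}" using D yz by auto
      have "a y \<le> b y" "a z \<le> b z" using pq[OF yz(1)] pq[OF yz(2)] by linarith+
      note * = ind_exps_three[where a = a and b = b, OF r W3 x(3,4) D(2) k[OF x(2)] this]
      show ?thesis
        by (rule *; rule aa; use x(1,3,4) yz D(2) in simp)
    qed
  next
    case 3
    have "card D \<le> card W" using finW by (intro card_mono) (auto simp: D_def)
    then show ?thesis using 3 cWD by linarith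
  qed
qed

lemma shi_flats:
  assumes V: "V = {1..l}" "E = {(j, i) | i j. i \<in> V \<and> j \<in> V \<and> i < j}" and l: "1 \<le> l" "l \<le> 5"
    and Y: "Y \<in> intersection_lattice (cone_space V) (cone_deformation V n E)"
  shows "\<exists>e. ind_exps Y (restriction (cone_deformation V n E :: (nat option \<Rightarrow> 'k::field_char_0) set set) Y) e"
proof -
  have finV: "finite V" and V0: "V \<noteq> {}" using V l by auto
  show ?thesis
  proof (rule flats_ind_exps[OF rep_cone_space[OF finV] V0, where Y = Y and
      Inv = "shi_inv l" and ?a0.0 = "residue l" and ?b0.0 = "\<lambda>v. residue l v + real (n v + 1)"])
    show "(cone_deformation V n E :: (nat option \<Rightarrow> 'k) set set) =
        arr (cone_space V) (\<lambda>y. y) {None} (pairs V (ibound (residue l) (\<lambda>v. residue l v + real (n v + 1))))"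
      unfolding cone_deformation_arr shi_arr[OF V] ..
    show "shi_inv l V (residue l) (\<lambda>v. residue l v + real (n v + 1))"
      unfolding shi_inv_def by (intro exI[of _ "\<lambda>w. w"]) (use V(1) in auto)
    show "Y \<in> intersection_lattice (cone_space V) (cone_deformation V n E)" by (rule Y)
  next
    fix W a b assume I: "shi_inv l W a b"
    then have ab: "a w + 1 \<le> b w" if "w \<in> W" for w using that unfolding shi_inv_def by blast
    show "a v \<le> b v" if "v \<in> W" for v using ab[OF that] by simp
    show "\<exists>c. (u, v, c) \<in> pairs W (ibound a b)" if uv: "u \<in> W" "v \<in> W" "u \<noteq> v" for u v
    proof (intro exI)
      have "- \<lfloor>b u - a v\<rfloor> \<le> \<lfloor>b v - a u\<rfloor>" using ab[OF uv(1)] ab[OF uv(2)] by linarith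
      then show "(u, v, \<lfloor>b v - a u\<rfloor>) \<in> pairs W (ibound a b)" using uv by (simp add: pairs_def ibound_def)
    qed
    show "shi_inv l (W - {u}) (a(v := min (a v) (a u + of_int c))) (b(v := max (b v) (b u + of_int c)))"
      if "(u, v, c) \<in> pairs W (ibound a b)" for u v c by (rule shi_inv_merge[OF I that])
    fix Y :: "(nat option \<Rightarrow> 'k) set" and f :: "(nat option \<Rightarrow> 'k) \<Rightarrow> (nat option \<Rightarrow> 'k)"
    assume "W \<noteq> {}" "rep Y f {None} W"
    then show "\<exists>e. ind_exps Y (arr Y f {None} (pairs W (ibound a b))) e" by (rule shi_inv_ind_exps[OF l(2) I])
  qed
qed

section \<open>A non-free restriction\<close>

text \<open>A sum of products of two polynomials without constant term has no linear term.\<close>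

lemma poly_ray_square:
  fixes Q R :: "'j \<Rightarrow> 'k::field_char_0 poly"
  assumes "\<And>t. t * c = (\<Sum>k\<in>S. poly (Q k) t * poly (R k) t)"
    and "\<And>k. k \<in> S \<Longrightarrow> poly (Q k) 0 = 0" "\<And>k. k \<in> S \<Longrightarrow> poly (R k) 0 = 0"
  shows "c = 0"
proof -
  have "[:0, c:] = (\<Sum>k\<in>S. Q k * R k)"
    by (rule poly_eq_poly_eq_iff[THEN iffD1]) (simp add: fun_eq_iff poly_sum assms(1))
  moreover have "coeff (Q k * R k) 1 = 0" if "k \<in> S" for k
    using assms(2,3)[OF that] by (simp add: coeff_mult poly_0_coeff_0)
  ultimately have "coeff [:0, c:] 1 = 0" by (simp add: coeff_sum)
  then show ?thesis by simp
qed

text \<open>Let \<open>\<theta>\<^sub>1, \<theta>\<^sub>2\<close> be the generators of degree \<open>h\<close> of \<open>D(A - {H})\<close>. On \<open>H\<close> one has \<open>\<theta>\<^sub>i(\<alpha>) = B g\<^sub>i\<close> with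
  a fixed \<open>B\<close> of degree \<open>h - 1\<close> and linear \<open>g\<^sub>i\<close>, which are linearly independent because \<open>D(A\<^sup>H)\<close> has too
  few generators of degree at most \<open>h\<close>. Hence \<open>D(A)\<close>, although of rank four, contains five elements
  linearly independent modulo its multiples by polynomials vanishing at the origin: the two generators of low degree, \<open>\<alpha> \<theta>\<^sub>1\<close>, \<open>\<alpha> \<theta>\<^sub>2\<close> and
  \<open>g\<^sub>2 \<theta>\<^sub>1 - g\<^sub>1 \<theta>\<^sub>2\<close>.\<close>

lemma not_free:
  fixes Y :: "('i \<Rightarrow> 'k::field_char_0) set"
  assumes HA: "H \<in> A" and H: "hyperplane Y H" and h: "h \<ge> 3"
    and g1: "good Y (A - {H}) {#0, 1, h, h#}" and g2: "good H (restriction A H) {#0, 1, Suc h#}"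
  shows "\<not> free_arrangement Y A"
proof
  assume "free_arrangement Y A"
  define A' where "A' = A - {H}"
  have Y: "fin_coords Y" and fin: "finite A" and A: "\<forall>h\<in>A. hyperplane Y h"
    using g1 H by (auto simp: good_def)
  have sY: "subsp Y" using Y by (simp add: fin_coords_def)
  obtain \<alpha> where \<alpha>: "is_form Y H \<alpha>" using H by (auto simp: hyperplane_def)
  have l\<alpha>: "linear_fun \<alpha>" by (rule is_form_linear[OF \<alpha>])
  have sH: "subsp H" by (rule hyperplane_subsp[OF sY H])
  have HY: "H \<subseteq> Y" by (rule hyperplane_subset[OF H])
  have A': "\<forall>h\<in>A'. hyperplane Y h" and HA': "H \<notin> A'" and finA': "finite A'" using A fin by (auto simp: A'_def)
  have lderA: "\<eta> \<in> lder Y A \<longleftrightarrow> \<eta> \<in> lder Y A' \<and> (\<forall>y\<in>H. \<alpha> (\<eta> y) = 0)" for \<eta>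
    unfolding A'_def by (rule lder_remove_iff[OF \<alpha> HA])
  obtain I :: "nat set" and \<theta> d where bas: "lder_basis Y A' I \<theta>" and d: "\<forall>i\<in>I. homog Y (d i) (\<theta> i)"
    and dI: "image_mset d (mset_set I) = {#0, 1, h, h#}" using g1 by (auto simp: good_def lder_exponents_def A'_def)
  obtain J :: "nat set" and \<eta> e where basH: "lder_basis H (restriction A H) J \<eta>" and e: "\<forall>j\<in>J. homog H (e j) (\<eta> j)"
    and eJ: "image_mset e (mset_set J) = {#0, 1, Suc h#}" using g2 by (auto simp: good_def lder_exponents_def)
  have finI: "finite I" and finJ: "finite J" using bas basH by (auto simp: lder_basis_def)
  have cJ: "card {j\<in>J. e j \<le> h} = 2"
    using arg_cong[OF eJ, of "\<lambda>M. size (filter_mset (\<lambda>x. x \<le> h) M)"] finJ h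
    by (simp add: size_filter_image_mset_set del: filter_mset_image_mset)
  have cI1: "card {i\<in>I. d i \<le> 1} = 2"
    using arg_cong[OF dI, of "\<lambda>M. size (filter_mset (\<lambda>x. x \<le> 1) M)"] finI h
    by (simp add: size_filter_image_mset_set del: filter_mset_image_mset)
  have cI2: "card {i\<in>I. d i = h} = 2"
    using arg_cong[OF dI, of "\<lambda>M. size (filter_mset (\<lambda>x. x = h) M)"] finI h
    by (simp add: size_filter_image_mset_set del: filter_mset_image_mset)
  obtain i0 i1 where I1: "{i\<in>I. d i \<le> 1} = {i0, i1}" "i0 \<noteq> i1" using cI1 by (auto simp: card_2_iff)
  obtain j0 j1 where I2: "{i\<in>I. d i = h} = {j0, j1}" "j0 \<noteq> j1" using cI2 by (auto simp: card_2_iff)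
  have dcases: "d i \<le> 1 \<or> d i = h" if "i \<in> I" for i
  proof -
    have "d i \<in># image_mset d (mset_set I)" using that finI by simp
    then show ?thesis unfolding dI by auto
  qed
  have I: "I = {i0, i1, j0, j1}" using dcases I1(1) I2(1) by blast
  have i01: "i0 \<in> I" "i1 \<in> I" "d i0 \<le> 1" "d i1 \<le> 1" using I1(1) by blast+
  have j01: "j0 \<in> I" "j1 \<in> I" "d j0 = h" "d j1 = h" using I2(1) by blast+
  have ne: "i0 \<noteq> j0" "i0 \<noteq> j1" "i1 \<noteq> j0" "i1 \<noteq> j1" using i01 j01 h by auto
  have sumI: "(\<Sum>i\<in>I. F i) = F i0 + F i1 + F j0 + F j1" for F :: "nat \<Rightarrow> 'x::comm_monoid_add"
    unfolding I using ne I1(2) I2(2) by (simp add: add.assoc)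
  have th: "\<theta> i \<in> lder Y A'" if "i \<in> I" for i using bas that by (simp add: lder_basis_def)
  \<comment> \<open>There are \<open>2 h + 1\<close> hyperplanes in \<open>A'\<close> and
    \<open>h + 2\<close> in the restriction.\<close>
  have card': "card A' = card (restriction A' H) + (h - 1)"
    using g1 g2 h by (simp add: good_def A'_def restriction_Diff_self)
  from lder_values[OF sY \<alpha> finA' HA' A' card'] obtain B where B: "B \<in> pfun H" "\<exists>z\<in>H. B z \<noteq> 0"
    "\<forall>\<theta>\<in>lder Y A'. \<forall>d. homog Y d \<theta> \<longrightarrow> (\<exists>g\<in>pfun H. (\<forall>y\<in>H. \<alpha> (\<theta> y) = B y * g y) \<and>
      (\<forall>t y. t \<noteq> 0 \<longrightarrow> y \<in> H \<longrightarrow> t ^ (h - 1) * g (fscale t y) = t ^ d * g y))" by blast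
  obtain z where z: "z \<in> H" "B z \<noteq> 0" using B(2) by blast
  have "\<exists>g\<in>pfun H. (\<forall>y\<in>H. \<alpha> (\<theta> i y) = B y * g y) \<and>
      (\<forall>t y. t \<noteq> 0 \<longrightarrow> y \<in> H \<longrightarrow> t ^ (h - 1) * g (fscale t y) = t ^ d i * g y)" if "i \<in> I" for i
    using B(3) th[OF that] d that by blast
  then obtain g where g: "\<And>i. i \<in> I \<Longrightarrow> g i \<in> pfun H" "\<And>i y. i \<in> I \<Longrightarrow> y \<in> H \<Longrightarrow> \<alpha> (\<theta> i y) = B y * g i y"
    "\<And>i t y. i \<in> I \<Longrightarrow> t \<noteq> 0 \<Longrightarrow> y \<in> H \<Longrightarrow> t ^ (h - 1) * g i (fscale t y) = t ^ d i * g i y" by metis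
  \<comment> \<open>The degree \<open>d i - (h - 1)\<close> is negative because of
    \<open>h \<ge> 3\<close>, so the two low generators are tangent to \<open>H\<close>
    already.\<close>
  have gi: "g i y = 0" if i: "i \<in> I" "d i \<le> 1" and y: "y \<in> H" for i y
  proof -
    have lt: "d i < h - 1" using i(2) h by simp
    from pfun_negative_degree[OF sH g(1)[OF i(1)] lt g(3)[OF i(1)] y] show ?thesis by simp
  qed
  have gj: "g j (fscale t y) = t * g j y" if j: "j \<in> I" "d j = h" and t: "t \<noteq> 0" and y: "y \<in> H" for j t y
  proof -
    have "t ^ h = t ^ (h - 1) * t" using h by (metis One_nat_def Suc_le_D Suc_1 diff_Suc_1 numeral_3_eq_3 power_Suc2)
    then have "t ^ (h - 1) * g j (fscale t y) = t ^ (h - 1) * (t * g j y)"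
      using g(3)[OF j(1) t y] j(2) by (simp add: mult.assoc)
    then show ?thesis using t by simp
  qed
  have indep: "p = 0 \<and> q = 0" if pq: "\<forall>y\<in>H. p * g j0 y + q * g j1 y = 0" for p q
  proof (rule ccontr)
    assume npq: "\<not> (p = 0 \<and> q = 0)"
    \<comment> \<open>Under a linear relation this combination is tangent to \<open>H\<close>. With
      the two low generators there are then three fields of degree at most \<open>h\<close>, against
      two basis elements of the restriction in that range; the resulting relation on
      \<open>H\<close>, rewritten in \<theta>, contradicts
      \<open>lder_basis_indep_restrict\<close>.\<close>
    define \<phi> where "\<phi> = (\<lambda>y. fscale p (\<theta> j0 y) + fscale q (\<theta> j1 y))"
    have "\<phi> = (\<lambda>y. \<Sum>i\<in>{j0, j1}. fscale (if i = j0 then p else q) (\<theta> i y))"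
      using I2(2) by (auto simp: \<phi>_def)
    moreover have "(\<lambda>y. \<Sum>i\<in>{j0, j1}. fscale (if i = j0 then p else q) (\<theta> i y)) \<in> lder Y A'"
      by (rule lder_sum[OF sY A' pfun_const]) (use th j01 in auto)
    moreover have "\<alpha> (\<phi> y) = 0" if "y \<in> H" for y
    proof -
      have "\<alpha> (\<phi> y) = B y * (p * g j0 y + q * g j1 y)"
        unfolding \<phi>_def linear_fun_add[OF l\<alpha>] linear_fun_scale[OF l\<alpha>] g(2)[OF j01(1) that] g(2)[OF j01(2) that]
        by (simp add: algebra_simps)
      then show ?thesis using pq that by simp
    qed
    ultimately have \<phi>A: "\<phi> \<in> lder Y A" unfolding lderA by simp
    have hj: "homog Y h (\<theta> j0)" "homog Y h (\<theta> j1)" using d j01 by auto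
    have \<phi>h: "homog Y h \<phi>"
      unfolding homog_def
    proof (intro allI impI)
      fix t y assume t: "(t::'k) \<noteq> 0" and y: "y \<in> Y"
      have "\<theta> j0 (fscale t y) = fscale (t ^ h) (\<theta> j0 y)" "\<theta> j1 (fscale t y) = fscale (t ^ h) (\<theta> j1 y)"
        using hj t y unfolding homog_def by blast+
      then show "\<phi> (fscale t y) = fscale (t ^ h) (\<phi> y)" by (simp add: \<phi>_def fun_eq_iff algebra_simps)
    qed
    define \<psi> where "\<psi> i = (if i = j0 then \<phi> else \<theta> i)" for i
    have \<psi>: "\<forall>i\<in>{i0, i1, j0}. \<psi> i \<in> lder Y A \<and> (\<exists>d\<le>h. homog Y d (\<psi> i))"
    proof
      fix i assume "i \<in> {i0, i1, j0}"
      then consider "i = j0" | "i \<in> I" "d i \<le> 1" "i \<noteq> j0" using i01 ne by auto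
      then show "\<psi> i \<in> lder Y A \<and> (\<exists>d\<le>h. homog Y d (\<psi> i))"
      proof cases
        case 1
        then show ?thesis using \<phi>A \<phi>h by (auto simp: \<psi>_def)
      next
        case 2
        have "\<theta> i \<in> lder Y A" unfolding lderA using th[OF 2(1)] g(2)[OF 2(1)] gi[OF 2(1,2)] by simp
        moreover have "homog Y (d i) (\<theta> i)" "d i \<le> h" using d 2 h by auto
        ultimately show ?thesis using 2(3) by (auto simp: \<psi>_def)
      qed
    qed
    have c3: "card {j\<in>J. e j \<le> h} < card {i0, i1, j0}" using cJ I1(2) ne by simp
    have f3: "finite {i0, i1, j0}" by simp
    from lder_too_many[OF sH HY HA basH e f3 \<psi> c3]
    obtain c where c: "\<forall>i\<in>{i0, i1, j0}. c i \<in> pfun H" "\<exists>i\<in>{i0, i1, j0}. \<exists>y\<in>H. c i y \<noteq> 0"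
      "\<forall>y\<in>H. (\<Sum>i\<in>{i0, i1, j0}. fscale (c i y) (\<psi> i y)) = 0" by blast
    define c' where "c' i = (if i = j0 then (\<lambda>y. p * c j0 y) else if i = j1 then (\<lambda>y. q * c j0 y) else c i)" for i
    have c'p: "c' i \<in> pfun H" if "i \<in> I" for i
      using c(1) that unfolding I c'_def by (auto intro!: pfun_cmult)
    have c's: "(\<Sum>i\<in>I. fscale (c' i y) (\<theta> i y)) = 0" if "y \<in> H" for y
    proof -
      have "(\<Sum>i\<in>I. fscale (c' i y) (\<theta> i y)) = (\<Sum>i\<in>{i0, i1, j0}. fscale (c i y) (\<psi> i y))"
        unfolding sumI using ne I1(2) I2(2) by (simp add: c'_def \<psi>_def \<phi>_def fun_eq_iff algebra_simps)
      then show ?thesis using c(3) that by simp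
    qed
    have z': "c' i y = 0" if "i \<in> I" "y \<in> H" for i y
      by (rule lder_basis_indep_restrict[where c = c', OF Y A' H HA' bas c'p c's that])
    have "c j0 y = 0" if "y \<in> H" for y
      using z'[OF j01(1) that] z'[OF j01(2) that] npq I2(2) by (auto simp: c'_def)
    moreover have "c i0 y = 0" "c i1 y = 0" if "y \<in> H" for y
      using z'[OF i01(1) that] z'[OF i01(2) that] ne by (auto simp: c'_def)
    ultimately show False using c(2) by auto
  qed
  obtain u where u: "u \<in> Y" "\<alpha> u = 1" "linear_map (\<lambda>y. y - fscale (\<alpha> y) u)"
    "\<And>y. y \<in> Y \<Longrightarrow> y - fscale (\<alpha> y) u \<in> H" "\<And>y. y \<in> H \<Longrightarrow> y - fscale (\<alpha> y) u = y"
    by (rule is_form_proj[OF sY \<alpha>]) (use that in blast)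
  define \<pi> where "\<pi> = (\<lambda>y. y - fscale (\<alpha> y) u)"
  have \<pi>: "linear_map \<pi>" "\<And>y. y \<in> Y \<Longrightarrow> \<pi> y \<in> H" "\<And>y. y \<in> H \<Longrightarrow> \<pi> y = y"
    using u by (auto simp: \<pi>_def)
  define G where "G j = (\<lambda>y. g j (\<pi> y))" for j
  have Gp: "G j \<in> pfun Y" if "j \<in> I" for j unfolding G_def by (rule pfun_comp[OF g(1)[OF that] \<pi>(1,2)])
  have Gt: "G j (fscale t y) = t * G j y" if "j \<in> I" "d j = h" "t \<noteq> 0" "y \<in> Y" for j t y
    unfolding G_def linear_map_scale[OF \<pi>(1)] by (rule gj[OF that(1-3) \<pi>(2)[OF that(4)]])
  \<comment> \<open>Coefficients in the basis \<theta> of the five elements of \<open>D(A)\<close>.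
    The last one is the syzygy, whose value on \<alpha> cancels along \<open>H\<close>.\<close>
  define C :: "nat \<Rightarrow> nat \<Rightarrow> ('i \<Rightarrow> 'k) \<Rightarrow> 'k" where
    "C s i = (if s = 0 then (if i = i0 then (\<lambda>_. 1) else (\<lambda>_. 0))
       else if s = 1 then (if i = i1 then (\<lambda>_. 1) else (\<lambda>_. 0))
       else if s = 2 then (if i = j0 then \<alpha> else (\<lambda>_. 0))
       else if s = 3 then (if i = j1 then \<alpha> else (\<lambda>_. 0))
       else (if i = j0 then G j1 else if i = j1 then (\<lambda>y. - G j0 y) else (\<lambda>_. 0)))" for s i
  have Cp: "C s i \<in> pfun Y" for s i
    unfolding C_def using pfun_const pfun_lin[OF l\<alpha>] Gp[OF j01(2)] pfun_uminus[OF Gp[OF j01(1)]] by auto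
  define \<omega> where "\<omega> s = (\<lambda>y. \<Sum>i\<in>I. fscale (C s i y) (\<theta> i y))" for s
  have \<omega>: "\<omega> s \<in> lder Y A" for s
    unfolding lderA
  proof
    show "\<omega> s \<in> lder Y A'" unfolding \<omega>_def by (rule lder_sum[OF sY A' Cp th])
    show "\<forall>y\<in>H. \<alpha> (\<omega> s y) = 0"
    proof
      fix y assume y: "y \<in> H"
      have "\<alpha> y = 0" using y is_form_iff[OF \<alpha>] by simp
      have "\<alpha> (\<omega> s y) = (\<Sum>i\<in>I. C s i y * (B y * g i y))"
        unfolding \<omega>_def linear_fun_sum[OF l\<alpha>] linear_fun_scale[OF l\<alpha>] by (rule sum.cong) (simp_all add: g(2)[OF _ y])
      also have "\<dots> = C s j0 y * (B y * g j0 y) + C s j1 y * (B y * g j1 y)"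
        unfolding sumI gi[OF i01(1,3) y] gi[OF i01(2,4) y] by simp
      also have "\<dots> = 0"
        using \<open>\<alpha> y = 0\<close> ne I2(2) \<pi>(3)[OF y] by (simp add: C_def G_def)
      finally show "\<alpha> (\<omega> s y) = 0" .
    qed
  qed
  \<comment> \<open>A hypothetical basis of \<open>D(A)\<close>. Inside \<open>D(A')\<close>, which
    has four basis elements, elimination bounds its size by 4.\<close>
  obtain S :: "(nat \<Rightarrow> 'k mpoly) set" and b where bA: "lder_basis Y A S b"
    using free_arrangement_lder_basis[OF sY A \<open>free_arrangement Y A\<close>] by blast
  have finS: "finite S" using bA by (simp add: lder_basis_def)
  have bl: "b k \<in> lder Y A" if "k \<in> S" for k using bA that by (simp add: lder_basis_def)
  have "\<exists>c. (\<forall>i\<in>I. c i \<in> pfun Y) \<and> (\<forall>y\<in>Y. b k y = (\<Sum>i\<in>I. fscale (c i y) (\<theta> i y)))" if "k \<in> S" for k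
  proof -
    have "b k \<in> lder Y A'" using bl[OF that] lderA by simp
    from lder_basis_span[OF bas this] obtain c where "\<forall>i\<in>I. c i \<in> pfun Y"
      "\<forall>y\<in>Y. b k y = (\<Sum>i\<in>I. fscale (c i y) (\<theta> i y))" .
    then show ?thesis by (intro exI[of _ c] conjI)
  qed
  then obtain n where n: "\<And>k. k \<in> S \<Longrightarrow> \<forall>i\<in>I. n k i \<in> pfun Y"
    "\<And>k. k \<in> S \<Longrightarrow> \<forall>y\<in>Y. b k y = (\<Sum>i\<in>I. fscale (n k i y) (\<theta> i y))" by metis
  have swap: "(\<Sum>k\<in>S. fscale (c k) (b k y)) = (\<Sum>i\<in>I. fscale (\<Sum>k\<in>S. c k * n k i y) (\<theta> i y))" if "y \<in> Y" for c y
  proof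
    fix x
    have "(\<Sum>k\<in>S. fscale (c k) (b k y)) x = (\<Sum>k\<in>S. \<Sum>i\<in>I. c k * n k i y * \<theta> i y x)"
      using n(2) that by (simp add: sum_fun_apply sum_distrib_left mult.assoc)
    also have "\<dots> = (\<Sum>i\<in>I. (\<Sum>k\<in>S. c k * n k i y) * \<theta> i y x)"
      by (subst sum.swap) (simp add: sum_distrib_right)
    finally show "(\<Sum>k\<in>S. fscale (c k) (b k y)) x = (\<Sum>i\<in>I. fscale (\<Sum>k\<in>S. c k * n k i y) (\<theta> i y)) x"
      by (simp add: sum_fun_apply)
  qed
  have cS: "card S \<le> 4"
  proof (rule ccontr)
    assume "\<not> card S \<le> 4"
    moreover have "card I = 4" unfolding I using ne I1(2) I2(2) by simp
    ultimately have lt: "card I < card S" by simp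
    have "\<exists>c. (\<forall>k\<in>S. c k \<in> pfun Y) \<and> (\<exists>k\<in>S. \<exists>y\<in>Y. c k y \<noteq> 0) \<and>
        (\<forall>i\<in>I. \<forall>y\<in>Y. (\<Sum>k\<in>S. c k y * n k i y) = 0)"
      by (rule pfun_elimination[OF sY finI finS lt]) (use n(1) in blast)
    then obtain c where c: "\<forall>k\<in>S. c k \<in> pfun Y" "\<exists>k\<in>S. \<exists>y\<in>Y. c k y \<noteq> 0"
      "\<forall>i\<in>I. \<forall>y\<in>Y. (\<Sum>k\<in>S. c k y * n k i y) = 0" by blast
    have "\<forall>y\<in>Y. (\<Sum>k\<in>S. fscale (c k y) (b k y)) = 0"
      using swap c(3) by simp
    from lder_basis_indep[OF bA c(1) this] c(2) show False by blast
  qed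
  have "\<exists>c. (\<forall>k\<in>S. c k \<in> pfun Y) \<and> (\<forall>y\<in>Y. \<omega> s y = (\<Sum>k\<in>S. fscale (c k y) (b k y)))" for s
  proof -
    from lder_basis_span[OF bA \<omega>[of s]] obtain c where "\<forall>k\<in>S. c k \<in> pfun Y"
      "\<forall>y\<in>Y. \<omega> s y = (\<Sum>k\<in>S. fscale (c k y) (b k y))" .
    then show ?thesis by (intro exI[of _ c] conjI)
  qed
  then obtain m where m: "\<And>s. \<forall>k\<in>S. m s k \<in> pfun Y"
    "\<And>s. \<forall>y\<in>Y. \<omega> s y = (\<Sum>k\<in>S. fscale (m s k y) (b k y))" by metis
  \<comment> \<open>Over the zero subspace elimination is linear algebra over the field. It is
    applied to the values at the origin of the coefficients of the five elements: five vectors with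
    at most four components.\<close>
  have s0: "subsp ({0} :: ('i \<Rightarrow> 'k) set)" by (auto simp: fun_space.subspace_def)
  have zY: "0 \<in> Y" "0 \<in> H" using subsp_0 sY sH by auto
  have lt5: "card S < card {..<5::nat}" using cS by simp
  have "\<exists>c. (\<forall>s\<in>{..<5::nat}. c s \<in> pfun {0}) \<and> (\<exists>s\<in>{..<5::nat}. \<exists>y\<in>{0}. c s y \<noteq> 0) \<and>
      (\<forall>k\<in>S. \<forall>y\<in>{0}. (\<Sum>s\<in>{..<5::nat}. c s y * m s k y) = 0)"
    by (rule pfun_elimination[OF s0 finS _ lt5]) (use m(1) zY in \<open>auto intro: pfun_mono\<close>)
  then obtain c where c: "\<exists>s\<in>{..<5::nat}. c s (0 :: 'i \<Rightarrow> 'k) \<noteq> 0" "\<forall>k\<in>S. (\<Sum>s<5. c s 0 * m s k 0) = 0" by auto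
  define \<epsilon> where "\<epsilon> s = c s 0" for s
  define P where "P k = (\<lambda>y. \<Sum>s<5. \<epsilon> s * m s k y)" for k
  have Pp: "P k \<in> pfun Y" if "k \<in> S" for k unfolding P_def using m(1) that by (intro pfun_sum pfun_cmult) blast
  have P0: "P k 0 = 0" if "k \<in> S" for k using c(2) that by (simp add: P_def \<epsilon>_def)
  have eqC: "(\<Sum>s<5. \<epsilon> s * C s i y) = (\<Sum>k\<in>S. P k y * n k i y)" if i: "i \<in> I" and y: "y \<in> Y" for i y
  proof -
    define D where "D i = (\<lambda>y. (\<Sum>s<5. \<epsilon> s * C s i y) - (\<Sum>k\<in>S. P k y * n k i y))" for i
    have "\<forall>i\<in>I. D i \<in> pfun Y"
    proof
      fix i assume i: "i \<in> I"
      have 1: "(\<lambda>y. \<Sum>s<5. \<epsilon> s * C s i y) \<in> pfun Y" by (rule pfun_sum, rule pfun_cmult, rule Cp)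
      have 2: "(\<lambda>y. \<Sum>k\<in>S. P k y * n k i y) \<in> pfun Y"
        by (rule pfun_sum, rule pfun_mult[OF Pp]) (use n(1) i in auto)
      show "D i \<in> pfun Y" unfolding D_def by (rule pfun_diff[OF 1 2])
    qed
    moreover have "\<forall>y\<in>Y. (\<Sum>i\<in>I. fscale (D i y) (\<theta> i y)) = 0"
    proof (intro ballI ext)
      fix y x assume y: "y \<in> Y"
      have "(\<Sum>s<5. \<epsilon> s * \<omega> s y x) = (\<Sum>s<5. \<Sum>i\<in>I. \<epsilon> s * C s i y * \<theta> i y x)"
        by (simp add: \<omega>_def sum_fun_apply sum_distrib_left mult.assoc)
      also have "\<dots> = (\<Sum>i\<in>I. (\<Sum>s<5. \<epsilon> s * C s i y) * \<theta> i y x)"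
        by (subst sum.swap) (simp add: sum_distrib_right)
      finally have 1: "(\<Sum>s<5. \<epsilon> s * \<omega> s y x) = (\<Sum>i\<in>I. (\<Sum>s<5. \<epsilon> s * C s i y) * \<theta> i y x)" .
      have "(\<Sum>s<5. \<epsilon> s * \<omega> s y x) = (\<Sum>s<5. \<Sum>k\<in>S. \<epsilon> s * m s k y * b k y x)"
        using m(2) y by (simp add: sum_fun_apply sum_distrib_left mult.assoc)
      also have "\<dots> = (\<Sum>k\<in>S. P k y * b k y x)"
        unfolding P_def by (subst sum.swap) (simp add: sum_distrib_right)
      also have "\<dots> = (\<Sum>k\<in>S. fscale (P k y) (b k y)) x" by (simp add: sum_fun_apply)
      also have "\<dots> = (\<Sum>i\<in>I. (\<Sum>k\<in>S. P k y * n k i y) * \<theta> i y x)"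
        unfolding swap[OF y] by (simp add: sum_fun_apply)
      finally have 2: "(\<Sum>s<5. \<epsilon> s * \<omega> s y x) = (\<Sum>i\<in>I. (\<Sum>k\<in>S. P k y * n k i y) * \<theta> i y x)" .
      show "(\<Sum>i\<in>I. fscale (D i y) (\<theta> i y)) x = 0 x"
        using 1 2 by (simp add: sum_fun_apply D_def left_diff_distrib sum_subtractf)
    qed
    ultimately have "\<forall>i\<in>I. \<forall>y\<in>Y. D i y = 0" by (rule lder_basis_indep[OF bas])
    then show ?thesis using i y by (simp add: D_def)
  qed
  \<comment> \<open>Tangency of \<open>b k\<close> gives
    \<open>n k j0 * g j0 + n k j1 * g j1 = 0\<close> on \<open>H\<close>. The \<open>g\<close> are
    linear, so along each ray the lowest term is a relation between them with the constants
    \<open>n k j0 0\<close> and \<open>n k j1 0\<close>, which \<open>indep\<close>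
    excludes.\<close>
  have n0: "n k j0 0 = 0 \<and> n k j1 0 = 0" if k: "k \<in> S" for k
  proof (rule indep, rule ballI)
    fix y assume y: "y \<in> H"
    then have yY: "y \<in> Y" using HY by blast
    have rel: "n k j0 y' * g j0 y' + n k j1 y' * g j1 y' = 0" if y': "y' \<in> H" for y'
    proof -
      have np: "n k j0 \<in> pfun H" "n k j1 \<in> pfun H" using n(1)[OF k] j01 HY by (auto intro: pfun_mono)
      have q: "(\<lambda>y. n k j0 y * g j0 y + n k j1 y * g j1 y) \<in> pfun H"
        by (rule pfun_add[OF pfun_mult[OF np(1) g(1)[OF j01(1)]] pfun_mult[OF np(2) g(1)[OF j01(2)]]])
      have "\<forall>y\<in>H. B y * (n k j0 y * g j0 y + n k j1 y * g j1 y) = B y * 0"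
      proof
        fix y assume y: "y \<in> H"
        have "0 = \<alpha> (b k y)" using bl[OF k] lderA y by simp
        also have "\<dots> = (\<Sum>i\<in>I. n k i y * \<alpha> (\<theta> i y))"
          using n(2)[OF k] y HY by (auto simp: linear_fun_sum[OF l\<alpha>] linear_fun_scale[OF l\<alpha>])
        also have "\<dots> = B y * (n k j0 y * g j0 y + n k j1 y * g j1 y)"
          unfolding sumI g(2)[OF i01(1) y] g(2)[OF i01(2) y] g(2)[OF j01(1) y] g(2)[OF j01(2) y]
            gi[OF i01(1,3) y] gi[OF i01(2,4) y] by (simp add: algebra_simps)
        finally show "B y * (n k j0 y * g j0 y + n k j1 y * g j1 y) = B y * 0" by simp
      qed
      from pfun_cancel[OF sH B(1) q pfun_const this z] show ?thesis using y' by blast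
    qed
    have "n k j0 \<in> pfun Y" "n k j1 \<in> pfun Y" using n(1)[OF k] j01 by auto
    then obtain Q0 Q1 where Q: "\<forall>t. n k j0 (fscale t y) = poly Q0 t" "\<forall>t. n k j1 (fscale t y) = poly Q1 t"
      using pfun_ray[OF _ sY yY] by metis
    have "poly (monom 1 1 * (smult (g j0 y) Q0 + smult (g j1 y) Q1)) t = 0" for t
    proof (cases "t = 0")
      case False
      have "n k j0 (fscale t y) * (t * g j0 y) + n k j1 (fscale t y) * (t * g j1 y) = 0"
        using rel[OF subsp_scale[OF sH y, of t]] gj[OF j01(1,3) False y] gj[OF j01(2,4) False y] by simp
      then have "t * (g j0 y * poly Q0 t + g j1 y * poly Q1 t) = 0" using Q by (simp add: algebra_simps)
      then show ?thesis by (simp add: poly_monom)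
    qed (simp add: poly_monom)
    then have "monom 1 1 * (smult (g j0 y) Q0 + smult (g j1 y) Q1) = 0" using poly_all_0_iff_0 by blast
    then have "smult (g j0 y) Q0 + smult (g j1 y) Q1 = 0" by (simp add: monom_eq_0_iff)
    then have "poly (smult (g j0 y) Q0 + smult (g j1 y) Q1) 0 = 0" by simp
    moreover have "poly Q0 0 = n k j0 0" "poly Q1 0 = n k j1 0" using Q[THEN spec, of 0] by simp_all
    ultimately show "n k j0 0 * g j0 y + n k j1 0 * g j1 y = 0" by (simp add: mult.commute)
  qed
  have five: "(\<Sum>s<5. F s) = F 0 + F 1 + F 2 + F 3 + F (4::nat)" for F :: "nat \<Rightarrow> 'k"
    by (simp add: eval_nat_numeral add.assoc)
  \<comment> \<open>By \<open>eqC\<close> this linear expression is a sum of products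
    \<open>P k * n k j\<close>. Both factors vanish at the origin, so there is no linear
    term.\<close>
  have sq: "\<epsilon> r * \<alpha> y + \<epsilon> 4 * f y = 0"
    if j: "j \<in> {j0, j1}" and y: "y \<in> Y" and f: "\<And>t. t \<noteq> 0 \<Longrightarrow> f (fscale t y) = t * f y"
      and eq: "\<And>y. y \<in> Y \<Longrightarrow> (\<Sum>s<5. \<epsilon> s * C s j y) = \<epsilon> r * \<alpha> y + \<epsilon> 4 * f y" for j y r f
  proof -
    have jI: "j \<in> I" using j j01 by auto
    have "\<exists>Q. \<forall>t. P k (fscale t y) = poly Q t" if "k \<in> S" for k by (rule pfun_ray[OF Pp[OF that] sY y])
    then obtain Q where Q: "\<And>k t. k \<in> S \<Longrightarrow> P k (fscale t y) = poly (Q k) t" by metis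
    have "\<exists>R. \<forall>t. n k j (fscale t y) = poly R t" if "k \<in> S" for k
      by (rule pfun_ray[OF n(1)[OF that, rule_format, OF jI] sY y])
    then obtain R where R: "\<And>k t. k \<in> S \<Longrightarrow> n k j (fscale t y) = poly (R k) t" by metis
    have Q0: "poly (Q k) 0 = 0" if "k \<in> S" for k using Q[OF that, of 0] P0[OF that] by simp
    have R0: "poly (R k) 0 = 0" if "k \<in> S" for k using R[OF that, of 0] n0[OF that] j by auto
    show ?thesis
    proof (rule poly_ray_square[where S = S and Q = Q and R = R])
      fix t
      show "t * (\<epsilon> r * \<alpha> y + \<epsilon> 4 * f y) = (\<Sum>k\<in>S. poly (Q k) t * poly (R k) t)"
      proof (cases "t = 0")
        case True
        then show ?thesis using Q0 by simp
      next
        case False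
        have ty: "fscale t y \<in> Y" by (rule subsp_scale[OF sY y])
        have "t * (\<epsilon> r * \<alpha> y + \<epsilon> 4 * f y) = \<epsilon> r * \<alpha> (fscale t y) + \<epsilon> 4 * f (fscale t y)"
          unfolding f[OF False] linear_fun_scale[OF l\<alpha>] by (simp add: algebra_simps)
        also have "\<dots> = (\<Sum>k\<in>S. P k (fscale t y) * n k j (fscale t y))"
          using eq[OF ty] eqC[OF jI ty] by simp
        also have "\<dots> = (\<Sum>k\<in>S. poly (Q k) t * poly (R k) t)" by (rule sum.cong) (simp_all add: Q R)
        finally show ?thesis by simp
      qed
    qed (use Q0 R0 in auto)
  qed
  have e0: "\<epsilon> 0 = 0"
  proof -
    have "\<epsilon> 0 = (\<Sum>s<5. \<epsilon> s * C s i0 0)" unfolding five using ne I1(2) by (simp add: C_def)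
    also have "\<dots> = 0" unfolding eqC[OF i01(1) zY(1)] using P0 by simp
    finally show ?thesis .
  qed
  have e1: "\<epsilon> 1 = 0"
  proof -
    have "\<epsilon> 1 = (\<Sum>s<5. \<epsilon> s * C s i1 0)" unfolding five using ne I1(2) by (simp add: C_def)
    also have "\<dots> = 0" unfolding eqC[OF i01(2) zY(1)] using P0 by simp
    finally show ?thesis .
  qed
  have E0: "\<epsilon> 2 * \<alpha> y + \<epsilon> 4 * G j1 y = 0" if y: "y \<in> Y" for y
    by (rule sq[of j0 y "G j1" 2]) (use y Gt[OF j01(2,4)] ne I2(2) in \<open>auto simp: five C_def\<close>)
  have E1: "\<epsilon> 3 * \<alpha> y + \<epsilon> 4 * - G j0 y = 0" if y: "y \<in> Y" for y
    by (rule sq[of j1 y "\<lambda>y. - G j0 y" 3]) (use y Gt[OF j01(1,3)] ne I2(2) in \<open>auto simp: five C_def\<close>)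
  \<comment> \<open>Where \<alpha> vanishes but \<open>g j1\<close> does not, \<open>E0\<close>
    yields \<open>\<epsilon> 4 = 0\<close>; evaluation at \<open>u\<close> then gives the other
    two.\<close>
  have "\<not> (\<forall>y\<in>H. 0 * g j0 y + 1 * g j1 y = 0)" using indep[of 0 1] by auto
  then obtain y1 where y1: "y1 \<in> H" "g j1 y1 \<noteq> 0" by auto
  have "\<alpha> y1 = 0" "y1 \<in> Y" using y1(1) is_form_iff[OF \<alpha>] by auto
  then have e4: "\<epsilon> 4 = 0" using E0[of y1] y1 \<pi>(3)[OF y1(1)] by (simp add: G_def)
  have e2: "\<epsilon> 2 = 0" using E0[OF u(1)] u(2) e4 by simp
  have e3: "\<epsilon> 3 = 0" using E1[OF u(1)] u(2) e4 by simp
  obtain s where s: "s < 5" "\<epsilon> s \<noteq> 0" using c(1) by (auto simp: \<epsilon>_def)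
  then have "s = 0 \<or> s = 1 \<or> s = 2 \<or> s = 3 \<or> s = 4" by linarith
  then show False using s(2) e0 e1 e2 e3 e4 by auto
qed

text \<open>Lowering the top of \<open>q\<close> from residue \<open>s5\<close> to \<open>s2\<close>
  passes a single bottom of another interval, \<open>s4\<close> of \<open>p\<close>, and so deletes
  exactly one hyperplane. After that the bottom of \<open>r\<close> can move from \<open>t\<close>
  to \<open>s3\<close> without passing a top. Now \<open>q\<close> and \<open>r\<close> have
  integral length, and \<open>p\<close> has equally many crossings with both, whence the double
  exponent \<open>h\<close>. Restricting to the deleted hyperplane leaves two vertices with third
  exponent \<open>h + 1\<close>.\<close>

lemma three_intervals_not_free:
  fixes Y :: "('i \<Rightarrow> 'k::field_char_0) set" and n1 n2 n3 n4 n5 :: nat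
  assumes r: "rep Y f {None} W" and W: "W = {p, q, r}" "p \<noteq> q" "p \<noteq> r" "q \<noteq> r"
    and s: "0 < s1" "s1 < s2" "s2 < s3" "s3 < s4" "s4 < s5" "s5 < t" "t < 1" and z: "z < int n3"
    and p: "a p = s4 - real n4 - 1" "b p = s1 + real n1 + 1"
    and q: "a q = s2" "b q = s5 + real n2 + real n5 + 1"
    and r': "a r = t + of_int z" "b r = s3 + real n3 + 1"
  shows "\<not> free_arrangement Y (arr Y f {None} (pairs W (ibound a b)))"
proof -
  define L where "L = ibound a b"
  have zr: "of_int z + 1 \<le> real n3" using z by linarith
  have Lv: "L p q = int n1" "L p r = int n1 - z" "L q p = int n2 + int n5 + int n4 + 2" "L q r = int n2 + int n5 - z"
    "L r p = int n3 + int n4 + 1" "L r q = int n3 + 1"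
    unfolding L_def ibound_def p q r' by (rule floor_unique; use s in simp)+
  define L0 where "L0 = L(q := (L q)(p := L q p - 1))"
  \<comment> \<open>The lengths \<open>k q + k r\<close> plus the number \<open>n1 + n4 + 1\<close>
    of crossings that \<open>p\<close> has with either.\<close>
  define h where "h = n1 + n2 + n4 + n5 + nat (int n3 - z) + 3"
  let ?A = "arr Y f {None} (pairs W L)" and ?H = "hp Y f (p, q, L q p)"
  have Lqp: "- L p q \<le> L q p" by (simp add: Lv)
  have qW: "q \<in> W" "p \<in> W" "r \<in> W" "q \<noteq> p" using W by auto
  note raise = arr_pairs_raise[where w = q and v = p, OF r qW(1,2) qW(4) Lqp L0_def]
  have AH: "?A - {?H} = arr Y f {None} (pairs W L0)" using raise by auto
  have HA: "?H \<in> ?A" using raise by auto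
  have H: "hyperplane Y ?H" using arr_hyperplanes[OF r pairs_dpairs] HA by blast
  define a' b' where "a' = a(r := s3 + of_int z)" and "b' = b(q := s2 + real n2 + real n5 + 1)"
  define k where "k v = (if v = q then n2 + n5 + 1 else nat (int n3 - z) + 1)" for v
  have ab': "a' p = s4 - real n4 - 1" "b' p = s1 + real n1 + 1" "a' q = s2" "b' q = s2 + real n2 + real n5 + 1"
    "a' r = s3 + of_int z" "b' r = s3 + real n3 + 1"
    using W p q r' by (simp_all add: a'_def b'_def)
  have L0v: "ibound a' b' p q = int n1" "ibound a' b' p r = int n1 - z"
    "ibound a' b' q p = int n2 + int n5 + int n4 + 1" "ibound a' b' q r = int n2 + int n5 - z"
    "ibound a' b' r p = int n3 + int n4 + 1" "ibound a' b' r q = int n3 + 1"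
    unfolding ibound_def ab' by (rule floor_unique; use s in simp)+
  have L0: "pairs W L0 = pairs W (ibound a' b')"
    by (rule pairs_cong) (use W in \<open>auto simp: L0_def Lv L0v\<close>)
  have nz: "real (nat (int n3 - z)) = real n3 - of_int z" using z by simp
  have nonint: "x \<notin> \<int>" if "of_int i < x" "x < of_int i + 1" for x :: real and i
    using that by (auto elim!: Ints_cases)
  have "a' p - a' q \<notin> \<int>" "a' p - a' r \<notin> \<int>" "a' q - a' r \<notin> \<int>"
    unfolding ab' by (rule nonint[of "- int n4 - 1"] nonint[of "- int n4 - 1 - z"] nonint[of "- z - 1"]; use s in simp)+
  moreover have "x - y \<notin> \<int>" if "y - x \<notin> \<int>" for x y :: real using that by (metis Ints_minus minus_diff_eq)
  ultimately have gen: "a' u - a' v \<notin> \<int>" if "u \<in> W" "v \<in> W" "u \<noteq> v" for u v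
    using that W by auto
  have k: "b' v = a' v + real (k v)" if "v \<in> W - {p}" for v
    using that W nz ab' by (auto simp: k_def)
  have abp: "a' p \<le> b' p" unfolding ab' using s by simp
  have "special W p a' b' k"
    unfolding special_def using k gen abp qW by blast
  from ind_exps_special[OF r this]
  have i1: "ind_exps Y (arr Y f {None} (pairs W L0)) ({#0, 1#} + special_exps W p a' b' k)" unfolding L0 .
  have Wp: "W - {p} = {q, r}" using W by auto
  have fl: "\<lfloor>b' p - a' q\<rfloor> = int n1" "\<lfloor>b' p - a' r\<rfloor> = int n1 - z"
    using L0v by (simp_all add: ibound_def)
  have fl2: "\<lfloor>a' p - a' q\<rfloor> = - int n4 - 1" "\<lfloor>a' p - a' r\<rfloor> = - int n4 - 1 - z"
    unfolding ab' by (rule floor_unique; use s in simp)+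
  have cr: "crossings p a' b' q = n1 + n4 + 1" "crossings p a' b' r = n1 + n4 + 1"
    unfolding crossings_def fl fl2 by simp_all
  have se: "special_exps W p a' b' k = {#h, h#}"
  proof -
    have "(\<Sum>u\<in>{q, r}. k u) + (n1 + n4 + 1) = h" using W by (simp add: k_def h_def)
    then show ?thesis unfolding special_exps_def Wp using W by (simp add: cr)
  qed
  have g1: "good Y (?A - {?H}) {#0, 1, h, h#}"
    using i1 unfolding AH ind_exps_def se by (simp add: add_mset_commute)
  have t: "(p, q, L q p) \<in> pairs W L" using qW Lqp by (simp add: pairs_def)
  have ab: "a y \<le> b y" if "y \<in> W" for y
    using that W p q r' s zr by auto
  have tri: "tri W L" unfolding L_def by (rule tri_ibound[OF ab])
  have R: "restriction ?A ?H = arr ?H (\<lambda>y. (f y)(Some p := 0)) {None} (pairs (W - {p}) (merge L p q (L q p)))"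
    by (rule restriction_arr_pairs[OF r t tri])
  have rH: "rep ?H (\<lambda>y. (f y)(Some p := 0)) {None} (W - {p})" by (rule rep_hp[OF r qW(2,1) W(2)])
  have m: "int (Suc h) = merge L p q (L q p) q r + merge L p q (L q p) r q + 1"
    using W z by (simp add: merge_def Lv h_def)
  have g2: "good ?H (restriction ?A ?H) {#0, 1, Suc h#}"
    using ind_exps_two[OF rH Wp W(4) m] unfolding R ind_exps_def by simp
  have h3: "h \<ge> 3" by (simp add: h_def)
  have "\<not> free_arrangement Y ?A" by (rule not_free[OF HA H h3 g1 g2])
  then show ?thesis by (simp add: L_def)
qed

text \<open>Translating the interval of \<open>u\<close> so that its top becomes \<open>s u\<close> gives the interval of \<open>v\<close> the
  residue of \<open>a u\<close> at the bottom and leaves the top alone.\<close>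

lemma flat_int_lower:
  fixes A :: "('i \<Rightarrow> 'k::field_char_0) set set"
  assumes fl: "flat_int X A Y f W a b" and uv: "u \<in> W" "v \<in> W" "u \<noteq> v"
    and s: "0 < sv" "sv < su" "su < 1"
    and v: "a v = sv" "b v = sv + real (n + 1)" and u: "b u - su \<in> \<int>" "a u - t \<in> \<int>" "a u + 1 \<le> b u"
  shows "\<exists>Y' f' a' b'. flat_int X A Y' f' (W - {u}) a' b' \<and> (\<forall>w. w \<noteq> v \<longrightarrow> a' w = a w \<and> b' w = b w) \<and>
    a' v - t \<in> \<int> \<and> b' v = b v \<and> a' v + 1 \<le> b' v"
proof -
  obtain i where i: "b u - su = of_int i" using u(1) by (auto elim!: Ints_cases)
  have c: "b u + of_int (- i) = su" using i by simp
  have t: "(u, v, - i) \<in> pairs W (ibound a b)"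
  proof -
    have "\<lfloor>b v - a u\<rfloor> \<ge> - i" unfolding le_floor_iff using i u(3) v s by simp
    moreover have "\<lfloor>b u - a v\<rfloor> \<ge> i" unfolding le_floor_iff using i v s by simp
    ultimately show ?thesis using uv by (simp add: pairs_def ibound_def)
  qed
  have mn: "min (a v) (a u + of_int (- i)) = a u + of_int (- i)" using c u(3) v s by simp
  have mx: "max (b v) (b u + of_int (- i)) = b v" using c v s by simp
  have "(a u - t) + of_int (- i) \<in> \<int>" by (intro Ints_add[OF u(2)]) auto
  then have "a u + of_int (- i) - t \<in> \<int>" by (simp add: algebra_simps)
  moreover have "a u + of_int (- i) + 1 \<le> b v" using c u(3) v s by simp
  moreover note flat_int_merge[OF fl t, unfolded mn mx]
  ultimately show ?thesis
    by (intro exI[of _ "hp Y f (u, v, - i)"] exI[of _ "\<lambda>y. (f y)(Some u := 0)"]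
      exI[of _ "a(v := a u + of_int (- i))"] exI[of _ "b(v := b v)"] conjI) simp_all
qed

text \<open>The vertices from \<open>l\<close> down to 7 are merged each into its predecessor. The
  bottom residue \<open>s l\<close> is passed along while each vertex keeps its own top; for
  \<open>l = 6\<close> nothing is merged.\<close>

lemma shi_chain:
  fixes A :: "('i \<Rightarrow> 'k::field_char_0) set set" and l :: nat
  defines "s \<equiv> residue l"
  assumes top: "flat_int X A X f0 {1..l} s (\<lambda>v. s v + real (n v + 1))" and k: "6 \<le> l"
  shows "\<exists>Y f a b. flat_int X A Y f {1..6} a b \<and> (\<forall>i\<in>{1..<6}. a i = s i \<and> b i = s i + real (n i + 1)) \<and>
    a 6 - s l \<in> \<int> \<and> b 6 - s 6 \<in> \<int> \<and> a 6 + 1 \<le> b (6::nat)"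
  using k
proof (induction rule: inc_induct)
  case base
  show ?case
    by (rule exI[of _ X], rule exI[of _ f0], rule exI[of _ s], rule exI[of _ "\<lambda>v. s v + real (n v + 1)"])
      (use top in simp)
next
  case (step k)
  then obtain Y f a b where fl: "flat_int X A Y f {1..Suc k} a b"
    and low: "\<forall>i\<in>{1..<Suc k}. a i = s i \<and> b i = s i + real (n i + 1)"
    and hi: "a (Suc k) - s l \<in> \<int>" "b (Suc k) - s (Suc k) \<in> \<int>" "a (Suc k) + 1 \<le> b (Suc k)" by (elim exE conjE)
  have mem: "Suc k \<in> {1..Suc k}" "k \<in> {1..Suc k}" "Suc k \<noteq> k" "k \<in> {1..l}" "Suc k \<in> {1..l}" using step by auto
  have kk: "a k = s k" "b k = s k + real (n k + 1)" using low step by auto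
  have sr: "0 < s k" "s k < s (Suc k)" "s (Suc k) < 1"
    using residue_range[OF mem(4)] residue_range[OF mem(5)] residue_less[of k "Suc k" l] by (simp_all add: s_def)
  from flat_int_lower[OF fl mem(1-3) sr kk hi(2,1,3)]
  obtain Y' f' a' b' where *: "flat_int X A Y' f' ({1..Suc k} - {Suc k}) a' b'"
    "\<forall>w. w \<noteq> k \<longrightarrow> a' w = a w \<and> b' w = b w" "a' k - s l \<in> \<int>" "b' k = b k" "a' k + 1 \<le> b' k" by (elim exE conjE)
  have e: "{1..Suc k} - {Suc k} = {1..k}" by auto
  show ?case
    by (rule exI[of _ Y'], rule exI[of _ f'], rule exI[of _ a'], rule exI[of _ b'])
      (use *[unfolded e] low kk in auto)
qed

text \<open>Merging 6 into 3, 5 into 2 and 4 into 1 yields intervals whose bottom and top residues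
  are \<open>s l, s 3\<close>, then \<open>s 2, s 5\<close>, then \<open>s 4, s 1\<close>. With 1,
  2, 3 as \<open>p, q, r\<close> this is the pattern of
  \<open>three_intervals_not_free\<close>.\<close>

lemma shi_nonfree_flat:
  assumes V: "V = {1..l}" "E = {(j, i) | i j. i \<in> V \<and> j \<in> V \<and> i < j}" and l: "6 \<le> l"
  shows "\<not> hereditarily_free (cone_space V) (cone_deformation V n E :: (nat option \<Rightarrow> 'k::field_char_0) set set)"
proof -
  define s where "s = residue l"
  let ?X = "cone_space V :: (nat option \<Rightarrow> 'k) set"
  define A where "A = (cone_deformation V n E :: (nat option \<Rightarrow> 'k) set set)"
  have finV: "finite V" and V0: "V \<noteq> {}" using V l by auto
  have top: "flat_int ?X A ?X (\<lambda>y. y) {1..l} (residue l) (\<lambda>v. residue l v + real (n v + 1))"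
    unfolding V(1)[symmetric]
    by (rule flat_int_top[OF rep_cone_space[OF finV] V0]) (simp_all add: A_def cone_deformation_arr shi_arr[OF V])
  have sl: "s i < s j" if "i < j" for i j using residue_less[OF that] by (simp add: s_def)
  have sr: "0 < s i" "s i < 1" if "i \<in> {1..l}" for i using residue_range[OF that] by (simp_all add: s_def)
  have s: "0 < s 1" "s 1 < s 2" "s 2 < s 3" "s 3 < s 4" "s 4 < s 5" "s 5 < s l" "s l < 1" "s 3 < s 6" "s 6 < 1" "0 < s 3"
    using l by (auto intro!: sl sr)
  from shi_chain[OF top l, folded s_def]
  obtain Y6 f6 a6 b6 where f6: "flat_int ?X A Y6 f6 {1..6} a6 b6"
    and low6: "\<forall>i\<in>{1..<6}. a6 i = s i \<and> b6 i = s i + real (n i + 1)"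
    and hi6: "a6 6 - s l \<in> \<int>" "b6 6 - s 6 \<in> \<int>" "a6 6 + 1 \<le> b6 6" by (elim exE conjE)
  have mem6: "(6::nat) \<in> {1..6}" "3 \<in> {1..6::nat}" "(6::nat) \<noteq> 3" by auto
  have 33: "a6 3 = s 3" "b6 3 = s 3 + real (n 3 + 1)" using low6 by auto
  from flat_int_lower[OF f6 mem6 s(10,8,9) 33 hi6(2,1,3)]
  obtain Y5 f5 a5 b5 where f5: "flat_int ?X A Y5 f5 ({1..6} - {6}) a5 b5"
    and o5: "\<forall>w. w \<noteq> 3 \<longrightarrow> a5 w = a6 w \<and> b5 w = b6 w" and 35: "a5 3 - s l \<in> \<int>" "b5 3 = b6 3" "a5 3 + 1 \<le> b5 3"
    by (elim exE conjE)
  have low5: "a5 i = s i \<and> b5 i = s i + real (n i) + 1" if "i \<in> {1, 2, 4, 5}" for i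
  proof -
    have "i \<noteq> 3" "i \<in> {1..<6}" using that by auto
    then show ?thesis using o5 low6 by simp
  qed
  note a51 = low5[of 1, simplified] and a52 = low5[of 2, simplified] and a54 = low5[of 4, simplified] and a55 = low5[of 5, simplified]
  note a51 = low5[of 1, unfolded insert_iff, OF disjI1[OF refl]]
  define U where "U = {1..6::nat} - {6}"
  have U: "U = {1, 2, 3, 4, 5}" by (auto simp: U_def)
  \<comment> \<open>The translated bottom \<open>s 5 + n 2\<close> lies below the top
    \<open>s 2 + n 2 + 1\<close> of vertex 2, and the union ends at the top of vertex 5.\<close>
  have t5: "(5, 2, int (n 2)) \<in> pairs U (ibound a5 b5)"
  proof -
    have "\<lfloor>b5 2 - a5 5\<rfloor> \<ge> int (n 2)" "\<lfloor>b5 5 - a5 2\<rfloor> \<ge> - int (n 2)" unfolding le_floor_iff using s a52 a55 by simp_all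
    then show ?thesis by (simp add: U pairs_def ibound_def)
  qed
  have mn5: "min (a5 2) (a5 5 + of_int (int (n 2))) = s 2" using s a52 a55 by simp
  have mx5: "max (b5 2) (b5 5 + of_int (int (n 2))) = s 5 + real (n 2) + real (n 5) + 1" using s a52 a55 by simp
  define a4 b4 where "a4 = a5(2 := s 2)" and "b4 = b5(2 := s 5 + real (n 2) + real (n 5) + 1)"
  from flat_int_merge[OF f5[folded U_def] t5, unfolded mn5 mx5, folded a4_def b4_def]
  obtain Y4 f4 where f4: "flat_int ?X A Y4 f4 (U - {5}) a4 b4" by blast
  have a4: "a4 1 = s 1" "b4 1 = s 1 + real (n 1) + 1" "a4 4 = s 4" "b4 4 = s 4 + real (n 4) + 1"
    using a51 a54 by (simp_all add: a4_def b4_def)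
  \<comment> \<open>The top of vertex 4 moves to \<open>s 4\<close>, below the top of vertex 1, so
    the union takes only its bottom from vertex 4.\<close>
  have t4: "(4, 1, - int (n 4) - 1) \<in> pairs (U - {5}) (ibound a4 b4)"
  proof -
    have "\<lfloor>b4 1 - a4 4\<rfloor> \<ge> - int (n 4) - 1" "\<lfloor>b4 4 - a4 1\<rfloor> \<ge> int (n 4) + 1" unfolding le_floor_iff a4 using s by simp_all
    then show ?thesis by (simp add: U pairs_def ibound_def)
  qed
  have mn4: "min (a4 1) (a4 4 + of_int (- int (n 4) - 1)) = s 4 - real (n 4) - 1" unfolding a4 using s by simp
  have mx4: "max (b4 1) (b4 4 + of_int (- int (n 4) - 1)) = s 1 + real (n 1) + 1" unfolding a4 using s by simp
  define a3 b3 where "a3 = a4(1 := s 4 - real (n 4) - 1)" and "b3 = b4(1 := s 1 + real (n 1) + 1)"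
  from flat_int_merge[OF f4 t4, unfolded mn4 mx4, folded a3_def b3_def]
  obtain Y f where fl: "flat_int ?X A Y f (U - {5} - {4}) a3 b3" by blast
  have U3: "U - {5} - {4} = {1, 2, 3}" by (auto simp: U)
  obtain z where z: "a5 3 - s l = of_int z" using 35(1) by (auto elim!: Ints_cases)
  have b53: "b5 3 = s 3 + real (n 3) + 1" using 35(2) 33 by simp
  \<comment> \<open>Length at least 1 reads \<open>s l + z + 1 \<le> s 3 + n 3 + 1\<close>, and
    \<open>s 3 < s l\<close>.\<close>
  have "of_int z < real (n 3)" using z 35(3) s unfolding b53 by simp
  then have z3: "z < int (n 3)" by linarith
  have v: "a3 1 = s 4 - real (n 4) - 1" "b3 1 = s 1 + real (n 1) + 1" "a3 2 = s 2"
    "b3 2 = s 5 + real (n 2) + real (n 5) + 1" "a3 3 = s l + of_int z" "b3 3 = s 3 + real (n 3) + 1"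
    using z b53 by (simp_all add: a3_def b3_def a4_def b4_def)
  have r: "rep Y f {None} (U - {5} - {4})" and R: "restriction A Y = arr Y f {None} (pairs (U - {5} - {4}) (ibound a3 b3))"
    and Y: "Y \<in> intersection_lattice ?X A" using fl by (simp_all add: flat_int_def)
  have "\<not> free_arrangement Y (restriction A Y)"
    unfolding R by (rule three_intervals_not_free[OF r U3 _ _ _ s(1-7) z3 v]) simp_all
  then show ?thesis using Y unfolding A_def hereditarily_free_def by blast
qed

theorem theorem4p1:
  shows "(\<forall>(V :: 'a set) (n :: 'a \<Rightarrow> nat) E.
            finite V \<and> card V \<ge> 2 \<and> digraph V E \<and> E = {} \<longrightarrow>
            hereditarily_inductively_free (cone_space V)
              (cone_deformation V n E :: ('a option \<Rightarrow> 'k::field_char_0) set set))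
       \<and> (\<forall>(V :: nat set) (l :: nat) (n :: nat \<Rightarrow> nat) E.
            finite V \<and> card V = l \<and> l \<ge> 2 \<and> digraph V E \<and>
            V = {1..l} \<and> E = {(j, i) | i j. i \<in> V \<and> j \<in> V \<and> i < j} \<longrightarrow>
            (hereditarily_free (cone_space V)
               (cone_deformation V n E :: (nat option \<Rightarrow> 'k) set set) \<longleftrightarrow> l \<le> 5))"
proof (intro conjI allI impI)
  fix V :: "'a set" and n :: "'a \<Rightarrow> nat" and E :: "('a \<times> 'a) set"
  assume "finite V \<and> card V \<ge> 2 \<and> digraph V E \<and> E = {}"
  then have "finite V" "V \<noteq> {}" "E = {}" by auto
  then show "hereditarily_inductively_free (cone_space V) (cone_deformation V n E :: ('a option \<Rightarrow> 'k) set set)"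
    unfolding hereditarily_inductively_free_def using catalan_flats ind_exps_def by blast
next
  fix V :: "nat set" and l :: nat and n :: "nat \<Rightarrow> nat" and E :: "(nat \<times> nat) set"
  assume "finite V \<and> card V = l \<and> l \<ge> 2 \<and> digraph V E \<and> V = {1..l} \<and> E = {(j, i) | i j. i \<in> V \<and> j \<in> V \<and> i < j}"
  then have l: "l \<ge> 2" and V: "V = {1..l}" "E = {(j, i) | i j. i \<in> V \<and> j \<in> V \<and> i < j}" by blast+
  have "hereditarily_free (cone_space V) (cone_deformation V n E :: (nat option \<Rightarrow> 'k) set set)" if "l \<le> 5"
    unfolding hereditarily_free_def using shi_flats[OF V _ that] l ind_exps_free by fastforce
  moreover have "\<not> hereditarily_free (cone_space V) (cone_deformation V n E :: (nat option \<Rightarrow> 'k) set set)" if "\<not> l \<le> 5"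
    by (rule shi_nonfree_flat[OF V]) (use that in simp)
  ultimately show "hereditarily_free (cone_space V) (cone_deformation V n E :: (nat option \<Rightarrow> 'k) set set) \<longleftrightarrow> l \<le> 5"
    by blast
qed

end
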